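(* Let $\mathcal{D}$ be a $k$-linear, Hom-finite triangulated category with a cluster-tilting object $T$ and a Serre functor, and let $\Lambda=\mathrm{End}^{op}_{\mathcal{D}}(T)$. Let $M_\Lambda=X_\Lambda\oplus U_\Lambda$ be a basic $\tau$-tilting $\Lambda$-module which is the Bongartz completion of $U_\Lambda$, where $X_\Lambda$ is indecomposable, and let $$X_\Lambda\xrightarrow{g_\Lambda}U'_\Lambda\xrightarrow{f_\Lambda}Y_\Lambda\to 0$$ be an exact sequence in which $g_\Lambda$ is a minimal left $(\mathrm{add}\,U_\Lambda)$-approximation. If $U_\Lambda$ is sincere, then $Y_\Lambda$ is indecomposable.
   Context: Conventions: $k$ is an algebraically closed field; triangulated categories are Krull-Schmidt, with shift $[1]$. A Serre functor is a $k$-linear equivalence $\mathbb{S}:\mathcal{D}\to\mathcal{D}$ with bifunctorial isomorphisms $\mathrm{Hom}_{\mathcal{D}}(A,B)\simeq \mathrm{Hom}_k(\mathrm{Hom}_{\mathcal{D}}(B,\mathbb{S}A),k)$. $\mathrm{add}\,M$ is the full subcategory of direct summands of finite direct sums of copies of $M$. An object $T$ is cluster-tilting if $\mathrm{add}\,T=\{X\mid \mathrm{Hom}_{\mathcal{D}}(T,X[1])=0\}=\{X\mid \mathrm{Hom}_{\mathcal{D}}(X,T[1])=0\}$. Modules are finitely generated left modules, $\tau$ is the Auslander-Reiten translation of $\mathrm{mod}\,\Lambda$, and $|X|$ is the number of non-isomorphic indecomposable direct summands of $X$; basic means that the indecomposable summands are pairwise non-isomorphic. A module $X$ is $\tau$-rigid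 if $\mathrm{Hom}_\Lambda(X,\tau X)=0$, and $\tau$-tilting if also $|X|=|\Lambda|$. A module is sincere if every simple $\Lambda$-module occurs as a composition factor of it. For a functorially finite torsion class $\mathcal{T}$ in $\mathrm{mod}\,\Lambda$, $P(\mathcal{T})$ is the direct sum of one copy of each indecomposable $X\in\mathcal{T}$ with $\mathrm{Ext}^1_\Lambda(X,\mathcal{T})=0$, up to isomorphism. For a basic $\tau$-rigid module $U$, the Bongartz completion of $U$ is $P({}^{\perp}(\tau U))$, where ${}^{\perp}(\tau U)=\{N\in\mathrm{mod}\,\Lambda\mid\mathrm{Hom}_\Lambda(N,\tau U)=0\}$. A left $(\mathrm{add}\,U)$-approximation of $X$ is a morphism $g:X\to U'$ with $U'\in\mathrm{add}\,U$ through which every morphism from $X$ to an object of $\mathrm{add}\,U$ factors; it is minimal if every endomorphism $\varphi$ of $U'$ with $\varphi g=g$ is an isomorphism. *)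

theory Defs
  imports "HOL-Algebra.Algebraic_Closure" "HOL-Algebra.Module"
begin

no_notation var (\<open>X\<index>\<close>)

section \<open>Left modules over a ring\<close>

text \<open>
  The locale \<open>module\<close> of HOL-Algebra is restricted to commutative rings; here the ring is
  arbitrary (the record type is the same, its fields \<open>mult\<close> and \<open>one\<close> are irrelevant for modules).
  A right module over a ring is a left module over the opposite ring.
\<close>

locale left_module = R?: ring R + M?: abelian_group M
  for R :: "('a, 'z) ring_scheme" (structure) and M :: "('a, 'x, 'p) module_scheme" (structure) +
  assumes smult_closed: "a \<in> carrier R \<Longrightarrow> x \<in> carrier M \<Longrightarrow> a \<odot>\<^bsub>M\<^esub> x \<in> carrier M"
    and smult_l_distr: "a \<in> carrier R \<Longrightarrow> b \<in> carrier R \<Longrightarrow> x \<in> carrier M \<Longrightarrow>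
      (a \<oplus> b) \<odot>\<^bsub>M\<^esub> x = a \<odot>\<^bsub>M\<^esub> x \<oplus>\<^bsub>M\<^esub> b \<odot>\<^bsub>M\<^esub> x"
    and smult_r_distr: "a \<in> carrier R \<Longrightarrow> x \<in> carrier M \<Longrightarrow> y \<in> carrier M \<Longrightarrow>
      a \<odot>\<^bsub>M\<^esub> (x \<oplus>\<^bsub>M\<^esub> y) = a \<odot>\<^bsub>M\<^esub> x \<oplus>\<^bsub>M\<^esub> a \<odot>\<^bsub>M\<^esub> y"
    and smult_assoc: "a \<in> carrier R \<Longrightarrow> b \<in> carrier R \<Longrightarrow> x \<in> carrier M \<Longrightarrow>
      (a \<otimes> b) \<odot>\<^bsub>M\<^esub> x = a \<odot>\<^bsub>M\<^esub> (b \<odot>\<^bsub>M\<^esub> x)"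
    and smult_one: "x \<in> carrier M \<Longrightarrow> \<one> \<odot>\<^bsub>M\<^esub> x = x"

definition module_map ::
  "('a, 'z) ring_scheme \<Rightarrow> ('a, 'x, 'p) module_scheme \<Rightarrow> ('a, 'y, 'q) module_scheme \<Rightarrow> ('x \<Rightarrow> 'y) \<Rightarrow> bool"
  where "module_map R M N f \<longleftrightarrow>
    f \<in> carrier M \<rightarrow> carrier N \<and>
    (\<forall>x\<in>carrier M. \<forall>y\<in>carrier M. f (x \<oplus>\<^bsub>M\<^esub> y) = f x \<oplus>\<^bsub>N\<^esub> f y) \<and>
    (\<forall>a\<in>carrier R. \<forall>x\<in>carrier M. f (a \<odot>\<^bsub>M\<^esub> x) = a \<odot>\<^bsub>N\<^esub> f x)"

definition module_iso ::
  "('a, 'z) ring_scheme \<Rightarrow> ('a, 'x, 'p) module_scheme \<Rightarrow> ('a, 'y, 'q) module_scheme \<Rightarrow> bool"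
  where "module_iso R M N \<longleftrightarrow> (\<exists>f. module_map R M N f \<and> bij_betw f (carrier M) (carrier N))"

definition fin_gen :: "('a, 'z) ring_scheme \<Rightarrow> ('a, 'x, 'p) module_scheme \<Rightarrow> bool"
  where "fin_gen R M \<longleftrightarrow> (\<exists>S. finite S \<and> S \<subseteq> carrier M \<and>
    (\<forall>x\<in>carrier M. \<exists>c\<in>S \<rightarrow> carrier R. x = (\<Oplus>\<^bsub>M\<^esub>s\<in>S. c s \<odot>\<^bsub>M\<^esub> s)))"

definition reg_module :: "('a, 'z) ring_scheme \<Rightarrow> ('a, 'a) module"
  where "reg_module R = \<lparr>carrier = carrier R, monoid.mult = monoid.mult R, one = one R,
    zero = zero R, add = add R, smult = monoid.mult R\<rparr>"

definition op_ring :: "('a, 'z) ring_scheme \<Rightarrow> ('a, 'z) ring_scheme"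
  where "op_ring R = R\<lparr>monoid.mult := \<lambda>x y. y \<otimes>\<^bsub>R\<^esub> x\<rparr>"

definition zero_module :: "('a, 'x, 'p) module_scheme \<Rightarrow> bool"
  where "zero_module M \<longleftrightarrow> carrier M = {\<zero>\<^bsub>M\<^esub>}"

definition hom_vanishes ::
  "('a, 'z) ring_scheme \<Rightarrow> ('a, 'x, 'p) module_scheme \<Rightarrow> ('a, 'y, 'q) module_scheme \<Rightarrow> bool"
  where "hom_vanishes R M N \<longleftrightarrow> (\<forall>f. module_map R M N f \<longrightarrow> (\<forall>x\<in>carrier M. f x = \<zero>\<^bsub>N\<^esub>))"

text \<open>
  Every finitely generated \<open>R\<close>-module is a quotient of some \<open>R\<^sup>n\<close>, hence isomorphic to a module
  whose elements have type \<open>nat \<Rightarrow> 'a\<close>, where \<open>'a\<close> is the type of elements of \<open>R\<close> (lemma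
  \<open>ex_iso_fgmod\<close> below). So \<open>fgmod R\<close> is (equivalent to) the category of all finitely generated left
  \<open>R\<close>-modules.
\<close>

type_synonym 'a std_module = "('a, nat \<Rightarrow> 'a) module"

definition fgmod :: "('a, 'z) ring_scheme \<Rightarrow> 'a std_module set"
  where "fgmod R = {M. left_module R M \<and> fin_gen R M}"

lemma module_map_finsum:
  assumes "left_module R M" "left_module R N" "module_map R M N f"
    and "finite S" "g \<in> S \<rightarrow> carrier M"
  shows "f (finsum M g S) = finsum N (\<lambda>s. f (g s)) S"
proof -
  interpret M: left_module R M by fact
  interpret N: left_module R N by fact
  note f = assms(3)[unfolded module_map_def]
  show ?thesis using assms(4,5)
  proof (induction S rule: finite_induct)
    case empty
    have f0: "f \<zero>\<^bsub>M\<^esub> \<in> carrier N" using f by blast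
    have "f \<zero>\<^bsub>M\<^esub> \<oplus>\<^bsub>N\<^esub> f \<zero>\<^bsub>M\<^esub> = f \<zero>\<^bsub>M\<^esub>"
      using f M.M.zero_closed M.M.l_zero by metis
    then have "f \<zero>\<^bsub>M\<^esub> = \<zero>\<^bsub>N\<^esub>"
      using f0 N.M.add.l_cancel_one' by metis
    then show ?case by simp
  next
    case (insert s S)
    have g: "g s \<in> carrier M" "g \<in> S \<rightarrow> carrier M" using insert by auto
    have fg: "(\<lambda>s. f (g s)) \<in> S \<rightarrow> carrier N" "f (g s) \<in> carrier N" using f g by auto
    show ?case
      using insert f g fg M.M.finsum_closed[OF g(2)]
      by (simp add: M.M.finsum_insert N.M.finsum_insert)
  qed
qed

lemma ex_iso_fgmod:
  fixes R :: "('a, 'z) ring_scheme" and M :: "('a, 'x, 'p) module_scheme"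
  assumes "left_module R M" "fin_gen R M"
  shows "\<exists>N\<in>fgmod R. module_iso R M N"
proof -
  interpret M: left_module R M by fact
  obtain S where S: "finite S" "S \<subseteq> carrier M"
    "\<And>x. x \<in> carrier M \<Longrightarrow> \<exists>c\<in>S \<rightarrow> carrier R. x = (\<Oplus>\<^bsub>M\<^esub>s\<in>S. c s \<odot>\<^bsub>M\<^esub> s)"
    using assms(2) unfolding fin_gen_def by blast
  obtain c where c: "\<And>x. x \<in> carrier M \<Longrightarrow> c x \<in> S \<rightarrow> carrier R"
    "\<And>x. x \<in> carrier M \<Longrightarrow> x = (\<Oplus>\<^bsub>M\<^esub>s\<in>S. c x s \<odot>\<^bsub>M\<^esub> s)"
    using S(3) by metis
  obtain h :: "'x \<Rightarrow> nat" where h: "inj_on h S"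
    using finite_imp_inj_to_nat_seg[OF S(1)] by blast
  define e where "e x = (\<lambda>i. c x (inv_into S h i))" for x
  have inj: "inj_on e (carrier M)"
  proof (rule inj_onI)
    fix x y assume xy: "x \<in> carrier M" "y \<in> carrier M" "e x = e y"
    have "c x s = c y s" if "s \<in> S" for s
      using fun_cong[OF xy(3), of "h s"] that h by (simp add: e_def)
    then have "(\<Oplus>\<^bsub>M\<^esub>s\<in>S. c x s \<odot>\<^bsub>M\<^esub> s) = (\<Oplus>\<^bsub>M\<^esub>s\<in>S. c y s \<odot>\<^bsub>M\<^esub> s)"
      using c(1)[OF xy(2)] S(2)
      by (intro M.M.finsum_cong') (auto intro!: M.smult_closed)
    then show "x = y" using c(2)[OF xy(1)] c(2)[OF xy(2)] by simp
  qed
  define d where "d = inv_into (carrier M) e"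
  have d[simp]: "d (e x) = x" if "x \<in> carrier M" for x
    using inj that by (simp add: d_def)
  define N :: "'a std_module" where "N = \<lparr>carrier = e ` carrier M, monoid.mult = undefined, one = undefined,
    zero = e \<zero>\<^bsub>M\<^esub>, add = (\<lambda>u v. e (d u \<oplus>\<^bsub>M\<^esub> d v)), smult = (\<lambda>a u. e (a \<odot>\<^bsub>M\<^esub> d u))\<rparr>"
  have "abelian_group N"
  proof (rule abelian_groupI)
    fix u assume "u \<in> carrier N"
    then obtain x where x: "x \<in> carrier M" "u = e x" by (auto simp: N_def)
    have "e (\<ominus>\<^bsub>M\<^esub> x) \<in> carrier N" "e (\<ominus>\<^bsub>M\<^esub> x) \<oplus>\<^bsub>N\<^esub> u = \<zero>\<^bsub>N\<^esub>"
      using x by (auto simp: N_def M.M.l_neg)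
    then show "\<exists>v\<in>carrier N. v \<oplus>\<^bsub>N\<^esub> u = \<zero>\<^bsub>N\<^esub>" by blast
  qed (auto simp: N_def M.M.a_ac)
  then have N: "left_module R N"
    by (intro left_module.intro left_module_axioms.intro M.R.ring_axioms)
      (auto simp: N_def M.smult_closed M.smult_l_distr M.smult_r_distr M.smult_assoc M.smult_one)
  have map: "module_map R M N e"
    by (auto simp: module_map_def N_def)
  have "fin_gen R N"
    unfolding fin_gen_def
  proof (intro exI[of _ "e ` S"] conjI ballI)
    fix u assume "u \<in> carrier N"
    then obtain x where x: "x \<in> carrier M" "u = e x" by (auto simp: N_def)
    have injS: "inj_on e S" using inj S(2) by (rule inj_on_subset)
    have dS: "d (e s) = s" if "s \<in> S" for s using that S(2) by auto
    interpret N: left_module R N by (rule N)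
    have cS: "c x s \<in> carrier R" "s \<in> carrier M" "e s \<in> carrier N" if "s \<in> S" for s
      using that c(1)[OF x(1)] S(2) by (auto simp: N_def)
    have "u = e (\<Oplus>\<^bsub>M\<^esub>s\<in>S. c x s \<odot>\<^bsub>M\<^esub> s)"
      using c(2)[OF x(1)] x(2) by simp
    also have "\<dots> = (\<Oplus>\<^bsub>N\<^esub>s\<in>S. e (c x s \<odot>\<^bsub>M\<^esub> s))"
      by (rule module_map_finsum[OF assms(1) N map S(1)]) (auto intro: M.smult_closed cS)
    also have "\<dots> = (\<Oplus>\<^bsub>N\<^esub>s\<in>S. (c x \<circ> d) (e s) \<odot>\<^bsub>N\<^esub> e s)"
      using map cS dS
      by (intro N.M.finsum_cong') (auto simp: module_map_def intro!: N.smult_closed)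
    also have "\<dots> = (\<Oplus>\<^bsub>N\<^esub>v\<in>e ` S. (c x \<circ> d) v \<odot>\<^bsub>N\<^esub> v)"
      using cS dS by (intro N.M.finsum_reindex[symmetric] injS) (auto intro!: N.smult_closed)
    finally show "\<exists>c\<in>e ` S \<rightarrow> carrier R. u = (\<Oplus>\<^bsub>N\<^esub>v\<in>e ` S. c v \<odot>\<^bsub>N\<^esub> v)"
      using cS dS by (intro bexI[of _ "c x \<circ> d"]) auto
  qed (use S in \<open>auto simp: N_def\<close>)
  moreover have "bij_betw e (carrier M) (carrier N)"
    using inj by (auto simp: bij_betw_def N_def)
  ultimately show ?thesis
    using N map unfolding fgmod_def module_iso_def by blast
qed


subsection \<open>Direct sums, indecomposable modules, add\<close>

definition module_direct_sum ::
  "('a, 'z) ring_scheme \<Rightarrow> ('a, 'x, 'p) module_scheme list \<Rightarrow> ('a, 'y, 'q) module_scheme \<Rightarrow> bool"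
  where "module_direct_sum R Xs M \<longleftrightarrow>
    (\<exists>\<iota>. (\<forall>i<length Xs. module_map R (Xs ! i) M (\<iota> i)) \<and>
      bij_betw (\<lambda>x. \<Oplus>\<^bsub>M\<^esub>i\<in>{..<length Xs}. \<iota> i (x i))
        (\<Pi>\<^sub>E i\<in>{..<length Xs}. carrier (Xs ! i)) (carrier M))"

definition module_summand :: "('a, 'z) ring_scheme \<Rightarrow> 'a std_module \<Rightarrow> ('a, 'x, 'p) module_scheme \<Rightarrow> bool"
  where "module_summand R N M \<longleftrightarrow> N \<in> fgmod R \<and> (\<exists>N'\<in>fgmod R. module_direct_sum R [N, N'] M)"

definition module_add :: "('a, 'z) ring_scheme \<Rightarrow> 'a std_module \<Rightarrow> 'a std_module set"
  where "module_add R U =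
    {V. \<exists>n. \<exists>W\<in>fgmod R. module_direct_sum R (replicate n U) W \<and> module_summand R V W}"

definition indecomposable :: "('a, 'z) ring_scheme \<Rightarrow> 'a std_module \<Rightarrow> bool"
  where "indecomposable R M \<longleftrightarrow> M \<in> fgmod R \<and> \<not> zero_module M \<and>
    (\<forall>A\<in>fgmod R. \<forall>B\<in>fgmod R. module_direct_sum R [A, B] M \<longrightarrow> zero_module A \<or> zero_module B)"

definition pairwise_non_iso :: "('a, 'z) ring_scheme \<Rightarrow> 'a std_module list \<Rightarrow> bool"
  where "pairwise_non_iso R Xs \<longleftrightarrow>
    (\<forall>i<length Xs. \<forall>j<length Xs. i \<noteq> j \<longrightarrow> \<not> module_iso R (Xs ! i) (Xs ! j))"

definition basic_module :: "('a, 'z) ring_scheme \<Rightarrow> 'a std_module \<Rightarrow> bool"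
  where "basic_module R M \<longleftrightarrow> M \<in> fgmod R \<and>
    (\<exists>Xs. (\<forall>X\<in>set Xs. indecomposable R X) \<and> pairwise_non_iso R Xs \<and> module_direct_sum R Xs M)"

definition iso_rel :: "('a, 'z) ring_scheme \<Rightarrow> ('a std_module \<times> 'a std_module) set"
  where "iso_rel R = {(M, N). M \<in> fgmod R \<and> N \<in> fgmod R \<and> module_iso R M N}"

text \<open>\<open>|X|\<close>; the set of isomorphism classes is finite for modules of finite length.\<close>

definition num_indec :: "('a, 'z) ring_scheme \<Rightarrow> ('a, 'x, 'p) module_scheme \<Rightarrow> nat"
  where "num_indec R X = card ({N. indecomposable R N \<and> module_summand R N X} // iso_rel R)"


subsection \<open>Sincere modules\<close>

definition simple_module :: "('a, 'z) ring_scheme \<Rightarrow> 'a std_module \<Rightarrow> bool"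
  where "simple_module R S \<longleftrightarrow> S \<in> fgmod R \<and> \<not> zero_module S \<and>
    (\<forall>L. submodule L R S \<longrightarrow> L = {\<zero>\<^bsub>S\<^esub>} \<or> L = carrier S)"

text \<open>\<open>L / L' \<cong> S\<close> for submodules \<open>L' \<subseteq> L\<close> of \<open>M\<close>\<close>

definition subquotient_iso ::
  "('a, 'z) ring_scheme \<Rightarrow> ('a, 'x) module \<Rightarrow> 'x set \<Rightarrow> 'x set \<Rightarrow> ('a, 'y) module \<Rightarrow> bool"
  where "subquotient_iso R M L L' S \<longleftrightarrow> (\<exists>\<pi>. module_map R (M\<lparr>carrier := L\<rparr>) S \<pi> \<and>
    \<pi> ` L = carrier S \<and> {x \<in> L. \<pi> x = \<zero>\<^bsub>S\<^esub>} = L')"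

definition composition_series :: "('a, 'z) ring_scheme \<Rightarrow> 'a std_module \<Rightarrow> (nat \<Rightarrow> 'a) set list \<Rightarrow> bool"
  where "composition_series R M Ls \<longleftrightarrow> Ls \<noteq> [] \<and> hd Ls = {\<zero>\<^bsub>M\<^esub>} \<and> last Ls = carrier M \<and>
    (\<forall>L\<in>set Ls. submodule L R M) \<and>
    (\<forall>i. Suc i < length Ls \<longrightarrow> Ls ! i \<subseteq> Ls ! Suc i \<and>
      (\<exists>S. simple_module R S \<and> subquotient_iso R M (Ls ! Suc i) (Ls ! i) S))"

definition composition_factor :: "('a, 'z) ring_scheme \<Rightarrow> 'a std_module \<Rightarrow> 'a std_module \<Rightarrow> bool"
  where "composition_factor R M S \<longleftrightarrow> simple_module R S \<and>
    (\<exists>Ls i. composition_series R M Ls \<and> Suc i < length Ls \<and>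
      subquotient_iso R M (Ls ! Suc i) (Ls ! i) S)"

definition sincere :: "('a, 'z) ring_scheme \<Rightarrow> 'a std_module \<Rightarrow> bool"
  where "sincere R M \<longleftrightarrow> M \<in> fgmod R \<and> (\<forall>S. simple_module R S \<longrightarrow> composition_factor R M S)"


subsection \<open>Yoneda Ext\<close>

definition extensions :: "('a, 'z) ring_scheme \<Rightarrow> 'a std_module \<Rightarrow> 'a std_module \<Rightarrow>
    ('a std_module \<times> ((nat \<Rightarrow> 'a) \<Rightarrow> (nat \<Rightarrow> 'a)) \<times> ((nat \<Rightarrow> 'a) \<Rightarrow> (nat \<Rightarrow> 'a))) set"
  where "extensions R X N = {(E, i, p). E \<in> fgmod R \<and>
    module_map R N E i \<and> inj_on i (carrier N) \<and>
    module_map R E X p \<and> p ` carrier E = carrier X \<and>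
    i ` carrier N = {x \<in> carrier E. p x = \<zero>\<^bsub>X\<^esub>}}"

definition ext_equiv where
  "ext_equiv R X N = {((E, i, p), (E', i', p')).
    (E, i, p) \<in> extensions R X N \<and> (E', i', p') \<in> extensions R X N \<and>
    (\<exists>h. module_map R E E' h \<and> (\<forall>x\<in>carrier N. h (i x) = i' x) \<and> (\<forall>x\<in>carrier E. p' (h x) = p x))}"

definition "Ext1 R X N = extensions R X N // ext_equiv R X N"

text \<open>The zero element of \<open>Ext\<^sup>1(X, N)\<close> is the class of the split extensions.\<close>

definition "Ext1_zero R X N = {(E, i, p) \<in> extensions R X N.
  \<exists>s. module_map R X E s \<and> (\<forall>x\<in>carrier X. p (s x) = x)}"

definition Ext1_vanishes :: "('a, 'z) ring_scheme \<Rightarrow> 'a std_module \<Rightarrow> 'a std_module \<Rightarrow> bool"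
  where "Ext1_vanishes R X N \<longleftrightarrow> Ext1 R X N = {Ext1_zero R X N}"


subsection \<open>Auslander--Reiten translation\<close>

definition projective :: "('a, 'z) ring_scheme \<Rightarrow> 'a std_module \<Rightarrow> bool"
  where "projective R P \<longleftrightarrow> P \<in> fgmod R \<and>
    (\<forall>A\<in>fgmod R. \<forall>B\<in>fgmod R. \<forall>q h. module_map R A B q \<and> q ` carrier A = carrier B \<and> module_map R P B h \<longrightarrow>
      (\<exists>h'. module_map R P A h' \<and> (\<forall>x\<in>carrier P. q (h' x) = h x)))"

text \<open>\<open>f : P \<rightarrow> N\<close> is a projective cover of the submodule \<open>A\<close> of \<open>N\<close>: it is an essential
  epimorphism from a projective module onto \<open>A\<close>.\<close>

definition projective_cover_onto ::
  "('a, 'z) ring_scheme \<Rightarrow> 'a std_module \<Rightarrow> ((nat \<Rightarrow> 'a) \<Rightarrow> (nat \<Rightarrow> 'a)) \<Rightarrow> 'a std_module \<Rightarrow> (nat \<Rightarrow> 'a) set \<Rightarrow> bool"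
  where "projective_cover_onto R P f N A \<longleftrightarrow> projective R P \<and> module_map R P N f \<and> f ` carrier P = A \<and>
    (\<forall>L. submodule L R P \<and> f ` L = A \<longrightarrow> L = carrier P)"

text \<open>\<open>P\<^sub>1 \<rightarrow> P\<^sub>0 \<rightarrow> X \<rightarrow> 0\<close> with maps \<open>d\<close> and \<open>e\<close>\<close>

definition min_proj_presentation where
  "min_proj_presentation R P1 d P0 e X \<longleftrightarrow>
    projective_cover_onto R P0 e X (carrier X) \<and>
    projective_cover_onto R P1 d P0 {x \<in> carrier P0. e x = \<zero>\<^bsub>X\<^esub>}"

text \<open>\<open>Hom\<^sub>R(P, R)\<close>, a right \<open>R\<close>-module\<close>

definition star :: "('a, 'z) ring_scheme \<Rightarrow> ('a, 'x, 'p) module_scheme \<Rightarrow> ('a, 'x \<Rightarrow> 'a) module"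
  where "star R P = \<lparr>carrier = {f \<in> extensional (carrier P). module_map R P (reg_module R) f},
    monoid.mult = undefined, one = undefined,
    zero = (\<lambda>x\<in>carrier P. \<zero>\<^bsub>R\<^esub>),
    add = (\<lambda>f g. \<lambda>x\<in>carrier P. f x \<oplus>\<^bsub>R\<^esub> g x),
    smult = (\<lambda>a f. \<lambda>x\<in>carrier P. f x \<otimes>\<^bsub>R\<^esub> a)\<rparr>"

text \<open>\<open>Q \<cong> Tr X\<close>: the right module \<open>Q\<close> is a cokernel of \<open>d\<^sup>* : P\<^sub>0\<^sup>* \<rightarrow> P\<^sub>1\<^sup>*\<close>.\<close>

definition is_transpose :: "('a, 'z) ring_scheme \<Rightarrow> 'a std_module \<Rightarrow> 'a std_module \<Rightarrow> bool"
  where "is_transpose R X Q \<longleftrightarrow> Q \<in> fgmod (op_ring R) \<and>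
    (\<exists>P1 d P0 e \<pi>. min_proj_presentation R P1 d P0 e X \<and>
      module_map (op_ring R) (star R P1) Q \<pi> \<and> \<pi> ` carrier (star R P1) = carrier Q \<and>
      {h \<in> carrier (star R P1). \<pi> h = \<zero>\<^bsub>Q\<^esub>} =
        (\<lambda>h. \<lambda>x\<in>carrier P1. h (d x)) ` carrier (star R P0))"

text \<open>
  An algebra over \<open>K\<close> is given by the record type \<open>module\<close>, all of whose fields are now relevant:
  \<open>mult\<close> and \<open>one\<close> belong to the ring structure and \<open>smult\<close> is the action of \<open>K\<close>.
\<close>

definition restrict_scalars ::
  "('k, 'a) module \<Rightarrow> ('a, 'x) module \<Rightarrow> ('k, 'x) module"
  where "restrict_scalars \<Lambda> M = \<lparr>carrier = carrier M, monoid.mult = monoid.mult M, one = one M,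
    zero = zero M, add = add M, smult = (\<lambda>c x. (c \<odot>\<^bsub>\<Lambda>\<^esub> \<one>\<^bsub>\<Lambda>\<^esub>) \<odot>\<^bsub>M\<^esub> x)\<rparr>"

definition dual_space ::
  "('k, 'z) ring_scheme \<Rightarrow> ('k, 'x, 'p) module_scheme \<Rightarrow> ('k, 'x \<Rightarrow> 'k) module"
  where "dual_space K V = \<lparr>carrier = {\<phi> \<in> extensional (carrier V). module_map K V (reg_module K) \<phi>},
    monoid.mult = undefined, one = undefined,
    zero = (\<lambda>x\<in>carrier V. \<zero>\<^bsub>K\<^esub>),
    add = (\<lambda>\<phi> \<psi>. \<lambda>x\<in>carrier V. \<phi> x \<oplus>\<^bsub>K\<^esub> \<psi> x),
    smult = (\<lambda>c \<phi>. \<lambda>x\<in>carrier V. c \<otimes>\<^bsub>K\<^esub> \<phi> x)\<rparr>"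

text \<open>The left \<open>\<Lambda>\<close>-module \<open>Hom\<^sub>K(Q, K)\<close> for a right \<open>\<Lambda>\<close>-module \<open>Q\<close>; here \<open>a \<odot>\<^bsub>Q\<^esub> x\<close> stands for \<open>x a\<close>.\<close>

definition dual_module ::
  "('k, 'z) ring_scheme \<Rightarrow> ('k, 'a) module \<Rightarrow> ('a, 'x) module \<Rightarrow> ('a, 'x \<Rightarrow> 'k) module"
  where "dual_module K \<Lambda> Q =
    (let D = dual_space K (restrict_scalars (op_ring \<Lambda>) Q) in
     \<lparr>carrier = carrier D, monoid.mult = monoid.mult D, one = one D, zero = zero D, add = add D,
      smult = (\<lambda>a \<phi>. \<lambda>x\<in>carrier Q. \<phi> (a \<odot>\<^bsub>Q\<^esub> x))\<rparr>)"

text \<open>\<open>\<tau> X = D Tr X\<close>, which is determined up to isomorphism\<close>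

definition tau :: "('k, 'z) ring_scheme \<Rightarrow> ('k, 'a) module \<Rightarrow> 'a std_module \<Rightarrow> 'a std_module"
  where "tau K \<Lambda> X = (SOME N. N \<in> fgmod \<Lambda> \<and>
    (\<exists>Q. is_transpose \<Lambda> X Q \<and> module_iso \<Lambda> N (dual_module K \<Lambda> Q)))"


subsection \<open>\<open>\<tau>\<close>-tilting modules, Bongartz completions, approximations\<close>

definition tau_rigid :: "('k, 'z) ring_scheme \<Rightarrow> ('k, 'a) module \<Rightarrow> 'a std_module \<Rightarrow> bool"
  where "tau_rigid K \<Lambda> X \<longleftrightarrow> X \<in> fgmod \<Lambda> \<and> hom_vanishes \<Lambda> X (tau K \<Lambda> X)"

definition tau_tilting :: "('k, 'z) ring_scheme \<Rightarrow> ('k, 'a) module \<Rightarrow> 'a std_module \<Rightarrow> bool"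
  where "tau_tilting K \<Lambda> X \<longleftrightarrow> tau_rigid K \<Lambda> X \<and> num_indec \<Lambda> X = num_indec \<Lambda> (reg_module \<Lambda>)"

definition left_perp :: "('a, 'z) ring_scheme \<Rightarrow> 'a std_module \<Rightarrow> 'a std_module set"
  where "left_perp R N = {L \<in> fgmod R. hom_vanishes R L N}"

definition indec_ext_projectives :: "('a, 'z) ring_scheme \<Rightarrow> 'a std_module set \<Rightarrow> 'a std_module set"
  where "indec_ext_projectives R \<T> = {X \<in> \<T>. indecomposable R X \<and> (\<forall>N\<in>\<T>. Ext1_vanishes R X N)}"

text \<open>\<open>M \<cong> P(\<T>)\<close>\<close>

definition is_P :: "('a, 'z) ring_scheme \<Rightarrow> 'a std_module set \<Rightarrow> 'a std_module \<Rightarrow> bool"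
  where "is_P R \<T> M \<longleftrightarrow> M \<in> fgmod R \<and>
    (\<exists>Xs. set Xs \<subseteq> indec_ext_projectives R \<T> \<and> pairwise_non_iso R Xs \<and>
      (\<forall>X\<in>indec_ext_projectives R \<T>. \<exists>X'\<in>set Xs. module_iso R X X') \<and>
      module_direct_sum R Xs M)"

definition is_Bongartz_completion ::
  "('k, 'z) ring_scheme \<Rightarrow> ('k, 'a) module \<Rightarrow> 'a std_module \<Rightarrow> 'a std_module \<Rightarrow> bool"
  where "is_Bongartz_completion K \<Lambda> U M \<longleftrightarrow> is_P \<Lambda> (left_perp \<Lambda> (tau K \<Lambda> U)) M"

definition left_approximation where
  "left_approximation R \<A> X g V \<longleftrightarrow> V \<in> \<A> \<and> module_map R X V g \<and>
    (\<forall>W\<in>\<A>. \<forall>h. module_map R X W h \<longrightarrow>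
      (\<exists>t. module_map R V W t \<and> (\<forall>x\<in>carrier X. h x = t (g x))))"

definition left_minimal where
  "left_minimal R X g V \<longleftrightarrow> (\<forall>\<phi>. module_map R V V \<phi> \<and> (\<forall>x\<in>carrier X. \<phi> (g x) = g x) \<longrightarrow>
    bij_betw \<phi> (carrier V) (carrier V))"

definition right_exact_seq where
  "right_exact_seq R X g V f Y \<longleftrightarrow> module_map R X V g \<and> module_map R V Y f \<and>
    g ` carrier X = {x \<in> carrier V. f x = \<zero>\<^bsub>Y\<^esub>} \<and> f ` carrier V = carrier Y"


section \<open>Linear categories\<close>

text \<open>Composition is written in the order of functions: \<open>g \<bullet> f\<close> is \<open>f\<close> followed by \<open>g\<close>.\<close>

record ('k, 'o, 'm) lincat =
  obj :: "'o set"
  homs :: "'o \<Rightarrow> 'o \<Rightarrow> ('k, 'm) module"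
  idm :: "'o \<Rightarrow> 'm"
  cmp :: "'m \<Rightarrow> 'm \<Rightarrow> 'm"  (infixl \<open>\<bullet>\<index>\<close> 70)

abbreviation Homs :: "('k, 'o, 'm, 'z) lincat_scheme \<Rightarrow> 'o \<Rightarrow> 'o \<Rightarrow> 'm set"
  where "Homs C A B \<equiv> carrier (homs C A B)"

definition cat_direct_sum :: "('k, 'o, 'm, 'z) lincat_scheme \<Rightarrow> 'o list \<Rightarrow> 'o \<Rightarrow> bool"
  where "cat_direct_sum C As P \<longleftrightarrow> set As \<subseteq> obj C \<and> P \<in> obj C \<and>
    (\<exists>\<iota> \<pi>. (\<forall>i<length As. \<iota> i \<in> Homs C (As ! i) P \<and> \<pi> i \<in> Homs C P (As ! i)) \<and>
      (\<forall>i<length As. \<forall>j<length As. \<pi> i \<bullet>\<^bsub>C\<^esub> \<iota> j =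
        (if i = j then idm C (As ! i) else \<zero>\<^bsub>homs C (As ! j) (As ! i)\<^esub>)) \<and>
      (\<Oplus>\<^bsub>homs C P P\<^esub>i\<in>{..<length As}. \<iota> i \<bullet>\<^bsub>C\<^esub> \<pi> i) = idm C P)"

definition is_zero_object :: "('k, 'o, 'm, 'z) lincat_scheme \<Rightarrow> 'o \<Rightarrow> bool"
  where "is_zero_object C Z \<longleftrightarrow> Z \<in> obj C \<and> idm C Z = \<zero>\<^bsub>homs C Z Z\<^esub>"

definition cat_isomorphism :: "('k, 'o, 'm, 'z) lincat_scheme \<Rightarrow> 'o \<Rightarrow> 'o \<Rightarrow> 'm \<Rightarrow> bool"
  where "cat_isomorphism C A B f \<longleftrightarrow> f \<in> Homs C A B \<and>
    (\<exists>g\<in>Homs C B A. g \<bullet>\<^bsub>C\<^esub> f = idm C A \<and> f \<bullet>\<^bsub>C\<^esub> g = idm C B)"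

definition cat_summand :: "('k, 'o, 'm, 'z) lincat_scheme \<Rightarrow> 'o \<Rightarrow> 'o \<Rightarrow> bool"
  where "cat_summand C X P \<longleftrightarrow> (\<exists>X'. cat_direct_sum C [X, X'] P)"

definition cat_add :: "('k, 'o, 'm, 'z) lincat_scheme \<Rightarrow> 'o \<Rightarrow> 'o set"
  where "cat_add C T = {X. \<exists>n P. cat_direct_sum C (replicate n T) P \<and> cat_summand C X P}"

definition End_alg :: "('k, 'o, 'm, 'z) lincat_scheme \<Rightarrow> 'o \<Rightarrow> ('k, 'm) module"
  where "End_alg C A = (homs C A A)\<lparr>monoid.mult := cmp C, one := idm C A\<rparr>"

locale linear_category =
  fixes K :: "('k, 'z) ring_scheme" and C :: "('k, 'o, 'm, 'q) lincat_scheme" (structure)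
  assumes field: "field K"
    and homs_module: "A \<in> obj C \<Longrightarrow> B \<in> obj C \<Longrightarrow> module K (homs C A B)"
    and homs_disjoint: "A \<in> obj C \<Longrightarrow> B \<in> obj C \<Longrightarrow> A' \<in> obj C \<Longrightarrow> B' \<in> obj C \<Longrightarrow>
      f \<in> Homs C A B \<Longrightarrow> f \<in> Homs C A' B' \<Longrightarrow> A = A' \<and> B = B'"
    and idm_closed: "A \<in> obj C \<Longrightarrow> idm C A \<in> Homs C A A"
    and comp_closed: "A \<in> obj C \<Longrightarrow> B \<in> obj C \<Longrightarrow> D \<in> obj C \<Longrightarrow>
      f \<in> Homs C A B \<Longrightarrow> g \<in> Homs C B D \<Longrightarrow> g \<bullet> f \<in> Homs C A D"
    and comp_assoc: "A \<in> obj C \<Longrightarrow> B \<in> obj C \<Longrightarrow> D \<in> obj C \<Longrightarrow> E \<in> obj C \<Longrightarrow>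
      f \<in> Homs C A B \<Longrightarrow> g \<in> Homs C B D \<Longrightarrow> h \<in> Homs C D E \<Longrightarrow> h \<bullet> g \<bullet> f = h \<bullet> (g \<bullet> f)"
    and comp_idm: "A \<in> obj C \<Longrightarrow> B \<in> obj C \<Longrightarrow> f \<in> Homs C A B \<Longrightarrow> f \<bullet> idm C A = f"
    and idm_comp: "A \<in> obj C \<Longrightarrow> B \<in> obj C \<Longrightarrow> f \<in> Homs C A B \<Longrightarrow> idm C B \<bullet> f = f"
    and linear_left: "A \<in> obj C \<Longrightarrow> B \<in> obj C \<Longrightarrow> D \<in> obj C \<Longrightarrow> g \<in> Homs C B D \<Longrightarrow>
      module_map K (homs C A B) (homs C A D) (\<lambda>f. g \<bullet> f)"
    and linear_right: "A \<in> obj C \<Longrightarrow> B \<in> obj C \<Longrightarrow> D \<in> obj C \<Longrightarrow> f \<in> Homs C A B \<Longrightarrow>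
      module_map K (homs C B D) (homs C A D) (\<lambda>g. g \<bullet> f)"

definition hom_finite :: "('k, 'z) ring_scheme \<Rightarrow> ('k, 'o, 'm, 'q) lincat_scheme \<Rightarrow> bool"
  where "hom_finite K C \<longleftrightarrow> (\<forall>A\<in>obj C. \<forall>B\<in>obj C. fin_gen K (homs C A B))"

definition local_ring :: "('a, 'z) ring_scheme \<Rightarrow> bool"
  where "local_ring R \<longleftrightarrow> ring R \<and> \<one>\<^bsub>R\<^esub> \<noteq> \<zero>\<^bsub>R\<^esub> \<and>
    (\<forall>x\<in>carrier R - Units R. \<forall>y\<in>carrier R - Units R. x \<oplus>\<^bsub>R\<^esub> y \<notin> Units R)"

definition krull_schmidt :: "('k, 'o, 'm, 'q) lincat_scheme \<Rightarrow> bool"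
  where "krull_schmidt C \<longleftrightarrow>
    (\<forall>A\<in>obj C. \<exists>As. cat_direct_sum C As A \<and> (\<forall>B\<in>set As. local_ring (End_alg C B)))"

text \<open>\<open>K\<close>-linear autoequivalences, given by their action on objects and on morphisms\<close>

definition linear_autoequivalence ::
  "('k, 'z) ring_scheme \<Rightarrow> ('k, 'o, 'm, 'q) lincat_scheme \<Rightarrow> ('o \<Rightarrow> 'o) \<Rightarrow> ('m \<Rightarrow> 'm) \<Rightarrow> bool"
  where "linear_autoequivalence K C FO FM \<longleftrightarrow>
    (\<forall>A\<in>obj C. FO A \<in> obj C \<and> FM (idm C A) = idm C (FO A)) \<and>
    (\<forall>A\<in>obj C. \<forall>B\<in>obj C. \<forall>D\<in>obj C. \<forall>f\<in>Homs C A B. \<forall>g\<in>Homs C B D.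
      FM (g \<bullet>\<^bsub>C\<^esub> f) = FM g \<bullet>\<^bsub>C\<^esub> FM f) \<and>
    (\<forall>A\<in>obj C. \<forall>B\<in>obj C. module_map K (homs C A B) (homs C (FO A) (FO B)) FM \<and>
      bij_betw FM (Homs C A B) (Homs C (FO A) (FO B))) \<and>
    (\<forall>B\<in>obj C. \<exists>A\<in>obj C. \<exists>f. cat_isomorphism C (FO A) B f)"

text \<open>
  \<open>\<eta> A B\<close> is the isomorphism \<open>Hom(A, B) \<rightarrow> D Hom(B, S A)\<close>. For \<open>a : A' \<rightarrow> A\<close> and \<open>b : B \<rightarrow> B'\<close>
  naturality says that \<open>\<eta> A' B' (b f a)\<close> is the linear form \<open>g \<mapsto> \<eta> A B f (S(a) g b)\<close> on
  \<open>Hom(B', S A')\<close>.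
\<close>

definition is_Serre_functor ::
  "('k, 'z) ring_scheme \<Rightarrow> ('k, 'o, 'm, 'q) lincat_scheme \<Rightarrow> ('o \<Rightarrow> 'o) \<Rightarrow> ('m \<Rightarrow> 'm) \<Rightarrow> bool"
  where "is_Serre_functor K C SO SM \<longleftrightarrow> linear_autoequivalence K C SO SM \<and>
    (\<exists>\<eta>. (\<forall>A\<in>obj C. \<forall>B\<in>obj C.
        module_map K (homs C A B) (dual_space K (homs C B (SO A))) (\<eta> A B) \<and>
        bij_betw (\<eta> A B) (Homs C A B) (carrier (dual_space K (homs C B (SO A))))) \<and>
      (\<forall>A\<in>obj C. \<forall>A'\<in>obj C. \<forall>B\<in>obj C. \<forall>B'\<in>obj C.
        \<forall>a\<in>Homs C A' A. \<forall>b\<in>Homs C B B'. \<forall>f\<in>Homs C A B. \<forall>g\<in>Homs C B' (SO A').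
          \<eta> A' B' (b \<bullet>\<^bsub>C\<^esub> f \<bullet>\<^bsub>C\<^esub> a) g = \<eta> A B f (SM a \<bullet>\<^bsub>C\<^esub> g \<bullet>\<^bsub>C\<^esub> b)))"


section \<open>Triangulated categories\<close>

text \<open>
  \<open>shO\<close> and \<open>shM\<close> are the shift \<open>[1]\<close> on objects and on morphisms, and \<open>(u, v, w) \<in> triangles\<close>
  means that \<open>A \<rightarrow> B \<rightarrow> E \<rightarrow> A[1]\<close> with maps \<open>u\<close>, \<open>v\<close>, \<open>w\<close> is a distinguished triangle; the objects are
  determined by the morphisms. The shift is only required to be an autoequivalence, not
  an automorphism.
\<close>

record ('k, 'o, 'm) tricat = "('k, 'o, 'm) lincat" +
  shO :: "'o \<Rightarrow> 'o"
  shM :: "'m \<Rightarrow> 'm"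
  triangles :: "('m \<times> 'm \<times> 'm) set"

definition candidate ::
  "('k, 'o, 'm, 'q) tricat_scheme \<Rightarrow> 'o \<Rightarrow> 'o \<Rightarrow> 'o \<Rightarrow> 'm \<Rightarrow> 'm \<Rightarrow> 'm \<Rightarrow> bool"
  where "candidate C A B E u v w \<longleftrightarrow> A \<in> obj C \<and> B \<in> obj C \<and> E \<in> obj C \<and>
    u \<in> Homs C A B \<and> v \<in> Homs C B E \<and> w \<in> Homs C E (shO C A)"

definition distinguished ::
  "('k, 'o, 'm, 'q) tricat_scheme \<Rightarrow> 'o \<Rightarrow> 'o \<Rightarrow> 'o \<Rightarrow> 'm \<Rightarrow> 'm \<Rightarrow> 'm \<Rightarrow> bool"
  where "distinguished C A B E u v w \<longleftrightarrow> candidate C A B E u v w \<and> (u, v, w) \<in> triangles C"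

locale triangulated_category = linear_category K C
  for K :: "('k, 'z) ring_scheme" and C :: "('k, 'o, 'm, 'q) tricat_scheme" (structure) +
  assumes direct_sums: "set As \<subseteq> obj C \<Longrightarrow> \<exists>P. cat_direct_sum C As P"
    and shift: "linear_autoequivalence K C (shO C) (shM C)"
    and TR1_iso: "distinguished C A B E u v w \<Longrightarrow> candidate C A' B' E' u' v' w' \<Longrightarrow>
      cat_isomorphism C A A' a \<Longrightarrow> cat_isomorphism C B B' b \<Longrightarrow> cat_isomorphism C E E' e \<Longrightarrow>
      b \<bullet> u = u' \<bullet> a \<Longrightarrow> e \<bullet> v = v' \<bullet> b \<Longrightarrow> shM C a \<bullet> w = w' \<bullet> e \<Longrightarrow>
      distinguished C A' B' E' u' v' w'"
    and TR1_id: "A \<in> obj C \<Longrightarrow> is_zero_object C Z \<Longrightarrow>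
      distinguished C A A Z (idm C A) \<zero>\<^bsub>homs C A Z\<^esub> \<zero>\<^bsub>homs C Z (shO C A)\<^esub>"
    and TR1_cone: "A \<in> obj C \<Longrightarrow> B \<in> obj C \<Longrightarrow> u \<in> Homs C A B \<Longrightarrow>
      \<exists>E v w. distinguished C A B E u v w"
    and TR2: "candidate C A B E u v w \<Longrightarrow>
      distinguished C A B E u v w \<longleftrightarrow>
      distinguished C B E (shO C A) v w (\<ominus>\<^bsub>homs C (shO C A) (shO C B)\<^esub> shM C u)"
    and TR3: "distinguished C A B E u v w \<Longrightarrow> distinguished C A' B' E' u' v' w' \<Longrightarrow>
      a \<in> Homs C A A' \<Longrightarrow> b \<in> Homs C B B' \<Longrightarrow> b \<bullet> u = u' \<bullet> a \<Longrightarrow>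
      \<exists>e\<in>Homs C E E'. e \<bullet> v = v' \<bullet> b \<and> shM C a \<bullet> w = w' \<bullet> e"
    and TR4: "distinguished C X Y Z' u i i' \<Longrightarrow> distinguished C Y Z X' v j j' \<Longrightarrow>
      distinguished C X Z Y' (v \<bullet> u) l l' \<Longrightarrow>
      \<exists>f\<in>Homs C Z' Y'. \<exists>g\<in>Homs C Y' X'.
        distinguished C Z' Y' X' f g (shM C i \<bullet> j') \<and>
        l \<bullet> v = f \<bullet> i \<and> l' \<bullet> f = i' \<and> g \<bullet> l = j \<and> j' \<bullet> g = shM C u \<bullet> l'"

definition cluster_tilting :: "('k, 'o, 'm, 'q) tricat_scheme \<Rightarrow> 'o \<Rightarrow> bool"
  where "cluster_tilting C T \<longleftrightarrow> T \<in> obj C \<and>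
    cat_add C T = {X \<in> obj C. Homs C T (shO C X) = {\<zero>\<^bsub>homs C T (shO C X)\<^esub>}} \<and>
    cat_add C T = {X \<in> obj C. Homs C X (shO C T) = {\<zero>\<^bsub>homs C X (shO C T)\<^esub>}}"

end

theory Submission
  imports Defs
begin

text \<open>
  Let \<open>T\<close> be the class of all \<open>N\<close> with \<open>Hom(N, \<tau>U) = 0\<close>, and let \<open>P1 \<rightarrow> P0 \<rightarrow> U \<rightarrow> 0\<close> be the presentation
  that defines \<open>\<tau>U\<close>. By duality \<open>N\<close> lies in \<open>T\<close> iff every map \<open>P1 \<rightarrow> N\<close> extends to \<open>P0\<close>, and \<open>\<tau>\<close> enters
  only through this description. It shows that the kernel of a right \<open>add U\<close>-approximation of a module
  by a module in \<open>T\<close> is again in \<open>T\<close>. Since \<open>Ext\<^sup>1(X, T)\<close> and \<open>Ext\<^sup>1(U, T)\<close> vanish, maps from \<open>X\<close> and \<open>U\<close> lift along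
  epimorphisms with kernel in \<open>T\<close>.

  Let \<open>g : X \<rightarrow> U'\<close>, \<open>f : U' \<rightarrow> Y\<close> be the given maps. Sincerity of \<open>U\<close> implies that \<open>g\<close> is not surjective, so
  \<open>Y \<noteq> 0\<close>. An idempotent \<open>\<epsilon>\<close> of \<open>Y\<close> lifts to an endomorphism \<open>\<phi>\<close> of \<open>U'\<close>, and the Bongartz construction
  allows us to correct \<open>\<phi>\<close> so that \<open>\<phi> g = g \<chi>\<close> for some endomorphism \<open>\<chi>\<close> of \<open>X\<close>. By Fitting's lemma \<open>\<chi>\<close> is
  nilpotent, or \<open>1 - \<chi>\<close> is, or \<open>\<chi> (1 - \<chi>)\<close> is invertible. Left minimality of \<open>g\<close> turns these
  cases into \<open>\<epsilon> = 0\<close>, \<open>\<epsilon> = 1\<close> and \<open>Y = 0\<close>. The triangulated category is needed only to know that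
  \<open>\<Lambda>\<close> is a finite-dimensional algebra.
\<close>

section \<open>Left modules and their maps\<close>

text \<open>The delicate point is the correction of \<phi>. A lift of \<epsilon> only maps g(X) into
  itself, and a map X -> g(X) need not lift along g: the kernel of g is not known to lie in T, so
  the relative projectivity of X gives nothing here. Maps from a projective module F do lift, and
  maps that factor through powers of U factor through g. Hence X is exhibited as a direct summand of
  E \<oplus> U^s, where E is an extension of a power of U by F. The part of the map that resists
  lifting becomes an endomorphism \<kappa> of U' with values in g(X) = ker f, and subtracting
  \<kappa> from \<phi> leaves the induced map \<epsilon> on Y unchanged.

  Sincerity supplies test objects: every simple quotient of ker g sits inside a quotient of U, and
  such quotients lie in T. If g is surjective, they force ker g = 0; then X would be a direct
  summand of a power of U, against the basicness of X \<oplus> U.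

  All finite powers of U come from a single finiteness fact, that Hom(M, N) is finitely generated
  over the centre of \<Lambda>.\<close>

context ring
begin

abbreviation lmod :: "('a, 'x) module \<Rightarrow> bool" where "lmod M \<equiv> left_module R M"
abbreviation mm :: "('a, 'x) module \<Rightarrow> ('a, 'y) module \<Rightarrow> ('x \<Rightarrow> 'y) \<Rightarrow> bool" where "mm M N f \<equiv> module_map R M N f"
abbreviation subm :: "'x set \<Rightarrow> ('a, 'x) module \<Rightarrow> bool" where "subm L M \<equiv> submodule L R M"

text \<open>Negatives come from the last hypothesis: since 0 x = 0, the element (-1) x is an
  additive inverse of x. All hypotheses are thus identities or closure conditions, which suits
  structures built by hand.\<close>

lemma lmodI:
  fixes M :: "('a, 'x) module"
  assumes "\<zero>\<^bsub>M\<^esub> \<in> carrier M"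
    and "\<And>x y. x \<in> carrier M \<Longrightarrow> y \<in> carrier M \<Longrightarrow> x \<oplus>\<^bsub>M\<^esub> y \<in> carrier M"
    and "\<And>a x. a \<in> carrier R \<Longrightarrow> x \<in> carrier M \<Longrightarrow> a \<odot>\<^bsub>M\<^esub> x \<in> carrier M"
    and "\<And>x y z. x \<in> carrier M \<Longrightarrow> y \<in> carrier M \<Longrightarrow> z \<in> carrier M \<Longrightarrow>
      (x \<oplus>\<^bsub>M\<^esub> y) \<oplus>\<^bsub>M\<^esub> z = x \<oplus>\<^bsub>M\<^esub> (y \<oplus>\<^bsub>M\<^esub> z)"
    and "\<And>x y. x \<in> carrier M \<Longrightarrow> y \<in> carrier M \<Longrightarrow> x \<oplus>\<^bsub>M\<^esub> y = y \<oplus>\<^bsub>M\<^esub> x"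
    and "\<And>x. x \<in> carrier M \<Longrightarrow> \<zero>\<^bsub>M\<^esub> \<oplus>\<^bsub>M\<^esub> x = x"
    and "\<And>a b x. a \<in> carrier R \<Longrightarrow> b \<in> carrier R \<Longrightarrow> x \<in> carrier M \<Longrightarrow>
      (a \<oplus> b) \<odot>\<^bsub>M\<^esub> x = a \<odot>\<^bsub>M\<^esub> x \<oplus>\<^bsub>M\<^esub> b \<odot>\<^bsub>M\<^esub> x"
    and "\<And>a x y. a \<in> carrier R \<Longrightarrow> x \<in> carrier M \<Longrightarrow> y \<in> carrier M \<Longrightarrow>
      a \<odot>\<^bsub>M\<^esub> (x \<oplus>\<^bsub>M\<^esub> y) = a \<odot>\<^bsub>M\<^esub> x \<oplus>\<^bsub>M\<^esub> a \<odot>\<^bsub>M\<^esub> y"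
    and "\<And>a b x. a \<in> carrier R \<Longrightarrow> b \<in> carrier R \<Longrightarrow> x \<in> carrier M \<Longrightarrow>
      (a \<otimes> b) \<odot>\<^bsub>M\<^esub> x = a \<odot>\<^bsub>M\<^esub> (b \<odot>\<^bsub>M\<^esub> x)"
    and "\<And>x. x \<in> carrier M \<Longrightarrow> \<one> \<odot>\<^bsub>M\<^esub> x = x"
    and "\<And>x. x \<in> carrier M \<Longrightarrow> \<zero> \<odot>\<^bsub>M\<^esub> x = \<zero>\<^bsub>M\<^esub>"
  shows "lmod M"
proof (intro left_module.intro left_module_axioms.intro abelian_groupI)
  show "ring R" by (rule ring_axioms)
  fix x assume x: "x \<in> carrier M"
  have "(\<ominus> \<one> \<oplus> \<one>) \<odot>\<^bsub>M\<^esub> x = (\<ominus> \<one>) \<odot>\<^bsub>M\<^esub> x \<oplus>\<^bsub>M\<^esub> \<one> \<odot>\<^bsub>M\<^esub> x" using x assms(7) by blast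
  then show "\<exists>y\<in>carrier M. y \<oplus>\<^bsub>M\<^esub> x = \<zero>\<^bsub>M\<^esub>"
    using assms(3,10,11) x by (intro bexI[of _ "(\<ominus> \<one>) \<odot>\<^bsub>M\<^esub> x"]) (auto simp: l_neg)
qed (use assms in auto)

section \<open>Arithmetic in modules over an arbitrary ring\<close>

lemma lm_ab: "lmod M \<Longrightarrow> abelian_group M" by (simp add: left_module_def)
lemma lm_abm: "lmod M \<Longrightarrow> abelian_monoid M" by (simp add: left_module_def abelian_group.axioms)

lemma lm_zero_closed [simp, intro]: "lmod M \<Longrightarrow> \<zero>\<^bsub>M\<^esub> \<in> carrier M"
  by (simp add: lm_abm abelian_monoid.zero_closed)
lemma lm_add_closed [simp, intro]:
  "lmod M \<Longrightarrow> x \<in> carrier M \<Longrightarrow> y \<in> carrier M \<Longrightarrow> x \<oplus>\<^bsub>M\<^esub> y \<in> carrier M"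
  by (simp add: lm_abm abelian_monoid.a_closed)
lemma lm_smult_closed [simp, intro]:
  "lmod M \<Longrightarrow> a \<in> carrier R \<Longrightarrow> x \<in> carrier M \<Longrightarrow> a \<odot>\<^bsub>M\<^esub> x \<in> carrier M"
  by (rule left_module.smult_closed)
lemma lm_assoc:
  "lmod M \<Longrightarrow> x \<in> carrier M \<Longrightarrow> y \<in> carrier M \<Longrightarrow> z \<in> carrier M \<Longrightarrow>
    (x \<oplus>\<^bsub>M\<^esub> y) \<oplus>\<^bsub>M\<^esub> z = x \<oplus>\<^bsub>M\<^esub> (y \<oplus>\<^bsub>M\<^esub> z)"
  by (simp add: lm_abm abelian_monoid.a_assoc)
lemma lm_comm: "lmod M \<Longrightarrow> x \<in> carrier M \<Longrightarrow> y \<in> carrier M \<Longrightarrow> x \<oplus>\<^bsub>M\<^esub> y = y \<oplus>\<^bsub>M\<^esub> x"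
  by (simp add: lm_abm abelian_monoid.a_comm)
lemma lm_lcomm:
  "lmod M \<Longrightarrow> x \<in> carrier M \<Longrightarrow> y \<in> carrier M \<Longrightarrow> z \<in> carrier M \<Longrightarrow>
    x \<oplus>\<^bsub>M\<^esub> (y \<oplus>\<^bsub>M\<^esub> z) = y \<oplus>\<^bsub>M\<^esub> (x \<oplus>\<^bsub>M\<^esub> z)"
  by (simp add: lm_abm abelian_monoid.a_lcomm)
lemmas lm_ac = lm_assoc lm_comm lm_lcomm
lemma lm_l_zero [simp]: "lmod M \<Longrightarrow> x \<in> carrier M \<Longrightarrow> \<zero>\<^bsub>M\<^esub> \<oplus>\<^bsub>M\<^esub> x = x"
  by (simp add: lm_abm abelian_monoid.l_zero)
lemma lm_r_zero [simp]: "lmod M \<Longrightarrow> x \<in> carrier M \<Longrightarrow> x \<oplus>\<^bsub>M\<^esub> \<zero>\<^bsub>M\<^esub> = x"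
  by (simp add: lm_abm abelian_monoid.r_zero)
lemma lm_smult_add:
  "lmod M \<Longrightarrow> a \<in> carrier R \<Longrightarrow> x \<in> carrier M \<Longrightarrow> y \<in> carrier M \<Longrightarrow>
    a \<odot>\<^bsub>M\<^esub> (x \<oplus>\<^bsub>M\<^esub> y) = a \<odot>\<^bsub>M\<^esub> x \<oplus>\<^bsub>M\<^esub> a \<odot>\<^bsub>M\<^esub> y"
  by (rule left_module.smult_r_distr)
lemma lm_add_smult:
  "lmod M \<Longrightarrow> a \<in> carrier R \<Longrightarrow> b \<in> carrier R \<Longrightarrow> x \<in> carrier M \<Longrightarrow>
    (a \<oplus> b) \<odot>\<^bsub>M\<^esub> x = a \<odot>\<^bsub>M\<^esub> x \<oplus>\<^bsub>M\<^esub> b \<odot>\<^bsub>M\<^esub> x"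
  by (rule left_module.smult_l_distr)
lemma lm_smult_assoc:
  "lmod M \<Longrightarrow> a \<in> carrier R \<Longrightarrow> b \<in> carrier R \<Longrightarrow> x \<in> carrier M \<Longrightarrow>
    (a \<otimes> b) \<odot>\<^bsub>M\<^esub> x = a \<odot>\<^bsub>M\<^esub> (b \<odot>\<^bsub>M\<^esub> x)"
  by (rule left_module.smult_assoc)
lemma lm_one [simp]: "lmod M \<Longrightarrow> x \<in> carrier M \<Longrightarrow> \<one> \<odot>\<^bsub>M\<^esub> x = x"
  by (rule left_module.smult_one)
lemma lm_cancel:
  "lmod M \<Longrightarrow> x \<in> carrier M \<Longrightarrow> y \<in> carrier M \<Longrightarrow> z \<in> carrier M \<Longrightarrow>
    x \<oplus>\<^bsub>M\<^esub> z = y \<oplus>\<^bsub>M\<^esub> z \<longleftrightarrow> x = y"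
  using lm_ab abelian_group.axioms(2) abelian_group.a_comm_group comm_group.axioms(2)
  by (metis abelian_group.minus_equality abelian_groupE(6) lm_assoc lm_comm lm_l_zero)
lemma lm_add4:
  assumes "lmod M" "x \<in> carrier M" "y \<in> carrier M" "u \<in> carrier M" "v \<in> carrier M"
  shows "(x \<oplus>\<^bsub>M\<^esub> y) \<oplus>\<^bsub>M\<^esub> (u \<oplus>\<^bsub>M\<^esub> v) = (x \<oplus>\<^bsub>M\<^esub> u) \<oplus>\<^bsub>M\<^esub> (y \<oplus>\<^bsub>M\<^esub> v)"
  using assms by (simp add: lm_assoc lm_lcomm[of M u y v])
lemma lm_zero_smult [simp]:
  assumes "lmod M" "x \<in> carrier M" shows "\<zero> \<odot>\<^bsub>M\<^esub> x = \<zero>\<^bsub>M\<^esub>"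
  using lm_add_smult[OF assms(1) zero_closed zero_closed assms(2)]
    lm_cancel[OF assms(1), of "\<zero> \<odot>\<^bsub>M\<^esub> x" "\<zero>\<^bsub>M\<^esub>" "\<zero> \<odot>\<^bsub>M\<^esub> x"] assms by simp
lemma lm_smult_zero [simp]:
  assumes "lmod M" "a \<in> carrier R" shows "a \<odot>\<^bsub>M\<^esub> \<zero>\<^bsub>M\<^esub> = \<zero>\<^bsub>M\<^esub>"
  using lm_smult_add[OF assms lm_zero_closed lm_zero_closed] assms
    lm_cancel[OF assms(1), of "a \<odot>\<^bsub>M\<^esub> \<zero>\<^bsub>M\<^esub>" "\<zero>\<^bsub>M\<^esub>" "a \<odot>\<^bsub>M\<^esub> \<zero>\<^bsub>M\<^esub>"] by simp

text \<open>Unlike \<open>a_minus\<close>, this difference depends only on the operations of \<open>M\<close> and not on its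
  carrier, so that it does not change on passing to submodules.\<close>

definition sb :: "('a, 'x) module \<Rightarrow> 'x \<Rightarrow> 'x \<Rightarrow> 'x" where
  "sb M x y = x \<oplus>\<^bsub>M\<^esub> (\<ominus> \<one>) \<odot>\<^bsub>M\<^esub> y"

lemma sb_closed [simp, intro]:
  "lmod M \<Longrightarrow> x \<in> carrier M \<Longrightarrow> y \<in> carrier M \<Longrightarrow> sb M x y \<in> carrier M"
  by (simp add: sb_def)
lemma neg_add: assumes "lmod M" "x \<in> carrier M" shows "(\<ominus> \<one>) \<odot>\<^bsub>M\<^esub> x \<oplus>\<^bsub>M\<^esub> x = \<zero>\<^bsub>M\<^esub>"
  using lm_add_smult[OF assms(1) a_inv_closed[OF one_closed] one_closed assms(2)] assms
  by (simp add: l_neg)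
lemma sb_self [simp]: "lmod M \<Longrightarrow> x \<in> carrier M \<Longrightarrow> sb M x x = \<zero>\<^bsub>M\<^esub>"
  using neg_add[of M x] by (simp add: sb_def lm_comm)
lemma sb_add [simp]:
  "lmod M \<Longrightarrow> x \<in> carrier M \<Longrightarrow> y \<in> carrier M \<Longrightarrow> sb M x y \<oplus>\<^bsub>M\<^esub> y = x"
  by (simp add: sb_def lm_assoc neg_add)
lemma add_sb [simp]:
  "lmod M \<Longrightarrow> x \<in> carrier M \<Longrightarrow> y \<in> carrier M \<Longrightarrow> y \<oplus>\<^bsub>M\<^esub> sb M x y = x"
  by (subst lm_comm) auto
lemma sb_eq_iff:
  "lmod M \<Longrightarrow> x \<in> carrier M \<Longrightarrow> y \<in> carrier M \<Longrightarrow> z \<in> carrier M \<Longrightarrow>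
    sb M x y = z \<longleftrightarrow> x = z \<oplus>\<^bsub>M\<^esub> y"
  using lm_cancel[of M "sb M x y" z y] by simp
lemma sb_zero_iff [simp]:
  "lmod M \<Longrightarrow> x \<in> carrier M \<Longrightarrow> y \<in> carrier M \<Longrightarrow> sb M x y = \<zero>\<^bsub>M\<^esub> \<longleftrightarrow> x = y"
  by (simp add: sb_eq_iff)
lemma sb_zero [simp]: "lmod M \<Longrightarrow> x \<in> carrier M \<Longrightarrow> sb M x \<zero>\<^bsub>M\<^esub> = x"
  by (simp add: sb_eq_iff)
lemma add_sb_cancel [simp]:
  "lmod M \<Longrightarrow> x \<in> carrier M \<Longrightarrow> y \<in> carrier M \<Longrightarrow> sb M (x \<oplus>\<^bsub>M\<^esub> y) y = x"
  by (simp add: sb_eq_iff)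

section \<open>Homomorphisms, their sums and factorisations\<close>

lemma mm_closed: "mm M N f \<Longrightarrow> x \<in> carrier M \<Longrightarrow> f x \<in> carrier N"
  by (auto simp: module_map_def)
lemma mm_add: "mm M N f \<Longrightarrow> x \<in> carrier M \<Longrightarrow> y \<in> carrier M \<Longrightarrow> f (x \<oplus>\<^bsub>M\<^esub> y) = f x \<oplus>\<^bsub>N\<^esub> f y"
  by (auto simp: module_map_def)
lemma mm_smult: "mm M N f \<Longrightarrow> a \<in> carrier R \<Longrightarrow> x \<in> carrier M \<Longrightarrow> f (a \<odot>\<^bsub>M\<^esub> x) = a \<odot>\<^bsub>N\<^esub> f x"
  by (auto simp: module_map_def)
lemma mm_zero: assumes "mm M N f" "lmod M" "lmod N" shows "f \<zero>\<^bsub>M\<^esub> = \<zero>\<^bsub>N\<^esub>"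
  using mm_smult[OF assms(1) zero_closed lm_zero_closed[OF assms(2)]] assms mm_closed[OF assms(1)]
  by simp
lemma mm_sb: "mm M N f \<Longrightarrow> lmod M \<Longrightarrow> x \<in> carrier M \<Longrightarrow> y \<in> carrier M \<Longrightarrow>
    f (sb M x y) = sb N (f x) (f y)"
  by (simp add: sb_def mm_add mm_smult)
lemma mmI:
  assumes "\<And>x. x \<in> carrier M \<Longrightarrow> f x \<in> carrier N"
    and "\<And>x y. x \<in> carrier M \<Longrightarrow> y \<in> carrier M \<Longrightarrow> f (x \<oplus>\<^bsub>M\<^esub> y) = f x \<oplus>\<^bsub>N\<^esub> f y"
    and "\<And>a x. a \<in> carrier R \<Longrightarrow> x \<in> carrier M \<Longrightarrow> f (a \<odot>\<^bsub>M\<^esub> x) = a \<odot>\<^bsub>N\<^esub> f x"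
  shows "mm M N f"
  using assms by (auto simp: module_map_def)
lemma mm_cong: "lmod M \<Longrightarrow> (\<And>x. x \<in> carrier M \<Longrightarrow> f x = g x) \<Longrightarrow> mm M N f \<longleftrightarrow> mm M N g"
  unfolding module_map_def by (auto simp: Pi_iff)
lemma mm_id: "mm M M (\<lambda>x. x)" by (auto simp: module_map_def)
lemma mm_comp: "mm M N f \<Longrightarrow> mm N P g \<Longrightarrow> mm M P (\<lambda>x. g (f x))"
  by (auto intro!: mmI simp: mm_closed mm_add mm_smult)
lemma mm_0: "lmod N \<Longrightarrow> mm M N (\<lambda>_. \<zero>\<^bsub>N\<^esub>)"
  by (auto intro!: mmI)
lemma mm_plus: "lmod N \<Longrightarrow> mm M N f \<Longrightarrow> mm M N g \<Longrightarrow> mm M N (\<lambda>x. f x \<oplus>\<^bsub>N\<^esub> g x)"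
  by (auto intro!: mmI simp: mm_closed mm_add mm_smult lm_ac lm_smult_add)
lemma mm_smultc:
  "lmod N \<Longrightarrow> mm M N f \<Longrightarrow> c \<in> carrier R \<Longrightarrow> (\<And>a. a \<in> carrier R \<Longrightarrow> a \<otimes> c = c \<otimes> a) \<Longrightarrow>
    mm M N (\<lambda>x. c \<odot>\<^bsub>N\<^esub> f x)"
  by (auto intro!: mmI simp: mm_closed mm_add mm_smult lm_smult_add lm_smult_assoc[symmetric])
lemma mm_minus:
  assumes "lmod N" "mm M N f" "mm M N g" shows "mm M N (\<lambda>x. sb N (f x) (g x))"
  unfolding sb_def using assms by (intro mm_plus mm_smultc) (auto simp: l_minus r_minus)
lemma mm_finsum:
  assumes "lmod M" "lmod N" "finite I" "\<And>i. i \<in> I \<Longrightarrow> mm M N (f i)"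
  shows "mm M N (\<lambda>x. finsum N (\<lambda>i. f i x) I)"
  using assms(3,4)
proof (induction I rule: finite_induct)
  case empty
  then show ?case by (simp add: abelian_monoid.finsum_empty[OF lm_abm[OF assms(2)]] mm_0 assms)
next
  case (insert i I)
  have a: "mm M N (\<lambda>x. f i x \<oplus>\<^bsub>N\<^esub> finsum N (\<lambda>i. f i x) I)"
    using insert(4) by (intro mm_plus assms(1,2) insert.IH) auto
  have b: "finsum N (\<lambda>i. f i x) (insert i I) = f i x \<oplus>\<^bsub>N\<^esub> finsum N (\<lambda>i. f i x) I"
    if "x \<in> carrier M" for x
    using insert(1,2) mm_closed[OF insert.prems that]
    by (intro abelian_monoid.finsum_insert[OF lm_abm[OF assms(2)]]) auto
  show ?case by (rule mm_cong[OF assms(1) b, THEN iffD2, OF _ a])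
qed

text \<open>Each axiom for Q is checked on preimages in M. Q is only a structure whose operations
  are the images of those of M, which is the situation of a quotient carried by
  representatives.\<close>

lemma lmod_image:
  assumes "lmod M" "mm M Q p" "p ` carrier M = carrier Q" "p \<zero>\<^bsub>M\<^esub> = \<zero>\<^bsub>Q\<^esub>"
  shows "lmod Q"
proof -
  have ex: "\<exists>u\<in>carrier M. x = p u" if "x \<in> carrier Q" for x using that assms(3) by (metis imageE)
  have p: "p u \<oplus>\<^bsub>Q\<^esub> p v = p (u \<oplus>\<^bsub>M\<^esub> v)" "a \<odot>\<^bsub>Q\<^esub> p u = p (a \<odot>\<^bsub>M\<^esub> u)"
    if "u \<in> carrier M" "v \<in> carrier M" "a \<in> carrier R" for u v a
    using mm_add[OF assms(2)] mm_smult[OF assms(2)] that by auto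
  note p' = p(1)[OF _ _ zero_closed] p(2)[OF _ lm_zero_closed[OF assms(1)]]
  note c = mm_closed[OF assms(2)]
  show ?thesis
  proof (rule lmodI)
    show "\<zero>\<^bsub>Q\<^esub> \<in> carrier Q" using c assms by (metis lm_zero_closed)
    fix x y assume "x \<in> carrier Q" "y \<in> carrier Q"
    then obtain u v where u: "u \<in> carrier M" "v \<in> carrier M" "x = p u" "y = p v" using ex by blast
    show "x \<oplus>\<^bsub>Q\<^esub> y \<in> carrier Q" using u assms(1) by (simp add: p' c)
    show "x \<oplus>\<^bsub>Q\<^esub> y = y \<oplus>\<^bsub>Q\<^esub> x" using u assms(1) by (simp add: p' lm_comm[of M u v])
    show "a \<odot>\<^bsub>Q\<^esub> (x \<oplus>\<^bsub>Q\<^esub> y) = a \<odot>\<^bsub>Q\<^esub> x \<oplus>\<^bsub>Q\<^esub> a \<odot>\<^bsub>Q\<^esub> y" if "a \<in> carrier R" for a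
      using u assms(1) that by (simp add: p' lm_smult_add)
    fix z assume "z \<in> carrier Q"
    then obtain w where w: "w \<in> carrier M" "z = p w" using ex by blast
    show "x \<oplus>\<^bsub>Q\<^esub> y \<oplus>\<^bsub>Q\<^esub> z = x \<oplus>\<^bsub>Q\<^esub> (y \<oplus>\<^bsub>Q\<^esub> z)" using u w assms(1) by (simp add: p' lm_assoc)
  next
    fix x assume "x \<in> carrier Q"
    then obtain u where u: "u \<in> carrier M" "x = p u" using ex by blast
    show "\<zero>\<^bsub>Q\<^esub> \<oplus>\<^bsub>Q\<^esub> x = x" using u assms(1) p'(1)[of "\<zero>\<^bsub>M\<^esub>" u] assms(4) by simp
    show "\<one> \<odot>\<^bsub>Q\<^esub> x = x" "\<zero> \<odot>\<^bsub>Q\<^esub> x = \<zero>\<^bsub>Q\<^esub>" using u assms(1,4) by (simp_all add: p')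
    fix a assume a: "a \<in> carrier R"
    show "a \<odot>\<^bsub>Q\<^esub> x \<in> carrier Q" using u a assms(1) by (simp add: p' c)
    fix b assume b: "b \<in> carrier R"
    show "(a \<oplus> b) \<odot>\<^bsub>Q\<^esub> x = a \<odot>\<^bsub>Q\<^esub> x \<oplus>\<^bsub>Q\<^esub> b \<odot>\<^bsub>Q\<^esub> x"
      using u a b assms(1) by (simp add: p' lm_add_smult)
    show "(a \<otimes> b) \<odot>\<^bsub>Q\<^esub> x = a \<odot>\<^bsub>Q\<^esub> (b \<odot>\<^bsub>Q\<^esub> x)"
      using u a b assms(1) by (simp add: p' lm_smult_assoc)
  qed
qed

lemma mm_inv:
  assumes "lmod M" "mm M N f" "bij_betw f (carrier M) (carrier N)"
  shows "mm N M (inv_into (carrier M) f)"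
proof -
  have i: "inv_into (carrier M) f y \<in> carrier M" "f (inv_into (carrier M) f y) = y"
    if "y \<in> carrier N" for y
    using assms(3) that by (auto simp: bij_betw_def inv_into_into f_inv_into_f)
  have e: "inv_into (carrier M) f (f x) = x" if "x \<in> carrier M" for x
    using assms(3) that by (auto simp: bij_betw_def)
  show ?thesis
  proof (rule mmI)
    fix x y assume "x \<in> carrier N" "y \<in> carrier N"
    then show "inv_into (carrier M) f (x \<oplus>\<^bsub>N\<^esub> y) =
        inv_into (carrier M) f x \<oplus>\<^bsub>M\<^esub> inv_into (carrier M) f y"
      using i assms e[of "inv_into (carrier M) f x \<oplus>\<^bsub>M\<^esub> inv_into (carrier M) f y"]
      by (simp add: mm_add)
  next
    fix a y assume "a \<in> carrier R" "y \<in> carrier N"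
    then show "inv_into (carrier M) f (a \<odot>\<^bsub>N\<^esub> y) = a \<odot>\<^bsub>M\<^esub> inv_into (carrier M) f y"
      using i assms e[of "a \<odot>\<^bsub>M\<^esub> inv_into (carrier M) f y"] by (simp add: mm_smult)
  qed (use i in auto)
qed

text \<open>The homomorphism theorem: t is f applied to a chosen preimage, and the condition on the
  kernel makes the choice irrelevant. Every map out of a quotient or a pushout below is obtained in
  this way.\<close>

lemma mm_factor_surj:
  assumes "lmod M" "lmod N" "mm M Q p" "p ` carrier M = carrier Q" "mm M N f"
    and "lmod Q" "\<And>x. x \<in> carrier M \<Longrightarrow> p x = \<zero>\<^bsub>Q\<^esub> \<Longrightarrow> f x = \<zero>\<^bsub>N\<^esub>"
  shows "\<exists>t. mm Q N t \<and> (\<forall>x\<in>carrier M. t (p x) = f x)"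
proof -
  define t where "t y = f (inv_into (carrier M) p y)" for y
  have i: "inv_into (carrier M) p y \<in> carrier M" "p (inv_into (carrier M) p y) = y"
    if "y \<in> carrier Q" for y
    using that assms(4) by (metis inv_into_into, metis f_inv_into_f)
  have eq: "f x = f y" if "x \<in> carrier M" "y \<in> carrier M" "p x = p y" for x y
  proof -
    have "p (sb M x y) = \<zero>\<^bsub>Q\<^esub>" using that assms by (simp add: mm_sb mm_closed)
    then have "f (sb M x y) = \<zero>\<^bsub>N\<^esub>" using assms(7) that assms by auto
    then show ?thesis using that assms by (simp add: mm_sb mm_closed)
  qed
  have t: "t (p x) = f x" if "x \<in> carrier M" for x
    using eq[of "inv_into (carrier M) p (p x)" x] that i[of "p x"] assms(3)
    by (auto simp: t_def mm_closed)
  have "mm Q N t"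
  proof (rule mmI)
    fix x y assume "x \<in> carrier Q" "y \<in> carrier Q"
    then obtain u v where "u \<in> carrier M" "v \<in> carrier M" "x = p u" "y = p v" using assms(4) by (metis imageE)
    then show "t (x \<oplus>\<^bsub>Q\<^esub> y) = t x \<oplus>\<^bsub>N\<^esub> t y"
      using t[of "u \<oplus>\<^bsub>M\<^esub> v"] t[of u] t[of v] assms by (simp add: mm_add)
  next
    fix a x assume a: "a \<in> carrier R" "x \<in> carrier Q"
    then obtain u where "u \<in> carrier M" "x = p u" using assms(4) by (metis imageE)
    then show "t (a \<odot>\<^bsub>Q\<^esub> x) = a \<odot>\<^bsub>N\<^esub> t x"
      using t[of "a \<odot>\<^bsub>M\<^esub> u"] t[of u] a assms by (simp add: mm_smult)
  next
    fix x assume "x \<in> carrier Q"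
    then show "t x \<in> carrier N" unfolding t_def using i assms(5) by (simp add: mm_closed)
  qed
  then show ?thesis using t by blast
qed

subsection \<open>Submodules and quotients\<close>

text \<open>Closure under negatives is deduced from closure under the scalar -1.\<close>

lemma submI:
  fixes M :: "('a, 'x) module"
  assumes "lmod M" "L \<subseteq> carrier M" "\<zero>\<^bsub>M\<^esub> \<in> L" "\<And>x y. x \<in> L \<Longrightarrow> y \<in> L \<Longrightarrow> x \<oplus>\<^bsub>M\<^esub> y \<in> L"
    "\<And>a x. a \<in> carrier R \<Longrightarrow> x \<in> L \<Longrightarrow> a \<odot>\<^bsub>M\<^esub> x \<in> L"
  shows "subm L M"
proof -
  interpret M: left_module R M by fact
  have inv: "\<ominus>\<^bsub>M\<^esub> x \<in> L" if "x \<in> L" for x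
  proof -
    have "x \<in> carrier M" using that assms(2) by auto
    then have "\<ominus>\<^bsub>M\<^esub> x = (\<ominus> \<one>) \<odot>\<^bsub>M\<^esub> x"
      using neg_add[OF assms(1), of x] assms(1) by (intro M.M.minus_equality) auto
    then show ?thesis using assms(5) that by simp
  qed
  show ?thesis
    by (intro submodule.intro subgroup.intro submodule_axioms.intro)
      (use assms inv in \<open>auto simp: a_inv_def[symmetric]\<close>)
qed

lemma subm_sub: "subm L M \<Longrightarrow> L \<subseteq> carrier M"
  using submodule.axioms(1) subgroup.subset by fastforce
lemma subm_in: "subm L M \<Longrightarrow> x \<in> L \<Longrightarrow> x \<in> carrier M"
  using subm_sub by blast
lemma subm_zero: "subm L M \<Longrightarrow> \<zero>\<^bsub>M\<^esub> \<in> L"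
  using submodule.axioms(1) subgroup.one_closed by fastforce
lemma subm_add: "subm L M \<Longrightarrow> x \<in> L \<Longrightarrow> y \<in> L \<Longrightarrow> x \<oplus>\<^bsub>M\<^esub> y \<in> L"
  using submodule.axioms(1) subgroup.m_closed by fastforce
lemma subm_smult: "subm L M \<Longrightarrow> a \<in> carrier R \<Longrightarrow> x \<in> L \<Longrightarrow> a \<odot>\<^bsub>M\<^esub> x \<in> L"
  by (rule submodule.smult_closed)
lemma subm_sb: "subm L M \<Longrightarrow> x \<in> L \<Longrightarrow> y \<in> L \<Longrightarrow> sb M x y \<in> L"
  by (simp add: sb_def subm_add subm_smult)
lemma subm_carrier: "lmod M \<Longrightarrow> subm (carrier M) M" by (auto intro!: submI)
lemma subm_0: "lmod M \<Longrightarrow> subm {\<zero>\<^bsub>M\<^esub>} M" by (auto intro!: submI)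

lemma lmod_sub: "lmod M \<Longrightarrow> subm L M \<Longrightarrow> lmod (M\<lparr>carrier := L\<rparr>)"
  by (rule lmodI)
    (auto simp: subm_add subm_smult subm_zero subm_in lm_ac lm_smult_add lm_add_smult lm_smult_assoc)

lemma sb_sub [simp]: "sb (M\<lparr>carrier := L\<rparr>) = sb M"
  by (auto simp: sb_def fun_eq_iff)

lemma mm_sub_dom: "mm M N f \<Longrightarrow> L \<subseteq> carrier M \<Longrightarrow> mm (M\<lparr>carrier := L\<rparr>) N f"
  by (auto simp: module_map_def subset_iff)
lemma mm_sub_cod_iff:
  "L \<subseteq> carrier N \<Longrightarrow> mm M (N\<lparr>carrier := L\<rparr>) f \<longleftrightarrow> mm M N f \<and> f ` carrier M \<subseteq> L"
  by (auto simp: module_map_def)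

lemma subm_sub_iff:
  fixes M :: "('a, 'x) module"
  assumes "lmod M" "subm L M"
  shows "subm L' (M\<lparr>carrier := L\<rparr>) \<longleftrightarrow> subm L' M \<and> L' \<subseteq> L"
proof
  assume a: "subm L' (M\<lparr>carrier := L\<rparr>)"
  have "subm L' M"
    using subm_sub[OF a] subm_zero[OF a] subm_add[OF a] subm_smult[OF a] subm_sub[OF assms(2)]
    by (intro submI assms) auto
  then show "subm L' M \<and> L' \<subseteq> L" using subm_sub[OF a] by auto
next
  assume a: "subm L' M \<and> L' \<subseteq> L"
  then show "subm L' (M\<lparr>carrier := L\<rparr>)"
    by (intro submI lmod_sub assms) (auto simp: subm_zero subm_add subm_smult)
qed

lemma subm_kernel: "lmod M \<Longrightarrow> lmod N \<Longrightarrow> mm M N f \<Longrightarrow> subm {x \<in> carrier M. f x = \<zero>\<^bsub>N\<^esub>} M"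
  by (rule submI) (auto simp: mm_zero mm_add mm_smult)
lemma subm_image:
  assumes "lmod M" "lmod N" "mm M N f" "subm L M" shows "subm (f ` L) N"
proof (rule submI)
  show "\<zero>\<^bsub>N\<^esub> \<in> f ` L" using assms mm_zero subm_zero by (metis image_eqI)
next
  fix x y assume "x \<in> f ` L" "y \<in> f ` L"
  then obtain u v where "u \<in> L" "v \<in> L" "x = f u" "y = f v" by auto
  then show "x \<oplus>\<^bsub>N\<^esub> y \<in> f ` L"
    using assms by (intro image_eqI[of _ _ "u \<oplus>\<^bsub>M\<^esub> v"]) (auto simp: mm_add subm_add subm_in)
next
  fix a x assume "x \<in> f ` L" "a \<in> carrier R"
  then obtain u where "u \<in> L" "x = f u" "a \<in> carrier R" by auto
  then show "a \<odot>\<^bsub>N\<^esub> x \<in> f ` L"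
    using assms by (intro image_eqI[of _ _ "a \<odot>\<^bsub>M\<^esub> u"]) (auto simp: mm_smult subm_smult subm_in)
qed (use assms in \<open>auto simp: mm_closed subm_in\<close>)
lemma subm_preimage:
  assumes "lmod M" "lmod N" "mm M N f" "subm L N" shows "subm {x \<in> carrier M. f x \<in> L} M"
  by (rule submI) (use assms in \<open>auto simp: mm_zero mm_add mm_smult subm_zero subm_add subm_smult\<close>)

lemma mm_inj_iff:
  assumes "lmod M" "lmod N" "mm M N f"
  shows "inj_on f (carrier M) \<longleftrightarrow> {x \<in> carrier M. f x = \<zero>\<^bsub>N\<^esub>} = {\<zero>\<^bsub>M\<^esub>}"
proof
  assume i: "inj_on f (carrier M)"
  have "x = \<zero>\<^bsub>M\<^esub>" if "x \<in> carrier M" "f x = \<zero>\<^bsub>N\<^esub>" for x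
    using inj_onD[OF i _ that(1) lm_zero_closed[OF assms(1)]] that(2) mm_zero[OF assms(3,1,2)] by simp
  then show "{x \<in> carrier M. f x = \<zero>\<^bsub>N\<^esub>} = {\<zero>\<^bsub>M\<^esub>}"
    using mm_zero[OF assms(3,1,2)] lm_zero_closed[OF assms(1)] by blast
next
  assume k: "{x \<in> carrier M. f x = \<zero>\<^bsub>N\<^esub>} = {\<zero>\<^bsub>M\<^esub>}"
  show "inj_on f (carrier M)"
  proof (rule inj_onI)
    fix x y assume "x \<in> carrier M" "y \<in> carrier M" "f x = f y"
    then have "sb M x y \<in> {x \<in> carrier M. f x = \<zero>\<^bsub>N\<^esub>}" using assms by (simp add: mm_sb mm_closed)
    then show "x = y" using k \<open>x \<in> carrier M\<close> \<open>y \<in> carrier M\<close> assms by auto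
  qed
qed

text \<open>The quotient is carried by a system of representatives, so that its element type does not
  change.\<close>

definition qrep :: "('a, 'x) module \<Rightarrow> 'x set \<Rightarrow> 'x \<Rightarrow> 'x" where
  "qrep M L x = (SOME y. y \<in> carrier M \<and> sb M x y \<in> L)"

definition quot :: "('a, 'x) module \<Rightarrow> 'x set \<Rightarrow> ('a, 'x) module" where
  "quot M L = M\<lparr>carrier := qrep M L ` carrier M, zero := qrep M L \<zero>\<^bsub>M\<^esub>,
    add := (\<lambda>x y. qrep M L (x \<oplus>\<^bsub>M\<^esub> y)), smult := (\<lambda>a x. qrep M L (a \<odot>\<^bsub>M\<^esub> x))\<rparr>"

lemma qrep:
  assumes "lmod M" "subm L M" "x \<in> carrier M"
  shows "qrep M L x \<in> carrier M" "sb M x (qrep M L x) \<in> L"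
proof -
  have "\<exists>y. y \<in> carrier M \<and> sb M x y \<in> L" using assms subm_zero by (intro exI[of _ x]) auto
  from someI_ex[OF this] show "qrep M L x \<in> carrier M" "sb M x (qrep M L x) \<in> L"
    by (auto simp: qrep_def)
qed

lemma sb_sb_cancel:
  assumes "lmod M" "x \<in> carrier M" "y \<in> carrier M" "z \<in> carrier M"
  shows "sb M x z = sb M x y \<oplus>\<^bsub>M\<^esub> sb M y z"
proof -
  have "x = (sb M x y \<oplus>\<^bsub>M\<^esub> sb M y z) \<oplus>\<^bsub>M\<^esub> z" using assms by (simp add: lm_assoc)
  then show ?thesis using assms by (simp add: sb_eq_iff)
qed

lemma sb_swap:
  assumes "lmod M" "x \<in> carrier M" "y \<in> carrier M"
  shows "sb M x y = (\<ominus> \<one>) \<odot>\<^bsub>M\<^esub> sb M y x"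
  using assms by (auto simp: sb_def lm_smult_add lm_comm lm_smult_assoc[symmetric] l_minus r_minus minus_minus)

lemma qrep_eq_iff:
  assumes "lmod M" "subm L M" "x \<in> carrier M" "y \<in> carrier M"
  shows "qrep M L x = qrep M L y \<longleftrightarrow> sb M x y \<in> L"
proof
  note q = qrep[OF assms(1,2,3)] qrep[OF assms(1,2,4)]
  assume "qrep M L x = qrep M L y"
  then have "sb M x y = sb M x (qrep M L x) \<oplus>\<^bsub>M\<^esub> (\<ominus> \<one>) \<odot>\<^bsub>M\<^esub> sb M y (qrep M L y)"
    using sb_sb_cancel[OF assms(1,3) q(1) assms(4)] sb_swap[of M "qrep M L y" y] q assms by simp
  then show "sb M x y \<in> L" using q subm_add[OF assms(2)] subm_smult[OF assms(2)] by simp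
next
  assume xy: "sb M x y \<in> L"
  have yx: "sb M y x \<in> L" using subm_smult[OF assms(2) _ xy, of "\<ominus> \<one>"] sb_swap[of M y x] assms by simp
  have "sb M x z \<in> L \<longleftrightarrow> sb M y z \<in> L" if "z \<in> carrier M" for z
    using sb_sb_cancel[OF assms(1,3,4) that] sb_sb_cancel[OF assms(1,4,3) that] xy yx
      subm_add[OF assms(2)] by metis
  \<comment> \<open>Congruent elements have literally the same predicate under the choice operator,
    so they receive the same representative.\<close>
  then have "(\<lambda>z. z \<in> carrier M \<and> sb M x z \<in> L) = (\<lambda>z. z \<in> carrier M \<and> sb M y z \<in> L)" by auto
  then show "qrep M L x = qrep M L y" by (simp add: qrep_def)
qed

lemma qrep_qrep:
  assumes "lmod M" "subm L M" "x \<in> carrier M"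
  shows "qrep M L (qrep M L x) = qrep M L x"
  using qrep_eq_iff[OF assms(1,2) qrep(1)[OF assms] assms(3)] qrep[OF assms] assms
    subm_smult[OF assms(2), of "\<ominus> \<one>"] sb_swap[OF assms(1) qrep(1)[OF assms] assms(3)] by simp

text \<open>The sum of two representatives need not be a representative, so the axioms cannot be
  read off from M. By \<open>padd\<close> and \<open>psm\<close>, however, \<open>qrep\<close>
  respects the operations, and \<open>lmod_image\<close> transports the module structure.\<close>

lemma quot:
  fixes M :: "('a, 'x) module"
  assumes "lmod M" "subm L M"
  shows "lmod (quot M L)" "mm M (quot M L) (qrep M L)"
    "qrep M L ` carrier M = carrier (quot M L)"
    "\<And>x. x \<in> carrier M \<Longrightarrow> qrep M L x = \<zero>\<^bsub>quot M L\<^esub> \<longleftrightarrow> x \<in> L"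
proof -
  let ?q = "qrep M L"
  note q = qrep[OF assms] qrep_qrep[OF assms]
  have padd: "?q (?q x \<oplus>\<^bsub>M\<^esub> ?q y) = ?q (x \<oplus>\<^bsub>M\<^esub> y)" if "x \<in> carrier M" "y \<in> carrier M" for x y
  proof -
    have "sb M (x \<oplus>\<^bsub>M\<^esub> y) (?q x \<oplus>\<^bsub>M\<^esub> ?q y) = sb M x (?q x) \<oplus>\<^bsub>M\<^esub> sb M y (?q y)"
      using that q assms lm_add4[OF assms(1), of "sb M x (?q x)" "?q x" "sb M y (?q y)" "?q y"]
      by (simp add: sb_eq_iff)
    then have "sb M (x \<oplus>\<^bsub>M\<^esub> y) (?q x \<oplus>\<^bsub>M\<^esub> ?q y) \<in> L"
      using that q subm_add[OF assms(2)] by simp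
    then have "?q (x \<oplus>\<^bsub>M\<^esub> y) = ?q (?q x \<oplus>\<^bsub>M\<^esub> ?q y)"
      using qrep_eq_iff[OF assms] that q assms by simp
    then show ?thesis by simp
  qed
  have psm: "?q (a \<odot>\<^bsub>M\<^esub> ?q x) = ?q (a \<odot>\<^bsub>M\<^esub> x)" if "x \<in> carrier M" "a \<in> carrier R" for x a
  proof -
    have "sb M (a \<odot>\<^bsub>M\<^esub> x) (a \<odot>\<^bsub>M\<^esub> ?q x) = a \<odot>\<^bsub>M\<^esub> sb M x (?q x)"
      using that q assms by (simp add: sb_eq_iff lm_smult_add[symmetric])
    then have "?q (a \<odot>\<^bsub>M\<^esub> x) = ?q (a \<odot>\<^bsub>M\<^esub> ?q x)"
      using qrep_eq_iff[OF assms] that q assms subm_smult[OF assms(2)] by simp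
    then show ?thesis by simp
  qed
  have padd1: "?q (?q x \<oplus>\<^bsub>M\<^esub> y) = ?q (x \<oplus>\<^bsub>M\<^esub> y)" if "x \<in> carrier M" "y \<in> carrier M" for x y
    using padd[of "?q x" y] padd[of x y] q that by simp
  have padd2: "?q (x \<oplus>\<^bsub>M\<^esub> ?q y) = ?q (x \<oplus>\<^bsub>M\<^esub> y)" if "x \<in> carrier M" "y \<in> carrier M" for x y
    using padd[of x "?q y"] padd[of x y] q that by simp
  note [simp] = padd1 padd2 psm
  show m: "mm M (quot M L) (qrep M L)"
    by (rule mmI) (use assms q in \<open>auto simp: quot_def\<close>)
  show "lmod (quot M L)"
    by (rule lmod_image[OF assms(1) m]) (auto simp: quot_def)
  show "qrep M L ` carrier M = carrier (quot M L)" by (simp add: quot_def)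
  show "qrep M L x = \<zero>\<^bsub>quot M L\<^esub> \<longleftrightarrow> x \<in> L" if "x \<in> carrier M" for x
    using qrep_eq_iff[OF assms that lm_zero_closed[OF assms(1)]] that assms by (simp add: quot_def)
qed

subsection \<open>Products\<close>

definition prodm :: "('a, 'x) module \<Rightarrow> ('a, 'y) module \<Rightarrow> ('a, 'x \<times> 'y) module" where
  "prodm M N = \<lparr>carrier = carrier M \<times> carrier N, monoid.mult = undefined, one = undefined,
    zero = (\<zero>\<^bsub>M\<^esub>, \<zero>\<^bsub>N\<^esub>), add = (\<lambda>x y. (fst x \<oplus>\<^bsub>M\<^esub> fst y, snd x \<oplus>\<^bsub>N\<^esub> snd y)),
    smult = (\<lambda>a x. (a \<odot>\<^bsub>M\<^esub> fst x, a \<odot>\<^bsub>N\<^esub> snd x))\<rparr>"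

lemma lmod_prodm: "lmod M \<Longrightarrow> lmod N \<Longrightarrow> lmod (prodm M N)"
  by (rule lmodI) (auto simp: prodm_def lm_ac lm_smult_add lm_add_smult lm_smult_assoc)
lemma mm_fst: "mm (prodm M N) M fst" and mm_snd: "mm (prodm M N) N snd"
  by (auto simp: prodm_def module_map_def)
lemma mm_Pair: "mm P M f \<Longrightarrow> mm P N g \<Longrightarrow> mm P (prodm M N) (\<lambda>x. (f x, g x))"
  by (auto simp: prodm_def module_map_def)

text \<open>The carrier is the extensional product that occurs in \<open>module_direct_sum\<close>,
  so for finite I a decomposition in that sense is an isomorphism from this module.\<close>

definition dsum :: "'i set \<Rightarrow> ('i \<Rightarrow> ('a, 'x) module) \<Rightarrow> ('a, 'i \<Rightarrow> 'x) module" where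
  "dsum I Ms = \<lparr>carrier = (\<Pi>\<^sub>E i\<in>I. carrier (Ms i)), monoid.mult = undefined, one = undefined,
    zero = (\<lambda>i\<in>I. \<zero>\<^bsub>Ms i\<^esub>), add = (\<lambda>x y. \<lambda>i\<in>I. x i \<oplus>\<^bsub>Ms i\<^esub> y i),
    smult = (\<lambda>a x. \<lambda>i\<in>I. a \<odot>\<^bsub>Ms i\<^esub> x i)\<rparr>"

definition dinj :: "'i set \<Rightarrow> ('i \<Rightarrow> ('a, 'x) module) \<Rightarrow> 'i \<Rightarrow> 'x \<Rightarrow> 'i \<Rightarrow> 'x" where
  "dinj I Ms i x = (\<lambda>j\<in>I. if j = i then x else \<zero>\<^bsub>Ms j\<^esub>)"

lemma dsum_in: "x \<in> carrier (dsum I Ms) \<Longrightarrow> i \<in> I \<Longrightarrow> x i \<in> carrier (Ms i)"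
  by (auto simp: dsum_def)
lemma dsum_eqI: "x \<in> carrier (dsum I Ms) \<Longrightarrow> y \<in> carrier (dsum I Ms) \<Longrightarrow>
    (\<And>i. i \<in> I \<Longrightarrow> x i = y i) \<Longrightarrow> x = y"
  by (auto simp: dsum_def intro: PiE_ext)

lemma lmod_dsum:
  assumes "\<And>i. i \<in> I \<Longrightarrow> lmod (Ms i)" shows "lmod (dsum I Ms)"
  by (rule lmodI)
    (use assms in \<open>auto simp: dsum_def lm_ac lm_smult_add lm_add_smult lm_smult_assoc
      PiE_iff extensional_def fun_eq_iff\<close>)

lemma mm_dproj: "i \<in> I \<Longrightarrow> mm (dsum I Ms) (Ms i) (\<lambda>x. x i)"
  by (auto simp: module_map_def dsum_def)
lemma mm_dinj: "(\<And>i. i \<in> I \<Longrightarrow> lmod (Ms i)) \<Longrightarrow> i \<in> I \<Longrightarrow> mm (Ms i) (dsum I Ms) (dinj I Ms i)"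
  by (auto simp: module_map_def dsum_def dinj_def intro!: restrict_ext)
lemma mm_dtuple: "(\<And>i. i \<in> I \<Longrightarrow> mm P (Ms i) (f i)) \<Longrightarrow> mm P (dsum I Ms) (\<lambda>x. \<lambda>i\<in>I. f i x)"
  by (auto simp: module_map_def dsum_def Pi_iff intro!: restrict_ext)

lemma dsum_finsum:
  assumes "finite I" "\<And>i. i \<in> I \<Longrightarrow> lmod (Ms i)" "finite S" "g \<in> S \<rightarrow> carrier (dsum I Ms)" "i \<in> I"
  shows "finsum (dsum I Ms) g S i = finsum (Ms i) (\<lambda>s. g s i) S"
  using module_map_finsum[OF lmod_dsum _ mm_dproj assms(3,4)] assms by blast

lemma finsum_single:
  assumes "lmod M" "finite S" "s \<in> S" "x \<in> carrier M"
  shows "finsum M (\<lambda>t. if t = s then x else \<zero>\<^bsub>M\<^esub>) S = x"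
  using abelian_monoid.finsum_singleton[OF lm_abm[OF assms(1)] assms(3,2), of "\<lambda>_. x"] assms(4)
  by (simp add: eq_commute cong: if_cong)

lemma dsum_decomp:
  assumes "finite I" "\<And>i. i \<in> I \<Longrightarrow> lmod (Ms i)" "x \<in> carrier (dsum I Ms)"
  shows "x = finsum (dsum I Ms) (\<lambda>i. dinj I Ms i (x i)) I"
proof (rule dsum_eqI)
  have c: "(\<lambda>i. dinj I Ms i (x i)) \<in> I \<rightarrow> carrier (dsum I Ms)"
  proof (rule Pi_I)
    fix i assume "i \<in> I"
    then show "dinj I Ms i (x i) \<in> carrier (dsum I Ms)"
      using mm_closed[OF mm_dinj[of I Ms i] dsum_in[OF assms(3)]] assms(2) by simp
  qed
  show "finsum (dsum I Ms) (\<lambda>i. dinj I Ms i (x i)) I \<in> carrier (dsum I Ms)"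
    by (rule abelian_monoid.finsum_closed[OF lm_abm[OF lmod_dsum] c]) (use assms in auto)
  fix i assume i: "i \<in> I"
  have "finsum (dsum I Ms) (\<lambda>i. dinj I Ms i (x i)) I i = finsum (Ms i) (\<lambda>s. dinj I Ms s (x s) i) I"
    by (rule dsum_finsum) (use assms c i in auto)
  also have "\<dots> = finsum (Ms i) (\<lambda>s. if s = i then x i else \<zero>\<^bsub>Ms i\<^esub>) I"
    using i assms dsum_in[OF assms(3)]
    by (intro abelian_monoid.finsum_cong'[OF lm_abm]) (auto simp: dinj_def)
  also have "\<dots> = x i" using assms i by (intro finsum_single) (auto simp: dsum_in)
  finally show "x i = finsum (dsum I Ms) (\<lambda>i. dinj I Ms i (x i)) I i" by simp
qed (use assms in auto)

lemma mm_dsum_expand: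
  assumes "finite I" "\<And>i. i \<in> I \<Longrightarrow> lmod (Ms i)" "lmod N" "mm (dsum I Ms) N f" "x \<in> carrier (dsum I Ms)"
  shows "f x = finsum N (\<lambda>i. f (dinj I Ms i (x i))) I"
  using module_map_finsum[OF lmod_dsum assms(3,4,1), of "\<lambda>i. dinj I Ms i (x i)"]
    dsum_decomp[OF assms(1,2,5)] assms mm_closed[OF mm_dinj] dsum_in
  by (smt (verit, best) Pi_I)

lemma mm_dcopair:
  assumes "finite I" "lmod N" "\<And>i. i \<in> I \<Longrightarrow> lmod (Ms i)" "\<And>i. i \<in> I \<Longrightarrow> mm (Ms i) N (f i)"
  shows "mm (dsum I Ms) N (\<lambda>x. finsum N (\<lambda>i. f i (x i)) I)"
  using assms by (intro mm_finsum mm_comp[OF mm_dproj] lmod_dsum) auto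

lemma dcopair_dinj:
  assumes "finite I" "lmod N" "\<And>i. i \<in> I \<Longrightarrow> lmod (Ms i)" "\<And>i. i \<in> I \<Longrightarrow> mm (Ms i) N (f i)"
    "i \<in> I" "x \<in> carrier (Ms i)"
  shows "finsum N (\<lambda>j. f j (dinj I Ms i x j)) I = f i x"
proof -
  have "finsum N (\<lambda>j. f j (dinj I Ms i x j)) I = finsum N (\<lambda>j. if j = i then f i x else \<zero>\<^bsub>N\<^esub>) I"
    using assms mm_closed[OF assms(4)] mm_zero[OF assms(4)]
    by (intro abelian_monoid.finsum_cong'[OF lm_abm]) (auto simp: dinj_def)
  also have "\<dots> = f i x" using assms mm_closed[OF assms(4)] by (intro finsum_single) auto
  finally show ?thesis .
qed

end

section \<open>Finite length\<close>

context ring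
begin

lemma subm_finsum:
  assumes "lmod M" "subm L M" "finite S" "g \<in> S \<rightarrow> L"
  shows "finsum M g S \<in> L"
  using assms(3,4)
proof (induction S rule: finite_induct)
  case empty
  then show ?case
    using assms by (simp add: abelian_monoid.finsum_empty[OF lm_abm] subm_zero)
next
  case (insert s S)
  then have "finsum M g (insert s S) = g s \<oplus>\<^bsub>M\<^esub> finsum M g S"
    using subm_in[OF assms(2)] by (intro abelian_monoid.finsum_insert[OF lm_abm[OF assms(1)]]) auto
  then show ?case using insert by (auto intro!: subm_add assms)
qed

text \<open>A bounded strictly monotone function on the submodules is a convenient form of finite length: it
  passes to submodules, quotients and products without a Jordan--Hoelder theorem.\<close>

definition finlen :: "('a, 'x) module \<Rightarrow> bool" where
  "finlen M \<longleftrightarrow> (\<exists>(h :: 'x set \<Rightarrow> nat) b. (\<forall>A. subm A M \<longrightarrow> h A \<le> b) \<and>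
    (\<forall>A B. subm A M \<longrightarrow> subm B M \<longrightarrow> A \<subset> B \<longrightarrow> h A < h B))"

lemma finlen_inj:
  assumes "lmod M" "lmod N" "mm M N f" "inj_on f (carrier M)" "finlen N"
  shows "finlen M"
proof -
  obtain h b where h: "\<And>A. subm A N \<Longrightarrow> h A \<le> (b::nat)"
    "\<And>A B. subm A N \<Longrightarrow> subm B N \<Longrightarrow> A \<subset> B \<Longrightarrow> h A < h B"
    using assms(5) unfolding finlen_def by blast
  have "f ` A \<subset> f ` B" if "subm A M" "subm B M" "A \<subset> B" for A B
    using inj_on_image_eq_iff[OF assms(4) subm_sub[OF that(1)] subm_sub[OF that(2)]] that(3) by blast
  then show ?thesis unfolding finlen_def
    by (intro exI[of _ "\<lambda>A. h (f ` A)"] exI[of _ b]) (simp add: h subm_image[OF assms(1-3)])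
qed

lemma finlen_surj:
  assumes "lmod M" "lmod N" "mm M N f" "f ` carrier M = carrier N" "finlen M"
  shows "finlen N"
proof -
  obtain h b where h: "\<And>A. subm A M \<Longrightarrow> h A \<le> (b::nat)"
    "\<And>A B. subm A M \<Longrightarrow> subm B M \<Longrightarrow> A \<subset> B \<Longrightarrow> h A < h B"
    using assms(5) unfolding finlen_def by blast
  have "{x \<in> carrier M. f x \<in> A} \<subset> {x \<in> carrier M. f x \<in> B}" if B: "subm B N" "A \<subset> B" for A B
  proof -
    obtain y where y: "y \<in> B" "y \<notin> A" using B(2) by blast
    then obtain x where "x \<in> carrier M" "f x = y" using assms(4) subm_in[OF B(1)] by (metis imageE)
    then show ?thesis using y B by auto
  qed
  then show ?thesis unfolding finlen_def
    by (intro exI[of _ "\<lambda>A. h {x \<in> carrier M. f x \<in> A}"] exI[of _ b])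
      (simp add: h subm_preimage[OF assms(1-3)])
qed

text \<open>A submodule V is measured by its projection to M and its intersection \<open>k V\<close>
  with N. If V is contained in W and both data agree, then V = W: an element w of W has the first
  component of some v in V, and w - v lies in the common intersection with N.\<close>

lemma finlen_prodm:
  assumes "lmod M" "lmod N" "finlen M" "finlen N"
  shows "finlen (prodm M N)"
proof -
  obtain h b where h: "\<And>A. subm A M \<Longrightarrow> h A \<le> (b::nat)"
    "\<And>A B. subm A M \<Longrightarrow> subm B M \<Longrightarrow> A \<subset> B \<Longrightarrow> h A < h B"
    using assms(3) unfolding finlen_def by blast
  obtain h' b' where h': "\<And>A. subm A N \<Longrightarrow> h' A \<le> (b'::nat)"
    "\<And>A B. subm A N \<Longrightarrow> subm B N \<Longrightarrow> A \<subset> B \<Longrightarrow> h' A < h' B"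
    using assms(4) unfolding finlen_def by blast
  note P = lmod_prodm[OF assms(1,2)]
  define k where "k V = {y \<in> carrier N. (\<zero>\<^bsub>M\<^esub>, y) \<in> V}" for V
  have s1: "subm (fst ` V) M" if "subm V (prodm M N)" for V
    by (rule subm_image[OF P assms(1) mm_fst that])
  have s2: "subm (k V) N" if "subm V (prodm M N)" for V
    unfolding k_def by (intro subm_preimage[OF assms(2) P _ that] mm_Pair mm_0 mm_id assms)
  have "h (fst ` V) + h' (k V) < h (fst ` W) + h' (k W)"
    if VW: "subm V (prodm M N)" "subm W (prodm M N)" "V \<subset> W" for V W
  proof -
    have sub: "fst ` V \<subseteq> fst ` W" "k V \<subseteq> k W" using VW by (auto simp: k_def)
    have ne: "fst ` V \<noteq> fst ` W \<or> k V \<noteq> k W"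
    proof (rule ccontr)
      assume "\<not> ?thesis"
      then have eq: "fst ` V = fst ` W" "k V = k W" by auto
      have "w \<in> V" if w: "w \<in> W" for w
      proof -
        obtain v where v: "v \<in> V" "fst v = fst w" using eq w by (metis imageE imageI)
        have in_c: "v \<in> carrier (prodm M N)" "w \<in> carrier (prodm M N)"
          using v w VW by (auto intro: subm_in)
        then have c: "fst v \<in> carrier M" "snd v \<in> carrier N" "snd w \<in> carrier N"
          by (auto simp: prodm_def)
        have "sb (prodm M N) w v = (\<zero>\<^bsub>M\<^esub>, sb N (snd w) (snd v))"
          using sb_self[OF assms(1) c(1)] v(2) by (simp add: sb_def prodm_def)
        moreover have "sb (prodm M N) w v \<in> W" using v w VW by (intro subm_sb) auto
        ultimately have "sb N (snd w) (snd v) \<in> k W" using c assms by (auto simp: k_def)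
        then have "sb (prodm M N) w v \<in> V"
          using eq \<open>sb (prodm M N) w v = (\<zero>\<^bsub>M\<^esub>, sb N (snd w) (snd v))\<close> by (auto simp: k_def)
        then have "sb (prodm M N) w v \<oplus>\<^bsub>prodm M N\<^esub> v \<in> V" using v VW by (intro subm_add) auto
        then show ?thesis using in_c P by simp
      qed
      then show False using VW by auto
    qed
    have "h (fst ` V) \<le> h (fst ` W)" "h' (k V) \<le> h' (k W)"
      using h(2)[OF s1[OF VW(1)] s1[OF VW(2)]] h'(2)[OF s2[OF VW(1)] s2[OF VW(2)]] sub
      by (metis order.strict_iff_order order.order_iff_strict)+
    moreover have "h (fst ` V) < h (fst ` W) \<or> h' (k V) < h' (k W)"
      using h(2)[OF s1[OF VW(1)] s1[OF VW(2)]] h'(2)[OF s2[OF VW(1)] s2[OF VW(2)]] sub ne by blast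
    ultimately show ?thesis by linarith
  qed
  moreover have "h (fst ` V) + h' (k V) \<le> b + b'" if "subm V (prodm M N)" for V
    using h(1)[OF s1[OF that]] h'(1)[OF s2[OF that]] by simp
  ultimately show ?thesis unfolding finlen_def
    by (intro exI[of _ "\<lambda>V. h (fst ` V) + h' (k V)"] exI[of _ "b + b'"]) auto
qed

text \<open>Splitting off one component embeds the sum into a product of two modules of finite
  length.\<close>

lemma finlen_dsum:
  assumes "finite I" "\<And>i. i \<in> I \<Longrightarrow> lmod (Ms i)" "\<And>i. i \<in> I \<Longrightarrow> finlen (Ms i)"
  shows "finlen (dsum I Ms)"
  using assms
proof (induction I rule: finite_induct)
  case empty
  then show ?case unfolding finlen_def
  proof (intro exI[of _ "\<lambda>_. 0"] exI[of _ 0] conjI allI impI)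
    fix A B assume a: "subm A (dsum {} Ms)" "subm B (dsum {} Ms)" "A \<subset> B"
    have "carrier (dsum {} Ms) = {\<zero>\<^bsub>dsum {} Ms\<^esub>}" by (auto simp: dsum_def)
    then show "(0::nat) < 0" using subm_zero[OF a(1)] subm_sub[OF a(2)] a(3) by auto
  qed auto
next
  case (insert i I)
  let ?f = "\<lambda>x. (x i, \<lambda>j\<in>I. x j)"
  have l: "lmod (dsum (insert i I) Ms)" "lmod (dsum I Ms)" "lmod (Ms i)"
    using insert.prems by (auto intro!: lmod_dsum)
  have "mm (dsum (insert i I) Ms) (prodm (Ms i) (dsum I Ms)) ?f"
    by (intro mm_Pair mm_dproj mm_dtuple) auto
  moreover have "inj_on ?f (carrier (dsum (insert i I) Ms))"
    by (rule inj_onI, rule dsum_eqI) (auto simp: fun_eq_iff restrict_def split: if_splits)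
  moreover have "finlen (prodm (Ms i) (dsum I Ms))"
    using insert l by (intro finlen_prodm) auto
  ultimately show ?case using l by (intro finlen_inj[OF l(1) lmod_prodm[OF l(3,2)]]) auto
qed

text \<open>A submodule of greatest measure among those with property P is maximal for inclusion,
  because the measure is strictly monotone. This is the ascending chain condition in the form used
  below; \<open>finlen_min\<close> is the descending one.\<close>

lemma finlen_max:
  assumes "finlen M" "subm A M" "P A"
  obtains B where "subm B M" "P B" "\<And>C. subm C M \<Longrightarrow> P C \<Longrightarrow> B \<subseteq> C \<Longrightarrow> C = B"
proof -
  obtain h b where h: "\<And>A. subm A M \<Longrightarrow> h A \<le> (b::nat)"
    "\<And>A B. subm A M \<Longrightarrow> subm B M \<Longrightarrow> A \<subset> B \<Longrightarrow> h A < h B"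
    using assms(1) unfolding finlen_def by blast
  obtain B where B: "subm B M \<and> P B" "\<And>C. subm C M \<and> P C \<Longrightarrow> h C \<le> h B"
    using ex_has_greatest_nat[of "\<lambda>A. subm A M \<and> P A" A h "Suc b"] assms h(1) by (auto simp: less_Suc_eq_le)
  show thesis using B h(2)[of B] by (intro that[of B]) (metis leD psubsetI)+
qed

lemma finlen_min:
  assumes "finlen M" "subm A M" "P A"
  obtains B where "subm B M" "P B" "\<And>C. subm C M \<Longrightarrow> P C \<Longrightarrow> C \<subseteq> B \<Longrightarrow> C = B"
proof -
  obtain h b where h: "\<And>A. subm A M \<Longrightarrow> h A \<le> (b::nat)"
    "\<And>A B. subm A M \<Longrightarrow> subm B M \<Longrightarrow> A \<subset> B \<Longrightarrow> h A < h B"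
    using assms(1) unfolding finlen_def by blast
  obtain B where B: "subm B M \<and> P B" "\<And>C. subm C M \<and> P C \<Longrightarrow> h B \<le> h C"
    using exists_least_lemma[of "\<lambda>n. \<exists>A. subm A M \<and> P A \<and> h A = n"] assms
      ex_has_least_nat[of "\<lambda>A. subm A M \<and> P A" A h] by blast
  show thesis using B h(2)[of _ B] by (intro that[of B]) (metis leD psubsetI)+
qed

section \<open>Free modules of finite rank and finite generation\<close>

lemma lmod_reg: "lmod (reg_module R)"
  by (rule lmodI) (auto simp: reg_module_def l_distr r_distr m_assoc a_ac)

abbreviation free :: "'i set \<Rightarrow> ('a, 'i \<Rightarrow> 'a) module" where
  "free S \<equiv> dsum S (\<lambda>_. reg_module R)"

lemma lmod_free: "lmod (free S)" by (rule lmod_dsum) (rule lmod_reg)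

lemma free_in: "c \<in> carrier (free S) \<longleftrightarrow> c \<in> S \<rightarrow>\<^sub>E carrier R"
  by (simp add: dsum_def reg_module_def)

lemma mm_reg: "lmod M \<Longrightarrow> x \<in> carrier M \<Longrightarrow> mm (reg_module R) M (\<lambda>a. a \<odot>\<^bsub>M\<^esub> x)"
  by (rule mmI) (auto simp: reg_module_def lm_add_smult lm_smult_assoc)

lemma mm_free:
  assumes "lmod M" "finite S" "\<And>s. s \<in> S \<Longrightarrow> v s \<in> carrier M"
  shows "mm (free S) M (\<lambda>c. finsum M (\<lambda>s. c s \<odot>\<^bsub>M\<^esub> v s) S)"
  using assms by (intro mm_dcopair mm_reg lmod_reg) auto

definition ubas :: "'i set \<Rightarrow> 'i \<Rightarrow> 'i \<Rightarrow> 'a" where "ubas S s = dinj S (\<lambda>_. reg_module R) s \<one>"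

lemma ubas_in: "s \<in> S \<Longrightarrow> ubas S s \<in> carrier (free S)"
  unfolding ubas_def by (rule mm_closed[OF mm_dinj]) (auto simp: lmod_reg, auto simp: reg_module_def)

lemma free_ubas:
  assumes "lmod M" "finite S" "\<And>s. s \<in> S \<Longrightarrow> v s \<in> carrier M" "s \<in> S"
  shows "finsum M (\<lambda>t. ubas S s t \<odot>\<^bsub>M\<^esub> v t) S = v s"
  unfolding ubas_def using assms
  by (subst dcopair_dinj[of S M "\<lambda>_. reg_module R" "\<lambda>t a. a \<odot>\<^bsub>M\<^esub> v t"])
    (auto simp: lmod_reg mm_reg, auto simp: reg_module_def)

lemma free_expand:
  assumes "lmod M" "finite S" "mm (free S) M f" "c \<in> carrier (free S)"
  shows "f c = finsum M (\<lambda>s. c s \<odot>\<^bsub>M\<^esub> f (ubas S s)) S"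
proof -
  have d: "f (dinj S (\<lambda>_. reg_module R) s (c s)) = c s \<odot>\<^bsub>M\<^esub> f (ubas S s)" if "s \<in> S" for s
  proof -
    have cs: "c s \<in> carrier R" using assms(4) that by (auto simp: free_in)
    have "mm (reg_module R) M (\<lambda>a. f (dinj S (\<lambda>_. reg_module R) s a))"
      by (rule mm_comp[OF mm_dinj assms(3)]) (auto simp: lmod_reg that)
    from mm_smult[OF this cs, of \<one>] show ?thesis
      using cs by (simp add: ubas_def reg_module_def)
  qed
  have "f c = finsum M (\<lambda>s. f (dinj S (\<lambda>_. reg_module R) s (c s))) S"
    using assms by (intro mm_dsum_expand) (auto simp: lmod_reg)
  also have "\<dots> = finsum M (\<lambda>s. c s \<odot>\<^bsub>M\<^esub> f (ubas S s)) S"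
    using assms(1,4) mm_closed[OF assms(3) ubas_in]
    by (intro abelian_monoid.finsum_cong'[OF lm_abm]) (auto simp: d free_in)
  finally show ?thesis .
qed

text \<open>The coefficients in \<open>fin_gen\<close> are arbitrary outside S; after restriction to
  S they are elements of a free module, and finite generation becomes an epimorphism from
  it.\<close>

lemma fin_gen_free:
  assumes "lmod M" "fin_gen R M"
  obtains S where "finite S" "S \<subseteq> carrier M"
    "(\<lambda>c. finsum M (\<lambda>s. c s \<odot>\<^bsub>M\<^esub> s) S) ` carrier (free S) = carrier M"
proof -
  obtain S where S: "finite S" "S \<subseteq> carrier M"
    "\<And>x. x \<in> carrier M \<Longrightarrow> \<exists>c\<in>S \<rightarrow> carrier R. x = finsum M (\<lambda>s. c s \<odot>\<^bsub>M\<^esub> s) S"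
    using assms(2) unfolding fin_gen_def by blast
  have "\<exists>c\<in>carrier (free S). x = finsum M (\<lambda>s. c s \<odot>\<^bsub>M\<^esub> s) S" if "x \<in> carrier M" for x
  proof -
    obtain c where c: "c \<in> S \<rightarrow> carrier R" "x = finsum M (\<lambda>s. c s \<odot>\<^bsub>M\<^esub> s) S"
      using S(3)[OF \<open>x \<in> carrier M\<close>] by auto
    have "x = finsum M (\<lambda>s. restrict c S s \<odot>\<^bsub>M\<^esub> s) S"
      using c S(2) assms(1) unfolding c(2)
      by (intro abelian_monoid.finsum_cong'[OF lm_abm]) (auto simp: Pi_iff subset_iff)
    then show ?thesis using c by (intro bexI[of _ "restrict c S"]) (auto simp: free_in)
  qed
  moreover have "finsum M (\<lambda>s. c s \<odot>\<^bsub>M\<^esub> s) S \<in> carrier M" if "c \<in> carrier (free S)" for c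
    by (rule mm_closed[OF mm_free[OF assms(1) S(1)] that]) (use S in auto)
  ultimately show thesis using S by (intro that[of S]) auto
qed

lemma fin_gen_surj:
  assumes "lmod M" "lmod N" "fin_gen R M" "mm M N f" "f ` carrier M = carrier N"
  shows "fin_gen R N"
proof -
  obtain S where S: "finite S" "S \<subseteq> carrier M"
    "(\<lambda>c. finsum M (\<lambda>s. c s \<odot>\<^bsub>M\<^esub> s) S) ` carrier (free S) = carrier M"
    using fin_gen_free[OF assms(1,3)] by blast
  show ?thesis unfolding fin_gen_def
  proof (intro exI[of _ "f ` S"] conjI ballI)
    fix y assume "y \<in> carrier N"
    then obtain c where c: "c \<in> carrier (free S)" "y = f (finsum M (\<lambda>s. c s \<odot>\<^bsub>M\<^esub> s) S)"
      using assms(5) S(3) by (metis (no_types, lifting) imageE)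
    have cS: "c s \<in> carrier R" "s \<in> carrier M" "f s \<in> carrier N" if "s \<in> S" for s
      using c(1) S(2) that mm_closed[OF assms(4)] by (auto simp: free_in)
    have fi: "finite (f ` S)" using S by simp
    define d where "d t = finsum (reg_module R) c {s \<in> S. f s = t}" for t
    have dc: "d t \<in> carrier R" for t
      using abelian_monoid.finsum_closed[OF lm_abm[OF lmod_reg], of c "{s \<in> S. f s = t}"] cS
      by (auto simp: d_def reg_module_def)
    have "y = finsum N (\<lambda>s. c s \<odot>\<^bsub>N\<^esub> f s) S"
      unfolding c(2) using module_map_finsum[OF assms(1,2,4) S(1), of "\<lambda>s. c s \<odot>\<^bsub>M\<^esub> s"] cS assms
      by (auto simp: mm_smult intro!: abelian_monoid.finsum_cong'[OF lm_abm])
    \<comment> \<open>As f may identify generators, the sum over S cannot be reindexed by the image.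
      It is instead seen to lie in the submodule spanned by the image of S, since each summand
      does.\<close>
    moreover have "finsum N (\<lambda>s. c s \<odot>\<^bsub>N\<^esub> f s) S \<in> (\<lambda>c. finsum N (\<lambda>s. c s \<odot>\<^bsub>N\<^esub> s) (f ` S)) ` carrier (free (f ` S))"
    proof (rule subm_finsum[OF assms(2) subm_image[OF lmod_free assms(2) mm_free[OF assms(2) fi] subm_carrier[OF lmod_free]] S(1)])
      show "(\<lambda>s. c s \<odot>\<^bsub>N\<^esub> f s) \<in> S \<rightarrow> (\<lambda>c. finsum N (\<lambda>s. c s \<odot>\<^bsub>N\<^esub> s) (f ` S)) ` carrier (free (f ` S))"
      proof (rule Pi_I)
        fix s assume s: "s \<in> S"
        have "finsum N (\<lambda>t. ubas (f ` S) (f s) t \<odot>\<^bsub>N\<^esub> t) (f ` S) = f s"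
          using free_ubas[OF assms(2) fi, of "\<lambda>t. t"] cS s by auto
        then have fs: "f s \<in> (\<lambda>c. finsum N (\<lambda>s. c s \<odot>\<^bsub>N\<^esub> s) (f ` S)) ` carrier (free (f ` S))"
          using ubas_in[of "f s" "f ` S"] s by (intro image_eqI[of _ _ "ubas (f ` S) (f s)"]) auto
        have "subm ((\<lambda>c. finsum N (\<lambda>s. c s \<odot>\<^bsub>N\<^esub> s) (f ` S)) ` carrier (free (f ` S))) N"
          by (intro subm_image[OF lmod_free assms(2) mm_free[OF assms(2) fi] subm_carrier[OF lmod_free]])
            (use cS in auto)
        from subm_smult[OF this cS(1)[OF s] fs]
        show "c s \<odot>\<^bsub>N\<^esub> f s \<in> (\<lambda>c. finsum N (\<lambda>s. c s \<odot>\<^bsub>N\<^esub> s) (f ` S)) ` carrier (free (f ` S))" .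
      qed
    qed (use cS in auto)
    ultimately have "\<exists>e\<in>carrier (free (f ` S)). y = finsum N (\<lambda>s. e s \<odot>\<^bsub>N\<^esub> s) (f ` S)" by auto
    then show "\<exists>c\<in>f ` S \<rightarrow> carrier R. y = finsum N (\<lambda>s. c s \<odot>\<^bsub>N\<^esub> s) (f ` S)"
      by (auto simp: free_in PiE_def)
  qed (use S mm_closed[OF assms(4)] in auto)
qed

text \<open>A maximal finitely generated submodule is the whole module, as adding one more generator
  x cannot enlarge it.\<close>

lemma finlen_fin_gen:
  fixes M :: "('a, 'x) module"
  assumes "lmod M" "finlen M" shows "fin_gen R M"
proof -
  define sp where "sp S = (\<lambda>c. finsum M (\<lambda>s. c s \<odot>\<^bsub>M\<^esub> s) S) ` carrier (free S)" for S
  have sp: "subm (sp S) M" if "finite S" "S \<subseteq> carrier M" for S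
    unfolding sp_def by (intro subm_image[OF lmod_free assms(1) mm_free subm_carrier[OF lmod_free]])
      (use that assms in auto)
  have in_sp: "s \<in> sp S" if "finite S" "S \<subseteq> carrier M" "s \<in> S" for s S
  proof -
    have "finsum M (\<lambda>t. ubas S s t \<odot>\<^bsub>M\<^esub> t) S = s"
      by (rule free_ubas) (use that assms in auto)
    then show ?thesis using ubas_in[OF that(3)] by (auto simp: sp_def intro!: image_eqI[of _ _ "ubas S s"])
  qed
  have sp_sub: "sp S \<subseteq> L" if "finite S" "subm L M" "S \<subseteq> L" for S L
  proof
    fix x assume "x \<in> sp S"
    then obtain c where "c \<in> carrier (free S)" "x = finsum M (\<lambda>s. c s \<odot>\<^bsub>M\<^esub> s) S" by (auto simp: sp_def)
    then show "x \<in> L" using that by (auto intro!: subm_finsum[OF assms(1)] subm_smult simp: free_in)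
  qed
  have e: "\<exists>S. finite S \<and> S \<subseteq> carrier M \<and> sp {} = sp S" by (intro exI[of _ "{}"]) auto
  obtain B where B: "\<exists>S. finite S \<and> S \<subseteq> carrier M \<and> B = sp S"
    "\<And>C. subm C M \<Longrightarrow> \<exists>S. finite S \<and> S \<subseteq> carrier M \<and> C = sp S \<Longrightarrow> B \<subseteq> C \<Longrightarrow> C = B"
    using finlen_max[OF assms(2) sp[of "{}"], of "\<lambda>B. \<exists>S. finite S \<and> S \<subseteq> carrier M \<and> B = sp S"] e
    by (metis empty_subsetI finite.emptyI)
  obtain S where S: "finite S" "S \<subseteq> carrier M" "B = sp S" using B(1) by auto
  have "x \<in> sp S" if x: "x \<in> carrier M" for x
  proof -
    have i: "finite (insert x S)" "insert x S \<subseteq> carrier M" using S x by auto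
    have "B \<subseteq> sp (insert x S)" unfolding S(3) by (rule sp_sub) (use i S sp in_sp in auto)
    then have "sp (insert x S) = B" using i by (intro B(2) sp) auto
    then show ?thesis using in_sp[OF i, of x] S by simp
  qed
  then show ?thesis unfolding fin_gen_def
    by (intro exI[of _ S]) (use S in \<open>force simp: sp_def free_in PiE_def\<close>)
qed

lemma fin_gen_finlen:
  assumes "finlen (reg_module R)" "lmod M" "fin_gen R M" shows "finlen M"
proof -
  obtain S where S: "finite S" "S \<subseteq> carrier M"
    "(\<lambda>c. finsum M (\<lambda>s. c s \<odot>\<^bsub>M\<^esub> s) S) ` carrier (free S) = carrier M"
    using fin_gen_free[OF assms(2,3)] by blast
  show ?thesis
    by (rule finlen_surj[OF lmod_free assms(2) mm_free S(3)])
      (use S assms in \<open>auto intro!: finlen_dsum lmod_reg\<close>)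
qed

text \<open>A decomposition in the sense of \<open>module_direct_sum\<close> provides injections and
  a bijection from the product; the projections are the components of the inverse of that
  bijection.\<close>

lemma direct_sumD:
  assumes "module_direct_sum R Xs M" "\<And>i. i < length Xs \<Longrightarrow> lmod (Xs ! i)" "lmod M"
  obtains \<iota> \<pi> where "\<And>i. i < length Xs \<Longrightarrow> mm (Xs ! i) M (\<iota> i)"
    "\<And>i. i < length Xs \<Longrightarrow> mm M (Xs ! i) (\<pi> i)"
    "\<And>i j x. i < length Xs \<Longrightarrow> j < length Xs \<Longrightarrow> x \<in> carrier (Xs ! j) \<Longrightarrow>
      \<pi> i (\<iota> j x) = (if i = j then x else \<zero>\<^bsub>Xs ! i\<^esub>)"
    "\<And>m. m \<in> carrier M \<Longrightarrow> finsum M (\<lambda>i. \<iota> i (\<pi> i m)) {..<length Xs} = m"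
proof -
  let ?I = "{..<length Xs}" and ?Ms = "(!) Xs"
  obtain \<iota> where \<iota>: "\<forall>i<length Xs. mm (Xs ! i) M (\<iota> i)"
    "bij_betw (\<lambda>x. finsum M (\<lambda>i. \<iota> i (x i)) ?I) (carrier (dsum ?I ?Ms)) (carrier M)"
    using assms(1) unfolding module_direct_sum_def dsum_def by auto
  define \<phi> where "\<phi> = (\<lambda>x. finsum M (\<lambda>i. \<iota> i (x i)) ?I)"
  define \<psi> where "\<psi> = inv_into (carrier (dsum ?I ?Ms)) \<phi>"
  have D: "lmod (dsum ?I ?Ms)" by (rule lmod_dsum) (use assms in auto)
  have \<phi>: "mm (dsum ?I ?Ms) M \<phi>" unfolding \<phi>_def by (rule mm_dcopair) (use assms \<iota> in auto)
  have \<psi>: "mm M (dsum ?I ?Ms) \<psi>" unfolding \<psi>_def using mm_inv[OF D \<phi>] \<iota> by (simp add: \<phi>_def)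
  have \<psi>\<phi>: "\<psi> (\<phi> x) = x" if "x \<in> carrier (dsum ?I ?Ms)" for x
    using \<iota>(2) that by (simp add: \<psi>_def bij_betw_def \<phi>_def[symmetric])
  have \<phi>\<psi>: "\<phi> (\<psi> m) = m" if "m \<in> carrier M" for m
    using \<iota>(2) that by (simp add: \<psi>_def bij_betw_def \<phi>_def[symmetric] f_inv_into_f)
  show thesis
  proof
    fix i assume "i < length Xs"
    then show "mm (Xs ! i) M (\<iota> i)" "mm M (Xs ! i) (\<lambda>m. \<psi> m i)"
      using \<iota> mm_comp[OF \<psi> mm_dproj[of i ?I ?Ms]] by auto
  next
    fix i j x assume ij: "i < length Xs" "j < length Xs" "x \<in> carrier (Xs ! j)"
    have "\<iota> j x = \<phi> (dinj ?I ?Ms j x)"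
      unfolding \<phi>_def by (rule dcopair_dinj[symmetric]) (use ij assms \<iota> in auto)
    then have "\<psi> (\<iota> j x) = dinj ?I ?Ms j x"
      using mm_closed[OF mm_dinj[of ?I ?Ms j] ij(3)] ij assms by (simp add: \<psi>\<phi>)
    then show "\<psi> (\<iota> j x) i = (if i = j then x else \<zero>\<^bsub>Xs ! i\<^esub>)" using ij by (simp add: dinj_def)
  next
    fix m assume "m \<in> carrier M"
    then show "finsum M (\<lambda>i. \<iota> i (\<psi> m i)) ?I = m" using \<phi>\<psi> by (simp add: \<phi>_def)
  qed
qed

lemma direct_sumI:
  assumes "\<And>i. i < length Xs \<Longrightarrow> lmod (Xs ! i)" "lmod M"
    "\<And>i. i < length Xs \<Longrightarrow> mm (Xs ! i) M (\<iota> i)"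
    "\<And>i. i < length Xs \<Longrightarrow> mm M (Xs ! i) (\<pi> i)"
    "\<And>i j x. i < length Xs \<Longrightarrow> j < length Xs \<Longrightarrow> x \<in> carrier (Xs ! j) \<Longrightarrow>
      \<pi> i (\<iota> j x) = (if i = j then x else \<zero>\<^bsub>Xs ! i\<^esub>)"
    "\<And>m. m \<in> carrier M \<Longrightarrow> finsum M (\<lambda>i. \<iota> i (\<pi> i m)) {..<length Xs} = m"
  shows "module_direct_sum R Xs M"
proof -
  let ?I = "{..<length Xs}" and ?Ms = "(!) Xs"
  let ?\<phi> = "\<lambda>x. finsum M (\<lambda>i. \<iota> i (x i)) ?I"
  have \<phi>: "mm (dsum ?I ?Ms) M ?\<phi>" by (rule mm_dcopair) (use assms in auto)
  have "bij_betw ?\<phi> (carrier (dsum ?I ?Ms)) (carrier M)"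
  proof (rule bij_betw_byWitness[where f' = "\<lambda>m. \<lambda>i\<in>?I. \<pi> i m"])
    have t: "(\<lambda>i\<in>?I. \<pi> i m) \<in> carrier (dsum ?I ?Ms)" if "m \<in> carrier M" for m
      using mm_closed[OF mm_dtuple[of ?I M ?Ms \<pi>] that] assms by auto
    show "\<forall>x\<in>carrier (dsum ?I ?Ms). (\<lambda>i\<in>?I. \<pi> i (?\<phi> x)) = x"
    proof
      fix x assume x: "x \<in> carrier (dsum ?I ?Ms)"
      show "(\<lambda>i\<in>?I. \<pi> i (?\<phi> x)) = x"
      proof (rule dsum_eqI[OF t[OF mm_closed[OF \<phi> x]] x])
        fix i assume i: "i \<in> ?I"
        have c: "\<iota> j (x j) \<in> carrier M" if "j \<in> ?I" for j
          using mm_closed[OF assms(3) dsum_in[OF x]] that by auto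
        have "\<pi> i (?\<phi> x) = finsum (Xs ! i) (\<lambda>j. \<pi> i (\<iota> j (x j))) ?I"
          by (rule module_map_finsum[of R M "Xs ! i"]) (use assms i c in auto)
        also have "\<dots> = finsum (Xs ! i) (\<lambda>j. if j = i then x i else \<zero>\<^bsub>Xs ! i\<^esub>) ?I"
          using assms i dsum_in[OF x] by (intro abelian_monoid.finsum_cong'[OF lm_abm]) auto
        also have "\<dots> = x i" using assms i dsum_in[OF x] by (intro finsum_single) auto
        finally show "(\<lambda>i\<in>?I. \<pi> i (?\<phi> x)) i = x i" using i by simp
      qed
    qed
    show "\<forall>m\<in>carrier M. ?\<phi> (\<lambda>i\<in>?I. \<pi> i m) = m"
    proof
      fix m assume m: "m \<in> carrier M"
      have "?\<phi> (\<lambda>i\<in>?I. \<pi> i m) = finsum M (\<lambda>i. \<iota> i (\<pi> i m)) ?I"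
        using assms m mm_closed[OF assms(3)] mm_closed[OF assms(4)]
        by (intro abelian_monoid.finsum_cong'[OF lm_abm]) auto
      then show "?\<phi> (\<lambda>i\<in>?I. \<pi> i m) = m" using assms(6)[OF m] by simp
    qed
    show "?\<phi> ` carrier (dsum ?I ?Ms) \<subseteq> carrier M" using mm_closed[OF \<phi>] by auto
    show "(\<lambda>m. \<lambda>i\<in>?I. \<pi> i m) ` carrier M \<subseteq> carrier (dsum ?I ?Ms)" using t by auto
  qed
  then show ?thesis unfolding module_direct_sum_def using assms(3) by (auto simp: dsum_def)
qed

lemma finsum_2:
  assumes "lmod M" "f 0 \<in> carrier M" "f 1 \<in> carrier M"
  shows "finsum M f {..<Suc (Suc 0)} = f 0 \<oplus>\<^bsub>M\<^esub> f 1"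
proof -
  have s: "{..<Suc (Suc 0)} = insert 0 (insert (Suc 0) {})" by auto
  show ?thesis unfolding s using assms
    by (simp add: abelian_monoid.finsum_insert[OF lm_abm] abelian_monoid.finsum_empty[OF lm_abm])
qed

lemma direct_sum2D:
  assumes "module_direct_sum R [A, B] M" "lmod A" "lmod B" "lmod M"
  obtains i j p q where "mm A M i" "mm B M j" "mm M A p" "mm M B q"
    "\<And>x. x \<in> carrier A \<Longrightarrow> p (i x) = x" "\<And>x. x \<in> carrier A \<Longrightarrow> q (i x) = \<zero>\<^bsub>B\<^esub>"
    "\<And>y. y \<in> carrier B \<Longrightarrow> q (j y) = y" "\<And>y. y \<in> carrier B \<Longrightarrow> p (j y) = \<zero>\<^bsub>A\<^esub>"
    "\<And>m. m \<in> carrier M \<Longrightarrow> i (p m) \<oplus>\<^bsub>M\<^esub> j (q m) = m"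
proof -
  have l: "lmod ([A, B] ! k)" if "k < length [A, B]" for k using that assms by (cases k) auto
  obtain \<iota> \<pi> where "\<And>k. k < length [A, B] \<Longrightarrow> mm ([A, B] ! k) M (\<iota> k)"
    "\<And>k. k < length [A, B] \<Longrightarrow> mm M ([A, B] ! k) (\<pi> k)"
    "\<And>k l x. k < length [A, B] \<Longrightarrow> l < length [A, B] \<Longrightarrow> x \<in> carrier ([A, B] ! l) \<Longrightarrow>
      \<pi> k (\<iota> l x) = (if k = l then x else \<zero>\<^bsub>[A, B] ! k\<^esub>)"
    "\<And>m. m \<in> carrier M \<Longrightarrow> finsum M (\<lambda>k. \<iota> k (\<pi> k m)) {..<length [A, B]} = m"
    using direct_sumD[OF assms(1) l assms(4)] by blast
  note D = this(1)[of 0] this(1)[of 1] this(2)[of 0] this(2)[of 1] this(3)[of 0 0]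
    this(3)[of 1 0] this(3)[of 1 1] this(3)[of 0 1] this(4)
  show thesis
  proof (rule that[of "\<iota> 0" "\<iota> 1" "\<pi> 0" "\<pi> 1"])
    fix m assume m: "m \<in> carrier M"
    have "finsum M (\<lambda>k. \<iota> k (\<pi> k m)) {..<Suc (Suc 0)} = \<iota> 0 (\<pi> 0 m) \<oplus>\<^bsub>M\<^esub> \<iota> 1 (\<pi> 1 m)"
      using D(1-4) m assms mm_closed[OF D(1) mm_closed[OF D(3)]] mm_closed[OF D(2) mm_closed[OF D(4)]]
      by (intro finsum_2) auto
    then show "\<iota> 0 (\<pi> 0 m) \<oplus>\<^bsub>M\<^esub> \<iota> 1 (\<pi> 1 m) = m" using D(9)[OF m] by simp
  qed (use D in auto)
qed

lemma direct_sum2I: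
  assumes "lmod A" "lmod B" "lmod M" "mm A M i" "mm B M j" "mm M A p" "mm M B q"
    "\<And>x. x \<in> carrier A \<Longrightarrow> p (i x) = x" "\<And>x. x \<in> carrier A \<Longrightarrow> q (i x) = \<zero>\<^bsub>B\<^esub>"
    "\<And>y. y \<in> carrier B \<Longrightarrow> q (j y) = y" "\<And>y. y \<in> carrier B \<Longrightarrow> p (j y) = \<zero>\<^bsub>A\<^esub>"
    "\<And>m. m \<in> carrier M \<Longrightarrow> i (p m) \<oplus>\<^bsub>M\<^esub> j (q m) = m"
  shows "module_direct_sum R [A, B] M"
proof (rule direct_sumI[where \<iota> = "\<lambda>k. if k = 0 then i else j" and \<pi> = "\<lambda>k. if k = 0 then p else q"])
  fix m assume m: "m \<in> carrier M"
  show "finsum M (\<lambda>k. (if k = 0 then i else j) ((if k = 0 then p else q) m)) {..<length [A, B]} = m"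
    using finsum_2[OF assms(3), of "\<lambda>k. (if k = 0 then i else j) ((if k = 0 then p else q) m)"]
      assms(12)[OF m] mm_closed[OF assms(4) mm_closed[OF assms(6) m]]
      mm_closed[OF assms(5) mm_closed[OF assms(7) m]] by simp
qed (use assms in \<open>auto simp: less_Suc_eq nth_Cons'\<close>)

end

section \<open>Artinian rings\<close>

lemma (in ring) mm_funpow: "mm M M f \<Longrightarrow> mm M M (f ^^ n)"
  by (induction n) (auto intro: mm_id mm_comp simp: id_def o_def)

text \<open>Finite length of the ring as a left module over itself, which makes finite generation
  and finite length of modules the same thing. The latter is the form used from here on, for modules
  with elements of any type.\<close>

locale artin_ring = ring +
  assumes finlen_reg: "finlen (reg_module R)"
begin

abbreviation fg :: "('a, 'x) module \<Rightarrow> bool" where "fg M \<equiv> lmod M \<and> finlen M"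

lemma fin_gen_iff: "lmod M \<Longrightarrow> fin_gen R M \<longleftrightarrow> finlen M"
  using fin_gen_finlen[OF finlen_reg] finlen_fin_gen by blast
lemma fgmod_iff: "M \<in> fgmod R \<longleftrightarrow> fg M"
  using fin_gen_iff by (auto simp: fgmod_def)

lemma fg_sub: "fg M \<Longrightarrow> subm L M \<Longrightarrow> fg (M\<lparr>carrier := L\<rparr>)"
  using finlen_inj[OF lmod_sub _ mm_sub_dom[OF mm_id]] lmod_sub subm_sub by fastforce
lemma fg_image: "fg M \<Longrightarrow> lmod N \<Longrightarrow> mm M N f \<Longrightarrow> f ` carrier M = carrier N \<Longrightarrow> fg N"
  using finlen_surj by blast
lemma fg_quot:
  assumes "fg M" "subm L M" shows "fg (quot M L)"
proof -
  have l: "lmod M" using assms by simp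
  show ?thesis using fg_image[OF assms(1) quot(1-3)[OF l assms(2)]] by simp
qed
lemma fg_prodm: "fg M \<Longrightarrow> fg N \<Longrightarrow> fg (prodm M N)"
  using finlen_prodm lmod_prodm by blast
lemma fg_dsum: "finite I \<Longrightarrow> (\<And>i. i \<in> I \<Longrightarrow> fg (Ms i)) \<Longrightarrow> fg (dsum I Ms)"
  by (simp add: finlen_dsum lmod_dsum)
lemma fg_free: "finite S \<Longrightarrow> fg (free S)"
  using fg_dsum[of S "\<lambda>_. reg_module R"] lmod_reg finlen_reg by simp

text \<open>Notions such as \<open>projective\<close> or \<open>Ext1_vanishes\<close> quantify over
  modules with elements of type \<open>nat \<Rightarrow> 'a\<close>, whereas products and pullbacks
  live on other types. They enter such a notion through an isomorphic copy.\<close>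

lemma std_copy:
  fixes M :: "('a, 'x) module"
  assumes "fg M"
  obtains N :: "'a std_module" and f g where "fg N" "mm M N f" "mm N M g"
    "\<And>x. x \<in> carrier M \<Longrightarrow> g (f x) = x" "\<And>y. y \<in> carrier N \<Longrightarrow> f (g y) = y"
proof -
  obtain N f where N: "N \<in> fgmod R" "mm M N f" "bij_betw f (carrier M) (carrier N)"
    using ex_iso_fgmod[of R M] assms fin_gen_iff[of M] by (auto simp: module_iso_def)
  show thesis
    by (rule that[of N f "inv_into (carrier M) f"])
      (use N assms mm_inv[of M N f] in \<open>auto simp: fgmod_iff bij_betw_def f_inv_into_f\<close>)
qed

text \<open>The kernels of the powers of f become stationary, say at n. If f x = 0, write x = f^n y;
  then y lies in the kernel of f^(n+1), which is that of f^n, so x = 0.\<close>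

lemma surj_endo_inj:
  assumes "fg M" "mm M M f" "f ` carrier M = carrier M"
  shows "inj_on f (carrier M)"
proof -
  define k where "k n = {x \<in> carrier M. (f ^^ n) x = \<zero>\<^bsub>M\<^esub>}" for n
  have l: "lmod M" using assms by simp
  have fn: "mm M M (f ^^ n)" for n by (rule mm_funpow) fact
  have k: "subm (k n) M" for n unfolding k_def by (rule subm_kernel[OF l l fn])
  obtain n where n: "\<And>m. k n \<subseteq> k m \<Longrightarrow> k m = k n"
    using finlen_max[of M "k 0" "\<lambda>A. \<exists>n. A = k n"] assms k by metis
  have "k n \<subseteq> k (Suc n)" using mm_zero[OF assms(2) l l] by (auto simp: k_def)
  from n[OF this] have eq: "k (Suc n) = k n" .
  have sn: "(f ^^ n) ` carrier M = carrier M" for n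
  proof (induction n)
    case (Suc n)
    have "(f ^^ Suc n) ` carrier M = f ` ((f ^^ n) ` carrier M)" by (simp add: image_comp)
    then show ?case using Suc assms(3) by simp
  qed simp
  have "x = \<zero>\<^bsub>M\<^esub>" if x: "x \<in> carrier M" "f x = \<zero>\<^bsub>M\<^esub>" for x
  proof -
    obtain y where y: "y \<in> carrier M" "x = (f ^^ n) y" using x(1) sn[of n] by (metis imageE)
    then have "y \<in> k (Suc n)" using x(2) by (simp add: k_def)
    then have "y \<in> k n" using eq by blast
    then show ?thesis using y by (simp add: k_def)
  qed
  then show ?thesis unfolding mm_inj_iff[OF l l assms(2)] using l mm_zero[OF assms(2) l l] by auto
qed

section \<open>Fitting's lemma and local endomorphism rings\<close>

lemma funpow_decreasing:
  assumes "f ` A \<subseteq> A" "m \<le> n" shows "(f ^^ n) ` A \<subseteq> (f ^^ m) ` A"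
proof -
  have "(f ^^ k) ` A \<subseteq> A" for k by (induction k) (use assms in auto)
  then have "(f ^^ m) ` ((f ^^ (n - m)) ` A) \<subseteq> (f ^^ m) ` A" by blast
  moreover have "f ^^ n = (f ^^ m) \<circ> (f ^^ (n - m))" using assms(2) by (metis funpow_add le_add_diff_inverse)
  ultimately show ?thesis by (simp add: image_comp)
qed

text \<open>For large n the module X is the direct sum of the kernel \<open>k n\<close> and the
  image \<open>r n\<close> of f^n, so one of them is zero: f is nilpotent if the image is, and
  surjective, hence bijective, if the kernel is.\<close>

lemma fitting:
  fixes X :: "'a std_module"
  assumes "indecomposable R X" "mm X X f"
  shows "bij_betw f (carrier X) (carrier X) \<or> (\<exists>n. \<forall>x\<in>carrier X. (f ^^ n) x = \<zero>\<^bsub>X\<^esub>)"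
proof -
  have X: "fg X" "lmod X" using assms(1) by (auto simp: indecomposable_def fgmod_iff)
  define k where "k n = {x \<in> carrier X. (f ^^ n) x = \<zero>\<^bsub>X\<^esub>}" for n
  define r where "r n = (f ^^ n) ` carrier X" for n
  have fn: "mm X X (f ^^ n)" for n by (rule mm_funpow) fact
  have fc: "(f ^^ n) x \<in> carrier X" if "x \<in> carrier X" for n x using mm_closed[OF fn that] .
  have k: "subm (k n) X" and r: "subm (r n) X" for n
    unfolding k_def r_def
    using subm_kernel[OF X(2) X(2) fn] subm_image[OF X(2) X(2) fn subm_carrier[OF X(2)]] by auto
  obtain n0 where n0: "\<And>m. k n0 \<subseteq> k m \<Longrightarrow> k m = k n0"
    using finlen_max[of X "k 0" "\<lambda>A. \<exists>n. A = k n"] X k by metis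
  obtain n1 where n1: "\<And>m. r m \<subseteq> r n1 \<Longrightarrow> r m = r n1"
    using finlen_min[of X "r 0" "\<lambda>A. \<exists>n. A = r n"] X r by metis
  \<comment> \<open>Large enough for both chains to be stationary. The successor guarantees n > 0,
    so that at the end the image of f^n lies in the image of f.\<close>
  define n where "n = Suc (n0 + n1)"
  define F where "F = f ^^ n"
  have add: "(f ^^ (a + b)) x = (f ^^ a) ((f ^^ b) x)" for a b x by (simp add: funpow_add)
  have kmono: "k a \<subseteq> k b" if "a \<le> b" for a b
    using mm_zero[OF fn X(2) X(2)] add[of "b - a" a] that by (auto simp: k_def)
  have rmono: "r b \<subseteq> r a" if "a \<le> b" for a b
    unfolding r_def by (rule funpow_decreasing) (use that mm_closed[OF assms(2)] in auto)
  have keq: "k (n + n) = k n"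
  proof -
    have "k (n + n) = k n0" by (rule n0, rule kmono) (simp add: n_def)
    moreover have "k n = k n0" by (rule n0, rule kmono) (simp add: n_def)
    ultimately show ?thesis by simp
  qed
  have req: "r (n + n) = r n"
  proof -
    have "r (n + n) = r n1" by (rule n1, rule rmono) (simp add: n_def)
    moreover have "r n = r n1" by (rule n1, rule rmono) (simp add: n_def)
    ultimately show ?thesis by simp
  qed
  let ?A = "X\<lparr>carrier := k n\<rparr>" and ?B = "X\<lparr>carrier := r n\<rparr>"
  have int: "x = \<zero>\<^bsub>X\<^esub>" if kr: "x \<in> k n" "x \<in> r n" for x
  proof -
    obtain y where y: "y \<in> carrier X" "x = (f ^^ n) y" using kr(2) by (auto simp: r_def)
    then have "y \<in> k (n + n)" using kr(1) by (simp add: k_def add)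
    then have "y \<in> k n" using keq by blast
    then show ?thesis using y by (simp add: k_def)
  qed
  have dec: "\<exists>u\<in>r n. sb X x u \<in> k n" if x: "x \<in> carrier X" for x
  proof -
    have "(f ^^ n) x \<in> r (n + n)" using x req by (auto simp: r_def)
    then obtain y where y: "y \<in> carrier X" "(f ^^ n) x = (f ^^ n) ((f ^^ n) y)" by (auto simp: r_def add)
    then have "sb X x ((f ^^ n) y) \<in> k n" using x X fc by (simp add: k_def mm_sb[OF fn])
    then show ?thesis using y by (auto simp: r_def)
  qed
  have zero: "zero_module ?A \<or> zero_module ?B"
  proof -
    \<comment> \<open>The projection onto \<open>r n\<close> along \<open>k n\<close>, defined by
      choice. Uniqueness of the decomposition (\<open>quniq\<close>) then makes it linear.\<close>
    obtain q where q: "\<And>x. x \<in> carrier X \<Longrightarrow> q x \<in> r n \<and> sb X x (q x) \<in> k n" using dec by metis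
    have q_in: "q x \<in> carrier X" if "x \<in> carrier X" for x using q[OF that] subm_in[OF r] by blast
    have quniq: "q x = u" if "x \<in> carrier X" "u \<in> r n" "sb X x u \<in> k n" for x u
    proof -
      have uc: "u \<in> carrier X" using that subm_in[OF r] by blast
      have "sb X x u = sb X (q x) u \<oplus>\<^bsub>X\<^esub> sb X x (q x)"
        using sb_sb_cancel[OF X(2) that(1) q_in[OF that(1)] uc]
          lm_comm[OF X(2), of "sb X x (q x)" "sb X (q x) u"] X that q_in uc by simp
      then have "sb X (q x) u = sb X (sb X x u) (sb X x (q x))" using X that q_in uc by simp
      then have "sb X (q x) u \<in> k n" using subm_sb[OF k] that q by simp
      moreover have "sb X (q x) u \<in> r n" using subm_sb[OF r] that q by simp
      ultimately have "sb X (q x) u = \<zero>\<^bsub>X\<^esub>" by (rule int)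
      then show ?thesis using X uc q_in that by simp
    qed
    have qm: "mm X X q"
    proof (rule mmI)
      fix x y assume a: "x \<in> carrier X" "y \<in> carrier X"
      have "sb X (x \<oplus>\<^bsub>X\<^esub> y) (q x \<oplus>\<^bsub>X\<^esub> q y) = sb X x (q x) \<oplus>\<^bsub>X\<^esub> sb X y (q y)"
        using a q_in X lm_add4[OF X(2), of "sb X x (q x)" "q x" "sb X y (q y)" "q y"]
        by (simp add: sb_eq_iff)
      then show "q (x \<oplus>\<^bsub>X\<^esub> y) = q x \<oplus>\<^bsub>X\<^esub> q y"
        using a q X by (intro quniq) (auto intro: subm_add[OF k] subm_add[OF r])
    next
      fix a x assume a: "a \<in> carrier R" "x \<in> carrier X"
      have "sb X (a \<odot>\<^bsub>X\<^esub> x) (a \<odot>\<^bsub>X\<^esub> q x) = a \<odot>\<^bsub>X\<^esub> sb X x (q x)"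
        using a q_in X by (simp add: sb_eq_iff lm_smult_add[symmetric])
      then show "q (a \<odot>\<^bsub>X\<^esub> x) = a \<odot>\<^bsub>X\<^esub> q x"
        using a q X by (intro quniq) (auto intro: subm_smult[OF k] subm_smult[OF r])
    qed (rule q_in)
    have "module_direct_sum R [?A, ?B] X"
    proof (rule direct_sum2I[where i = "\<lambda>x. x" and j = "\<lambda>x. x" and p = "\<lambda>x. sb X x (q x)" and q = q])
      show "lmod ?A" "lmod ?B" "lmod X" using lmod_sub X k r by auto
      show "mm ?A X (\<lambda>x. x)" "mm ?B X (\<lambda>x. x)"
        by (rule mm_sub_dom[OF mm_id subm_sub[OF k]], rule mm_sub_dom[OF mm_id subm_sub[OF r]])
      show "mm X ?A (\<lambda>x. sb X x (q x))" "mm X ?B q"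
        using mm_minus[OF X(2) mm_id qm] qm q subm_sub[OF k] subm_sub[OF r]
        by (auto simp: mm_sub_cod_iff)
      show qA: "q x = \<zero>\<^bsub>?B\<^esub>" if "x \<in> carrier ?A" for x
        using that subm_zero[OF r] subm_in[OF k] X by (auto intro!: quniq)
      show qB: "q x = x" if "x \<in> carrier ?B" for x
        using that subm_zero[OF k] subm_in[OF r] X by (auto intro!: quniq)
      show "sb X x (q x) = x" if "x \<in> carrier ?A" for x
        using qA[OF that] that X subm_in[OF k] by simp
      show "sb X x (q x) = \<zero>\<^bsub>?A\<^esub>" if "x \<in> carrier ?B" for x
        using qB[OF that] that X subm_in[OF r] by simp
      show "sb X x (q x) \<oplus>\<^bsub>X\<^esub> q x = x" if "x \<in> carrier X" for x
        using that X q_in by simp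
    qed
    then show ?thesis using assms(1) fg_sub[OF X(1)] k r by (auto simp: indecomposable_def fgmod_iff)
  qed
  then show ?thesis
  proof
    assume "zero_module ?B"
    then have "\<forall>x\<in>carrier X. (f ^^ n) x = \<zero>\<^bsub>X\<^esub>" by (auto simp: zero_module_def r_def)
    then show ?thesis by blast
  next
    assume "zero_module ?A"
    then have k0: "k n = {\<zero>\<^bsub>X\<^esub>}" by (auto simp: zero_module_def)
    have "x \<in> r n" if x: "x \<in> carrier X" for x
    proof -
      obtain u where u: "u \<in> r n" "sb X x u \<in> k n" using dec[OF x] by blast
      then have "x = u" using k0 X x subm_in[OF r, of u] by simp
      then show ?thesis using u by simp
    qed
    then have "carrier X \<subseteq> r 1" using rmono[of 1 n] by (auto simp: n_def)
    then have "f ` carrier X = carrier X" using mm_closed[OF assms(2)] by (auto simp: r_def)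
    then show ?thesis using surj_endo_inj[OF X(1) assms(2)] by (simp add: bij_betw_def)
  qed
qed

lemma indecomposable_fg: "indecomposable R X \<Longrightarrow> fg X"
  by (auto simp: indecomposable_def fgmod_iff)
lemma indecomposable_nz: "indecomposable R X \<Longrightarrow> \<exists>x\<in>carrier X. x \<noteq> \<zero>\<^bsub>X\<^esub>"
  using lm_zero_closed[of X] indecomposable_fg[of X] unfolding indecomposable_def zero_module_def by blast

text \<open>The endomorphism ring of X is local. Composing with the inverse of a + b reduces to A +
  B = 1. If B is not bijective it is nilpotent; then A x = 0 gives B x = x and x = 0, so A is
  injective, hence not nilpotent, hence bijective.\<close>

lemma local_add:
  assumes X: "indecomposable R X" and m: "mm X X a" "mm X X b"
    and u: "bij_betw (\<lambda>x. a x \<oplus>\<^bsub>X\<^esub> b x) (carrier X) (carrier X)"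
  shows "bij_betw a (carrier X) (carrier X) \<or> bij_betw b (carrier X) (carrier X)"
proof (rule disjCI)
  assume nb: "\<not> bij_betw b (carrier X) (carrier X)"
  let ?u = "\<lambda>x. a x \<oplus>\<^bsub>X\<^esub> b x"
  define v where "v = inv_into (carrier X) ?u"
  have lX: "lmod X" using indecomposable_fg[OF X] by simp
  have um: "mm X X ?u" using m lX by (intro mm_plus)
  have vm: "mm X X v" unfolding v_def by (rule mm_inv[OF lX um u])
  have vb: "bij_betw v (carrier X) (carrier X)" unfolding v_def by (rule bij_betw_inv_into[OF u])
  have vu: "v (?u x) = x" if "x \<in> carrier X" for x
    unfolding v_def by (rule bij_betw_inv_into_left[OF u that])
  have uv: "?u (v x) = x" if "x \<in> carrier X" for x
    using bij_betw_inv_into_right[OF u that] by (simp add: v_def)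
  define A where "A = (\<lambda>x. v (a x))"
  define B where "B = (\<lambda>x. v (b x))"
  have AB: "mm X X A" "mm X X B" unfolding A_def B_def using mm_comp[OF m(1) vm] mm_comp[OF m(2) vm] by auto
  have s: "A x \<oplus>\<^bsub>X\<^esub> B x = x" if "x \<in> carrier X" for x
    using vu[OF that] mm_add[OF vm mm_closed[OF m(1) that] mm_closed[OF m(2) that]]
    by (simp add: A_def B_def)
  have bB: "b x = ?u (B x)" if "x \<in> carrier X" for x using uv mm_closed[OF m(2) that] by (simp add: B_def)
  have aA: "a x = ?u (A x)" if "x \<in> carrier X" for x using uv mm_closed[OF m(1) that] by (simp add: A_def)
  have "\<not> bij_betw B (carrier X) (carrier X)"
  proof
    assume "bij_betw B (carrier X) (carrier X)"
    from bij_betw_trans[OF this u] have "bij_betw (\<lambda>x. ?u (B x)) (carrier X) (carrier X)" by (simp add: o_def)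
    then have "bij_betw b (carrier X) (carrier X)"
      by (subst bij_betw_cong[of _ b "\<lambda>x. ?u (B x)"]) (use bB in auto)
    then show False using nb by simp
  qed
  then obtain n where n: "\<forall>x\<in>carrier X. (B ^^ n) x = \<zero>\<^bsub>X\<^esub>" using fitting[OF X AB(2)] by blast
  have A0: "x = \<zero>\<^bsub>X\<^esub>" if x: "x \<in> carrier X" "A x = \<zero>\<^bsub>X\<^esub>" for x
  proof -
    have "B x = x" using s[OF x(1)] x mm_closed[OF AB(2) x(1)] lX by simp
    then have "(B ^^ k) x = x" for k by (induction k) auto
    then show ?thesis using n x by metis
  qed
  have "bij_betw A (carrier X) (carrier X)"
  proof (rule ccontr)
    assume "\<not> ?thesis"
    then obtain k where k: "\<forall>x\<in>carrier X. (A ^^ k) x = \<zero>\<^bsub>X\<^esub>" using fitting[OF X AB(1)] by blast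
    have A0k: "x = \<zero>\<^bsub>X\<^esub>" if "x \<in> carrier X" "(A ^^ k) x = \<zero>\<^bsub>X\<^esub>" for x k
      using that
    proof (induction k)
      case (Suc k)
      have "(A ^^ k) x = \<zero>\<^bsub>X\<^esub>" by (rule A0) (use Suc mm_closed[OF mm_funpow[OF AB(1)]] in auto)
      then show ?case using Suc by simp
    qed simp
    show False using indecomposable_nz[OF X] A0k k by blast
  qed
  from bij_betw_trans[OF this u] have "bij_betw (\<lambda>x. ?u (A x)) (carrier X) (carrier X)" by (simp add: o_def)
  then show "bij_betw a (carrier X) (carrier X)"
    by (subst bij_betw_cong[of _ a "\<lambda>x. ?u (A x)"]) (use aA in auto)
qed

text \<open>By induction from two summands; the empty sum is excluded because the zero map of a
  nonzero module is not bijective.\<close>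

lemma local_finsum:
  assumes X: "indecomposable R X" and I: "finite I" "\<And>i. i \<in> I \<Longrightarrow> mm X X (f i)"
    and u: "bij_betw (\<lambda>x. finsum X (\<lambda>i. f i x) I) (carrier X) (carrier X)"
  shows "\<exists>i\<in>I. bij_betw (f i) (carrier X) (carrier X)"
  using I u
proof (induction I rule: finite_induct)
  case empty
  have lX: "lmod X" using indecomposable_fg[OF X] by simp
  obtain x where x: "x \<in> carrier X" "x \<noteq> \<zero>\<^bsub>X\<^esub>" using indecomposable_nz[OF X] by blast
  have "inj_on (\<lambda>x. \<zero>\<^bsub>X\<^esub>) (carrier X)"
    using empty(2) by (simp add: abelian_monoid.finsum_empty[OF lm_abm[OF lX]] bij_betw_def)
  then show ?case using x lX by (auto simp: inj_on_def)
next
  case (insert i I)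
  have lX: "lmod X" using indecomposable_fg[OF X] by simp
  have eq: "finsum X (\<lambda>i. f i x) (insert i I) = f i x \<oplus>\<^bsub>X\<^esub> finsum X (\<lambda>i. f i x) I" if "x \<in> carrier X" for x
    using insert(1,2) mm_closed[OF insert(4) that]
    by (intro abelian_monoid.finsum_insert[OF lm_abm[OF lX]]) auto
  have "bij_betw (\<lambda>x. f i x \<oplus>\<^bsub>X\<^esub> finsum X (\<lambda>i. f i x) I) (carrier X) (carrier X)"
    using insert(5) by (subst bij_betw_cong[OF eq[symmetric]])
  from local_add[OF X _ _ this] show ?case
    using insert mm_finsum[OF lX lX insert(1), of f] by auto
qed

text \<open>With v inverse to p i, the endomorphism e = i v p of Z is the identity on i(X). Since i
  is injective and X is nonzero, e is not nilpotent, so it is bijective by Fitting, and its image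
  lies in i(X).\<close>

lemma retract_indecomposable:
  assumes X: "indecomposable R X" "indecomposable R Z" and m: "mm X Z i" "mm Z X p"
    and u: "bij_betw (\<lambda>x. p (i x)) (carrier X) (carrier X)"
  shows "bij_betw i (carrier X) (carrier Z)" "bij_betw p (carrier Z) (carrier X)"
proof -
  let ?u = "\<lambda>x. p (i x)"
  have l: "lmod X" "lmod Z" using X indecomposable_fg by auto
  define v where "v = inv_into (carrier X) ?u"
  have um: "mm X X ?u" using m by (rule mm_comp)
  have vm: "mm X X v" unfolding v_def by (rule mm_inv[OF l(1) um u])
  have vu: "v (?u x) = x" if "x \<in> carrier X" for x
    unfolding v_def by (rule bij_betw_inv_into_left[OF u that])
  define e where "e = (\<lambda>z. i (v (p z)))"
  have em: "mm Z Z e" unfolding e_def by (rule mm_comp[OF mm_comp[OF m(2) vm] m(1)])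
  have ei: "e (i x) = i x" if "x \<in> carrier X" for x using vu[OF that] by (simp add: e_def)
  have ein: "(e ^^ n) (i x) = i x" if "x \<in> carrier X" for x n by (induction n) (use ei that in auto)
  have i0: "x = \<zero>\<^bsub>X\<^esub>" if "x \<in> carrier X" "i x = \<zero>\<^bsub>Z\<^esub>" for x
    using vu[OF that(1)] that mm_zero[OF m(2) l(2,1)] mm_zero[OF vm l(1,1)] by simp
  have "bij_betw e (carrier Z) (carrier Z)"
  proof (rule ccontr)
    assume "\<not> ?thesis"
    then obtain n where "\<forall>z\<in>carrier Z. (e ^^ n) z = \<zero>\<^bsub>Z\<^esub>" using fitting[OF X(2) em] by blast
    then show False using indecomposable_nz[OF X(1)] ein i0 mm_closed[OF m(1)] by metis
  qed
  then have eS: "e ` carrier Z = carrier Z" by (simp add: bij_betw_def)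
  have "z \<in> i ` carrier X" if z: "z \<in> carrier Z" for z
  proof -
    have "z \<in> e ` carrier Z" using z eS by simp
    then obtain w where "w \<in> carrier Z" "z = e w" by auto
    then show ?thesis using mm_closed[OF vm mm_closed[OF m(2)]] by (simp add: e_def)
  qed
  then have "i ` carrier X = carrier Z" using mm_closed[OF m(1)] by auto
  moreover have "inj_on i (carrier X)" using u by (auto simp: bij_betw_def inj_on_def)
  ultimately show ib: "bij_betw i (carrier X) (carrier Z)" by (simp add: bij_betw_def)
  have ub: "bij_betw (\<lambda>z. ?u (inv_into (carrier X) i z)) (carrier Z) (carrier X)"
    using bij_betw_trans[OF bij_betw_inv_into[OF ib] u] by (simp add: o_def)
  have "p z = ?u (inv_into (carrier X) i z)" if "z \<in> carrier Z" for z
    using ib that by (simp add: bij_betw_inv_into_right)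
  then show "bij_betw p (carrier Z) (carrier X)"
    by (subst bij_betw_cong[of _ p "\<lambda>z. ?u (inv_into (carrier X) i z)"]) (use ub in auto)
qed

subsection \<open>Projective modules\<close>

lemma free_lift:
  assumes "finite S" "lmod A" "lmod B" "mm A B q" "q ` carrier A = carrier B" "mm (free S) B h"
  obtains h' where "mm (free S) A h'" "\<And>c. c \<in> carrier (free S) \<Longrightarrow> q (h' c) = h c"
proof -
  have "\<forall>s\<in>S. \<exists>v\<in>carrier A. q v = h (ubas S s)"
  proof
    fix s assume "s \<in> S"
    then have "h (ubas S s) \<in> q ` carrier A" using mm_closed[OF assms(6) ubas_in] assms(5) by auto
    then show "\<exists>v\<in>carrier A. q v = h (ubas S s)" by auto
  qed
  then obtain v where v: "\<And>s. s \<in> S \<Longrightarrow> v s \<in> carrier A" "\<And>s. s \<in> S \<Longrightarrow> q (v s) = h (ubas S s)" by metis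
  show thesis
  proof (rule that[of "\<lambda>c. finsum A (\<lambda>s. c s \<odot>\<^bsub>A\<^esub> v s) S"])
    show "mm (free S) A (\<lambda>c. finsum A (\<lambda>s. c s \<odot>\<^bsub>A\<^esub> v s) S)" using assms v by (intro mm_free) auto
    fix c assume c: "c \<in> carrier (free S)"
    then have cs: "c s \<in> carrier R" if "s \<in> S" for s using that by (auto simp: free_in)
    have "q (finsum A (\<lambda>s. c s \<odot>\<^bsub>A\<^esub> v s) S) = finsum B (\<lambda>s. q (c s \<odot>\<^bsub>A\<^esub> v s)) S"
      by (rule module_map_finsum[of R A B]) (use assms v cs in auto)
    also have "\<dots> = finsum B (\<lambda>s. c s \<odot>\<^bsub>B\<^esub> h (ubas S s)) S"
      using assms v cs mm_closed[OF assms(6) ubas_in]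
      by (intro abelian_monoid.finsum_cong'[OF lm_abm]) (auto simp: mm_smult)
    also have "\<dots> = h c" using free_expand[OF assms(3,1,6) c] by simp
    finally show "q (finsum A (\<lambda>s. c s \<odot>\<^bsub>A\<^esub> v s) S) = h c" .
  qed
qed

lemma projective_retract_free:
  assumes "fg P" "finite S" "mm P (free S) i" "mm (free S) P p" "\<And>x. x \<in> carrier P \<Longrightarrow> p (i x) = x"
  shows "projective R P"
  unfolding projective_def
proof (intro conjI ballI allI impI)
  fix A B :: "'a std_module" and q h
  assume a: "A \<in> fgmod R" "B \<in> fgmod R" "mm A B q \<and> q ` carrier A = carrier B \<and> mm P B h"
  obtain h' where h': "mm (free S) A h'" "\<And>c. c \<in> carrier (free S) \<Longrightarrow> q (h' c) = h (p c)"
    using free_lift[OF assms(2), of A B q "\<lambda>c. h (p c)"] a assms(4) mm_comp[OF assms(4), of B h]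
    by (auto simp: fgmod_iff)
  show "\<exists>h'. mm P A h' \<and> (\<forall>x\<in>carrier P. q (h' x) = h x)"
    using mm_comp[OF assms(3) h'(1)] h'(2) assms(5) mm_closed[OF assms(3)]
    by (intro exI[of _ "\<lambda>x. h' (i x)"]) auto
qed (use assms in \<open>simp add: fgmod_iff\<close>)

lemma projectiveD:
  fixes A B :: "'a std_module"
  assumes "projective R P" "fg A" "fg B" "mm A B q" "q ` carrier A = carrier B" "mm P B h"
  shows "\<exists>h'. mm P A h' \<and> (\<forall>x\<in>carrier P. q (h' x) = h x)"
  using assms(1)[unfolded projective_def, THEN conjunct2, rule_format, of A B q h] assms(2-)
  by (simp add: fgmod_iff)

lemma projective_fg: "projective R P \<Longrightarrow> fg P" by (simp add: projective_def fgmod_iff)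

text \<open>The dual basis lemma: the functionals \<open>y s\<close> are the coordinates of a
  section of an epimorphism from a free module. The section is found on a standard copy of the free
  module and then carried back.\<close>

lemma projective_basis:
  assumes "projective R P"
  obtains S y where "finite S" "S \<subseteq> carrier P" "\<And>s. s \<in> S \<Longrightarrow> mm P (reg_module R) (y s)"
    "\<And>x. x \<in> carrier P \<Longrightarrow> finsum P (\<lambda>s. y s x \<odot>\<^bsub>P\<^esub> s) S = x"
proof -
  have P: "fg P" using projective_fg[OF assms] .
  obtain S where S: "finite S" "S \<subseteq> carrier P"
    "(\<lambda>c. finsum P (\<lambda>s. c s \<odot>\<^bsub>P\<^esub> s) S) ` carrier (free S) = carrier P"
    using fin_gen_free[of P] P fin_gen_iff by blast
  define p where "p = (\<lambda>c. finsum P (\<lambda>s. c s \<odot>\<^bsub>P\<^esub> s) S)"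
  have p: "mm (free S) P p" unfolding p_def by (rule mm_free) (use P S in auto)
  obtain F :: "'a std_module" and f g where F: "fg F" "mm (free S) F f" "mm F (free S) g"
    "\<And>x. x \<in> carrier (free S) \<Longrightarrow> g (f x) = x" "\<And>y. y \<in> carrier F \<Longrightarrow> f (g y) = y"
  proof (rule std_copy[OF fg_free[OF S(1)]])
    fix N :: "'a std_module" and f g
    assume "fg N" "mm (free S) N f" "mm N (free S) g"
      "\<And>x. x \<in> carrier (free S) \<Longrightarrow> g (f x) = x" "\<And>y. y \<in> carrier N \<Longrightarrow> f (g y) = y"
    then show thesis by (rule that[of N f g])
  qed
  have pg: "mm F P (\<lambda>x. p (g x))" by (rule mm_comp[OF F(3) p])
  have pgs: "(\<lambda>x. p (g x)) ` carrier F = carrier P"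
  proof
    show "carrier P \<subseteq> (\<lambda>x. p (g x)) ` carrier F"
    proof
      fix x assume "x \<in> carrier P"
      then have "x \<in> p ` carrier (free S)" using S(3) by (simp add: p_def)
      then obtain c where c: "c \<in> carrier (free S)" "x = p c" by auto
      then show "x \<in> (\<lambda>x. p (g x)) ` carrier F"
        using F(4)[OF c(1)] mm_closed[OF F(2) c(1)] by (intro image_eqI[of _ _ "f c"]) auto
    qed
  qed (use mm_closed[OF pg] in auto)
  have "\<exists>h. mm P F h \<and> (\<forall>x\<in>carrier P. p (g (h x)) = x)"
    using projectiveD[OF assms F(1) P pg pgs mm_id] .
  then obtain h where h: "mm P F h" "\<And>x. x \<in> carrier P \<Longrightarrow> p (g (h x)) = x" by blast
  have gh: "mm P (free S) (\<lambda>x. g (h x))" by (rule mm_comp[OF h(1) F(3)])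
  show thesis
  proof (rule that[of S "\<lambda>s x. g (h x) s"])
    show "mm P (reg_module R) (\<lambda>x. g (h x) s)" if "s \<in> S" for s
      using mm_comp[OF gh mm_dproj[of s S "\<lambda>_. reg_module R"]] that by simp
    show "finsum P (\<lambda>s. g (h x) s \<odot>\<^bsub>P\<^esub> s) S = x" if "x \<in> carrier P" for x
      using h(2)[OF that] by (simp add: p_def)
  qed (use S in auto)
qed

lemma reg_in: "mm P (reg_module R) y \<Longrightarrow> x \<in> carrier P \<Longrightarrow> y x \<in> carrier R"
  using mm_closed[of P "reg_module R" y x] by (simp add: reg_module_def)

lemma basis_expand:
  assumes "lmod P" "lmod N" "finite S" "S \<subseteq> carrier P" "\<And>s. s \<in> S \<Longrightarrow> mm P (reg_module R) (y s)"
    "\<And>x. x \<in> carrier P \<Longrightarrow> finsum P (\<lambda>s. y s x \<odot>\<^bsub>P\<^esub> s) S = x" "mm P N f" "x \<in> carrier P"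
  shows "f x = finsum N (\<lambda>s. y s x \<odot>\<^bsub>N\<^esub> f s) S"
proof -
  have c: "y s x \<in> carrier R" "s \<in> carrier P" if "s \<in> S" for s
    using that reg_in[OF assms(5) assms(8)] assms(4) by auto
  have "f x = f (finsum P (\<lambda>s. y s x \<odot>\<^bsub>P\<^esub> s) S)" using assms(6,8) by simp
  also have "\<dots> = finsum N (\<lambda>s. f (y s x \<odot>\<^bsub>P\<^esub> s)) S"
    by (rule module_map_finsum[OF assms(1,2,7,3)]) (use c assms(1) in auto)
  also have "\<dots> = finsum N (\<lambda>s. y s x \<odot>\<^bsub>N\<^esub> f s) S"
    using c assms(2) mm_closed[OF assms(7)]
    by (intro abelian_monoid.finsum_cong'[OF lm_abm]) (auto simp: mm_smult[OF assms(7)])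
  finally show ?thesis .
qed

text \<open>The dual basis yields a lift by choosing preimages of the images of the generators.
  Unlike in the definition, A and B may have elements of any type and need not be finitely
  generated.\<close>

lemma projective_lift:
  assumes "projective R P" "lmod A" "lmod B" "mm A B q" "q ` carrier A = carrier B" "mm P B h"
  shows "\<exists>h'. mm P A h' \<and> (\<forall>x\<in>carrier P. q (h' x) = h x)"
proof -
  have P: "lmod P" using projective_fg[OF assms(1)] by simp
  obtain S y where S: "finite S" "S \<subseteq> carrier P" "\<And>s. s \<in> S \<Longrightarrow> mm P (reg_module R) (y s)"
    "\<And>x. x \<in> carrier P \<Longrightarrow> finsum P (\<lambda>s. y s x \<odot>\<^bsub>P\<^esub> s) S = x"
    using projective_basis[OF assms(1)] by blast
  have "\<forall>s\<in>S. \<exists>v\<in>carrier A. q v = h s"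
  proof
    fix s assume "s \<in> S"
    then have "h s \<in> q ` carrier A" using mm_closed[OF assms(6)] S(2) assms(5) by auto
    then show "\<exists>v\<in>carrier A. q v = h s" by auto
  qed
  then obtain v where v: "\<And>s. s \<in> S \<Longrightarrow> v s \<in> carrier A" "\<And>s. s \<in> S \<Longrightarrow> q (v s) = h s" by metis
  show ?thesis
  proof (intro exI[of _ "\<lambda>x. finsum A (\<lambda>s. y s x \<odot>\<^bsub>A\<^esub> v s) S"] conjI ballI)
    show "mm P A (\<lambda>x. finsum A (\<lambda>s. y s x \<odot>\<^bsub>A\<^esub> v s) S)"
      using mm_comp[OF S(3) mm_reg[OF assms(2) v(1)]] assms P S by (intro mm_finsum) auto
    fix x assume x: "x \<in> carrier P"
    have c: "y s x \<in> carrier R" if "s \<in> S" for s using that reg_in[OF S(3) x] by auto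
    have "q (finsum A (\<lambda>s. y s x \<odot>\<^bsub>A\<^esub> v s) S) = finsum B (\<lambda>s. q (y s x \<odot>\<^bsub>A\<^esub> v s)) S"
      by (rule module_map_finsum[OF assms(2,3,4) S(1)]) (use c v assms in auto)
    also have "\<dots> = finsum B (\<lambda>s. y s x \<odot>\<^bsub>B\<^esub> h s) S"
      using assms v c mm_closed[OF assms(6)] S(2)
      by (intro abelian_monoid.finsum_cong'[OF lm_abm]) (auto simp: mm_smult[OF assms(4)])
    also have "\<dots> = h x" using basis_expand[OF P assms(3) S assms(6) x] by simp
    finally show "q (finsum A (\<lambda>s. y s x \<odot>\<^bsub>A\<^esub> v s) S) = h x" .
  qed
qed

section \<open>Projective covers and simple quotients\<close>

lemma projective_retract:
  assumes "projective R P" "fg Q" "mm Q P i" "mm P Q p" "\<And>x. x \<in> carrier Q \<Longrightarrow> p (i x) = x"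
  shows "projective R Q"
  unfolding projective_def
proof (intro conjI ballI allI impI)
  fix A B :: "'a std_module" and q h
  assume a: "A \<in> fgmod R" "B \<in> fgmod R" "mm A B q \<and> q ` carrier A = carrier B \<and> mm Q B h"
  obtain h' where h': "mm P A h'" "\<And>c. c \<in> carrier P \<Longrightarrow> q (h' c) = h (p c)"
    using projective_lift[OF assms(1), of A B q "\<lambda>c. h (p c)"] a assms(4) mm_comp[OF assms(4), of B h]
    by (auto simp: fgmod_iff)
  show "\<exists>h'. mm Q A h' \<and> (\<forall>x\<in>carrier Q. q (h' x) = h x)"
    using mm_comp[OF assms(3) h'(1)] h'(2) assms(5) mm_closed[OF assms(3)]
    by (intro exI[of _ "\<lambda>x. h' (i x)"]) auto
qed (use assms in \<open>simp add: fgmod_iff\<close>)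

text \<open>Within a free module F mapping onto A, choose L minimal among the projective submodules
  that still map onto A, and L2 minimal among all submodules of L that do. A lift L -> L2 of the map
  to A makes L2 a direct summand of L. Thus L2 is projective and equals L, and the minimality of L2
  says that L -> A is essential.\<close>

lemma ex_projective_cover:
  fixes N :: "'a std_module"
  assumes N: "fg N" "subm A N"
  obtains P f where "projective_cover_onto R P f N A"
proof -
  let ?A = "N\<lparr>carrier := A\<rparr>"
  have A: "fg ?A" using fg_sub N by blast
  obtain S where S: "finite S" "S \<subseteq> carrier ?A"
    "(\<lambda>c. finsum ?A (\<lambda>s. c s \<odot>\<^bsub>?A\<^esub> s) S) ` carrier (free S) = carrier ?A"
    using fin_gen_free[of ?A] A fin_gen_iff[of ?A] by blast
  define p where "p = (\<lambda>c. finsum ?A (\<lambda>s. c s \<odot>\<^bsub>?A\<^esub> s) S)"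
  have p: "mm (free S) ?A p" unfolding p_def by (rule mm_free) (use A S in auto)
  obtain F :: "'a std_module" and f g where F: "fg F" "mm (free S) F f" "mm F (free S) g"
    "\<And>x. x \<in> carrier (free S) \<Longrightarrow> g (f x) = x" "\<And>y. y \<in> carrier F \<Longrightarrow> f (g y) = y"
  proof (rule std_copy[OF fg_free[OF S(1)]])
    fix N :: "'a std_module" and f g
    assume "fg N" "mm (free S) N f" "mm N (free S) g"
      "\<And>x. x \<in> carrier (free S) \<Longrightarrow> g (f x) = x" "\<And>y. y \<in> carrier N \<Longrightarrow> f (g y) = y"
    then show thesis by (rule that[of N f g])
  qed
  have lF: "lmod F" "finlen F" and lN: "lmod N" using F N by auto
  define \<phi> where "\<phi> = (\<lambda>x. p (g x))"
  have \<phi>A: "mm F ?A \<phi>" unfolding \<phi>_def by (rule mm_comp[OF F(3) p])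
  then have \<phi>: "mm F N \<phi>" using mm_sub_cod_iff[OF subm_sub[OF N(2)]] by blast
  have "x \<in> \<phi> ` carrier F" if "x \<in> A" for x
  proof -
    have "x \<in> p ` carrier (free S)" using S(3) that by (simp add: p_def)
    then obtain c where c: "c \<in> carrier (free S)" "x = p c" by auto
    then show ?thesis
      using F(4)[OF c(1)] mm_closed[OF F(2) c(1)] by (intro image_eqI[of _ _ "f c"]) (auto simp: \<phi>_def)
  qed
  then have \<phi>s: "\<phi> ` carrier F = A" using mm_closed[OF \<phi>A] by auto
  have "projective R F" by (rule projective_retract_free[OF F(1) S(1) F(3,2)]) (rule F(5))
  then have pF: "projective R (F\<lparr>carrier := carrier F\<rparr>)" by simp
  define Q where "Q L \<longleftrightarrow> projective R (F\<lparr>carrier := L\<rparr>) \<and> \<phi> ` L = A" for L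
  have "Q (carrier F)" using pF \<phi>s by (simp add: Q_def)
  then obtain L where L0: "subm L F" "Q L" "\<And>C. subm C F \<Longrightarrow> Q C \<Longrightarrow> C \<subseteq> L \<Longrightarrow> C = L"
    using finlen_min[OF lF(2) subm_carrier[OF lF(1)], of Q] by blast
  have L: "subm L F" "projective R (F\<lparr>carrier := L\<rparr>)" "\<phi> ` L = A"
    "\<And>C. subm C F \<Longrightarrow> projective R (F\<lparr>carrier := C\<rparr>) \<Longrightarrow> \<phi> ` C = A \<Longrightarrow> C \<subseteq> L \<Longrightarrow> C = L"
    using L0(1,2) by (simp_all add: Q_def L0(3))
  define Q' where "Q' C \<longleftrightarrow> C \<subseteq> L \<and> \<phi> ` C = A" for C
  have "Q' L" using L(3) by (simp add: Q'_def)
  then obtain L2 where L20: "subm L2 F" "Q' L2" "\<And>C. subm C F \<Longrightarrow> Q' C \<Longrightarrow> C \<subseteq> L2 \<Longrightarrow> C = L2"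
    using finlen_min[OF lF(2) L(1), of Q'] by blast
  have L2: "subm L2 F" "L2 \<subseteq> L" "\<phi> ` L2 = A"
    "\<And>C. subm C F \<Longrightarrow> C \<subseteq> L \<Longrightarrow> \<phi> ` C = A \<Longrightarrow> C \<subseteq> L2 \<Longrightarrow> C = L2"
    using L20(1,2) by (simp_all add: Q'_def L20(3))
  let ?L = "F\<lparr>carrier := L\<rparr>" and ?L2 = "F\<lparr>carrier := L2\<rparr>"
  have l2: "lmod ?L2" "fg ?L2" "lmod ?L" using lmod_sub fg_sub F(1) L L2 by auto
  have res: "mm (F\<lparr>carrier := C\<rparr>) ?A \<phi>" if "subm C F" for C
    using mm_sub_dom[OF \<phi>A subm_sub[OF that]] .
  obtain s where s: "mm ?L ?L2 s" "\<And>x. x \<in> L \<Longrightarrow> \<phi> (s x) = \<phi> x"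
    using projective_lift[OF L(2) l2(1) _ res[OF L2(1)] _ res[OF L(1)]] A L2(3) by auto
  have sL2: "mm ?L2 ?L2 s" using mm_sub_dom[OF s(1), of L2] L2(2) by simp
  have "subm (s ` L2) ?L2" using subm_image[OF l2(1) l2(1) sL2 subm_carrier[OF l2(1)]] by simp
  then have sub: "subm (s ` L2) F" "s ` L2 \<subseteq> L2" using subm_sub_iff[OF lF(1) L2(1)] by auto
  have "\<phi> ` (s ` L2) = \<phi> ` L2"
    using s(2) L2(2) by (simp add: image_image) (intro image_cong, auto)
  then have "\<phi> ` (s ` L2) = A" using L2(3) by simp
  \<comment> \<open>The lift s commutes with the maps to A, so s(L2) still maps onto A and is all of
    L2; a surjective endomorphism of a module of finite length is bijective.\<close>
  then have sL: "s ` L2 = L2" using L2(4)[OF sub(1)] sub(2) L2(2) by blast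
  then have "bij_betw s L2 L2" using surj_endo_inj[OF l2(2) sL2] by (simp add: bij_betw_def)
  then have b: "bij_betw s (carrier ?L2) (carrier ?L2)" by simp
  define t where "t = inv_into (carrier ?L2) s"
  have t: "mm ?L2 ?L2 t" unfolding t_def by (rule mm_inv[OF l2(1) sL2 b])
  have ts: "t (s x) = x" if "x \<in> L2" for x using b that by (simp add: t_def bij_betw_def)
  have i: "mm ?L2 ?L (\<lambda>x. x)" using L2(2) by (auto simp: module_map_def)
  have "projective R ?L2"
    by (rule projective_retract[OF L(2) l2(2) i mm_comp[OF s(1) t]]) (use ts in auto)
  then have "L2 = L" using L(4)[OF L2(1)] L2 by blast
  then have "projective_cover_onto R ?L \<phi> N A"
    using L mm_sub_dom[OF \<phi> subm_sub[OF L(1)]] L2(4) subm_sub_iff[OF lF(1) L(1)]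
    by (auto simp: projective_cover_onto_def)
  then show thesis by (rule that)
qed

text \<open>The quotient by a maximal proper submodule, which exists by finite length because the
  zero submodule is proper. As \<open>quot\<close> keeps the element type, the quotient is a module
  to which \<open>simple_module\<close> applies.\<close>

lemma ex_simple_quotient:
  fixes M :: "'a std_module"
  assumes "fg M" "carrier M \<noteq> {\<zero>\<^bsub>M\<^esub>}"
  obtains S f where "simple_module R S" "mm M S f" "f ` carrier M = carrier S"
proof -
  have l: "lmod M" "finlen M" using assms by auto
  obtain L where L: "subm L M" "L \<noteq> carrier M"
    "\<And>C. subm C M \<Longrightarrow> C \<noteq> carrier M \<Longrightarrow> L \<subseteq> C \<Longrightarrow> C = L"
    using finlen_max[OF l(2) subm_0[OF l(1)], of "\<lambda>L. L \<noteq> carrier M"] assms(2) by blast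
  note q = quot[OF l(1) L(1)]
  have "simple_module R (quot M L)"
    unfolding simple_module_def
  proof (intro conjI allI impI)
    show "quot M L \<in> fgmod R" using fg_quot[OF assms(1) L(1)] by (simp add: fgmod_iff)
    obtain x where x: "x \<in> carrier M" "x \<notin> L" using L(2) subm_sub[OF L(1)] by blast
    then have "qrep M L x \<noteq> \<zero>\<^bsub>quot M L\<^esub>" using q(4) by blast
    then show "\<not> zero_module (quot M L)" using mm_closed[OF q(2) x(1)] by (auto simp: zero_module_def)
    fix B assume B: "subm B (quot M L)"
    define C where "C = {x \<in> carrier M. qrep M L x \<in> B}"
    have C: "subm C M" unfolding C_def by (rule subm_preimage[OF l(1) q(1,2) B])
    have BC: "B = qrep M L ` C"
    proof
      show "B \<subseteq> qrep M L ` C"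
      proof
        fix y assume y: "y \<in> B"
        then have "y \<in> qrep M L ` carrier M" using subm_sub[OF B] q(3) by blast
        then show "y \<in> qrep M L ` C" using y by (auto simp: C_def)
      qed
    qed (auto simp: C_def)
    have "L \<subseteq> C"
    proof
      fix x assume "x \<in> L"
      then show "x \<in> C" using subm_zero[OF B] q(4)[of x] subm_in[OF L(1)] by (simp add: C_def)
    qed
    then consider "C = carrier M" | "C = L" using L(3)[OF C] by blast
    then show "B = {\<zero>\<^bsub>quot M L\<^esub>} \<or> B = carrier (quot M L)"
    proof cases
      case 1
      then show ?thesis using BC q(3) by simp
    next
      case 2
      have "B \<subseteq> {\<zero>\<^bsub>quot M L\<^esub>}" unfolding BC 2 using q(4) subm_in[OF L(1)] by auto
      then show ?thesis using subm_zero[OF B] by auto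
    qed
  qed
  then show thesis using that q by blast
qed

end

lemma (in ring) mm_factor_inj:
  assumes "lmod A" "lmod N" "mm A N i" "inj_on i (carrier A)" "mm M N f" "f ` carrier M \<subseteq> i ` carrier A"
  shows "\<exists>t. mm M A t \<and> (\<forall>x\<in>carrier M. i (t x) = f x)"
proof -
  let ?I = "N\<lparr>carrier := i ` carrier A\<rparr>"
  have sub: "i ` carrier A \<subseteq> carrier N" using mm_closed[OF assms(3)] by auto
  have i: "mm A ?I i" using assms(3) sub by (simp add: mm_sub_cod_iff)
  have b: "bij_betw i (carrier A) (carrier ?I)" using assms(4) by (simp add: bij_betw_def)
  have f: "mm M ?I f" using assms(5,6) sub by (simp add: mm_sub_cod_iff)
  show ?thesis
  proof (intro exI[of _ "\<lambda>x. inv_into (carrier A) i (f x)"] conjI ballI)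
    show "mm M A (\<lambda>x. inv_into (carrier A) i (f x))" by (rule mm_comp[OF f mm_inv[OF assms(1) i b]])
    show "i (inv_into (carrier A) i (f x)) = f x" if "x \<in> carrier M" for x
      using assms(6) that by (intro f_inv_into_f) auto
  qed
qed

abbreviation (in ring) kermod :: "('a, 'x) module \<Rightarrow> ('a, 'y) module \<Rightarrow> ('x \<Rightarrow> 'y) \<Rightarrow> ('a, 'x) module"
  where "kermod M N f \<equiv> M\<lparr>carrier := {x \<in> carrier M. f x = \<zero>\<^bsub>N\<^esub>}\<rparr>"

text \<open>Central elements act as endomorphisms on every module, compatibly with all
  homomorphisms. They stand in for the scalars of the base field where no field is
  mentioned.\<close>

definition (in ring) central :: "'a \<Rightarrow> bool" where
  "central c \<longleftrightarrow> c \<in> carrier R \<and> (\<forall>a\<in>carrier R. a \<otimes> c = c \<otimes> a)"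

lemma (in ring) mm_central: "lmod M \<Longrightarrow> central c \<Longrightarrow> mm M M (\<lambda>x. c \<odot>\<^bsub>M\<^esub> x)"
  by (rule mm_smultc[OF _ mm_id]) (auto simp: central_def)

section \<open>The torsion class of a projective presentation\<close>

text \<open>The hypothesis \<open>Hom_span\<close> says that Hom(M, N) is generated over the centre
  by finitely many maps \<open>w j\<close>. In this form the finite dimension of Hom spaces enters,
  and it makes approximations by finite powers exist.\<close>

locale presentation = artin_ring +
  fixes P1 P0 U :: "'a std_module" and d e :: "(nat \<Rightarrow> 'a) \<Rightarrow> (nat \<Rightarrow> 'a)"
  assumes P1: "projective R P1" and P0: "projective R P0" and U: "fg U"
    and d: "mm P1 P0 d" and e: "mm P0 U e" and e_surj: "e ` carrier P0 = carrier U"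
    and d_image: "d ` carrier P1 = {x \<in> carrier P0. e x = \<zero>\<^bsub>U\<^esub>}"
    and Hom_span: "\<And>(M :: 'a std_module) (N :: 'a std_module). fg M \<Longrightarrow> fg N \<Longrightarrow> \<exists>r w. (\<forall>j<r. mm M N (w j)) \<and>
      (\<forall>k. mm M N k \<longrightarrow> (\<exists>c. (\<forall>j<r. central (c j)) \<and>
        (\<forall>x\<in>carrier M. k x = finsum N (\<lambda>j. c j \<odot>\<^bsub>N\<^esub> w j x) {..<(r::nat)})))"
begin

text \<open>\<open>inT N\<close> says that \<open>Hom(d, N)\<close> is surjective. For the minimal presentation that defines
  \<open>\<tau>U\<close> this is the condition \<open>Hom(N, \<tau>U) = 0\<close> (\<open>tau_presentation\<close> below).\<close>

definition inT :: "('a, 'x) module \<Rightarrow> bool" where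
  "inT N \<longleftrightarrow> fg N \<and> (\<forall>k. mm P1 N k \<longrightarrow> (\<exists>k'. mm P0 N k' \<and> (\<forall>x\<in>carrier P1. k' (d x) = k x)))"

lemma P_fg: "fg P1" "fg P0" "lmod P1" "lmod P0" "lmod U"
  using projective_fg[OF P1] projective_fg[OF P0] U by auto

lemma ed: "x \<in> carrier P1 \<Longrightarrow> e (d x) = \<zero>\<^bsub>U\<^esub>"
  using d_image by blast
lemma d_closed: "x \<in> carrier P1 \<Longrightarrow> d x \<in> carrier P0"
  by (rule mm_closed[OF d])

lemma inT_fg: "inT N \<Longrightarrow> fg N" by (simp add: inT_def)

lemma inT_ext:
  assumes "inT N" "mm P1 N k"
  shows "\<exists>k'. mm P0 N k' \<and> (\<forall>x\<in>carrier P1. k' (d x) = k x)"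
  using assms by (auto simp: inT_def)

text \<open>A map from P1 to N lifts to M since P1 is projective, extends to P0 there, and is pushed
  back to N.\<close>

lemma inT_image:
  assumes "inT M" "lmod N" "mm M N f" "f ` carrier M = carrier N"
  shows "inT N"
  unfolding inT_def
proof (intro conjI allI impI)
  have M: "fg M" "lmod M" using inT_fg[OF assms(1)] by auto
  show "lmod N" "finlen N" using fg_image[OF M(1) assms(2-4)] by auto
  fix k assume k: "mm P1 N k"
  obtain l where l: "mm P1 M l" "\<And>x. x \<in> carrier P1 \<Longrightarrow> f (l x) = k x"
    using projective_lift[OF P1 M(2) assms(2-4) k] by blast
  obtain l' where l': "mm P0 M l'" "\<And>x. x \<in> carrier P1 \<Longrightarrow> l' (d x) = l x"
    using inT_ext[OF assms(1) l(1)] by blast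
  show "\<exists>k'. mm P0 N k' \<and> (\<forall>x\<in>carrier P1. k' (d x) = k x)"
    using mm_comp[OF l'(1) assms(3)] l(2) l'(2) by (intro exI[of _ "\<lambda>x. f (l' x)"]) auto
qed

lemma inT_prodm:
  assumes "inT M" "inT N" shows "inT (prodm M N)"
  unfolding inT_def
proof (intro conjI allI impI)
  have fgs: "fg M" "fg N" using inT_fg assms by auto
  show "lmod (prodm M N)" "finlen (prodm M N)" using fg_prodm[OF fgs] by auto
  fix k assume k: "mm P1 (prodm M N) k"
  obtain a where a: "mm P0 M a" "\<And>x. x \<in> carrier P1 \<Longrightarrow> a (d x) = fst (k x)"
    using inT_ext[OF assms(1) mm_comp[OF k mm_fst]] by blast
  obtain b where b: "mm P0 N b" "\<And>x. x \<in> carrier P1 \<Longrightarrow> b (d x) = snd (k x)"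
    using inT_ext[OF assms(2) mm_comp[OF k mm_snd]] by blast
  show "\<exists>k'. mm P0 (prodm M N) k' \<and> (\<forall>x\<in>carrier P1. k' (d x) = k x)"
    using mm_Pair[OF a(1) b(1)] a(2) b(2) by (intro exI[of _ "\<lambda>x. (a x, b x)"]) auto
qed

lemma inT_dsum:
  assumes "finite I" "\<And>i. i \<in> I \<Longrightarrow> inT (Ms i)" shows "inT (dsum I Ms)"
  unfolding inT_def
proof (intro conjI allI impI)
  have "fg (dsum I Ms)" by (rule fg_dsum) (use assms inT_fg in auto)
  then show "lmod (dsum I Ms)" "finlen (dsum I Ms)" by auto
  fix k assume k: "mm P1 (dsum I Ms) k"
  have "\<forall>i\<in>I. \<exists>a. mm P0 (Ms i) a \<and> (\<forall>x\<in>carrier P1. a (d x) = k x i)"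
    using assms(2) mm_comp[OF k mm_dproj] by (auto simp: inT_def)
  then obtain a where a: "\<And>i. i \<in> I \<Longrightarrow> mm P0 (Ms i) (a i)"
    "\<And>i x. i \<in> I \<Longrightarrow> x \<in> carrier P1 \<Longrightarrow> a i (d x) = k x i" by metis
  have m: "mm P0 (dsum I Ms) (\<lambda>x. \<lambda>i\<in>I. a i x)" by (rule mm_dtuple) (rule a(1))
  show "\<exists>k'. mm P0 (dsum I Ms) k' \<and> (\<forall>x\<in>carrier P1. k' (d x) = k x)"
  proof (intro exI[of _ "\<lambda>x. \<lambda>i\<in>I. a i x"] conjI ballI m)
    fix x assume x: "x \<in> carrier P1"
    show "(\<lambda>i\<in>I. a i (d x)) = k x"
      by (rule dsum_eqI[OF mm_closed[OF m d_closed[OF x]] mm_closed[OF k x]]) (use a(2) x in auto)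
  qed
qed

text \<open>If every map from \<open>U\<close> lifts along \<open>v\<close>, then an extension to \<open>P0\<close> of a map from \<open>P1\<close> to
  the kernel of \<open>v\<close> can be corrected by a map that factors through \<open>U\<close>.\<close>

lemma inT_kernel:
  assumes V: "inT V" and N: "lmod N" and v: "mm V N v"
    and lift: "\<And>r. mm U N r \<Longrightarrow> \<exists>r'. mm U V r' \<and> (\<forall>u\<in>carrier U. v (r' u) = r u)"
  shows "inT (kermod V N v)"
  unfolding inT_def
proof (intro conjI allI impI)
  have l: "fg V" "lmod V" using inT_fg[OF V] by auto
  let ?K = "{x \<in> carrier V. v x = \<zero>\<^bsub>N\<^esub>}"
  have K: "subm ?K V" by (rule subm_kernel[OF l(2) N v])
  show "lmod (kermod V N v)" "finlen (kermod V N v)" using fg_sub[OF l(1) K] by auto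
  fix k assume "mm P1 (kermod V N v) k"
  then have k: "mm P1 V k" "k ` carrier P1 \<subseteq> ?K" using subm_sub[OF K] by (simp_all add: mm_sub_cod_iff)
  obtain k1 where k1: "mm P0 V k1" "\<And>x. x \<in> carrier P1 \<Longrightarrow> k1 (d x) = k x" using inT_ext[OF V k(1)] by blast
  have van: "v (k1 y) = \<zero>\<^bsub>N\<^esub>" if "y \<in> carrier P0" "e y = \<zero>\<^bsub>U\<^esub>" for y
  proof -
    have "y \<in> d ` carrier P1" using that d_image by simp
    then obtain x where "x \<in> carrier P1" "y = d x" by auto
    then show ?thesis using k1(2) k(2) by auto
  qed
  \<comment> \<open>The extension \<open>k1\<close> need not take values in the kernel of v, but v
    k1 vanishes on d(P1) = ker e and so descends to U. A lift r' of the descended map gives the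
    correction r' e, which vanishes on d(P1).\<close>
  obtain r where r: "mm U N r" "\<And>y. y \<in> carrier P0 \<Longrightarrow> r (e y) = v (k1 y)"
    using mm_factor_surj[OF P_fg(4) N e e_surj mm_comp[OF k1(1) v] P_fg(5) van] by blast
  obtain r' where r': "mm U V r'" "\<And>u. u \<in> carrier U \<Longrightarrow> v (r' u) = r u" using lift[OF r(1)] by blast
  let ?k = "\<lambda>y. sb V (k1 y) (r' (e y))"
  have m: "mm P0 V ?k" by (rule mm_minus[OF l(2) k1(1) mm_comp[OF e r'(1)]])
  have "?k y \<in> ?K" if y: "y \<in> carrier P0" for y
  proof -
    have c: "k1 y \<in> carrier V" "r' (e y) \<in> carrier V" "v (k1 y) \<in> carrier N" "e y \<in> carrier U"
      using y mm_closed[OF k1(1)] mm_closed[OF r'(1)] mm_closed[OF e] mm_closed[OF v] by auto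
    then show ?thesis using l N y by (simp add: mm_sb[OF v] r'(2) r(2))
  qed
  then have "mm P0 (kermod V N v) ?k" using m subm_sub[OF K] by (auto simp: mm_sub_cod_iff)
  moreover have "?k (d x) = k x" if "x \<in> carrier P1" for x
    using that ed k1(2) mm_zero[OF r'(1) P_fg(5) l(2)] l mm_closed[OF k(1)] by simp
  ultimately show "\<exists>k'. mm P0 (kermod V N v) k' \<and> (\<forall>x\<in>carrier P1. k' (d x) = k x)" by blast
qed

text \<open>\<open>Ext\<^sup>1(X, -)\<close> vanishes on the torsion class.\<close>

definition Tproj :: "'a std_module \<Rightarrow> bool" where
  "Tproj X \<longleftrightarrow> fg X \<and> (\<forall>Z :: 'a std_module. \<forall>p. fg Z \<and> mm Z X p \<and> p ` carrier Z = carrier X \<and>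
    inT (kermod Z X p) \<longrightarrow> (\<exists>s. mm X Z s \<and> (\<forall>x\<in>carrier X. p (s x) = x)))"

lemma Tproj_fg: "Tproj X \<Longrightarrow> fg X" by (simp add: Tproj_def)

text \<open>The pullback of p along h is an extension of X whose kernel is a copy of ker p, hence it
  splits; a section followed by the projection to Z is the lift. In contrast to the definition of
  \<open>Tproj\<close>, any target W and any element types are allowed.\<close>

lemma Tproj_lift:
  fixes Z :: "('a, 'z) module" and W :: "('a, 'w) module"
  assumes X: "Tproj X" and Z: "fg Z" and W: "lmod W" and p: "mm Z W p" "p ` carrier Z = carrier W"
    and T: "inT (kermod Z W p)" and h: "mm X W h"
  shows "\<exists>h'. mm X Z h' \<and> (\<forall>x\<in>carrier X. p (h' x) = h x)"
proof -
  have fX: "fg X" "lmod X" "lmod Z" using Tproj_fg[OF X] Z by auto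
  let ?P = "prodm Z X"
  have P: "fg ?P" "lmod ?P" using fg_prodm[OF Z fX(1)] by auto
  let ?D = "\<lambda>y. sb W (p (fst y)) (h (snd y))"
  have D: "mm ?P W ?D" by (rule mm_minus[OF W mm_comp[OF mm_fst p(1)] mm_comp[OF mm_snd h]])
  \<comment> \<open>The pullback of Z and X over W, as the kernel of the difference of the two maps
    to W.\<close>
  define Y where "Y = kermod ?P W ?D"
  have Ysub: "subm {y \<in> carrier ?P. ?D y = \<zero>\<^bsub>W\<^esub>} ?P" by (rule subm_kernel[OF P(2) W D])
  have Y: "fg Y" "lmod Y" unfolding Y_def using fg_sub[OF P(1) Ysub] by auto
  have Yin: "y \<in> carrier Y \<longleftrightarrow> fst y \<in> carrier Z \<and> snd y \<in> carrier X \<and> p (fst y) = h (snd y)" for y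
    using mm_closed[OF p(1), of "fst y"] mm_closed[OF h, of "snd y"] W
    by (cases y) (auto simp: Y_def prodm_def)
  have Yfst: "mm Y Z fst" and Ysnd: "mm Y X snd"
    unfolding Y_def by (rule mm_sub_dom[OF mm_fst], blast) (rule mm_sub_dom[OF mm_snd], blast)
  obtain N :: "'a std_module" and f g where N: "fg N" "mm Y N f" "mm N Y g"
    "\<And>y. y \<in> carrier Y \<Longrightarrow> g (f y) = y" "\<And>n. n \<in> carrier N \<Longrightarrow> f (g n) = n"
  proof (rule std_copy[OF Y(1)])
    fix N :: "'a std_module" and f g
    assume "fg N" "mm Y N f" "mm N Y g"
      "\<And>x. x \<in> carrier Y \<Longrightarrow> g (f x) = x" "\<And>y. y \<in> carrier N \<Longrightarrow> f (g y) = y"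
    then show thesis by (rule that[of N f g])
  qed
  let ?q = "\<lambda>n. snd (g n)"
  have q: "mm N X ?q" by (rule mm_comp[OF N(3) Ysnd])
  have qs: "?q ` carrier N = carrier X"
  proof
    show "carrier X \<subseteq> ?q ` carrier N"
    proof
      fix x assume x: "x \<in> carrier X"
      then have "h x \<in> p ` carrier Z" using mm_closed[OF h] p(2) by auto
      then obtain z where z: "z \<in> carrier Z" "p z = h x" by auto
      then have y: "(z, x) \<in> carrier Y" using x by (simp add: Yin)
      show "x \<in> ?q ` carrier N"
        using N(4)[OF y] mm_closed[OF N(2) y] by (intro image_eqI[of _ _ "f (z, x)"]) auto
    qed
  qed (use mm_closed[OF q] in auto)
  have lN: "lmod N" using N(1) by simp
  have Ksub: "subm {n \<in> carrier N. ?q n = \<zero>\<^bsub>X\<^esub>} N" by (rule subm_kernel[OF lN fX(2) q])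
  have h0: "h \<zero>\<^bsub>X\<^esub> = \<zero>\<^bsub>W\<^esub>" by (rule mm_zero[OF h fX(2) W])
  have inY: "(z, \<zero>\<^bsub>X\<^esub>) \<in> carrier Y" if "z \<in> carrier Z" "p z = \<zero>\<^bsub>W\<^esub>" for z
    using that fX h0 by (simp add: Yin)
  \<comment> \<open>The kernel of N -> X consists of the pairs (z, 0) with z in ker p, so it is an
    image of a module in the torsion class.\<close>
  have TK: "inT (kermod N X ?q)"
  proof (rule inT_image[OF T lmod_sub[OF lN Ksub], of "\<lambda>z. f (z, \<zero>\<^bsub>X\<^esub>)"])
    have "mm (kermod Z W p) Y (\<lambda>z. (z, \<zero>\<^bsub>X\<^esub>))"
      unfolding Y_def using inY mm_sub_dom[OF mm_Pair[OF mm_id mm_0[OF fX(2)]], of _ Z] subm_sub[OF Ysub]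
      by (subst mm_sub_cod_iff) (auto simp: Y_def)
    from mm_comp[OF this N(2)] have "mm (kermod Z W p) N (\<lambda>z. f (z, \<zero>\<^bsub>X\<^esub>))" .
    then show "mm (kermod Z W p) (kermod N X ?q) (\<lambda>z. f (z, \<zero>\<^bsub>X\<^esub>))"
      using subm_sub[OF Ksub] mm_closed[OF N(2) inY] N(4)[OF inY] by (subst mm_sub_cod_iff) auto
    show "(\<lambda>z. f (z, \<zero>\<^bsub>X\<^esub>)) ` carrier (kermod Z W p) = carrier (kermod N X ?q)"
    proof
      show "carrier (kermod N X ?q) \<subseteq> (\<lambda>z. f (z, \<zero>\<^bsub>X\<^esub>)) ` carrier (kermod Z W p)"
      proof
        fix n assume "n \<in> carrier (kermod N X ?q)"
        then have n: "n \<in> carrier N" "snd (g n) = \<zero>\<^bsub>X\<^esub>" by auto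
        have gn: "g n \<in> carrier Y" by (rule mm_closed[OF N(3) n(1)])
        then have eq: "g n = (fst (g n), \<zero>\<^bsub>X\<^esub>)" using n(2) by (metis prod.collapse)
        have c: "fst (g n) \<in> carrier (kermod Z W p)" using gn n(2) h0 by (simp add: Yin)
        show "n \<in> (\<lambda>z. f (z, \<zero>\<^bsub>X\<^esub>)) ` carrier (kermod Z W p)"
          using N(5)[OF n(1)] eq by (intro image_eqI[OF _ c]) simp
      qed
    qed (use mm_closed[OF N(2) inY] N(4)[OF inY] in auto)
  qed
  obtain s where s: "mm X N s" "\<And>x. x \<in> carrier X \<Longrightarrow> snd (g (s x)) = x"
    using X[unfolded Tproj_def, THEN conjunct2, rule_format, of N ?q] N(1) q qs TK by blast
  show ?thesis
  proof (intro exI[of _ "\<lambda>x. fst (g (s x))"] conjI ballI)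
    show "mm X Z (\<lambda>x. fst (g (s x)))" by (rule mm_comp[OF mm_comp[OF s(1) N(3)] Yfst])
    show "p (fst (g (s x))) = h x" if "x \<in> carrier X" for x
      using s(2)[OF that] mm_closed[OF mm_comp[OF s(1) N(3)] that] by (simp add: Yin)
  qed
qed

text \<open>The map p : M -> X lifts along any admissible q : Z -> X; restricted along i, the lift
  is a section of q.\<close>

lemma Tproj_retract:
  assumes M: "Tproj M" and X: "fg X" and i: "mm X M i" and p: "mm M X p"
    and pi: "\<And>x. x \<in> carrier X \<Longrightarrow> p (i x) = x"
  shows "Tproj X"
  unfolding Tproj_def
proof (intro conjI allI impI)
  show "lmod X" "finlen X" using X by auto
  fix Z :: "'a std_module" and q
  assume a: "fg Z \<and> mm Z X q \<and> q ` carrier Z = carrier X \<and> inT (kermod Z X q)"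
  then have a': "fg Z" "mm Z X q" "q ` carrier Z = carrier X" "inT (kermod Z X q)" by auto
  have lX: "lmod X" using X by simp
  obtain h where h: "mm M Z h" "\<And>m. m \<in> carrier M \<Longrightarrow> q (h m) = p m"
    using Tproj_lift[OF M a'(1) lX a'(2-4) p] by blast
  show "\<exists>s. mm X Z s \<and> (\<forall>x\<in>carrier X. q (s x) = x)"
    using mm_comp[OF i h(1)] h(2) mm_closed[OF i] pi by (intro exI[of _ "\<lambda>x. h (i x)"]) auto
qed

text \<open>The inclusions of the summands lift to Z one by one, and the lifts composed with the
  projections add up to a section.\<close>

lemma Tproj_direct_sum:
  fixes M :: "'a std_module"
  assumes M: "fg M" and Xs: "\<And>X. X \<in> set Xs \<Longrightarrow> Tproj X" and ds: "module_direct_sum R Xs M"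
  shows "Tproj M"
  unfolding Tproj_def
proof (intro conjI allI impI)
  show lM: "lmod M" and "finlen M" using M by auto
  fix Z :: "'a std_module" and q
  assume a: "fg Z \<and> mm Z M q \<and> q ` carrier Z = carrier M \<and> inT (kermod Z M q)"
  then have a': "fg Z" "lmod Z" "mm Z M q" "q ` carrier Z = carrier M" "inT (kermod Z M q)" by auto
  have Xi: "Tproj (Xs ! i)" if "i < length Xs" for i using Xs that by simp
  have lXi: "lmod (Xs ! i)" if "i < length Xs" for i using Tproj_fg[OF Xi[OF that]] by simp
  have "\<exists>\<iota> \<pi>. (\<forall>i<length Xs. mm (Xs ! i) M (\<iota> i) \<and> mm M (Xs ! i) (\<pi> i)) \<and>
    (\<forall>m\<in>carrier M. finsum M (\<lambda>i. \<iota> i (\<pi> i m)) {..<length Xs} = m)"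
    by (rule direct_sumD[OF ds lXi lM]) blast+
  then obtain \<iota> \<pi> where \<iota>: "\<And>i. i < length Xs \<Longrightarrow> mm (Xs ! i) M (\<iota> i)"
    "\<And>i. i < length Xs \<Longrightarrow> mm M (Xs ! i) (\<pi> i)"
    "\<And>m. m \<in> carrier M \<Longrightarrow> finsum M (\<lambda>i. \<iota> i (\<pi> i m)) {..<length Xs} = m"
    by blast
  have "\<exists>h. mm (Xs ! i) Z h \<and> (\<forall>x\<in>carrier (Xs ! i). q (h x) = \<iota> i x)" if i: "i < length Xs" for i
    using Tproj_lift[OF Xi[OF i] a'(1) lM a'(3-5) \<iota>(1)[OF i]] by auto
  then obtain h where h: "\<And>i. i < length Xs \<Longrightarrow> mm (Xs ! i) Z (h i)"
    "\<And>i x. i < length Xs \<Longrightarrow> x \<in> carrier (Xs ! i) \<Longrightarrow> q (h i x) = \<iota> i x" by metis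
  let ?s = "\<lambda>m. finsum Z (\<lambda>i. h i (\<pi> i m)) {..<length Xs}"
  have m: "mm M Z (\<lambda>m. h i (\<pi> i m))" if "i < length Xs" for i
    by (rule mm_comp[OF \<iota>(2)[OF that] h(1)[OF that]])
  have s: "mm M Z ?s" by (rule mm_finsum[OF lM a'(2)]) (use m in auto)
  have "q (?s m) = m" if "m \<in> carrier M" for m
  proof -
    have "q (?s m) = finsum M (\<lambda>i. q (h i (\<pi> i m))) {..<length Xs}"
      by (rule module_map_finsum[OF a'(2) lM a'(3)]) (use mm_closed[OF m that] in auto)
    also have "\<dots> = finsum M (\<lambda>i. \<iota> i (\<pi> i m)) {..<length Xs}"
      using h(2) mm_closed[OF \<iota>(2) that] mm_closed[OF \<iota>(1)]
      by (intro abelian_monoid.finsum_cong'[OF lm_abm[OF lM]]) auto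
    finally show ?thesis using \<iota>(3)[OF that] by simp
  qed
  then show "\<exists>s. mm M Z s \<and> (\<forall>x\<in>carrier M. q (s x) = x)" using s by blast
qed

text \<open>An epimorphism p : Z -> X is itself an extension of X by the submodule ker p. Its class
  is the only class there is, the zero class, whose members are split.\<close>

lemma Tproj_Ext1:
  assumes X: "fg X" and ext: "\<And>N :: 'a std_module. inT N \<Longrightarrow> Ext1_vanishes R X N"
  shows "Tproj X"
  unfolding Tproj_def
proof (intro conjI allI impI)
  show "lmod X" "finlen X" using X by auto
  fix Z :: "'a std_module" and p
  assume "fg Z \<and> mm Z X p \<and> p ` carrier Z = carrier X \<and> inT (kermod Z X p)"
  then have a: "fg Z" "mm Z X p" "p ` carrier Z = carrier X" "inT (kermod Z X p)" by auto
  let ?N = "kermod Z X p" and ?t = "(Z, \<lambda>x. x, p)"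
  have "mm ?N Z (\<lambda>x. x)" by (rule mm_sub_dom[OF mm_id]) blast
  then have t: "?t \<in> Defs.extensions R X ?N" using a by (auto simp: Defs.extensions_def fgmod_iff)
  then have c: "ext_equiv R X ?N `` {?t} \<in> Ext1 R X ?N" unfolding Ext1_def by (rule quotientI)
  have "(?t, ?t) \<in> ext_equiv R X ?N" using t mm_id[of Z] unfolding ext_equiv_def by blast
  then have "?t \<in> ext_equiv R X ?N `` {?t}" by blast
  moreover have "ext_equiv R X ?N `` {?t} = Ext1_zero R X ?N"
    using c ext[OF a(4)] by (simp add: Ext1_vanishes_def)
  ultimately have "?t \<in> Ext1_zero R X ?N" by simp
  then show "\<exists>s. mm X Z s \<and> (\<forall>x\<in>carrier X. p (s x) = x)" by (simp add: Ext1_zero_def)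
qed

subsection \<open>Approximations\<close>

text \<open>The generators of Hom(M, N) are assembled into one map w from M^r to N, so that every
  map M -> N is w preceded by a diagonal map with central entries. Diagonal maps of this kind exist
  on every module and commute with homomorphisms.\<close>

lemma span_dsum:
  fixes M N :: "'a std_module"
  assumes M: "fg M" and N: "fg N"
  shows "\<exists>r w. mm (dsum {..<(r::nat)} (\<lambda>_. M)) N w \<and>
    (\<forall>k. mm M N k \<longrightarrow> (\<exists>c. (\<forall>j<r. central (c j)) \<and>
      (\<forall>x\<in>carrier M. k x = w (\<lambda>j\<in>{..<r}. c j \<odot>\<^bsub>M\<^esub> x))))"
proof -
  obtain r w where rw: "\<forall>j<r. mm M N (w j)"
    "\<forall>k. mm M N k \<longrightarrow> (\<exists>c. (\<forall>j<r. central (c j)) \<and>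
        (\<forall>x\<in>carrier M. k x = finsum N (\<lambda>j. c j \<odot>\<^bsub>N\<^esub> w j x) {..<(r::nat)}))"
    using Hom_span[OF M N] by blast
  have l: "lmod M" "lmod N" using M N by auto
  let ?w = "\<lambda>x. finsum N (\<lambda>j. w j (x j)) {..<r}"
  have m: "mm (dsum {..<r} (\<lambda>_. M)) N ?w" by (rule mm_dcopair) (use l rw in auto)
  have "finsum N (\<lambda>j. c j \<odot>\<^bsub>N\<^esub> w j x) {..<r} = ?w (\<lambda>j\<in>{..<r}. c j \<odot>\<^bsub>M\<^esub> x)"
    if "\<forall>j<r. central (c j)" "x \<in> carrier M" for c x
  proof (rule abelian_monoid.finsum_cong'[OF lm_abm[OF l(2)] refl])
    have wj: "mm M N (w j)" "c j \<in> carrier R" if "j \<in> {..<r}" for j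
      using rw(1) \<open>\<forall>j<r. central (c j)\<close> that by (auto simp: central_def)
    show "(\<lambda>j. w j ((\<lambda>j\<in>{..<r}. c j \<odot>\<^bsub>M\<^esub> x) j)) \<in> {..<r} \<rightarrow> carrier N"
      using mm_closed[OF wj(1)] wj(2) that(2) l by auto
    show "c j \<odot>\<^bsub>N\<^esub> w j x = w j ((\<lambda>j\<in>{..<r}. c j \<odot>\<^bsub>M\<^esub> x) j)" if "j \<in> {..<r}" for j
      using mm_smult[OF wj(1)[OF that] wj(2)[OF that] \<open>x \<in> carrier M\<close>] that by simp
  qed
  note eq = this
  show ?thesis
  proof (rule exI[of _ r], rule exI[of _ ?w], intro conjI allI impI)
    show "mm (dsum {..<r} (\<lambda>_. M)) N ?w" by (rule m)
    fix k assume "mm M N k"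
    then obtain c where "\<forall>j<r. central (c j)"
      "\<forall>x\<in>carrier M. k x = finsum N (\<lambda>j. c j \<odot>\<^bsub>N\<^esub> w j x) {..<r}" using rw(2) by blast
    then show "\<exists>c. (\<forall>j<r. central (c j)) \<and> (\<forall>x\<in>carrier M. k x = ?w (\<lambda>j\<in>{..<r}. c j \<odot>\<^bsub>M\<^esub> x))"
      using eq[of c] by (intro exI[of _ c]) simp
  qed
qed

lemma mm_diag:
  assumes "lmod M" "\<And>j. j \<in> I \<Longrightarrow> central (c j)"
  shows "mm M (dsum I (\<lambda>_. M)) (\<lambda>x. \<lambda>j\<in>I. c j \<odot>\<^bsub>M\<^esub> x)"
  by (rule mm_dtuple, rule mm_central) (use assms in auto)

text \<open>The map U^s -> N assembled from generators of Hom(U, N) is a right add U-approximation: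
  a map U -> N factors through it by a diagonal map U -> U^s.\<close>

lemma right_approx:
  fixes N :: "'a std_module"
  assumes N: "fg N"
  shows "\<exists>s v. mm (dsum {..<(s::nat)} (\<lambda>_. U)) N v \<and>
    (\<forall>r. mm U N r \<longrightarrow> (\<exists>r'. mm U (dsum {..<s} (\<lambda>_. U)) r' \<and> (\<forall>u\<in>carrier U. v (r' u) = r u)))"
proof -
  obtain s v where v: "mm (dsum {..<(s::nat)} (\<lambda>_. U)) N v"
    "\<forall>k. mm U N k \<longrightarrow> (\<exists>c. (\<forall>j<s. central (c j)) \<and>
      (\<forall>x\<in>carrier U. k x = v (\<lambda>j\<in>{..<s}. c j \<odot>\<^bsub>U\<^esub> x)))"
    using span_dsum[OF U N] by blast
  have "\<exists>r'. mm U (dsum {..<s} (\<lambda>_. U)) r' \<and> (\<forall>u\<in>carrier U. v (r' u) = r u)" if r: "mm U N r" for r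
  proof -
    obtain c where c: "\<forall>j<s. central (c j)" "\<forall>x\<in>carrier U. r x = v (\<lambda>j\<in>{..<s}. c j \<odot>\<^bsub>U\<^esub> x)"
      using v(2) r by blast
    have "mm U (dsum {..<s} (\<lambda>_. U)) (\<lambda>x. \<lambda>j\<in>{..<s}. c j \<odot>\<^bsub>U\<^esub> x)"
      by (rule mm_diag) (use c(1) P_fg in auto)
    then show ?thesis using c(2) by (intro exI[of _ "\<lambda>x. \<lambda>j\<in>{..<s}. c j \<odot>\<^bsub>U\<^esub> x"]) auto
  qed
  then show ?thesis using v(1) by blast
qed

text \<open>\<open>E\<close> is the pushout of \<open>d\<^sup>r : P1\<^sup>r \<rightarrow> P0\<^sup>r\<close> along a map \<open>P1\<^sup>r \<rightarrow> F\<close> whose components span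
  \<open>Hom(P1, F)\<close>; for \<open>F = R\<close> it is the Bongartz completion of \<open>U\<close> up to multiplicities.\<close>

lemma left_approx:
  fixes F :: "'a std_module"
  assumes F: "projective R F" and TU: "inT U"
  shows "\<exists>r a b. \<exists>E :: ('a, (nat \<Rightarrow> 'a) \<times> (nat \<Rightarrow> nat \<Rightarrow> 'a)) module. inT E \<and> mm F E a \<and>
    mm E (dsum {..<(r::nat)} (\<lambda>_. U)) b \<and> b ` carrier E = carrier (dsum {..<r} (\<lambda>_. U)) \<and>
    {x \<in> carrier E. b x = \<zero>\<^bsub>dsum {..<r} (\<lambda>_. U)\<^esub>} = a ` carrier F \<and>
    (\<forall>N :: 'a std_module. \<forall>h. inT N \<and> mm F N h \<longrightarrow>
      (\<exists>h'. mm E N h' \<and> (\<forall>x\<in>carrier F. h' (a x) = h x)))"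
proof -
  have fF: "fg F" "lmod F" using projective_fg[OF F] by auto
  obtain r w where w: "mm (dsum {..<(r::nat)} (\<lambda>_. P1)) F w"
    "\<forall>k. mm P1 F k \<longrightarrow> (\<exists>c. (\<forall>j<r. central (c j)) \<and>
      (\<forall>x\<in>carrier P1. k x = w (\<lambda>j\<in>{..<r}. c j \<odot>\<^bsub>P1\<^esub> x)))"
    using span_dsum[OF P_fg(1) fF(1)] by blast
  let ?I = "{..<r}"
  let ?P1 = "dsum ?I (\<lambda>_. P1)" and ?P0 = "dsum ?I (\<lambda>_. P0)" and ?U = "dsum ?I (\<lambda>_. U)"
  have ls: "lmod ?P1" "lmod ?P0" "lmod ?U" "fg ?P0"
    using P_fg fg_dsum[of ?I "\<lambda>_. P0"] by (auto intro!: lmod_dsum)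
  let ?Q = "prodm F ?P0"
  have Q: "fg ?Q" "lmod ?Q" using fg_prodm[OF fF(1) ls(4)] by auto
  define D where "D = (\<lambda>t. \<lambda>j\<in>?I. d (t j))"
  have D: "mm ?P1 ?P0 D" unfolding D_def by (rule mm_dtuple, rule mm_comp[OF mm_dproj[of _ ?I "\<lambda>_. P1"] d])
  \<comment> \<open>The image of rho is the relation submodule of the pushout; the sign in the
    second component makes w t and D t equal in the quotient.\<close>
  define rho where "rho = (\<lambda>t. (w t, sb ?P0 \<zero>\<^bsub>?P0\<^esub> (D t)))"
  have rho: "mm ?P1 ?Q rho" unfolding rho_def
    by (rule mm_Pair[OF w(1) mm_minus[OF ls(2) mm_0[OF ls(2)] D]])
  define L where "L = rho ` carrier ?P1"
  have L: "subm L ?Q" unfolding L_def by (rule subm_image[OF ls(1) Q(2) rho subm_carrier[OF ls(1)]])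
  define E where "E = quot ?Q L"
  define q where "q = qrep ?Q L"
  have E: "fg E" "lmod E" unfolding E_def using fg_quot[OF Q(1) L] by auto
  have q: "mm ?Q E q" "q ` carrier ?Q = carrier E"
    "\<And>z. z \<in> carrier ?Q \<Longrightarrow> q z = \<zero>\<^bsub>E\<^esub> \<longleftrightarrow> z \<in> L"
    using quot[OF Q(2) L] by (auto simp: E_def q_def)
  have Qin: "(x, y) \<in> carrier ?Q \<longleftrightarrow> x \<in> carrier F \<and> y \<in> carrier ?P0" for x y by (simp add: prodm_def)
  have F0: "mm F ?Q (\<lambda>x. (x, \<zero>\<^bsub>?P0\<^esub>))" by (rule mm_Pair[OF mm_id mm_0[OF ls(2)]])
  have P00: "mm ?P0 ?Q (\<lambda>y. (\<zero>\<^bsub>F\<^esub>, y))" by (rule mm_Pair[OF mm_0[OF fF(2)] mm_id])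
  define a where "a = (\<lambda>x. q (x, \<zero>\<^bsub>?P0\<^esub>))"
  have a: "mm F E a" unfolding a_def by (rule mm_comp[OF F0 q(1)])
  have split: "q (x, y) = q (x, \<zero>\<^bsub>?P0\<^esub>) \<oplus>\<^bsub>E\<^esub> q (\<zero>\<^bsub>F\<^esub>, y)" if "x \<in> carrier F" "y \<in> carrier ?P0" for x y
    using mm_add[OF q(1), of "(x, \<zero>\<^bsub>?P0\<^esub>)" "(\<zero>\<^bsub>F\<^esub>, y)"] that fF ls
    by (simp add: Qin) (simp add: prodm_def)
  have rel: "q (\<zero>\<^bsub>F\<^esub>, D t) = a (w t)" if t: "t \<in> carrier ?P1" for t
  proof -
    have c: "w t \<in> carrier F" "D t \<in> carrier ?P0" using mm_closed[OF w(1) t] mm_closed[OF D t] by auto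
    have "rho t \<oplus>\<^bsub>?Q\<^esub> (\<zero>\<^bsub>F\<^esub>, D t) = (w t, \<zero>\<^bsub>?P0\<^esub>)"
      using c fF ls by (simp add: rho_def) (simp add: prodm_def)
    moreover have "q (rho t) = \<zero>\<^bsub>E\<^esub>" using q(3)[of "rho t"] mm_closed[OF rho t] t by (auto simp: L_def)
    ultimately show ?thesis
      using mm_add[OF q(1) mm_closed[OF rho t], of "(\<zero>\<^bsub>F\<^esub>, D t)"] c fF E(2)
        mm_closed[OF q(1), of "(\<zero>\<^bsub>F\<^esub>, D t)"] by (simp add: Qin a_def)
  qed
  define eU where "eU = (\<lambda>y. \<lambda>j\<in>?I. e (y j))"
  have eU: "mm ?P0 ?U eU" unfolding eU_def by (rule mm_dtuple, rule mm_comp[OF mm_dproj[of _ ?I "\<lambda>_. P0"] e])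
  have eD: "eU (D t) = \<zero>\<^bsub>?U\<^esub>" if "t \<in> carrier ?P1" for t
  proof (rule dsum_eqI[OF mm_closed[OF eU mm_closed[OF D that]] lm_zero_closed[OF ls(3)]])
    fix j assume "j \<in> ?I"
    then show "eU (D t) j = \<zero>\<^bsub>?U\<^esub> j" using ed[OF dsum_in[OF that]] by (simp add: eU_def D_def dsum_def)
  qed
  \<comment> \<open>The sequence P1^r -> P0^r -> U^r is exact, componentwise. It identifies ker b
    with the image of F.\<close>
  have ker_e: "\<exists>t\<in>carrier ?P1. y = D t" if y: "y \<in> carrier ?P0" "eU y = \<zero>\<^bsub>?U\<^esub>" for y
  proof -
    have "\<exists>t\<in>carrier P1. y j = d t" if j: "j \<in> ?I" for j
    proof -
      have "e (y j) = \<zero>\<^bsub>U\<^esub>" using fun_cong[OF y(2), of j] j by (simp add: eU_def dsum_def)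
      then have "y j \<in> d ` carrier P1" using dsum_in[OF y(1) j] d_image by simp
      then show ?thesis by auto
    qed
    then obtain t where t: "\<And>j. j \<in> ?I \<Longrightarrow> t j \<in> carrier P1 \<and> y j = d (t j)" by metis
    have c: "restrict t ?I \<in> carrier ?P1" using t by (auto simp: dsum_def)
    have "y = D (restrict t ?I)"
      by (rule dsum_eqI[OF y(1) mm_closed[OF D c]]) (use t in \<open>auto simp: D_def\<close>)
    then show ?thesis using c by blast
  qed
  have "\<exists>b. mm E ?U b \<and> (\<forall>z\<in>carrier ?Q. b (q z) = eU (snd z))"
  proof (rule mm_factor_surj[OF Q(2) ls(3) q(1,2) mm_comp[OF mm_snd eU] E(2)])
    fix z assume z: "z \<in> carrier ?Q" "q z = \<zero>\<^bsub>E\<^esub>"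
    then obtain t where t: "t \<in> carrier ?P1" "z = rho t" using q(3) by (auto simp: L_def)
    then show "eU (snd z) = \<zero>\<^bsub>?U\<^esub>"
      using eD[OF t(1)] ls mm_closed[OF D t(1)] mm_zero[OF eU ls(2,3)]
      by (simp add: rho_def mm_sb[OF eU])
  qed
  then obtain b where b: "mm E ?U b" "\<And>x y. x \<in> carrier F \<Longrightarrow> y \<in> carrier ?P0 \<Longrightarrow> b (q (x, y)) = eU y"
    by (auto simp: prodm_def)
  have Eex: "\<exists>x y. x \<in> carrier F \<and> y \<in> carrier ?P0 \<and> z = q (x, y)" if "z \<in> carrier E" for z
  proof -
    have "z \<in> q ` carrier ?Q" using that q(2) by simp
    then show ?thesis by (auto simp: prodm_def)
  qed
  have bs: "b ` carrier E = carrier ?U"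
  proof
    show "carrier ?U \<subseteq> b ` carrier E"
    proof
      fix u assume u: "u \<in> carrier ?U"
      have "\<exists>y\<in>carrier P0. e y = u j" if "j \<in> ?I" for j
      proof -
        have "u j \<in> e ` carrier P0" using dsum_in[OF u that] e_surj by simp
        then show ?thesis by auto
      qed
      then obtain y where y: "\<And>j. j \<in> ?I \<Longrightarrow> y j \<in> carrier P0 \<and> e (y j) = u j" by metis
      have c: "restrict y ?I \<in> carrier ?P0" using y by (auto simp: dsum_def)
      have "eU (restrict y ?I) = u"
        by (rule dsum_eqI[OF mm_closed[OF eU c] u]) (use y in \<open>auto simp: eU_def\<close>)
      then have "u = b (q (\<zero>\<^bsub>F\<^esub>, restrict y ?I))" using b(2)[OF _ c, of "\<zero>\<^bsub>F\<^esub>"] fF by simp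
      moreover have "q (\<zero>\<^bsub>F\<^esub>, restrict y ?I) \<in> carrier E" using mm_closed[OF q(1)] c fF by (simp add: Qin)
      ultimately show "u \<in> b ` carrier E" by blast
    qed
  qed (use mm_closed[OF b(1)] in auto)
  have ba: "b (a x) = \<zero>\<^bsub>?U\<^esub>" if "x \<in> carrier F" for x
    using b(2)[OF that lm_zero_closed[OF ls(2)]] mm_zero[OF eU ls(2,3)] by (simp add: a_def)
  have kb: "{z \<in> carrier E. b z = \<zero>\<^bsub>?U\<^esub>} = a ` carrier F"
  proof
    show "{z \<in> carrier E. b z = \<zero>\<^bsub>?U\<^esub>} \<subseteq> a ` carrier F"
    proof
      fix z assume z: "z \<in> {z \<in> carrier E. b z = \<zero>\<^bsub>?U\<^esub>}"
      then obtain x y where xy: "x \<in> carrier F" "y \<in> carrier ?P0" "z = q (x, y)" using Eex by blast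
      then have "eU y = \<zero>\<^bsub>?U\<^esub>" using z b(2) by simp
      then obtain t where t: "t \<in> carrier ?P1" "y = D t" using ker_e xy(2) by blast
      have "z = a (x \<oplus>\<^bsub>F\<^esub> w t)"
        using split[OF xy(1,2)] rel[OF t(1)] mm_add[OF a xy(1) mm_closed[OF w(1) t(1)]] xy(3) t(2)
        by (simp add: a_def)
      then show "z \<in> a ` carrier F" using xy(1) mm_closed[OF w(1) t(1)] fF by blast
    qed
  qed (use ba mm_closed[OF a] in auto)
  \<comment> \<open>Given k : P1 -> E, the map b k extends to P0 because U^r lies in the torsion
    class, and the extension lifts to m' : P0 -> E by projectivity. The difference k - m' d has
    values in ker b = a(F), and so lifts to a map l : P1 -> F.\<close>
  have TE: "inT E"
    unfolding inT_def
  proof (intro conjI allI impI)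
    fix k assume k: "mm P1 E k"
    have TU': "inT ?U" by (rule inT_dsum) (use TU in auto)
    obtain m where m: "mm P0 ?U m" "\<And>x. x \<in> carrier P1 \<Longrightarrow> m (d x) = b (k x)"
      using inT_ext[OF TU' mm_comp[OF k b(1)]] by blast
    obtain m' where m': "mm P0 E m'" "\<And>x. x \<in> carrier P0 \<Longrightarrow> b (m' x) = m x"
      using projective_lift[OF P0 E(2) ls(3) b(1) bs m(1)] by blast
    let ?k = "\<lambda>x. sb E (k x) (m' (d x))"
    have k1: "mm P1 E ?k" by (rule mm_minus[OF E(2) k mm_comp[OF d m'(1)]])
    let ?K = "kermod E ?U b"
    have Ksub: "subm {z \<in> carrier E. b z = \<zero>\<^bsub>?U\<^esub>} E" by (rule subm_kernel[OF E(2) ls(3) b(1)])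
    have lK: "lmod ?K" by (rule lmod_sub[OF E(2) Ksub])
    have "b (?k x) = \<zero>\<^bsub>?U\<^esub>" if x: "x \<in> carrier P1" for x
    proof -
      have c: "k x \<in> carrier E" "m' (d x) \<in> carrier E" "b (k x) \<in> carrier ?U"
        using mm_closed[OF k x] mm_closed[OF m'(1) d_closed[OF x]] mm_closed[OF b(1)] by auto
      have "b (m' (d x)) = b (k x)" using m'(2)[OF d_closed[OF x]] m(2)[OF x] by simp
      then show ?thesis using c ls(3) by (simp add: mm_sb[OF b(1) E(2)])
    qed
    then have k2: "mm P1 ?K ?k" using k1 mm_closed[OF k1] subm_sub[OF Ksub] by (subst mm_sub_cod_iff) auto
    have aK: "mm F ?K a" using a kb subm_sub[OF Ksub] by (subst mm_sub_cod_iff) auto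
    obtain l where l: "mm P1 F l" "\<And>x. x \<in> carrier P1 \<Longrightarrow> a (l x) = ?k x"
      using projective_lift[OF P1 fF(2) lK aK _ k2] kb by auto
    obtain c where c: "\<forall>j<r. central (c j)" "\<forall>x\<in>carrier P1. l x = w (\<lambda>j\<in>?I. c j \<odot>\<^bsub>P1\<^esub> x)"
      using w(2) l(1) by blast
    \<comment> \<open>Here the spanning property of w pays off: l is w after the diagonal map
      \<open>?c1\<close>. The same central entries define \<open>?c0\<close> on P0, d carries one
      diagonal map to the other, and the pushout relation turns a w into a map defined on P0^r. So a
      l extends along d.\<close>
    let ?c0 = "\<lambda>y. \<lambda>j\<in>?I. c j \<odot>\<^bsub>P0\<^esub> y" and ?c1 = "\<lambda>y. \<lambda>j\<in>?I. c j \<odot>\<^bsub>P1\<^esub> y"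
    have c0: "mm P0 ?P0 ?c0" and c1: "mm P1 ?P1 ?c1" by (rule mm_diag; use c(1) P_fg in auto)+
    let ?k' = "\<lambda>y. q (\<zero>\<^bsub>F\<^esub>, ?c0 y) \<oplus>\<^bsub>E\<^esub> m' y"
    have "mm P0 E ?k'" by (rule mm_plus[OF E(2) mm_comp[OF mm_comp[OF c0 P00] q(1)] m'(1)])
    moreover have "?k' (d x) = k x" if x: "x \<in> carrier P1" for x
    proof -
      have "?c0 (d x) = D (?c1 x)"
        using c(1) mm_smult[OF d _ x] by (auto simp: D_def central_def intro!: restrict_ext)
      then have "q (\<zero>\<^bsub>F\<^esub>, ?c0 (d x)) = a (w (?c1 x))" using rel[OF mm_closed[OF c1 x]] by simp
      also have "\<dots> = ?k x" using c(2) x l(2)[OF x] by simp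
      finally show ?thesis using E(2) mm_closed[OF k x] mm_closed[OF m'(1) d_closed[OF x]] by simp
    qed
    ultimately show "\<exists>k'. mm P0 E k' \<and> (\<forall>x\<in>carrier P1. k' (d x) = k x)" by blast
  qed (use E in auto)
  \<comment> \<open>The components P1 -> N of h w extend along d because N is in the torsion class;
    the extensions give a map P0^r -> N that agrees with h on the pushout relations.\<close>
  have ext: "\<exists>h'. mm E N h' \<and> (\<forall>x\<in>carrier F. h' (a x) = h x)"
    if N: "inT N" and h: "mm F N h" for N :: "'a std_module" and h
  proof -
    have lN: "lmod N" using inT_fg[OF N] by simp
    have wj: "mm P1 N (\<lambda>x. h (w (dinj ?I (\<lambda>_. P1) j x)))" if "j \<in> ?I" for j
      by (rule mm_comp[OF mm_comp[OF mm_dinj w(1)] h]) (use that P_fg in auto)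
    have "\<forall>j\<in>?I. \<exists>k. mm P0 N k \<and> (\<forall>x\<in>carrier P1. k (d x) = h (w (dinj ?I (\<lambda>_. P1) j x)))"
      using inT_ext[OF N wj] by blast
    then obtain k where k: "\<And>j. j \<in> ?I \<Longrightarrow> mm P0 N (k j)"
      "\<And>j x. j \<in> ?I \<Longrightarrow> x \<in> carrier P1 \<Longrightarrow> k j (d x) = h (w (dinj ?I (\<lambda>_. P1) j x))" by metis
    let ?s = "\<lambda>y. finsum N (\<lambda>j. k j (y j)) ?I"
    have s: "mm ?P0 N ?s" by (rule mm_dcopair) (use k P_fg lN in auto)
    have sD: "?s (D t) = h (w t)" if t: "t \<in> carrier ?P1" for t
    proof -
      have "h (w t) = finsum N (\<lambda>j. h (w (dinj ?I (\<lambda>_. P1) j (t j)))) ?I"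
        by (rule mm_dsum_expand[OF _ _ lN mm_comp[OF w(1) h] t]) (use P_fg in auto)
      also have "\<dots> = ?s (D t)"
        using k(2) dsum_in[OF t] mm_closed[OF k(1)] d_closed mm_closed[OF wj]
        by (intro abelian_monoid.finsum_cong'[OF lm_abm[OF lN]]) (auto simp: D_def)
      finally show ?thesis by simp
    qed
    have hm: "mm ?Q N (\<lambda>z. h (fst z) \<oplus>\<^bsub>N\<^esub> ?s (snd z))"
      by (rule mm_plus[OF lN mm_comp[OF mm_fst h] mm_comp[OF mm_snd s]])
    have "\<exists>h'. mm E N h' \<and> (\<forall>z\<in>carrier ?Q. h' (q z) = h (fst z) \<oplus>\<^bsub>N\<^esub> ?s (snd z))"
    proof (rule mm_factor_surj[OF Q(2) lN q(1,2) hm E(2)])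
      fix z assume z: "z \<in> carrier ?Q" "q z = \<zero>\<^bsub>E\<^esub>"
      then obtain t where t: "t \<in> carrier ?P1" "z = rho t" using q(3) by (auto simp: L_def)
      have c: "h (w t) \<in> carrier N" using mm_closed[OF h mm_closed[OF w(1) t(1)]] .
      have "?s (snd z) = sb N \<zero>\<^bsub>N\<^esub> (h (w t))"
        using sD[OF t(1)] mm_sb[OF s ls(2) lm_zero_closed[OF ls(2)] mm_closed[OF D t(1)]]
          mm_zero[OF s ls(2) lN] t(2) by (simp add: rho_def)
      then show "h (fst z) \<oplus>\<^bsub>N\<^esub> ?s (snd z) = \<zero>\<^bsub>N\<^esub>" using c lN t(2) by (simp add: rho_def)
    qed
    then obtain h' where h': "mm E N h'"
      "\<And>z. z \<in> carrier ?Q \<Longrightarrow> h' (q z) = h (fst z) \<oplus>\<^bsub>N\<^esub> ?s (snd z)" by blast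
    have "h' (a x) = h x" if "x \<in> carrier F" for x
      using h'(2)[OF mm_closed[OF F0 that]] mm_zero[OF s ls(2) lN] lN mm_closed[OF h that]
      by (simp add: a_def)
    then show ?thesis using h'(1) by blast
  qed
  show ?thesis
    using TE a b(1) bs kb ext
    by (intro exI[of _ r] exI[of _ a] exI[of _ b] exI[of _ E]) blast
qed

lemma factor_dsum:
  fixes X V :: "'a std_module"
  assumes X: "lmod X" and V: "lmod V" and g: "mm X V g"
    and apx: "\<And>h. mm X U h \<Longrightarrow> \<exists>t. mm V U t \<and> (\<forall>x\<in>carrier X. h x = t (g x))"
    and h: "mm X (dsum I (\<lambda>_. U)) h"
  shows "\<exists>t. mm V (dsum I (\<lambda>_. U)) t \<and> (\<forall>x\<in>carrier X. h x = t (g x))"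
proof -
  have "\<forall>i\<in>I. \<exists>t. mm V U t \<and> (\<forall>x\<in>carrier X. h x i = t (g x))"
    using apx mm_comp[OF h mm_dproj[of _ I "\<lambda>_. U"]] by blast
  then obtain t where t: "\<And>i. i \<in> I \<Longrightarrow> mm V U (t i)"
    "\<And>i x. i \<in> I \<Longrightarrow> x \<in> carrier X \<Longrightarrow> h x i = t i (g x)" by metis
  have m: "mm V (dsum I (\<lambda>_. U)) (\<lambda>v. \<lambda>i\<in>I. t i v)" by (rule mm_dtuple) (rule t(1))
  show ?thesis
  proof (intro exI[of _ "\<lambda>v. \<lambda>i\<in>I. t i v"] conjI ballI m)
    fix x assume x: "x \<in> carrier X"
    show "h x = (\<lambda>i\<in>I. t i (g x))"
      by (rule dsum_eqI[OF mm_closed[OF h x] mm_closed[OF m mm_closed[OF g x]]]) (use t(2) x in auto)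
  qed
qed

text \<open>A projective cover \<open>F \<rightarrow> X\<close> extends to the left approximation \<open>E\<close> of \<open>F\<close>, and together with a
  right approximation \<open>U\<^sup>s \<rightarrow> X\<close> this is a split epimorphism \<open>E \<oplus> U\<^sup>s \<rightarrow> X\<close>. On the image of \<open>F\<close> the map
  \<open>\<eta>\<close> lifts along \<open>g\<close> by projectivity; what remains factors through \<open>add U\<close>, hence through \<open>g\<close>.\<close>

lemma endo_decomposition:
  fixes X V :: "'a std_module"
  assumes TU: "inT U" and X: "inT X" "Tproj X" and V: "fg V" and g: "mm X V g"
    and apx: "\<And>h. mm X U h \<Longrightarrow> \<exists>t. mm V U t \<and> (\<forall>x\<in>carrier X. h x = t (g x))"
    and \<eta>: "mm X V \<eta>" "\<eta> ` carrier X \<subseteq> g ` carrier X"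
  shows "\<exists>\<chi> \<kappa>. mm X X \<chi> \<and> mm V V \<kappa> \<and> \<kappa> ` carrier V \<subseteq> g ` carrier X \<and>
    (\<forall>x\<in>carrier X. \<eta> x = g (\<chi> x) \<oplus>\<^bsub>V\<^esub> \<kappa> (g x))"
proof -
  have l: "fg X" "lmod X" "lmod V" using inT_fg[OF X(1)] V by auto
  obtain F \<pi> where "projective_cover_onto R F \<pi> X (carrier X)"
    using ex_projective_cover[OF l(1) subm_carrier[OF l(2)]] by blast
  then have F: "projective R F" "mm F X \<pi>" "\<pi> ` carrier F = carrier X"
    by (auto simp: projective_cover_onto_def)
  obtain r a b and E :: "('a, (nat \<Rightarrow> 'a) \<times> (nat \<Rightarrow> nat \<Rightarrow> 'a)) module" where
    E: "inT E" "mm F E a" "mm E (dsum {..<(r::nat)} (\<lambda>_. U)) b"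
      "b ` carrier E = carrier (dsum {..<r} (\<lambda>_. U))"
      "{x \<in> carrier E. b x = \<zero>\<^bsub>dsum {..<r} (\<lambda>_. U)\<^esub>} = a ` carrier F"
      and Eext: "\<forall>N :: 'a std_module. \<forall>h. inT N \<and> mm F N h \<longrightarrow>
        (\<exists>h'. mm E N h' \<and> (\<forall>x\<in>carrier F. h' (a x) = h x))"
    using left_approx[OF F(1) TU] by (elim exE conjE) (rule that, assumption+)
  have lE: "fg E" "lmod E" using inT_fg[OF E(1)] by auto
  let ?Ur = "dsum {..<r} (\<lambda>_. U)"
  obtain s v where v: "mm (dsum {..<(s::nat)} (\<lambda>_. U)) X v"
    "\<And>k. mm U X k \<Longrightarrow> \<exists>k'. mm U (dsum {..<s} (\<lambda>_. U)) k' \<and> (\<forall>u\<in>carrier U. v (k' u) = k u)"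
    using right_approx[OF l(1)] by blast
  let ?Us = "dsum {..<s} (\<lambda>_. U)"
  have lU: "lmod ?Ur" "lmod ?Us" "inT ?Us" using P_fg TU by (auto intro!: lmod_dsum inT_dsum)
  obtain qE where qE: "mm E X qE" "\<And>x. x \<in> carrier F \<Longrightarrow> qE (a x) = \<pi> x"
    using Eext X(1) F(2) by blast
  let ?Q = "prodm E ?Us"
  \<comment> \<open>The summand E makes this map surjective, because F already maps onto X. The
    summand U^s makes every map from U to X lift, which puts the kernel into the torsion class.
    Relative projectivity of X then splits the map.\<close>
  let ?q = "\<lambda>z. qE (fst z) \<oplus>\<^bsub>X\<^esub> v (snd z)"
  have q: "mm ?Q X ?q" by (rule mm_plus[OF l(2) mm_comp[OF mm_fst qE(1)] mm_comp[OF mm_snd v(1)]])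
  have TQ: "inT ?Q" by (rule inT_prodm[OF E(1) lU(3)])
  have fQ: "fg ?Q" by (rule inT_fg[OF TQ])
  have v0: "v \<zero>\<^bsub>?Us\<^esub> = \<zero>\<^bsub>X\<^esub>" by (rule mm_zero[OF v(1) lU(2) l(2)])
  have qE0: "qE \<zero>\<^bsub>E\<^esub> = \<zero>\<^bsub>X\<^esub>" by (rule mm_zero[OF qE(1) lE(2) l(2)])
  have qs: "?q ` carrier ?Q = carrier X"
  proof
    show "carrier X \<subseteq> ?q ` carrier ?Q"
    proof
      fix x assume x: "x \<in> carrier X"
      then have "x \<in> \<pi> ` carrier F" using F(3) by simp
      then obtain y where y: "y \<in> carrier F" "x = \<pi> y" by auto
      have "x = ?q (a y, \<zero>\<^bsub>?Us\<^esub>)" using y qE(2) v0 x l(2) by simp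
      moreover have "(a y, \<zero>\<^bsub>?Us\<^esub>) \<in> carrier ?Q"
        using mm_closed[OF E(2) y(1)] lm_zero_closed[OF lU(2)] by (simp add: prodm_def)
      ultimately show "x \<in> ?q ` carrier ?Q" by (rule image_eqI)
    qed
  qed (use mm_closed[OF q] in auto)
  have lift: "\<exists>k'. mm U ?Q k' \<and> (\<forall>u\<in>carrier U. ?q (k' u) = k u)" if k: "mm U X k" for k
  proof -
    obtain k' where k': "mm U ?Us k'" "\<And>u. u \<in> carrier U \<Longrightarrow> v (k' u) = k u" using v(2)[OF k] by blast
    have "mm U ?Q (\<lambda>u. (\<zero>\<^bsub>E\<^esub>, k' u))" by (rule mm_Pair[OF mm_0[OF lE(2)] k'(1)])
    moreover have "?q (\<zero>\<^bsub>E\<^esub>, k' u) = k u" if "u \<in> carrier U" for u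
      using k'(2)[OF that] qE0 l(2) mm_closed[OF k that] by simp
    ultimately show ?thesis by blast
  qed
  have TK: "inT (kermod ?Q X ?q)" by (rule inT_kernel[OF TQ l(2) q lift])
  obtain i where i: "mm X ?Q i" "\<And>x. x \<in> carrier X \<Longrightarrow> ?q (i x) = x"
    using Tproj_lift[OF X(2) fQ l(2) q qs TK mm_id] by blast
  let ?K = "V\<lparr>carrier := g ` carrier X\<rparr>"
  have Ksub: "subm (g ` carrier X) V" by (rule subm_image[OF l(2,3) g subm_carrier[OF l(2)]])
  have lK: "lmod ?K" by (rule lmod_sub[OF l(3) Ksub])
  have gK: "mm X ?K g" and \<eta>K: "mm X ?K \<eta>" using g \<eta> subm_sub[OF Ksub] by (simp_all add: mm_sub_cod_iff)
  \<comment> \<open>Only on F can \<eta> be lifted along g, since g is onto its image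
    \<open>?K\<close> and F is projective. The lift f is then extended to E as
    \<open>\<chi>0\<close>.\<close>
  obtain f where f: "mm F X f" "\<And>y. y \<in> carrier F \<Longrightarrow> g (f y) = \<eta> (qE (a y))"
    using projective_lift[OF F(1) l(2) lK gK _ mm_comp[OF mm_comp[OF E(2) qE(1)] \<eta>K]] by auto
  obtain \<chi>0 where \<chi>0: "mm E X \<chi>0" "\<And>y. y \<in> carrier F \<Longrightarrow> \<chi>0 (a y) = f y"
    using Eext X(1) f(1) by blast
  \<comment> \<open>The failure of \<open>\<chi>0\<close> to lift \<eta> on all of E. It vanishes on
    a(F) = ker b, so it descends to U^r.\<close>
  let ?\<zeta> = "\<lambda>z. sb ?K (\<eta> (qE z)) (g (\<chi>0 z))"
  have \<zeta>: "mm E ?K ?\<zeta>"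
    by (rule mm_minus[OF lK mm_comp[OF qE(1) \<eta>K] mm_comp[OF \<chi>0(1) gK]])
  have "\<exists>\<zeta>'. mm ?Ur ?K \<zeta>' \<and> (\<forall>z\<in>carrier E. \<zeta>' (b z) = ?\<zeta> z)"
  proof (rule mm_factor_surj[OF lE(2) lK E(3,4) \<zeta> lU(1)])
    fix z assume "z \<in> carrier E" "b z = \<zero>\<^bsub>?Ur\<^esub>"
    then have "z \<in> a ` carrier F" using E(5) by blast
    then obtain y where y: "y \<in> carrier F" "z = a y" by blast
    have "\<eta> (qE (a y)) \<in> carrier ?K" by (rule mm_closed[OF mm_comp[OF mm_comp[OF E(2) qE(1)] \<eta>K] y(1)])
    then show "?\<zeta> z = \<zero>\<^bsub>?K\<^esub>" unfolding y(2) \<chi>0(2)[OF y(1)] f(2)[OF y(1)] by (rule sb_self[OF lK])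
  qed
  then obtain \<zeta>' where \<zeta>': "mm ?Ur ?K \<zeta>'" "\<And>z. z \<in> carrier E \<Longrightarrow> \<zeta>' (b z) = ?\<zeta> z" by blast
  have i1: "mm X E (\<lambda>x. fst (i x))" and i2: "mm X ?Us (\<lambda>x. snd (i x))"
    by (rule mm_comp[OF i(1) mm_fst], rule mm_comp[OF i(1) mm_snd])
  \<comment> \<open>Followed by b on the first component, both components of the section i become
    maps from X to powers of U, and therefore factor through g.\<close>
  obtain t1 where t1: "mm V ?Ur t1" "\<And>x. x \<in> carrier X \<Longrightarrow> b (fst (i x)) = t1 (g x)"
    using factor_dsum[OF l(2,3) g apx mm_comp[OF i1 E(3)]] by blast
  obtain t2 where t2: "mm V ?Us t2" "\<And>x. x \<in> carrier X \<Longrightarrow> snd (i x) = t2 (g x)"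
    using factor_dsum[OF l(2,3) g apx i2] by blast
  \<comment> \<open>Both terms take values in g(X). At g x they contribute the failure on the
    E-component and the value of \<eta> on the U^s-component of i x; together with g
    \<open>\<chi>0\<close> this is \<eta> of the recombined element, that is, \<eta> x.\<close>
  let ?\<kappa> = "\<lambda>u. \<zeta>' (t1 u) \<oplus>\<^bsub>?K\<^esub> \<eta> (v (t2 u))"
  have \<kappa>: "mm V ?K ?\<kappa>"
    by (rule mm_plus[OF lK mm_comp[OF t1(1) \<zeta>'(1)] mm_comp[OF mm_comp[OF t2(1) v(1)] \<eta>K]])
  note \<kappa>2 = \<kappa>[THEN mm_sub_cod_iff[OF subm_sub[OF Ksub], THEN iffD1]]
  note \<kappa>V = \<kappa>2[THEN conjunct1] \<kappa>2[THEN conjunct2]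
  have \<chi>: "mm X X (\<lambda>x. \<chi>0 (fst (i x)))" by (rule mm_comp[OF i1 \<chi>0(1)])
  have "\<eta> x = g (\<chi>0 (fst (i x))) \<oplus>\<^bsub>V\<^esub> ?\<kappa> (g x)" if x: "x \<in> carrier X" for x
  proof -
    let ?z = "fst (i x)" and ?w = "snd (i x)"
    have c: "?z \<in> carrier E" "?w \<in> carrier ?Us" using mm_closed[OF i1 x] mm_closed[OF i2 x] by auto
    have c': "qE ?z \<in> carrier X" "v ?w \<in> carrier X" "\<chi>0 ?z \<in> carrier X"
      using mm_closed[OF qE(1) c(1)] mm_closed[OF v(1) c(2)] mm_closed[OF \<chi>0(1) c(1)] by auto
    have c'': "\<eta> (qE ?z) \<in> carrier V" "\<eta> (v ?w) \<in> carrier V" "g (\<chi>0 ?z) \<in> carrier V"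
      using mm_closed[OF \<eta>(1)] mm_closed[OF g] c' by auto
    have "\<zeta>' (t1 (g x)) = sb V (\<eta> (qE ?z)) (g (\<chi>0 ?z))"
      using t1(2)[OF x] \<zeta>'(2)[OF c(1)] by simp
    moreover have "\<eta> (v (t2 (g x))) = \<eta> (v ?w)" using t2(2)[OF x] by simp
    ultimately have "g (\<chi>0 ?z) \<oplus>\<^bsub>V\<^esub> ?\<kappa> (g x) =
        g (\<chi>0 ?z) \<oplus>\<^bsub>V\<^esub> (sb V (\<eta> (qE ?z)) (g (\<chi>0 ?z)) \<oplus>\<^bsub>V\<^esub> \<eta> (v ?w))" by simp
    also have "\<dots> = \<eta> (qE ?z) \<oplus>\<^bsub>V\<^esub> \<eta> (v ?w)"
      using c'' l(3) by (simp add: lm_assoc[symmetric])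
    also have "\<dots> = \<eta> (?q (i x))" using mm_add[OF \<eta>(1) c'(1,2)] by simp
    finally show ?thesis using i(2)[OF x] by simp
  qed
  note e = ballI[OF this]
  show ?thesis
    by (rule exI[of _ "\<lambda>x. \<chi>0 (fst (i x))"], rule exI[of _ ?\<kappa>]) (intro conjI \<chi> \<kappa>V e)
qed

subsection \<open>The cokernel of the approximation\<close>

text \<open>If the kernel \<open>L\<close> of \<open>g\<close> is nonzero, a simple quotient of \<open>L\<close> embeds into a quotient \<open>N\<close> of \<open>U\<close>.
  The map \<open>L \<rightarrow> N\<close> extends to \<open>X\<close>, because \<open>V = X / L\<close> is relatively projective, then lifts to a map
  from \<open>X\<close> to a power of \<open>U\<close>, and so factors through \<open>g\<close>; but then it vanishes on \<open>L\<close>.\<close>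

lemma approx_surj_inj:
  fixes X V :: "'a std_module"
  assumes TU: "inT U" and X: "inT X" "Tproj X" and V: "Tproj V" and g: "mm X V g"
    and apx: "\<And>h. mm X U h \<Longrightarrow> \<exists>t. mm V U t \<and> (\<forall>x\<in>carrier X. h x = t (g x))"
    and sinc: "sincere R U" and gs: "g ` carrier X = carrier V"
  shows "{x \<in> carrier X. g x = \<zero>\<^bsub>V\<^esub>} = {\<zero>\<^bsub>X\<^esub>}"
proof (rule ccontr)
  assume ne: "\<not> ?thesis"
  let ?L = "kermod X V g"
  have nz: "carrier ?L \<noteq> {\<zero>\<^bsub>?L\<^esub>}" using ne by simp
  have l: "fg X" "lmod X" "fg V" "lmod V" "lmod U" using inT_fg[OF X(1)] Tproj_fg[OF V] P_fg by auto
  have Lsub: "subm {x \<in> carrier X. g x = \<zero>\<^bsub>V\<^esub>} X" by (rule subm_kernel[OF l(2,4) g])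
  have L: "fg ?L" "lmod ?L" using fg_sub[OF l(1) Lsub] by auto
  obtain S \<sigma> where S: "simple_module R S" "mm ?L S \<sigma>" "\<sigma> ` carrier ?L = carrier S"
    using ex_simple_quotient[OF L(1) nz] by blast
  have "composition_factor R U S" using sinc S(1) by (simp add: sincere_def)
  then obtain Ls k where Ls: "composition_series R U Ls" "Suc k < length Ls"
    "subquotient_iso R U (Ls ! Suc k) (Ls ! k) S" by (auto simp: composition_factor_def)
  define W W1 where "W = Ls ! Suc k" and "W1 = Ls ! k"
  have W: "subm W U" "subm W1 U" using Ls by (auto simp: composition_series_def W_def W1_def)
  obtain \<pi> where \<pi>: "mm (U\<lparr>carrier := W\<rparr>) S \<pi>" "\<pi> ` W = carrier S" "{x \<in> W. \<pi> x = \<zero>\<^bsub>S\<^esub>} = W1"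
    using Ls(3) by (auto simp: subquotient_iso_def W_def W1_def)
  have lS: "lmod S" "\<not> zero_module S" using S(1) by (auto simp: simple_module_def fgmod_iff)
  have lW: "lmod (U\<lparr>carrier := W\<rparr>)" by (rule lmod_sub[OF l(5) W(1)])
  \<comment> \<open>S is a subquotient W / W1 of U by sincerity, so it embeds into N = U / W1. As a
    quotient of U, the module N lies in the torsion class.\<close>
  define N where "N = quot U W1"
  define \<nu> where "\<nu> = qrep U W1"
  have \<nu>: "mm U N \<nu>" "\<nu> ` carrier U = carrier N" "\<And>x. x \<in> carrier U \<Longrightarrow> \<nu> x = \<zero>\<^bsub>N\<^esub> \<longleftrightarrow> x \<in> W1"
    and lN: "lmod N"
    using quot[OF l(5) W(2)] by (auto simp: N_def \<nu>_def)
  have TN: "inT N" by (rule inT_image[OF TU lN \<nu>(1,2)])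
  have fN: "fg N" by (rule inT_fg[OF TN])
  have "\<exists>\<tau>. mm S N \<tau> \<and> (\<forall>w\<in>carrier (U\<lparr>carrier := W\<rparr>). \<tau> (\<pi> w) = \<nu> w)"
  proof (rule mm_factor_surj[OF lW lN \<pi>(1) _ mm_sub_dom[OF \<nu>(1) subm_sub[OF W(1)]] lS(1)])
    show "\<pi> ` carrier (U\<lparr>carrier := W\<rparr>) = carrier S" using \<pi>(2) by simp
    fix w assume "w \<in> carrier (U\<lparr>carrier := W\<rparr>)" "\<pi> w = \<zero>\<^bsub>S\<^esub>"
    then have "w \<in> W1" using \<pi>(3) by auto
    then show "\<nu> w = \<zero>\<^bsub>N\<^esub>" using \<nu>(3) subm_in[OF W(2)] by simp
  qed
  then obtain \<tau> where \<tau>: "mm S N \<tau>" "\<And>w. w \<in> W \<Longrightarrow> \<tau> (\<pi> w) = \<nu> w" by auto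
  define \<mu> where "\<mu> = (\<lambda>x. \<tau> (\<sigma> x))"
  have \<mu>: "mm ?L N \<mu>" unfolding \<mu>_def by (rule mm_comp[OF S(2) \<tau>(1)])
  have "\<exists>x\<in>carrier ?L. \<mu> x \<noteq> \<zero>\<^bsub>N\<^esub>"
  proof -
    obtain s where s: "s \<in> carrier S" "s \<noteq> \<zero>\<^bsub>S\<^esub>"
      using lS lm_zero_closed[OF lS(1)] unfolding zero_module_def by blast
    then have "s \<in> \<pi> ` W" "s \<in> \<sigma> ` carrier ?L" using \<pi>(2) S(3) by auto
    then obtain w x where w: "w \<in> W" "s = \<pi> w" and x: "x \<in> carrier ?L" "s = \<sigma> x" by blast
    have "w \<notin> W1" using w s(2) \<pi>(3) by auto
    then have "\<nu> w \<noteq> \<zero>\<^bsub>N\<^esub>" using \<nu>(3) subm_in[OF W(1) w(1)] by simp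
    then have "\<mu> x \<noteq> \<zero>\<^bsub>N\<^esub>" using \<tau>(2)[OF w(1)] w(2) x(2) by (simp add: \<mu>_def)
    then show ?thesis using x(1) by blast
  qed
  then obtain x0 where x0: "x0 \<in> carrier ?L" "\<mu> x0 \<noteq> \<zero>\<^bsub>N\<^esub>" by blast
  let ?Q = "prodm N X"
  have Q: "fg ?Q" "lmod ?Q" using fg_prodm[OF fN l(1)] by auto
  have Qin: "(n, x) \<in> carrier ?Q \<longleftrightarrow> n \<in> carrier N \<and> x \<in> carrier X" for n x by (simp add: prodm_def)
  \<comment> \<open>The relations of the pushout E of the inclusion L -> X along \<mu> : L -> N.
    Since g is surjective with kernel L, this E is an extension of V by N.\<close>
  define rho where "rho = (\<lambda>x. (\<mu> x, sb X \<zero>\<^bsub>X\<^esub> x))"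
  have Lid: "mm ?L X (\<lambda>x. x)" by (rule mm_sub_dom[OF mm_id subm_sub[OF Lsub]])
  have rho: "mm ?L ?Q rho" unfolding rho_def
    by (rule mm_Pair[OF \<mu> mm_minus[OF l(2) mm_0[OF l(2)] Lid]])
  define B where "B = rho ` carrier ?L"
  have B: "subm B ?Q" unfolding B_def by (rule subm_image[OF L(2) Q(2) rho subm_carrier[OF L(2)]])
  define E where "E = quot ?Q B"
  define q where "q = qrep ?Q B"
  have E: "fg E" "lmod E" unfolding E_def using fg_quot[OF Q(1) B] by auto
  have q: "mm ?Q E q" "q ` carrier ?Q = carrier E"
    "\<And>z. z \<in> carrier ?Q \<Longrightarrow> q z = \<zero>\<^bsub>E\<^esub> \<longleftrightarrow> z \<in> B"
    using quot[OF Q(2) B] by (auto simp: E_def q_def)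
  have "\<exists>p. mm E V p \<and> (\<forall>z\<in>carrier ?Q. p (q z) = g (snd z))"
  proof (rule mm_factor_surj[OF Q(2) l(4) q(1,2) mm_comp[OF mm_snd g] E(2)])
    fix z assume z: "z \<in> carrier ?Q" "q z = \<zero>\<^bsub>E\<^esub>"
    then obtain x where x: "x \<in> carrier ?L" "z = rho x" using q(3) by (auto simp: B_def)
    then show "g (snd z) = \<zero>\<^bsub>V\<^esub>"
      using l mm_zero[OF g l(2,4)] by (simp add: rho_def mm_sb[OF g])
  qed
  then obtain p where p: "mm E V p" "\<And>n x. n \<in> carrier N \<Longrightarrow> x \<in> carrier X \<Longrightarrow> p (q (n, x)) = g x"
    by (auto simp: prodm_def)
  have Eex: "\<exists>n x. n \<in> carrier N \<and> x \<in> carrier X \<and> z = q (n, x)" if "z \<in> carrier E" for z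
  proof -
    have "z \<in> q ` carrier ?Q" using that q(2) by simp
    then show ?thesis by (auto simp: prodm_def)
  qed
  have q2: "mm X E (\<lambda>x. q (\<zero>\<^bsub>N\<^esub>, x))" by (rule mm_comp[OF mm_Pair[OF mm_0[OF lN] mm_id] q(1)])
  define j where "j = (\<lambda>n. q (n, \<zero>\<^bsub>X\<^esub>))"
  have j: "mm N E j" unfolding j_def by (rule mm_comp[OF mm_Pair[OF mm_id mm_0[OF l(2)]] q(1)])
  have split: "q (n, x) = j n \<oplus>\<^bsub>E\<^esub> q (\<zero>\<^bsub>N\<^esub>, x)" if "n \<in> carrier N" "x \<in> carrier X" for n x
    using mm_add[OF q(1), of "(n, \<zero>\<^bsub>X\<^esub>)" "(\<zero>\<^bsub>N\<^esub>, x)"] that lN l(2)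
    by (simp add: Qin j_def) (simp add: prodm_def)
  have jL: "q (\<zero>\<^bsub>N\<^esub>, x) = j (\<mu> x)" if x: "x \<in> carrier ?L" for x
  proof -
    have c: "\<mu> x \<in> carrier N" "x \<in> carrier X" using mm_closed[OF \<mu> x] x by auto
    have "rho x \<oplus>\<^bsub>?Q\<^esub> (\<zero>\<^bsub>N\<^esub>, x) = (\<mu> x, \<zero>\<^bsub>X\<^esub>)"
      using c lN l(2) by (simp add: rho_def) (simp add: prodm_def)
    moreover have "q (rho x) = \<zero>\<^bsub>E\<^esub>" using q(3)[OF mm_closed[OF rho x]] x by (auto simp: B_def)
    ultimately show ?thesis
      using mm_add[OF q(1) mm_closed[OF rho x], of "(\<zero>\<^bsub>N\<^esub>, x)"] c lN E(2) mm_closed[OF q2 c(2)]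
      by (simp add: Qin j_def)
  qed
  have ps: "p ` carrier E = carrier V"
  proof
    show "carrier V \<subseteq> p ` carrier E"
    proof
      fix u assume "u \<in> carrier V"
      then have "u \<in> g ` carrier X" using gs by simp
      then obtain x where x: "x \<in> carrier X" "u = g x" by auto
      then have "u = p (q (\<zero>\<^bsub>N\<^esub>, x))" using p(2) lN by simp
      then show "u \<in> p ` carrier E" using mm_closed[OF q2 x(1)] by blast
    qed
  qed (use mm_closed[OF p(1)] in auto)
  have pj: "p (j n) = \<zero>\<^bsub>V\<^esub>" if "n \<in> carrier N" for n
    using p(2)[OF that lm_zero_closed[OF l(2)]] mm_zero[OF g l(2,4)] by (simp add: j_def)
  have kp: "{z \<in> carrier E. p z = \<zero>\<^bsub>V\<^esub>} = j ` carrier N"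
  proof
    show "{z \<in> carrier E. p z = \<zero>\<^bsub>V\<^esub>} \<subseteq> j ` carrier N"
    proof
      fix z assume z: "z \<in> {z \<in> carrier E. p z = \<zero>\<^bsub>V\<^esub>}"
      then obtain n x where nx: "n \<in> carrier N" "x \<in> carrier X" "z = q (n, x)" using Eex by blast
      then have x: "x \<in> carrier ?L" using z p(2) by simp
      have c: "\<mu> x \<in> carrier N" by (rule mm_closed[OF \<mu> x])
      have "z = j (n \<oplus>\<^bsub>N\<^esub> \<mu> x)" using split[OF nx(1,2)] jL[OF x] mm_add[OF j nx(1) c] nx(3) by simp
      then show "z \<in> j ` carrier N" using nx(1) c lN by blast
    qed
  qed (use pj mm_closed[OF j] in auto)
  have jinj: "inj_on j (carrier N)"
    unfolding mm_inj_iff[OF lN E(2) j]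
  proof
    show "{n \<in> carrier N. j n = \<zero>\<^bsub>E\<^esub>} \<subseteq> {\<zero>\<^bsub>N\<^esub>}"
    proof
      fix n assume "n \<in> {n \<in> carrier N. j n = \<zero>\<^bsub>E\<^esub>}"
      then have n: "n \<in> carrier N" "j n = \<zero>\<^bsub>E\<^esub>" by auto
      then have "(n, \<zero>\<^bsub>X\<^esub>) \<in> B" using q(3)[of "(n, \<zero>\<^bsub>X\<^esub>)"] l(2) by (simp add: Qin j_def)
      then obtain x where x: "x \<in> carrier ?L" "n = \<mu> x" "sb X \<zero>\<^bsub>X\<^esub> x = \<zero>\<^bsub>X\<^esub>"
        by (auto simp: B_def rho_def)
      then have "x = \<zero>\<^bsub>?L\<^esub>" using l(2) by simp
      then show "n \<in> {\<zero>\<^bsub>N\<^esub>}" using x(2) mm_zero[OF \<mu> L(2) lN] by simp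
    qed
  qed (use mm_zero[OF j lN E(2)] lN in auto)
  have Ksub: "subm {z \<in> carrier E. p z = \<zero>\<^bsub>V\<^esub>} E" by (rule subm_kernel[OF E(2) l(4) p(1)])
  have TK: "inT (kermod E V p)"
  proof (rule inT_image[OF TN lmod_sub[OF E(2) Ksub]])
    show "mm N (kermod E V p) j" using j kp subm_sub[OF Ksub] by (subst mm_sub_cod_iff) auto
    show "j ` carrier N = carrier (kermod E V p)" using kp by simp
  qed
  obtain s where s: "mm V E s" "\<And>u. u \<in> carrier V \<Longrightarrow> p (s u) = u"
    using Tproj_lift[OF V E(1) l(4) p(1) ps TK mm_id] by blast
  \<comment> \<open>The maps X -> E and s g agree after p, so their difference takes values in j(N)
    and yields h : X -> N. On L the term s g vanishes and the pushout relation gives \<mu>; thus h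
    extends \<mu>.\<close>
  let ?\<psi> = "\<lambda>x. sb E (q (\<zero>\<^bsub>N\<^esub>, x)) (s (g x))"
  have \<psi>: "mm X E ?\<psi>" by (rule mm_minus[OF E(2) q2 mm_comp[OF g s(1)]])
  have "?\<psi> x \<in> j ` carrier N" if x: "x \<in> carrier X" for x
  proof -
    have c: "g x \<in> carrier V" "q (\<zero>\<^bsub>N\<^esub>, x) \<in> carrier E" "s (g x) \<in> carrier E"
      using mm_closed[OF g x] mm_closed[OF q2 x] mm_closed[OF s(1)] by auto
    have "p (?\<psi> x) = \<zero>\<^bsub>V\<^esub>"
      using c l(4) E(2) p(2)[OF lm_zero_closed[OF lN] x] s(2)[OF c(1)] by (simp add: mm_sb[OF p(1)])
    then show ?thesis using kp mm_closed[OF \<psi> x] by blast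
  qed
  then obtain h where h: "mm X N h" "\<And>x. x \<in> carrier X \<Longrightarrow> j (h x) = ?\<psi> x"
    using mm_factor_inj[OF lN E(2) j jinj \<psi>] by blast
  have h\<mu>: "h x = \<mu> x" if x: "x \<in> carrier ?L" for x
  proof -
    have xX: "x \<in> carrier X" "g x = \<zero>\<^bsub>V\<^esub>" using x by auto
    have "j (h x) = j (\<mu> x)"
      using h(2)[OF xX(1)] jL[OF x] xX(2) mm_zero[OF s(1) l(4) E(2)] E(2) mm_closed[OF q2 xX(1)] by simp
    then show ?thesis using inj_onD[OF jinj] mm_closed[OF h(1) xX(1)] mm_closed[OF \<mu> x] by blast
  qed
  \<comment> \<open>A right approximation of N is onto because \<nu> : U -> N factors through it,
    and its kernel is in the torsion class. Hence h lifts to a power of U, and the lift factors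
    through g, which kills L.\<close>
  obtain m v where v: "mm (dsum {..<(m::nat)} (\<lambda>_. U)) N v"
    "\<And>k. mm U N k \<Longrightarrow> \<exists>k'. mm U (dsum {..<m} (\<lambda>_. U)) k' \<and> (\<forall>u\<in>carrier U. v (k' u) = k u)"
    using right_approx[OF fN] by blast
  let ?Um = "dsum {..<m} (\<lambda>_. U)"
  have TUm: "inT ?Um" using TU by (intro inT_dsum) auto
  have fUm: "fg ?Um" "lmod ?Um" using inT_fg[OF TUm] by auto
  have vs: "v ` carrier ?Um = carrier N"
  proof
    obtain k where k: "mm U ?Um k" "\<And>u. u \<in> carrier U \<Longrightarrow> v (k u) = \<nu> u" using v(2)[OF \<nu>(1)] by blast
    show "carrier N \<subseteq> v ` carrier ?Um"
    proof
      fix n assume "n \<in> carrier N"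
      then have "n \<in> \<nu> ` carrier U" using \<nu>(2) by simp
      then obtain u where "u \<in> carrier U" "n = \<nu> u" by auto
      then show "n \<in> v ` carrier ?Um" using k(2) mm_closed[OF k(1)] by (metis image_eqI)
    qed
  qed (use mm_closed[OF v(1)] in auto)
  have TKv: "inT (kermod ?Um N v)" by (rule inT_kernel[OF TUm lN v])
  obtain h' where h': "mm X ?Um h'" "\<And>x. x \<in> carrier X \<Longrightarrow> v (h' x) = h x"
    using Tproj_lift[OF X(2) fUm(1) lN v(1) vs TKv h(1)] by blast
  obtain t where t: "mm V ?Um t" "\<And>x. x \<in> carrier X \<Longrightarrow> h' x = t (g x)"
    using factor_dsum[OF l(2,4) g apx h'(1)] by blast
  have xX: "x0 \<in> carrier X" "g x0 = \<zero>\<^bsub>V\<^esub>" using x0(1) by auto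
  have "h x0 = v (t \<zero>\<^bsub>V\<^esub>)" using h'(2)[OF xX(1)] t(2)[OF xX(1)] xX(2) by simp
  also have "\<dots> = \<zero>\<^bsub>N\<^esub>" using mm_zero[OF t(1) l(4) fUm(2)] mm_zero[OF v(1) fUm(2) lN] by simp
  finally show False using h\<mu>[OF x0(1)] x0(2) by simp
qed

text \<open>A power \<psi> of \<phi> kills g(X) and still induces \<epsilon>, so \<psi> u depends
  only on f u, and \<psi>^2 is idempotent. The endomorphism 1 - \<psi>^2 fixes g(X), so left
  minimality makes it injective; it kills the image of \<psi>^2, which is therefore zero. Then
  \<epsilon> = \<epsilon>^2 = 0.\<close>

lemma nilpotent_case:
  fixes X V Y :: "'a std_module"
  assumes l: "lmod X" "lmod V" "lmod Y" and g: "mm X V g" and f: "mm V Y f" "f ` carrier V = carrier Y"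
    and fk: "g ` carrier X = {u \<in> carrier V. f u = \<zero>\<^bsub>Y\<^esub>}"
    and min: "\<And>k. mm V V k \<Longrightarrow> (\<And>x. x \<in> carrier X \<Longrightarrow> k (g x) = g x) \<Longrightarrow> bij_betw k (carrier V) (carrier V)"
    and \<epsilon>: "\<And>y. y \<in> carrier Y \<Longrightarrow> \<epsilon> (\<epsilon> y) = \<epsilon> y"
    and \<phi>: "mm V V \<phi>" "\<And>u. u \<in> carrier V \<Longrightarrow> f (\<phi> u) = \<epsilon> (f u)"
    and \<chi>: "mm X X \<chi>" "\<And>x. x \<in> carrier X \<Longrightarrow> \<phi> (g x) = g (\<chi> x)"
    and nil: "\<And>x. x \<in> carrier X \<Longrightarrow> (\<chi> ^^ n) x = \<zero>\<^bsub>X\<^esub>"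
    and y: "y \<in> carrier Y"
  shows "\<epsilon> y = \<zero>\<^bsub>Y\<^esub>"
proof -
  \<comment> \<open>The exponent n + 1 keeps the power positive even for n = 0; the zeroth power
    would induce the identity on Y instead of \<epsilon>.\<close>
  define \<psi> where "\<psi> = \<phi> ^^ Suc n"
  have \<psi>: "mm V V \<psi>" unfolding \<psi>_def by (rule mm_funpow[OF \<phi>(1)])
  note c\<psi> = mm_closed[OF \<psi>]
  have \<chi>n: "mm X X (\<chi> ^^ k)" for k by (rule mm_funpow[OF \<chi>(1)])
  have \<phi>n: "(\<phi> ^^ k) (g x) = g ((\<chi> ^^ k) x)" if "x \<in> carrier X" for k x
    using that by (induction k) (auto simp: \<chi>(2) mm_closed[OF \<chi>n])
  have \<psi>g: "\<psi> (g x) = \<zero>\<^bsub>V\<^esub>" if "x \<in> carrier X" for x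
    using \<phi>n[OF that, of "Suc n"] nil[OF that] mm_zero[OF \<chi>(1) l(1,1)] mm_zero[OF g l(1,2)]
    by (simp add: \<psi>_def)
  have f\<psi>: "f (\<psi> u) = \<epsilon> (f u)" if "u \<in> carrier V" for u
  proof -
    have "f ((\<phi> ^^ Suc k) u) = \<epsilon> (f u)" for k
    proof (induction k)
      case (Suc k)
      have "f ((\<phi> ^^ Suc (Suc k)) u) = \<epsilon> (f ((\<phi> ^^ Suc k) u))"
        using \<phi>(2)[OF mm_closed[OF mm_funpow[OF \<phi>(1), of "Suc k"] that]] by simp
      then show ?case using Suc \<epsilon>[OF mm_closed[OF f(1) that]] by simp
    qed (use \<phi>(2) that in simp)
    then show ?thesis by (simp add: \<psi>_def)
  qed
  have \<psi>eq: "\<psi> u = \<psi> w" if "u \<in> carrier V" "w \<in> carrier V" "f u = f w" for u w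
  proof -
    have "sb V u w \<in> {u \<in> carrier V. f u = \<zero>\<^bsub>Y\<^esub>}"
      using that l mm_closed[OF f(1)] by (simp add: mm_sb[OF f(1)])
    then have "sb V u w \<in> g ` carrier X" using fk by simp
    then have "\<psi> (sb V u w) = \<zero>\<^bsub>V\<^esub>" using \<psi>g by auto
    then show ?thesis using that l c\<psi> by (simp add: mm_sb[OF \<psi>])
  qed
  \<comment> \<open>Both \<psi> (\<psi> u) and \<psi> u have image \<epsilon> (f u) in Y, and \<psi>
    only sees the image in Y.\<close>
  have \<psi>3: "\<psi> (\<psi> (\<psi> u)) = \<psi> (\<psi> u)" if "u \<in> carrier V" for u
    using that c\<psi> \<epsilon>[OF mm_closed[OF f(1) that]] by (intro \<psi>eq) (auto simp: f\<psi>)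
  let ?e = "\<lambda>u. \<psi> (\<psi> u)"
  have e: "mm V V ?e" by (rule mm_comp[OF \<psi> \<psi>])
  let ?k = "\<lambda>u. sb V u (?e u)"
  have k: "mm V V ?k" by (rule mm_minus[OF l(2) mm_id e])
  have "bij_betw ?k (carrier V) (carrier V)"
  proof (rule min[OF k])
    fix x assume x: "x \<in> carrier X"
    show "?k (g x) = g x" using \<psi>g[OF x] mm_zero[OF \<psi> l(2,2)] l(2) mm_closed[OF g x] by simp
  qed
  then have inj: "inj_on ?k (carrier V)" by (simp add: bij_betw_def)
  have e0: "?e u = \<zero>\<^bsub>V\<^esub>" if u: "u \<in> carrier V" for u
  proof (rule inj_onD[OF inj])
    have "?e (?e u) = ?e u" using \<psi>3 u c\<psi> by simp
    then show "?k (?e u) = ?k \<zero>\<^bsub>V\<^esub>" using l(2) u c\<psi> mm_zero[OF e l(2,2)] by simp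
  qed (use u c\<psi> l in auto)
  have "y \<in> f ` carrier V" using y f(2) by simp
  then obtain u where u: "u \<in> carrier V" "y = f u" by auto
  have "\<epsilon> y = f (?e u)" using u \<epsilon>[OF y] c\<psi> by (simp add: f\<psi>)
  then show ?thesis using e0[OF u(1)] mm_zero[OF f(1) l(2,3)] by simp
qed

lemma idempotent_trivial:
  fixes X V Y :: "'a std_module"
  assumes TU: "inT U" and X: "inT X" "Tproj X" "indecomposable R X" and V: "Tproj V" and g: "mm X V g"
    and apx: "\<And>h. mm X U h \<Longrightarrow> \<exists>t. mm V U t \<and> (\<forall>x\<in>carrier X. h x = t (g x))"
    and apxV: "\<And>h. mm X V h \<Longrightarrow> \<exists>t. mm V V t \<and> (\<forall>x\<in>carrier X. h x = t (g x))"
    and lY: "lmod Y" and f: "mm V Y f" "f ` carrier V = carrier Y"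
    and fk: "g ` carrier X = {u \<in> carrier V. f u = \<zero>\<^bsub>Y\<^esub>}"
    and min: "\<And>k. mm V V k \<Longrightarrow> (\<And>x. x \<in> carrier X \<Longrightarrow> k (g x) = g x) \<Longrightarrow> bij_betw k (carrier V) (carrier V)"
    and nz: "g ` carrier X \<noteq> carrier V"
    and \<epsilon>: "mm Y Y \<epsilon>" "\<And>y. y \<in> carrier Y \<Longrightarrow> \<epsilon> (\<epsilon> y) = \<epsilon> y"
  shows "(\<forall>y\<in>carrier Y. \<epsilon> y = \<zero>\<^bsub>Y\<^esub>) \<or> (\<forall>y\<in>carrier Y. \<epsilon> y = y)"
proof -
  have l: "lmod X" "lmod V" "fg V" using inT_fg[OF X(1)] Tproj_fg[OF V] by auto
  have Ksub: "subm (g ` carrier X) V" by (rule subm_image[OF l(1,2) g subm_carrier[OF l(1)]])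
  have gK: "mm X (kermod V Y f) g"
    unfolding fk[symmetric] using g subm_sub[OF Ksub] by (simp add: mm_sub_cod_iff)
  \<comment> \<open>The kernel of f is the image of X, hence in the torsion class. So the relative
    projectivity of V lifts \<epsilon> f along f.\<close>
  have TK: "inT (kermod V Y f)"
    by (rule inT_image[OF X(1) lmod_sub[OF l(2) subm_kernel[OF l(2) lY f(1)]] gK]) (simp add: fk)
  obtain \<phi>0 where \<phi>0: "mm V V \<phi>0" "\<And>u. u \<in> carrier V \<Longrightarrow> f (\<phi>0 u) = \<epsilon> (f u)"
    using Tproj_lift[OF V l(3) lY f TK mm_comp[OF f(1) \<epsilon>(1)]] by blast
  have fg0: "f (g x) = \<zero>\<^bsub>Y\<^esub>" if "x \<in> carrier X" for x using fk that by auto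
  have \<eta>: "mm X V (\<lambda>x. \<phi>0 (g x))" by (rule mm_comp[OF g \<phi>0(1)])
  have \<eta>K: "(\<lambda>x. \<phi>0 (g x)) ` carrier X \<subseteq> g ` carrier X"
    unfolding fk using mm_closed[OF \<eta>] \<phi>0(2)[OF mm_closed[OF g]] fg0 mm_zero[OF \<epsilon>(1) lY lY] by auto
  obtain \<chi> \<kappa> where \<chi>: "mm X X \<chi>" and \<kappa>: "mm V V \<kappa>" "\<kappa> ` carrier V \<subseteq> g ` carrier X"
    and dec: "\<And>x. x \<in> carrier X \<Longrightarrow> \<phi>0 (g x) = g (\<chi> x) \<oplus>\<^bsub>V\<^esub> \<kappa> (g x)"
    using endo_decomposition[OF TU X(1,2) l(3) g apx \<eta> \<eta>K] by blast
  \<comment> \<open>The values of \<kappa> lie in g(X) = ker f, so \<phi> still induces \<epsilon>,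
    while now \<phi> g = g \<chi> holds exactly.\<close>
  define \<phi> where "\<phi> = (\<lambda>u. sb V (\<phi>0 u) (\<kappa> u))"
  have \<phi>: "mm V V \<phi>" unfolding \<phi>_def by (rule mm_minus[OF l(2) \<phi>0(1) \<kappa>(1)])
  have f\<phi>: "f (\<phi> u) = \<epsilon> (f u)" if u: "u \<in> carrier V" for u
  proof -
    have "f (\<kappa> u) = \<zero>\<^bsub>Y\<^esub>" using \<kappa>(2) fk u by blast
    moreover have "\<phi>0 u \<in> carrier V" "\<kappa> u \<in> carrier V" "\<epsilon> (f u) \<in> carrier Y"
      using mm_closed[OF \<phi>0(1) u] mm_closed[OF \<kappa>(1) u] mm_closed[OF \<epsilon>(1) mm_closed[OF f(1) u]] by auto
    ultimately show ?thesis using l lY \<phi>0(2)[OF u] by (simp add: \<phi>_def mm_sb[OF f(1)])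
  qed
  have \<phi>g: "\<phi> (g x) = g (\<chi> x)" if x: "x \<in> carrier X" for x
    using dec[OF x] l mm_closed[OF g mm_closed[OF \<chi> x]] mm_closed[OF \<kappa>(1) mm_closed[OF g x]]
    by (simp add: \<phi>_def)
  consider n where "\<forall>x\<in>carrier X. (\<chi> ^^ n) x = \<zero>\<^bsub>X\<^esub>" | "bij_betw \<chi> (carrier X) (carrier X)"
    using fitting[OF X(3) \<chi>] by blast
  then show ?thesis
  proof cases
    case 1
    then show ?thesis
      using nilpotent_case[OF l(1,2) lY g f fk min \<epsilon>(2) \<phi> f\<phi> \<chi> \<phi>g, of n] by blast
  next
    case b: 2
    \<comment> \<open>The complementary idempotent 1 - \<epsilon> is induced by 1 - \<phi>, which
      restricts to 1 - \<chi>; the nilpotent case applies to it unchanged.\<close>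
    define \<epsilon>1 \<phi>1 \<chi>1 where defs: "\<epsilon>1 = (\<lambda>y. sb Y y (\<epsilon> y))" "\<phi>1 = (\<lambda>u. sb V u (\<phi> u))"
      "\<chi>1 = (\<lambda>x. sb X x (\<chi> x))"
    have m: "mm Y Y \<epsilon>1" "mm V V \<phi>1" "mm X X \<chi>1"
      using mm_minus[OF lY mm_id \<epsilon>(1)] mm_minus[OF l(2) mm_id \<phi>] mm_minus[OF l(1) mm_id \<chi>] by (auto simp: defs)
    have \<epsilon>': "\<epsilon>1 (\<epsilon>1 y) = \<epsilon>1 y" if y: "y \<in> carrier Y" for y
      using lY y mm_closed[OF \<epsilon>(1)] \<epsilon>(2) by (simp add: defs mm_sb[OF \<epsilon>(1)])
    have f\<phi>': "f (\<phi>1 u) = \<epsilon>1 (f u)" if "u \<in> carrier V" for u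
      using that l mm_closed[OF \<phi> that] f\<phi>[OF that] by (simp add: defs mm_sb[OF f(1)])
    have \<phi>g': "\<phi>1 (g x) = g (\<chi>1 x)" if "x \<in> carrier X" for x
      using that l mm_closed[OF \<chi> that] \<phi>g[OF that] by (simp add: defs mm_sb[OF g])
    consider n where "\<forall>x\<in>carrier X. (\<chi>1 ^^ n) x = \<zero>\<^bsub>X\<^esub>" | "bij_betw \<chi>1 (carrier X) (carrier X)"
      using fitting[OF X(3) m(3)] by blast
    then show ?thesis
    proof cases
      case 1
      have "\<epsilon>1 y = \<zero>\<^bsub>Y\<^esub>" if "y \<in> carrier Y" for y
        using nilpotent_case[OF l(1,2) lY g f fk min \<epsilon>' m(2) f\<phi>' m(3) \<phi>g', of n y] 1 that by blast
      then have "\<epsilon> y = y" if "y \<in> carrier Y" for y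
        using that lY sb_zero_iff[OF lY that mm_closed[OF \<epsilon>(1) that]] mm_closed[OF \<epsilon>(1) that] by (simp add: defs)
      then show ?thesis by blast
    next
      case 2
      have bu: "bij_betw (\<lambda>x. \<chi> (\<chi>1 x)) (carrier X) (carrier X)"
        using bij_betw_trans[OF 2 b] by (simp add: o_def)
      define v where "v = inv_into (carrier X) (\<lambda>x. \<chi> (\<chi>1 x))"
      have vm: "mm X X v" unfolding v_def by (rule mm_inv[OF l(1) mm_comp[OF m(3) \<chi>] bu])
      have v: "\<chi> (\<chi>1 (v x)) = x" if "x \<in> carrier X" for x
        using bij_betw_inv_into_right[OF bu that] by (simp add: v_def)
      \<comment> \<open>The inverse v of \<chi> (1 - \<chi>) is extended to V through the
        approximation property. Then \<phi> (1 - \<phi>) w fixes g(X) and is bijective by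
        minimality. But it induces zero on Y, as \<epsilon> (1 - \<epsilon>) = 0, so every element
        of V lies in ker f = g(X).\<close>
      obtain w where w: "mm V V w" "\<And>x. x \<in> carrier X \<Longrightarrow> g (v x) = w (g x)"
        using apxV[OF mm_comp[OF vm g]] by blast
      have k: "mm V V (\<lambda>u. \<phi> (\<phi>1 (w u)))" by (rule mm_comp[OF mm_comp[OF w(1) m(2)] \<phi>])
      have "bij_betw (\<lambda>u. \<phi> (\<phi>1 (w u))) (carrier V) (carrier V)"
      proof (rule min[OF k])
        fix x assume x: "x \<in> carrier X"
        have c: "v x \<in> carrier X" "\<chi>1 (v x) \<in> carrier X"
          using mm_closed[OF vm x] mm_closed[OF m(3)] by auto
        have "\<phi> (\<phi>1 (w (g x))) = \<phi> (\<phi>1 (g (v x)))" using w(2)[OF x] by simp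
        also have "\<dots> = g (\<chi> (\<chi>1 (v x)))" using \<phi>g'[OF c(1)] \<phi>g[OF c(2)] by simp
        finally show "\<phi> (\<phi>1 (w (g x))) = g x" using v[OF x] by simp
      qed
      then have s: "(\<lambda>u. \<phi> (\<phi>1 (w u))) ` carrier V = carrier V" by (simp add: bij_betw_def)
      have "u \<in> g ` carrier X" if u: "u \<in> carrier V" for u
      proof -
        have "u \<in> (\<lambda>u. \<phi> (\<phi>1 (w u))) ` carrier V" using s u by simp
        then obtain z where z: "z \<in> carrier V" "u = \<phi> (\<phi>1 (w z))" by auto
        have c: "w z \<in> carrier V" "\<phi>1 (w z) \<in> carrier V" "f (w z) \<in> carrier Y"
          using mm_closed[OF w(1) z(1)] mm_closed[OF m(2)] mm_closed[OF f(1)] by auto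
        have "f u = \<epsilon> (\<epsilon>1 (f (w z)))" using z(2) f\<phi>[OF c(2)] f\<phi>'[OF c(1)] by simp
        also have "\<dots> = \<zero>\<^bsub>Y\<^esub>" using c lY mm_closed[OF \<epsilon>(1)] \<epsilon>(2) by (simp add: defs mm_sb[OF \<epsilon>(1)])
        finally show ?thesis using fk u by simp
      qed
      then show ?thesis using nz subm_sub[OF Ksub] by blast
    qed
  qed
qed

text \<open>A decomposition of Y provides the idempotent i p; it is zero only if A is zero, and the
  identity only if B is. That Y is nonzero rests on sincerity: otherwise g would be surjective, then
  injective, and hence bijective.\<close>

lemma cokernel_indecomposable:
  fixes X V Y :: "'a std_module"
  assumes TU: "inT U" and X: "inT X" "Tproj X" "indecomposable R X" and V: "Tproj V" and g: "mm X V g"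
    and apx: "\<And>h. mm X U h \<Longrightarrow> \<exists>t. mm V U t \<and> (\<forall>x\<in>carrier X. h x = t (g x))"
    and apxV: "\<And>h. mm X V h \<Longrightarrow> \<exists>t. mm V V t \<and> (\<forall>x\<in>carrier X. h x = t (g x))"
    and Y: "fg Y" and f: "mm V Y f" "f ` carrier V = carrier Y"
    and fk: "g ` carrier X = {u \<in> carrier V. f u = \<zero>\<^bsub>Y\<^esub>}"
    and min: "\<And>k. mm V V k \<Longrightarrow> (\<And>x. x \<in> carrier X \<Longrightarrow> k (g x) = g x) \<Longrightarrow> bij_betw k (carrier V) (carrier V)"
    and sinc: "sincere R U" and niso: "\<not> bij_betw g (carrier X) (carrier V)"
  shows "indecomposable R Y"
  unfolding indecomposable_def
proof (intro conjI ballI impI)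
  have l: "lmod X" "lmod V" "fg V" "lmod Y" using inT_fg[OF X(1)] Tproj_fg[OF V] Y by auto
  show "Y \<in> fgmod R" using Y by (simp add: fgmod_iff)
  have nz: "g ` carrier X \<noteq> carrier V"
  proof
    assume gs: "g ` carrier X = carrier V"
    have "inj_on g (carrier X)"
      using approx_surj_inj[OF TU X(1,2) V g apx sinc gs] mm_inj_iff[OF l(1,2) g] by simp
    then show False using niso gs by (simp add: bij_betw_def)
  qed
  show "\<not> zero_module Y"
  proof
    assume "zero_module Y"
    then have "f u = \<zero>\<^bsub>Y\<^esub>" if "u \<in> carrier V" for u
      using mm_closed[OF f(1) that] by (simp add: zero_module_def)
    then show False using nz fk by auto
  qed
  fix A B assume AB: "A \<in> fgmod R" "B \<in> fgmod R" and ds: "module_direct_sum R [A, B] Y"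
  have lAB: "lmod A" "lmod B" using AB by (auto simp: fgmod_iff)
  obtain i j p q where D: "mm A Y i" "mm B Y j" "mm Y A p" "mm Y B q"
    "\<And>x. x \<in> carrier A \<Longrightarrow> p (i x) = x"
    "\<And>y. y \<in> carrier B \<Longrightarrow> q (j y) = y" "\<And>y. y \<in> carrier B \<Longrightarrow> p (j y) = \<zero>\<^bsub>A\<^esub>"
    by (rule direct_sum2D[OF ds lAB l(4)]) blast
  define \<epsilon> where "\<epsilon> = (\<lambda>y. i (p y))"
  have \<epsilon>: "mm Y Y \<epsilon>" unfolding \<epsilon>_def by (rule mm_comp[OF D(3,1)])
  have \<epsilon>\<epsilon>: "\<epsilon> (\<epsilon> y) = \<epsilon> y" if "y \<in> carrier Y" for y
    using D(5)[OF mm_closed[OF D(3) that]] by (simp add: \<epsilon>_def)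
  have "(\<forall>y\<in>carrier Y. \<epsilon> y = \<zero>\<^bsub>Y\<^esub>) \<or> (\<forall>y\<in>carrier Y. \<epsilon> y = y)"
    by (rule idempotent_trivial[OF TU X V g apx apxV l(4) f fk min nz \<epsilon> \<epsilon>\<epsilon>])
  from this[unfolded \<epsilon>_def] show "zero_module A \<or> zero_module B"
  proof
    assume 1: "\<forall>y\<in>carrier Y. i (p y) = \<zero>\<^bsub>Y\<^esub>"
    have "x = \<zero>\<^bsub>A\<^esub>" if x: "x \<in> carrier A" for x
    proof -
      have "i x = \<zero>\<^bsub>Y\<^esub>" using bspec[OF 1 mm_closed[OF D(1) x]] D(5)[OF x] by simp
      then show ?thesis using D(5)[OF x] mm_zero[OF D(3) l(4) lAB(1)] by simp
    qed
    then show ?thesis using lm_zero_closed[OF lAB(1)] unfolding zero_module_def by blast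
  next
    assume 2: "\<forall>y\<in>carrier Y. i (p y) = y"
    have "y = \<zero>\<^bsub>B\<^esub>" if y: "y \<in> carrier B" for y
    proof -
      have "j y = i (p (j y))" using bspec[OF 2 mm_closed[OF D(2) y]] by simp
      also have "\<dots> = \<zero>\<^bsub>Y\<^esub>" using D(7)[OF y] mm_zero[OF D(1) lAB(1) l(4)] by simp
      finally show ?thesis using D(6)[OF y] mm_zero[OF D(4) l(4) lAB(2)] by simp
    qed
    then show ?thesis using lm_zero_closed[OF lAB(2)] unfolding zero_module_def by blast
  qed
qed

end

section \<open>Finite-dimensional algebras\<close>

lemma (in ring) fin_gen_enum:
  assumes "lmod M" "fin_gen R M"
  shows "\<exists>r v. (\<forall>j<(r::nat). v j \<in> carrier M) \<and>
    (\<forall>x\<in>carrier M. \<exists>c. (\<forall>j<r. c j \<in> carrier R) \<and> x = finsum M (\<lambda>j. c j \<odot>\<^bsub>M\<^esub> v j) {..<r})"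
proof -
  obtain S where S: "finite S" "S \<subseteq> carrier M"
    "\<And>x. x \<in> carrier M \<Longrightarrow> \<exists>c\<in>S \<rightarrow> carrier R. x = finsum M (\<lambda>s. c s \<odot>\<^bsub>M\<^esub> s) S"
    using assms(2) unfolding fin_gen_def by blast
  obtain v where v: "bij_betw v {..<card S} S"
    using ex_bij_betw_nat_finite[OF S(1)] by (auto simp: atLeast0LessThan)
  have vS: "v j \<in> S" if "j < card S" for j using v that by (auto simp: bij_betw_def)
  have "\<exists>c. (\<forall>j<card S. c j \<in> carrier R) \<and> x = finsum M (\<lambda>j. c j \<odot>\<^bsub>M\<^esub> v j) {..<card S}"
    if x: "x \<in> carrier M" for x
  proof -
    obtain c where c: "c \<in> S \<rightarrow> carrier R" "x = finsum M (\<lambda>s. c s \<odot>\<^bsub>M\<^esub> s) S" using S(3)[OF x] by blast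
    have "finsum M (\<lambda>s. c s \<odot>\<^bsub>M\<^esub> s) (v ` {..<card S}) = finsum M (\<lambda>j. c (v j) \<odot>\<^bsub>M\<^esub> v j) {..<card S}"
      by (rule abelian_monoid.finsum_reindex[OF lm_abm[OF assms(1)]])
        (use v c S(2) assms(1) in \<open>auto simp: bij_betw_def\<close>)
    moreover have "v ` {..<card S} = S" using v by (simp add: bij_betw_def)
    ultimately have "x = finsum M (\<lambda>j. c (v j) \<odot>\<^bsub>M\<^esub> v j) {..<card S}" using c(2) by simp
    then show ?thesis using c(1) vS by (intro exI[of _ "\<lambda>j. c (v j)"]) auto
  qed
  then show ?thesis using vS S(2) by (intro exI[of _ "card S"] exI[of _ v]) blast
qed

lemma (in ring) mm_eq_on_gens:
  assumes "lmod M" "lmod N" "mm M N f" "mm M N g" "finite S" "S \<subseteq> carrier M"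
    "\<And>x. x \<in> carrier M \<Longrightarrow> \<exists>c\<in>S \<rightarrow> carrier R. x = finsum M (\<lambda>s. c s \<odot>\<^bsub>M\<^esub> s) S"
    "\<And>s. s \<in> S \<Longrightarrow> f s = g s" "x \<in> carrier M"
  shows "f x = g x"
proof -
  obtain c where c: "c \<in> S \<rightarrow> carrier R" "x = finsum M (\<lambda>s. c s \<odot>\<^bsub>M\<^esub> s) S" using assms(7,9) by blast
  have cs: "c s \<in> carrier R" "s \<in> carrier M" if "s \<in> S" for s using c(1) assms(6) that by auto
  have e: "h x = finsum N (\<lambda>s. c s \<odot>\<^bsub>N\<^esub> h s) S" if "mm M N h" for h
  proof -
    have "h x = finsum N (\<lambda>s. h (c s \<odot>\<^bsub>M\<^esub> s)) S"
      unfolding c(2) by (rule module_map_finsum[OF assms(1,2) that assms(5)]) (use cs assms(1) in auto)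
    also have "\<dots> = finsum N (\<lambda>s. c s \<odot>\<^bsub>N\<^esub> h s) S"
      using cs assms(2) mm_closed[OF that] mm_smult[OF that]
      by (intro abelian_monoid.finsum_cong'[OF lm_abm[OF assms(2)]]) auto
    finally show ?thesis .
  qed
  have "finsum N (\<lambda>s. c s \<odot>\<^bsub>N\<^esub> f s) S = finsum N (\<lambda>s. c s \<odot>\<^bsub>N\<^esub> g s) S"
    using cs assms(2,8) mm_closed[OF assms(4)]
    by (intro abelian_monoid.finsum_cong'[OF lm_abm[OF assms(2)]]) auto
  then show ?thesis using e[OF assms(3)] e[OF assms(4)] by simp
qed

section \<open>Vector spaces and linear functionals\<close>

lemma (in field) finlen_reg_field: "finlen (reg_module R)"
  unfolding finlen_def
\<comment> \<open>The measure is the dimension: a nonzero subspace contains a unit and is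
  everything.\<close>
proof (intro exI[of _ "\<lambda>A. if A \<subseteq> {\<zero>} then 0 else 1"] exI[of _ 1] conjI allI impI)
  fix A B assume A: "subm A (reg_module R)" and B: "subm B (reg_module R)" and AB: "A \<subset> B"
  have z: "\<zero> \<in> A" using subm_zero[OF A] by (simp add: reg_module_def)
  have "A \<subseteq> {\<zero>}"
  proof (rule ccontr)
    assume "\<not> A \<subseteq> {\<zero>}"
    then obtain a where a: "a \<in> A" "a \<noteq> \<zero>" by auto
    then have aR: "a \<in> carrier R" using subm_in[OF A] by (auto simp: reg_module_def)
    then have au: "a \<in> Units R" using a field_Units by auto
    have "x \<in> A" if "x \<in> carrier R" for x
    proof -
      have "(x \<otimes> inv a) \<otimes> a \<in> A"
        using subm_smult[OF A _ a(1), of "x \<otimes> inv a"] that au by (simp add: reg_module_def)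
      then show ?thesis using that au aR by (simp add: m_assoc)
    qed
    then show False using AB subm_sub[OF B] by (auto simp: reg_module_def)
  qed
  moreover have "\<not> B \<subseteq> {\<zero>}" using AB z by auto
  ultimately show "(if A \<subseteq> {\<zero>} then 0 else 1) < (if B \<subseteq> {\<zero>} then 0 else 1::nat)" by simp
qed auto

text \<open>A subspace C maximal among those that contain B and avoid v has a quotient spanned by
  the class of v; the coordinate with respect to this class is the functional. Finite length takes
  the place of an extension of bases.\<close>

lemma (in field) ex_functional:
  assumes V: "lmod V" "finlen V" and B: "subm B V" and v: "v \<in> carrier V" "v \<notin> B"
  shows "\<exists>F. mm V (reg_module R) F \<and> (\<forall>x\<in>B. F x = \<zero>) \<and> F v \<noteq> \<zero>"
proof -
  obtain C where C: "subm C V" "B \<subseteq> C \<and> v \<notin> C"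
    "\<And>D. subm D V \<Longrightarrow> B \<subseteq> D \<and> v \<notin> D \<Longrightarrow> C \<subseteq> D \<Longrightarrow> D = C"
    using finlen_max[OF V(2) B, of "\<lambda>D. B \<subseteq> D \<and> v \<notin> D"] v(2) by blast
  define q where "q = qrep V C"
  define Q where "Q = quot V C"
  have q: "lmod Q" "mm V Q q" "q ` carrier V = carrier Q" "\<And>x. x \<in> carrier V \<Longrightarrow> q x = \<zero>\<^bsub>Q\<^esub> \<longleftrightarrow> x \<in> C"
    using quot[OF V(1) C(1)] by (auto simp: q_def Q_def)
  have qv: "q v \<in> carrier Q" "q v \<noteq> \<zero>\<^bsub>Q\<^esub>" using mm_closed[OF q(2) v(1)] q(4)[OF v(1)] C(2) by auto
  let ?f = "\<lambda>c. c \<odot>\<^bsub>Q\<^esub> q v"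
  have f: "mm (reg_module R) Q ?f" by (rule mm_reg[OF q(1) qv(1)])
  have inv_smult: "x = inv c \<odot>\<^bsub>Q\<^esub> (c \<odot>\<^bsub>Q\<^esub> x)" "inv c \<in> carrier R"
    if "c \<in> carrier R" "c \<noteq> \<zero>" "x \<in> carrier Q" for c x
  proof -
    have u: "c \<in> Units R" using that field_Units by auto
    then show "x = inv c \<odot>\<^bsub>Q\<^esub> (c \<odot>\<^bsub>Q\<^esub> x)" "inv c \<in> carrier R"
      using that q(1) lm_smult_assoc[OF q(1), of "inv c" c x] by auto
  qed
  have inj: "inj_on ?f (carrier (reg_module R))"
    unfolding mm_inj_iff[OF lmod_reg q(1) f]
  proof
    show "{c \<in> carrier (reg_module R). c \<odot>\<^bsub>Q\<^esub> q v = \<zero>\<^bsub>Q\<^esub>} \<subseteq> {\<zero>\<^bsub>reg_module R\<^esub>}"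
    proof
      fix c assume "c \<in> {c \<in> carrier (reg_module R). c \<odot>\<^bsub>Q\<^esub> q v = \<zero>\<^bsub>Q\<^esub>}"
      then have c: "c \<in> carrier R" "c \<odot>\<^bsub>Q\<^esub> q v = \<zero>\<^bsub>Q\<^esub>" by (auto simp: reg_module_def)
      have "c = \<zero>"
      proof (rule ccontr)
        assume "c \<noteq> \<zero>"
        from inv_smult[OF c(1) this qv(1)] show False using c(2) qv q(1) by simp
      qed
      then show "c \<in> {\<zero>\<^bsub>reg_module R\<^esub>}" by (simp add: reg_module_def)
    qed
  qed (use q(1) qv in \<open>auto simp: reg_module_def\<close>)
  have surj: "?f ` carrier (reg_module R) = carrier Q"
  proof
    show "carrier Q \<subseteq> ?f ` carrier (reg_module R)"
    proof
      fix y assume y: "y \<in> carrier Q"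
      then have "y \<in> q ` carrier V" using q(3) by simp
      then obtain w where w: "w \<in> carrier V" "y = q w" by auto
      let ?g = "\<lambda>c. c \<odot>\<^bsub>Q\<^esub> q w"
      have g: "mm (reg_module R) Q ?g" using mm_reg[OF q(1)] y w by simp
      define I where "I = ?g ` carrier (reg_module R)"
      have I: "subm I Q" unfolding I_def by (rule subm_image[OF lmod_reg q(1) g subm_carrier[OF lmod_reg]])
      \<comment> \<open>The preimage of the line through y. It contains C, so by maximality either
        it equals C and y = 0, or it contains v; then the class of v is an invertible multiple of
        y.\<close>
      define D where "D = {x \<in> carrier V. q x \<in> I}"
      have D: "subm D V" unfolding D_def by (rule subm_preimage[OF V(1) q(1,2) I])
      have CD: "C \<subseteq> D"
      proof
        fix x assume "x \<in> C"
        then show "x \<in> D" using subm_in[OF C(1)] q(4)[of x] subm_zero[OF I] by (simp add: D_def)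
      qed
      have "q w \<in> I" unfolding I_def using y w(2) q(1)
        by (intro image_eqI[of _ _ \<one>]) (auto simp: reg_module_def)
      then have wD: "w \<in> D" using w(1) by (simp add: D_def)
      show "y \<in> ?f ` carrier (reg_module R)"
      proof (cases "v \<in> D")
        case False
        then have "D = C" using C(2) CD by (intro C(3)[OF D]) auto
        then have "y = \<zero>\<^bsub>Q\<^esub>" using wD q(4) w by simp
        then show ?thesis using q(1) qv by (intro image_eqI[of _ _ \<zero>]) (auto simp: reg_module_def)
      next
        case True
        then obtain c where c: "c \<in> carrier R" "q v = c \<odot>\<^bsub>Q\<^esub> q w" by (auto simp: D_def I_def reg_module_def)
        have "c \<noteq> \<zero>" using c(2) qv y w(2) q(1) by auto
        from inv_smult[OF c(1) this y] show ?thesis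
          using c w(2) by (intro image_eqI[of _ _ "inv c"]) (auto simp: reg_module_def)
      qed
    qed
  qed (use mm_closed[OF f] in auto)
  have b: "bij_betw ?f (carrier (reg_module R)) (carrier Q)" using inj surj by (simp add: bij_betw_def)
  define h where "h = inv_into (carrier (reg_module R)) ?f"
  have h: "mm Q (reg_module R) h" unfolding h_def by (rule mm_inv[OF lmod_reg f b])
  have F: "mm V (reg_module R) (\<lambda>x. h (q x))" by (rule mm_comp[OF q(2) h])
  have "h (q v) = \<one>"
  proof -
    have "?f \<one> = q v" using q(1) qv by simp
    then show ?thesis using bij_betw_inv_into_left[OF b, of \<one>] by (simp add: h_def reg_module_def)
  qed
  moreover have "h (q x) = \<zero>" if "x \<in> B" for x
  proof -
    have "q x = \<zero>\<^bsub>Q\<^esub>" using that C(2) q(4) subm_in[OF B] by blast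
    then show ?thesis using mm_zero[OF h q(1) lmod_reg] by (simp add: reg_module_def)
  qed
  ultimately show ?thesis using F by (intro exI[of _ "\<lambda>x. h (q x)"]) auto
qed

locale fd_algebra =
  fixes K :: "('k, 'z) ring_scheme" and \<Lambda> :: "('k, 'a) module"
  assumes field_K: "field K" and ring_\<Lambda>: "ring \<Lambda>" and mod_\<Lambda>: "left_module K \<Lambda>"
    and smult_mult: "c \<in> carrier K \<Longrightarrow> a \<in> carrier \<Lambda> \<Longrightarrow> b \<in> carrier \<Lambda> \<Longrightarrow>
      (c \<odot>\<^bsub>\<Lambda>\<^esub> a) \<otimes>\<^bsub>\<Lambda>\<^esub> b = c \<odot>\<^bsub>\<Lambda>\<^esub> (a \<otimes>\<^bsub>\<Lambda>\<^esub> b)"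
    and mult_smult: "c \<in> carrier K \<Longrightarrow> a \<in> carrier \<Lambda> \<Longrightarrow> b \<in> carrier \<Lambda> \<Longrightarrow>
      a \<otimes>\<^bsub>\<Lambda>\<^esub> (c \<odot>\<^bsub>\<Lambda>\<^esub> b) = c \<odot>\<^bsub>\<Lambda>\<^esub> (a \<otimes>\<^bsub>\<Lambda>\<^esub> b)"
    and fin_\<Lambda>: "fin_gen K \<Lambda>"
begin

sublocale KF: field K by (rule field_K)
sublocale LR: ring \<Lambda> by (rule ring_\<Lambda>)

section \<open>Restriction of scalars to the base field\<close>

abbreviation sc where "sc c \<equiv> c \<odot>\<^bsub>\<Lambda>\<^esub> \<one>\<^bsub>\<Lambda>\<^esub>"

lemma sc:
  "c \<in> carrier K \<Longrightarrow> sc c \<in> carrier \<Lambda>"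
  "c \<in> carrier K \<Longrightarrow> a \<in> carrier \<Lambda> \<Longrightarrow> sc c \<otimes>\<^bsub>\<Lambda>\<^esub> a = c \<odot>\<^bsub>\<Lambda>\<^esub> a"
  "c \<in> carrier K \<Longrightarrow> a \<in> carrier \<Lambda> \<Longrightarrow> a \<otimes>\<^bsub>\<Lambda>\<^esub> sc c = c \<odot>\<^bsub>\<Lambda>\<^esub> a"
  "c \<in> carrier K \<Longrightarrow> c' \<in> carrier K \<Longrightarrow> sc (c \<oplus>\<^bsub>K\<^esub> c') = sc c \<oplus>\<^bsub>\<Lambda>\<^esub> sc c'"
  "c \<in> carrier K \<Longrightarrow> c' \<in> carrier K \<Longrightarrow> sc (c \<otimes>\<^bsub>K\<^esub> c') = sc c \<otimes>\<^bsub>\<Lambda>\<^esub> sc c'"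
  "sc \<one>\<^bsub>K\<^esub> = \<one>\<^bsub>\<Lambda>\<^esub>" "sc \<zero>\<^bsub>K\<^esub> = \<zero>\<^bsub>\<Lambda>\<^esub>"
proof -
  show "c \<in> carrier K \<Longrightarrow> c' \<in> carrier K \<Longrightarrow> sc (c \<otimes>\<^bsub>K\<^esub> c') = sc c \<otimes>\<^bsub>\<Lambda>\<^esub> sc c'"
    using mod_\<Lambda> smult_mult[of c "\<one>\<^bsub>\<Lambda>\<^esub>" "sc c'"] by (simp add: KF.lm_smult_assoc)
qed (use mod_\<Lambda> in \<open>auto simp: smult_mult mult_smult KF.lm_add_smult\<close>)

lemma central_sc: "c \<in> carrier K \<Longrightarrow> LR.central (sc c)"
  by (simp add: LR.central_def sc)

abbreviation rs where "rs M \<equiv> restrict_scalars \<Lambda> M"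

lemma rs_simps [simp]:
  "carrier (rs M) = carrier M" "zero (rs M) = zero M" "add (rs M) = add M"
  "c \<odot>\<^bsub>rs M\<^esub> x = sc c \<odot>\<^bsub>M\<^esub> x"
  by (simp_all add: restrict_scalars_def)

lemma lmod_rs:
  assumes "left_module \<Lambda> M" shows "left_module K (rs M)"
  by (rule KF.lmodI) (use assms in \<open>auto simp: sc(1,4-7) LR.lm_ac LR.lm_smult_add LR.lm_add_smult LR.lm_smult_assoc\<close>)

lemma subm_rs: "left_module \<Lambda> M \<Longrightarrow> submodule L \<Lambda> M \<Longrightarrow> submodule L K (rs M)"
  by (rule KF.submI[OF lmod_rs])
    (auto simp: LR.subm_in LR.subm_zero LR.subm_add LR.subm_smult sc)

text \<open>Submodules over \<Lambda> are subspaces over K, so the same measure serves.\<close>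

lemma finlen_rs: "left_module \<Lambda> M \<Longrightarrow> KF.finlen (rs M) \<Longrightarrow> LR.finlen M"
proof -
  assume M: "left_module \<Lambda> M" and "KF.finlen (rs M)"
  then obtain h b where h: "\<forall>A. submodule A K (rs M) \<longrightarrow> h A \<le> (b::nat)"
    "\<forall>A B. submodule A K (rs M) \<longrightarrow> submodule B K (rs M) \<longrightarrow> A \<subset> B \<longrightarrow> h A < h B"
    by (auto simp: KF.finlen_def)
  show ?thesis
    unfolding LR.finlen_def using h subm_rs[OF M] by (intro exI[of _ h] exI[of _ b]) simp
qed

lemma mm_rs: "module_map \<Lambda> M N f \<Longrightarrow> module_map K (rs M) (rs N) f"
  by (auto simp: module_map_def sc)

lemma KF_fin_gen_finlen: "left_module K V \<Longrightarrow> fin_gen K V \<Longrightarrow> KF.finlen V"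
  by (rule KF.fin_gen_finlen[OF KF.finlen_reg_field])

lemma finlen_K_reg: "KF.finlen (rs (reg_module \<Lambda>))"
proof (rule KF.finlen_surj[OF mod_\<Lambda> lmod_rs[OF LR.lmod_reg]])
  show "module_map K \<Lambda> (rs (reg_module \<Lambda>)) (\<lambda>x. x)"
    by (rule KF.mmI) (auto simp: reg_module_def sc)
  show "(\<lambda>x. x) ` carrier \<Lambda> = carrier (rs (reg_module \<Lambda>))" by (simp add: reg_module_def)
  show "KF.finlen \<Lambda>" by (rule KF_fin_gen_finlen[OF mod_\<Lambda> fin_\<Lambda>])
qed

sublocale L: artin_ring \<Lambda>
  by unfold_locales (rule finlen_rs[OF LR.lmod_reg finlen_K_reg])

text \<open>M is a quotient of a finite power of \<Lambda>, which has finite dimension over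
  K.\<close>

lemma finlen_K:
  assumes M: "L.fg M" shows "KF.finlen (rs M)"
proof -
  have fin: "fin_gen \<Lambda> M" and lM: "left_module \<Lambda> M" using L.fin_gen_iff M by auto
  obtain S where S: "finite S" "S \<subseteq> carrier M"
    "(\<lambda>c. finsum M (\<lambda>s. c s \<odot>\<^bsub>M\<^esub> s) S) ` carrier (LR.free S) = carrier M"
    using LR.fin_gen_free[OF lM fin] by blast
  let ?D = "KF.dsum S (\<lambda>_. rs (reg_module \<Lambda>))"
  have D: "left_module K ?D" "KF.finlen ?D"
    using KF.lmod_dsum[of S "\<lambda>_. rs (reg_module \<Lambda>)"] KF.finlen_dsum[OF S(1), of "\<lambda>_. rs (reg_module \<Lambda>)"]
      finlen_K_reg lmod_rs[OF LR.lmod_reg] by auto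
  have c: "carrier ?D = carrier (LR.free S)" by (simp add: KF.dsum_def LR.dsum_def)
  have "module_map \<Lambda> (LR.free S) M (\<lambda>c. finsum M (\<lambda>s. c s \<odot>\<^bsub>M\<^esub> s) S)"
    by (rule LR.mm_free[OF lM S(1)]) (use S in auto)
  from mm_rs[OF this] have m: "module_map K ?D (rs M) (\<lambda>c. finsum M (\<lambda>s. c s \<odot>\<^bsub>M\<^esub> s) S)"
    by (simp add: module_map_def KF.dsum_def LR.dsum_def)
  show ?thesis
    by (rule KF.finlen_surj[OF D(1) lmod_rs[OF lM] m _ D(2)]) (simp add: c S(3))
qed

text \<open>Evaluation at finitely many generators of M identifies Hom(M, N) with a subspace of N^S,
  which has finite dimension over K. The coefficients of a spanning family act through the image of
  K in the centre of \<Lambda>.\<close>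

lemma Hom_span:
  fixes M N :: "('a, 'x) module"
  assumes M: "L.fg M" and N: "L.fg N"
  shows "\<exists>r w. (\<forall>j<r. module_map \<Lambda> M N (w j)) \<and>
      (\<forall>k. module_map \<Lambda> M N k \<longrightarrow> (\<exists>c. (\<forall>j<r. LR.central (c j)) \<and>
        (\<forall>x\<in>carrier M. k x = finsum N (\<lambda>j. c j \<odot>\<^bsub>N\<^esub> w j x) {..<(r::nat)})))"
proof -
  have l: "left_module \<Lambda> M" "left_module \<Lambda> N" "left_module K (rs N)" "fin_gen \<Lambda> M"
    using M N lmod_rs L.fin_gen_iff by auto
  obtain S where S: "finite S" "S \<subseteq> carrier M"
    "\<And>x. x \<in> carrier M \<Longrightarrow> \<exists>c\<in>S \<rightarrow> carrier \<Lambda>. x = finsum M (\<lambda>s. c s \<odot>\<^bsub>M\<^esub> s) S"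
    using l(4) unfolding fin_gen_def by blast
  let ?V = "KF.dsum S (\<lambda>_. rs N)"
  have V: "left_module K ?V" "KF.finlen ?V"
    using KF.lmod_dsum[of S "\<lambda>_. rs N"] KF.finlen_dsum[OF S(1), of "\<lambda>_. rs N"] l finlen_K[OF N] by auto
  define ev where "ev k = (\<lambda>s\<in>S. k s)" for k :: "'x \<Rightarrow> 'x"
  define H where "H = ev ` {k. module_map \<Lambda> M N k}"
  have evV: "ev k \<in> carrier ?V" if "module_map \<Lambda> M N k" for k
    using LR.mm_closed[OF that] S(2) by (auto simp: ev_def KF.dsum_def)
  have H: "submodule H K ?V"
  proof (rule KF.submI[OF V(1)])
    show "H \<subseteq> carrier ?V" using evV by (auto simp: H_def)
    have "\<zero>\<^bsub>?V\<^esub> = ev (\<lambda>_. \<zero>\<^bsub>N\<^esub>)" by (simp add: ev_def KF.dsum_def)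
    then show "\<zero>\<^bsub>?V\<^esub> \<in> H" using LR.mm_0[OF l(2), of M] by (auto simp: H_def)
  next
    fix x y assume "x \<in> H" "y \<in> H"
    then obtain k k' where k: "module_map \<Lambda> M N k" "module_map \<Lambda> M N k'" "x = ev k" "y = ev k'"
      by (auto simp: H_def)
    have "x \<oplus>\<^bsub>?V\<^esub> y = ev (\<lambda>u. k u \<oplus>\<^bsub>N\<^esub> k' u)" using k by (auto simp: ev_def KF.dsum_def)
    then show "x \<oplus>\<^bsub>?V\<^esub> y \<in> H" using LR.mm_plus[OF l(2) k(1,2)] by (auto simp: H_def)
  next
    fix c x assume c: "c \<in> carrier K" "x \<in> H"
    then obtain k where k: "module_map \<Lambda> M N k" "x = ev k" by (auto simp: H_def)
    have "c \<odot>\<^bsub>?V\<^esub> x = ev (\<lambda>u. sc c \<odot>\<^bsub>N\<^esub> k u)" using k by (auto simp: ev_def KF.dsum_def)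
    then show "c \<odot>\<^bsub>?V\<^esub> x \<in> H"
      using LR.mm_comp[OF k(1) LR.mm_central[OF l(2) central_sc[OF c(1)]]] by (auto simp: H_def)
  qed
  let ?H = "?V\<lparr>carrier := H\<rparr>"
  have lH: "left_module K ?H" by (rule KF.lmod_sub[OF V(1) H])
  have "KF.finlen ?H"
    using KF.finlen_inj[OF lH V(1) KF.mm_sub_dom[OF KF.mm_id KF.subm_sub[OF H]]] V(2) by simp
  then have "fin_gen K ?H" by (rule KF.finlen_fin_gen[OF lH])
  then obtain r v where v: "\<forall>j<(r::nat). v j \<in> carrier ?H"
    "\<forall>x\<in>carrier ?H. \<exists>c. (\<forall>j<r. c j \<in> carrier K) \<and> x = finsum ?H (\<lambda>j. c j \<odot>\<^bsub>?H\<^esub> v j) {..<r}"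
    using KF.fin_gen_enum[OF lH] by blast
  have "\<forall>j<r. \<exists>k. module_map \<Lambda> M N k \<and> v j = ev k" using v(1) by (auto simp: H_def)
  then obtain w where w: "\<And>j. j < r \<Longrightarrow> module_map \<Lambda> M N (w j)" "\<And>j. j < r \<Longrightarrow> v j = ev (w j)" by metis
  have "\<exists>c. (\<forall>j<r. LR.central (c j)) \<and>
        (\<forall>x\<in>carrier M. k x = finsum N (\<lambda>j. c j \<odot>\<^bsub>N\<^esub> w j x) {..<r})" if k: "module_map \<Lambda> M N k" for k
  proof -
    have "ev k \<in> carrier ?H" using k by (auto simp: H_def)
    then obtain c where c: "\<forall>j<r. c j \<in> carrier K" "ev k = finsum ?H (\<lambda>j. c j \<odot>\<^bsub>?H\<^esub> v j) {..<r}"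
      using v(2) by blast
    have cH: "c j \<odot>\<^bsub>?V\<^esub> v j \<in> H" if "j < r" for j
      using KF.subm_smult[OF H, of "c j" "v j"] c(1) v(1) that by simp
    have e1: "k s = finsum N (\<lambda>j. sc (c j) \<odot>\<^bsub>N\<^esub> w j s) {..<r}" if s: "s \<in> S" for s
    proof -
      have pr: "module_map K ?H (rs N) (\<lambda>x. x s)"
        by (rule KF.mm_sub_dom[OF _ KF.subm_sub[OF H]]) (use KF.mm_dproj[OF s, of "\<lambda>_. rs N"] in simp)
      have "k s = ev k s" using s by (simp add: ev_def)
      also have "\<dots> = finsum (rs N) (\<lambda>j. (c j \<odot>\<^bsub>?H\<^esub> v j) s) {..<r}"
        unfolding c(2) by (rule module_map_finsum[OF lH l(3) pr]) (use cH in auto)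
      also have "\<dots> = finsum (rs N) (\<lambda>j. sc (c j) \<odot>\<^bsub>N\<^esub> w j s) {..<r}"
        using s w(2) LR.mm_closed[OF w(1)] S(2) l(2) c(1) sc(1)
        by (intro abelian_monoid.finsum_cong'[OF KF.lm_abm[OF l(3)]]) (auto simp: KF.dsum_def ev_def)
      also have "\<dots> = finsum N (\<lambda>j. sc (c j) \<odot>\<^bsub>N\<^esub> w j s) {..<r}"
        by (simp add: finsum_def finprod_def restrict_scalars_def)
      finally show ?thesis .
    qed
    have m: "module_map \<Lambda> M N (\<lambda>x. finsum N (\<lambda>j. sc (c j) \<odot>\<^bsub>N\<^esub> w j x) {..<r})"
    proof (rule LR.mm_finsum[OF l(1,2) finite_lessThan])
      fix j assume "j \<in> {..<r}"
      then show "module_map \<Lambda> M N (\<lambda>x. sc (c j) \<odot>\<^bsub>N\<^esub> w j x)"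
        using LR.mm_comp[OF w(1) LR.mm_central[OF l(2) central_sc]] c(1) by simp
    qed
    have "k x = finsum N (\<lambda>j. sc (c j) \<odot>\<^bsub>N\<^esub> w j x) {..<r}" if "x \<in> carrier M" for x
      by (rule LR.mm_eq_on_gens[OF l(1,2) k m S e1 that])
    then show ?thesis using c(1) central_sc by (intro exI[of _ "\<lambda>j. sc (c j)"]) auto
  qed
  then show ?thesis using w(1) by blast
qed

end

section \<open>The Auslander--Reiten translation\<close>

lemma op_ring_simps [simp]:
  "carrier (op_ring A) = carrier A" "one (op_ring A) = one A" "zero (op_ring A) = zero A"
  "add (op_ring A) = add A" "x \<otimes>\<^bsub>op_ring A\<^esub> y = y \<otimes>\<^bsub>A\<^esub> x"
  by (simp_all add: op_ring_def)

lemma op_ring_smult [simp]: "smult (op_ring (A :: ('k, 'a) module)) = smult A"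
  by (simp add: op_ring_def)

lemma reg_op_simps:
  "carrier (reg_module A) = carrier A" "zero (reg_module A) = zero A" "add (reg_module A) = add A"
  "a \<odot>\<^bsub>reg_module A\<^esub> x = a \<otimes>\<^bsub>A\<^esub> x"
  by (simp_all add: reg_module_def)

lemma finsum_same:
  assumes "carrier A = carrier B" "zero A = zero B" "add A = add B"
  shows "finsum A f I = finsum B f I"
  using assms by (simp add: finsum_def finprod_def)

lemma ring_op: assumes "ring A" shows "ring (op_ring A)"
proof -
  interpret A: ring A by fact
  show ?thesis
  proof (rule ringI)
    show "abelian_group (op_ring A)"
    proof (rule abelian_groupI)
      fix x assume "x \<in> carrier (op_ring A)"
      then show "\<exists>y\<in>carrier (op_ring A). y \<oplus>\<^bsub>op_ring A\<^esub> x = \<zero>\<^bsub>op_ring A\<^esub>"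
        by (intro bexI[of _ "\<ominus>\<^bsub>A\<^esub> x"]) (auto simp: A.l_neg)
    qed (auto simp: A.a_ac)
    show "monoid (op_ring A)" by (rule monoidI) (auto simp: A.m_assoc)
  qed (auto simp: A.l_distr A.r_distr)
qed

context fd_algebra
begin

text \<open>Transposes are right modules. Treating the opposite algebra as a second instance of the
  locale makes the theory of left modules available for them.\<close>

lemma fd_algebra_op: "fd_algebra K (op_ring \<Lambda>)"
proof (rule fd_algebra.intro)
  show "field K" by (rule field_K)
  show "ring (op_ring \<Lambda>)" by (rule ring_op[OF ring_\<Lambda>])
  show l: "left_module K (op_ring \<Lambda>)"
    by (rule KF.lmodI) (use mod_\<Lambda> in \<open>auto simp: KF.lm_assoc KF.lm_smult_add KF.lm_add_smult KF.lm_smult_assoc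
      intro: KF.lm_comm\<close>)
  have "module_map K \<Lambda> (op_ring \<Lambda>) (\<lambda>x. x)" by (simp add: module_map_def)
  then show "fin_gen K (op_ring \<Lambda>)" using KF.fin_gen_surj[OF mod_\<Lambda> l fin_\<Lambda>] by simp
qed (auto simp: smult_mult mult_smult)

interpretation O: fd_algebra K "op_ring \<Lambda>" by (rule fd_algebra_op)

subsection \<open>Duals of modules\<close>

lemma star_simps:
  fixes P :: "('a, 'x) module"
  shows
  "h \<in> carrier (star \<Lambda> P) \<longleftrightarrow> h \<in> extensional (carrier P) \<and> module_map \<Lambda> P (reg_module \<Lambda>) h"
  "zero (star \<Lambda> P) = (\<lambda>x\<in>carrier P. \<zero>\<^bsub>\<Lambda>\<^esub>)"
  "f \<oplus>\<^bsub>star \<Lambda> P\<^esub> g = (\<lambda>x\<in>carrier P. f x \<oplus>\<^bsub>\<Lambda>\<^esub> g x)"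
  "a \<odot>\<^bsub>star \<Lambda> P\<^esub> f = (\<lambda>x\<in>carrier P. f x \<otimes>\<^bsub>\<Lambda>\<^esub> a)"
  by (simp_all add: star_def)

lemma mm_restrict:
  fixes P :: "('a, 'x) module" and N :: "('a, 'y) module"
  shows "left_module \<Lambda> P \<Longrightarrow> module_map \<Lambda> P N (\<lambda>x\<in>carrier P. f x) \<longleftrightarrow> module_map \<Lambda> P N f"
  by (rule LR.mm_cong) auto

lemma star_val:
  fixes P :: "('a, 'x) module"
  shows "h \<in> carrier (star \<Lambda> P) \<Longrightarrow> x \<in> carrier P \<Longrightarrow> h x \<in> carrier \<Lambda>"
  using L.reg_in unfolding star_simps by (auto simp: module_map_def reg_module_def)

lemma star_eqI:
  fixes P :: "('a, 'x) module"
  shows "h \<in> carrier (star \<Lambda> P) \<Longrightarrow> h' \<in> carrier (star \<Lambda> P) \<Longrightarrow>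
    (\<And>x. x \<in> carrier P \<Longrightarrow> h x = h' x) \<Longrightarrow> h = h'"
  unfolding star_simps by (auto intro: extensionalityI)

lemma lmod_star:
  fixes P :: "('a, 'x) module"
  assumes P: "left_module \<Lambda> P" shows "left_module (op_ring \<Lambda>) (star \<Lambda> P)"
proof (rule O.LR.lmodI)
  show "\<zero>\<^bsub>star \<Lambda> P\<^esub> \<in> carrier (star \<Lambda> P)"
    using LR.mm_0[OF LR.lmod_reg, of P] by (simp add: star_simps mm_restrict[OF P] reg_op_simps)
  show "f \<oplus>\<^bsub>star \<Lambda> P\<^esub> g \<in> carrier (star \<Lambda> P)"
    if "f \<in> carrier (star \<Lambda> P)" "g \<in> carrier (star \<Lambda> P)" for f g
    using LR.mm_plus[OF LR.lmod_reg, of P f g] that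
    by (simp add: star_simps mm_restrict[OF P] reg_op_simps)
  show "a \<odot>\<^bsub>star \<Lambda> P\<^esub> f \<in> carrier (star \<Lambda> P)"
    if a: "a \<in> carrier (op_ring \<Lambda>)" and f: "f \<in> carrier (star \<Lambda> P)" for a f
  proof -
    have f': "module_map \<Lambda> P (reg_module \<Lambda>) f" using f by (simp add: star_simps)
    have "module_map \<Lambda> P (reg_module \<Lambda>) (\<lambda>x. f x \<otimes>\<^bsub>\<Lambda>\<^esub> a)"
    proof (rule LR.mmI)
      show "f x \<otimes>\<^bsub>\<Lambda>\<^esub> a \<in> carrier (reg_module \<Lambda>)" if "x \<in> carrier P" for x
        using star_val[OF f that] a by (simp add: reg_op_simps)
    qed (use a P LR.mm_add[OF f'] LR.mm_smult[OF f'] star_val[OF f] in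
        \<open>auto simp: reg_op_simps LR.l_distr LR.m_assoc\<close>)
    then show ?thesis by (simp add: star_simps mm_restrict[OF P])
  qed
qed (auto simp: star_simps(2-4) LR.a_ac LR.r_distr LR.l_distr LR.m_assoc star_val fun_eq_iff restrict_def
    dest: star_val, auto simp: star_simps extensional_def)

lemma star_ev:
  fixes P :: "('a, 'x) module"
  assumes "x \<in> carrier P"
  shows "module_map (op_ring \<Lambda>) (star \<Lambda> P) (reg_module (op_ring \<Lambda>)) (\<lambda>h. h x)"
  by (rule O.LR.mmI) (use assms in \<open>auto simp: star_simps(2-4) reg_op_simps star_val\<close>)

text \<open>The coordinate functionals of a dual basis generate the dual of P, and the coefficient
  of h at \<open>y s\<close> is the value h s.\<close>

lemma star_basis:
  assumes P: "projective \<Lambda> P" and S: "finite S" "S \<subseteq> carrier P"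
    "\<And>s. s \<in> S \<Longrightarrow> module_map \<Lambda> P (reg_module \<Lambda>) (y s)"
    "\<And>x. x \<in> carrier P \<Longrightarrow> finsum P (\<lambda>s. y s x \<odot>\<^bsub>P\<^esub> s) S = x"
    and h: "h \<in> carrier (star \<Lambda> P)"
  shows "finsum (star \<Lambda> P) (\<lambda>s. h s \<odot>\<^bsub>star \<Lambda> P\<^esub> restrict (y s) (carrier P)) S = h"
proof -
  have lP: "left_module \<Lambda> P" using L.projective_fg[OF P] by simp
  have hm: "module_map \<Lambda> P (reg_module \<Lambda>) h" using h unfolding star_simps by (rule conjunct2)
  note lS = lmod_star[OF lP]
  have ys: "restrict (y s) (carrier P) \<in> carrier (star \<Lambda> P)" if "s \<in> S" for s
    using S(3)[OF that] by (simp add: star_simps mm_restrict[OF lP])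
  have hs: "h s \<in> carrier (op_ring \<Lambda>)" if "s \<in> S" for s using star_val[OF h] S(2) that by auto
  have t: "h s \<odot>\<^bsub>star \<Lambda> P\<^esub> restrict (y s) (carrier P) \<in> carrier (star \<Lambda> P)" if "s \<in> S" for s
    by (rule O.LR.lm_smult_closed[OF lS hs[OF that] ys[OF that]])
  have fc: "finsum (star \<Lambda> P) (\<lambda>s. h s \<odot>\<^bsub>star \<Lambda> P\<^esub> restrict (y s) (carrier P)) S \<in> carrier (star \<Lambda> P)"
    by (rule abelian_monoid.finsum_closed[OF O.LR.lm_abm[OF lS]]) (use t in auto)
  show ?thesis
  proof (rule star_eqI[OF fc h])
    fix x assume x: "x \<in> carrier P"
    have "finsum (star \<Lambda> P) (\<lambda>s. h s \<odot>\<^bsub>star \<Lambda> P\<^esub> restrict (y s) (carrier P)) S x =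
        finsum (reg_module (op_ring \<Lambda>)) (\<lambda>s. (h s \<odot>\<^bsub>star \<Lambda> P\<^esub> restrict (y s) (carrier P)) x) S"
      by (rule module_map_finsum[OF lS O.LR.lmod_reg star_ev[OF x] S(1)]) (use t in auto)
    also have "\<dots> = finsum (reg_module \<Lambda>) (\<lambda>s. (h s \<odot>\<^bsub>star \<Lambda> P\<^esub> restrict (y s) (carrier P)) x) S"
      by (rule finsum_same) (simp_all add: reg_op_simps)
    also have "\<dots> = finsum (reg_module \<Lambda>) (\<lambda>s. y s x \<odot>\<^bsub>reg_module \<Lambda>\<^esub> h s) S"
      using x L.reg_in[OF S(3) x] star_val[OF h] S(2)
      by (intro abelian_monoid.finsum_cong'[OF LR.lm_abm[OF LR.lmod_reg]])
        (auto simp: star_simps(4) reg_op_simps)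
    also have "\<dots> = h x"
      by (rule L.basis_expand[OF lP LR.lmod_reg S hm x, symmetric])
    finally show "finsum (star \<Lambda> P) (\<lambda>s. h s \<odot>\<^bsub>star \<Lambda> P\<^esub> restrict (y s) (carrier P)) S x = h x" .
  qed
qed

text \<open>By \<open>star_basis\<close> finitely many coordinate functionals suffice. Hence
  cokernels of maps between such duals, in particular transposes, are finitely generated.\<close>

lemma fg_star:
  assumes P: "projective \<Lambda> P" shows "O.L.fg (star \<Lambda> P)"
proof -
  have lP: "left_module \<Lambda> P" using L.projective_fg[OF P] by simp
  note lS = lmod_star[OF lP]
  obtain S y where S: "finite S" "S \<subseteq> carrier P"
    "\<And>s. s \<in> S \<Longrightarrow> module_map \<Lambda> P (reg_module \<Lambda>) (y s)"
    "\<And>x. x \<in> carrier P \<Longrightarrow> finsum P (\<lambda>s. y s x \<odot>\<^bsub>P\<^esub> s) S = x"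
    using L.projective_basis[OF P] by blast
  let ?v = "\<lambda>s. restrict (y s) (carrier P)"
  have v: "?v s \<in> carrier (star \<Lambda> P)" if "s \<in> S" for s
    using S(3)[OF that] by (simp add: star_simps mm_restrict[OF lP])
  define F where "F = (\<lambda>c. finsum (star \<Lambda> P) (\<lambda>s. c s \<odot>\<^bsub>star \<Lambda> P\<^esub> ?v s) S)"
  have f: "module_map (op_ring \<Lambda>) (O.LR.free S) (star \<Lambda> P) F" unfolding F_def by (rule O.LR.mm_free[OF lS S(1) v])
  have "F ` carrier (O.LR.free S) = carrier (star \<Lambda> P)"
  proof
    show "carrier (star \<Lambda> P) \<subseteq> F ` carrier (O.LR.free S)"
    proof
      fix h assume h: "h \<in> carrier (star \<Lambda> P)"
      have r: "restrict h S \<in> carrier (O.LR.free S)"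
        using star_val[OF h] S(2) by (auto simp: O.LR.free_in)
      have "F (restrict h S) = finsum (star \<Lambda> P) (\<lambda>s. h s \<odot>\<^bsub>star \<Lambda> P\<^esub> ?v s) S"
        unfolding F_def using O.LR.lm_smult_closed[OF lS _ v] star_val[OF h] S(2)
        by (intro abelian_monoid.finsum_cong'[OF O.LR.lm_abm[OF lS]]) auto
      also have "\<dots> = h" by (rule star_basis[OF P S h])
      finally show "h \<in> F ` carrier (O.LR.free S)" using r by (metis image_eqI)
    qed
  qed (use O.LR.mm_closed[OF f] in auto)
  from this show ?thesis by (rule O.L.fg_image[OF O.L.fg_free[OF S(1)] lS f])
qed

lemma mm_star_comp:
  fixes P Q :: "('a, 'x) module"
  assumes l: "left_module \<Lambda> P" "left_module \<Lambda> Q" and d: "module_map \<Lambda> P Q d"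
  shows "module_map (op_ring \<Lambda>) (star \<Lambda> Q) (star \<Lambda> P) (\<lambda>h. \<lambda>x\<in>carrier P. h (d x))"
proof (rule O.LR.mmI)
  show "(\<lambda>x\<in>carrier P. h (d x)) \<in> carrier (star \<Lambda> P)" if "h \<in> carrier (star \<Lambda> Q)" for h
    using that LR.mm_comp[OF d, of "reg_module \<Lambda>" h] by (simp add: star_simps mm_restrict[OF l(1)])
qed (use LR.mm_closed[OF d] in \<open>auto simp: star_simps(2-4) fun_eq_iff restrict_def\<close>)

subsection \<open>Vector space duals\<close>

lemma rs_op: "O.rs M = rs M" by (simp add: restrict_scalars_def)

lemma dual_simps:
  fixes Q :: "('a, 'x) module"
  shows "f \<in> carrier (dual_module K \<Lambda> Q) \<longleftrightarrow>
      f \<in> extensional (carrier Q) \<and> module_map K (O.rs Q) (reg_module K) f"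
    "zero (dual_module K \<Lambda> Q) = (\<lambda>x\<in>carrier Q. \<zero>\<^bsub>K\<^esub>)"
    "f \<oplus>\<^bsub>dual_module K \<Lambda> Q\<^esub> g = (\<lambda>x\<in>carrier Q. f x \<oplus>\<^bsub>K\<^esub> g x)"
    "a \<odot>\<^bsub>dual_module K \<Lambda> Q\<^esub> f = (\<lambda>x\<in>carrier Q. f (a \<odot>\<^bsub>Q\<^esub> x))"
  by (simp_all add: dual_module_def Let_def dual_space_def)

lemma mm_restrict_K:
  fixes Q :: "('a, 'x) module" and N :: "('k, 'y) module"
  assumes "left_module (op_ring \<Lambda>) Q"
  shows "module_map K (O.rs Q) N (\<lambda>x\<in>carrier Q. f x) \<longleftrightarrow> module_map K (O.rs Q) N f"
  by (rule KF.mm_cong[OF O.lmod_rs[OF assms]]) simp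

lemma dual_val:
  fixes Q :: "('a, 'x) module"
  shows "f \<in> carrier (dual_module K \<Lambda> Q) \<Longrightarrow> x \<in> carrier Q \<Longrightarrow> f x \<in> carrier K"
  unfolding dual_simps by (auto simp: module_map_def reg_module_def)

text \<open>Scalars from K are central in \<Lambda>, so the two orders of multiplication by a and by
  a scalar agree. This makes the functional x \<mapsto> f (a x) linear and gives the dual its
  \<Lambda>-action.\<close>

lemma mm_action:
  fixes Q :: "('a, 'x) module"
  assumes Q: "left_module (op_ring \<Lambda>) Q" and a: "a \<in> carrier \<Lambda>"
  shows "module_map K (O.rs Q) (O.rs Q) (\<lambda>x. a \<odot>\<^bsub>Q\<^esub> x)"
proof (rule KF.mmI)
  fix c x assume c: "c \<in> carrier K" "x \<in> carrier (O.rs Q)"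
  have "a \<odot>\<^bsub>Q\<^esub> (sc c \<odot>\<^bsub>Q\<^esub> x) = (sc c \<otimes>\<^bsub>\<Lambda>\<^esub> a) \<odot>\<^bsub>Q\<^esub> x"
    using O.LR.lm_smult_assoc[OF Q, of a "sc c" x] a c sc(1) by simp
  also have "\<dots> = (a \<otimes>\<^bsub>\<Lambda>\<^esub> sc c) \<odot>\<^bsub>Q\<^esub> x" using a c by (simp add: sc)
  also have "\<dots> = sc c \<odot>\<^bsub>Q\<^esub> (a \<odot>\<^bsub>Q\<^esub> x)"
    using O.LR.lm_smult_assoc[OF Q, of "sc c" a x] a c sc(1) by simp
  finally show "a \<odot>\<^bsub>Q\<^esub> (c \<odot>\<^bsub>O.rs Q\<^esub> x) = c \<odot>\<^bsub>O.rs Q\<^esub> (a \<odot>\<^bsub>Q\<^esub> x)" by simp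
qed (use Q a O.LR.lm_smult_closed[OF Q] O.LR.lm_smult_add[OF Q] in auto)

lemma lmod_dual:
  fixes Q :: "('a, 'x) module"
  assumes Q: "left_module (op_ring \<Lambda>) Q" shows "left_module \<Lambda> (dual_module K \<Lambda> Q)"
proof (rule LR.lmodI)
  let ?D = "dual_module K \<Lambda> Q"
  note rK = KF.lmod_reg
  have Qc: "a \<odot>\<^bsub>Q\<^esub> x \<in> carrier Q" if "a \<in> carrier \<Lambda>" "x \<in> carrier Q" for a x
    using O.LR.lm_smult_closed[OF Q] that by simp
  show "\<zero>\<^bsub>?D\<^esub> \<in> carrier ?D"
    using KF.mm_0[OF rK, of "O.rs Q"] by (simp add: dual_simps mm_restrict_K[OF Q] reg_op_simps)
  show "f \<oplus>\<^bsub>?D\<^esub> g \<in> carrier ?D" if "f \<in> carrier ?D" "g \<in> carrier ?D" for f g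
    using KF.mm_plus[OF rK, of "O.rs Q" f g] that
    by (simp add: dual_simps mm_restrict_K[OF Q] reg_op_simps)
  show "a \<odot>\<^bsub>?D\<^esub> f \<in> carrier ?D" if "a \<in> carrier \<Lambda>" "f \<in> carrier ?D" for a f
    using KF.mm_comp[OF mm_action[OF Q that(1)], of "reg_module K" f] that(2)
    by (simp add: dual_simps mm_restrict_K[OF Q])
  show "(a \<oplus>\<^bsub>\<Lambda>\<^esub> b) \<odot>\<^bsub>?D\<^esub> f = a \<odot>\<^bsub>?D\<^esub> f \<oplus>\<^bsub>?D\<^esub> b \<odot>\<^bsub>?D\<^esub> f"
    if "a \<in> carrier \<Lambda>" "b \<in> carrier \<Lambda>" "f \<in> carrier ?D" for a b f
  proof -
    have f: "module_map K (O.rs Q) (reg_module K) f" using that(3) by (simp add: dual_simps)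
    have "f ((a \<oplus>\<^bsub>\<Lambda>\<^esub> b) \<odot>\<^bsub>Q\<^esub> x) = f (a \<odot>\<^bsub>Q\<^esub> x) \<oplus>\<^bsub>K\<^esub> f (b \<odot>\<^bsub>Q\<^esub> x)" if x: "x \<in> carrier Q" for x
      using KF.mm_add[OF f, of "a \<odot>\<^bsub>Q\<^esub> x" "b \<odot>\<^bsub>Q\<^esub> x"] Qc x \<open>a \<in> carrier \<Lambda>\<close> \<open>b \<in> carrier \<Lambda>\<close>
        O.LR.lm_add_smult[OF Q, of a b x] by (simp add: reg_op_simps)
    then show ?thesis by (simp add: dual_simps(2-4) cong: restrict_cong)
  qed
  show "(a \<otimes>\<^bsub>\<Lambda>\<^esub> b) \<odot>\<^bsub>?D\<^esub> f = a \<odot>\<^bsub>?D\<^esub> (b \<odot>\<^bsub>?D\<^esub> f)"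
    if "a \<in> carrier \<Lambda>" "b \<in> carrier \<Lambda>" "f \<in> carrier ?D" for a b f
    using that Qc O.LR.lm_smult_assoc[OF Q, of b a] by (simp add: dual_simps(2-4) cong: restrict_cong)
  show "a \<odot>\<^bsub>?D\<^esub> (f \<oplus>\<^bsub>?D\<^esub> g) = a \<odot>\<^bsub>?D\<^esub> f \<oplus>\<^bsub>?D\<^esub> a \<odot>\<^bsub>?D\<^esub> g"
    if "a \<in> carrier \<Lambda>" "f \<in> carrier ?D" "g \<in> carrier ?D" for a f g
    using that Qc by (simp add: dual_simps(2-4) cong: restrict_cong)
  fix f assume f: "f \<in> carrier ?D"
  then have fx: "f \<in> extensional (carrier Q)" and fm: "module_map K (O.rs Q) (reg_module K) f"
    by (simp_all add: dual_simps)
  show "\<zero>\<^bsub>?D\<^esub> \<oplus>\<^bsub>?D\<^esub> f = f" using fx dual_val[OF f]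
    by (auto simp: dual_simps(2-4) intro!: extensionalityI[OF _ fx])
  show "\<one>\<^bsub>\<Lambda>\<^esub> \<odot>\<^bsub>?D\<^esub> f = f" using fx O.LR.lm_one[OF Q]
    by (auto simp: dual_simps(2-4) intro!: extensionalityI[OF _ fx])
  show "\<zero>\<^bsub>\<Lambda>\<^esub> \<odot>\<^bsub>?D\<^esub> f = \<zero>\<^bsub>?D\<^esub>"
    using O.LR.lm_zero_smult[OF Q] KF.mm_zero[OF fm O.lmod_rs[OF Q] rK]
    by (auto simp: dual_simps(2-4) reg_op_simps intro!: restrict_ext)
  fix g assume g: "g \<in> carrier ?D"
  show "f \<oplus>\<^bsub>?D\<^esub> g = g \<oplus>\<^bsub>?D\<^esub> f"
    using dual_val[OF f] dual_val[OF g] by (auto simp: dual_simps(2-4) KF.a_comm intro!: restrict_ext)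
  fix h assume h: "h \<in> carrier ?D"
  show "f \<oplus>\<^bsub>?D\<^esub> g \<oplus>\<^bsub>?D\<^esub> h = f \<oplus>\<^bsub>?D\<^esub> (g \<oplus>\<^bsub>?D\<^esub> h)"
    using dual_val[OF f] dual_val[OF g] dual_val[OF h]
    by (auto simp: dual_simps(2-4) KF.a_assoc intro!: restrict_ext)
qed

text \<open>A functional is determined by its values on a finite K-generating set G, so the dual
  embeds into K^G; finite length over K gives finite length over \<Lambda>.\<close>

lemma fg_dual:
  fixes Q :: "('a, 'x) module"
  assumes Q: "O.L.fg Q" shows "L.fg (dual_module K \<Lambda> Q)"
proof -
  let ?D = "dual_module K \<Lambda> Q"
  have lQ: "left_module (op_ring \<Lambda>) Q" using Q by simp
  note lD = lmod_dual[OF lQ]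
  note rQ = O.lmod_rs[OF lQ]
  have "fin_gen K (O.rs Q)" by (rule KF.finlen_fin_gen[OF rQ O.finlen_K[OF Q]])
  then obtain G where G: "finite G" "G \<subseteq> carrier (O.rs Q)"
    "\<And>x. x \<in> carrier (O.rs Q) \<Longrightarrow> \<exists>c\<in>G \<rightarrow> carrier K. x = finsum (O.rs Q) (\<lambda>s. c s \<odot>\<^bsub>O.rs Q\<^esub> s) G"
    unfolding fin_gen_def by blast
  have GQ: "s \<in> carrier Q" if "s \<in> G" for s using G(2) that by auto
  let ?F = "KF.free G"
  have F: "left_module K ?F" "KF.finlen ?F"
    using KF.lmod_free KF.finlen_dsum[OF G(1), of "\<lambda>_. reg_module K"] KF.lmod_reg KF.finlen_reg_field by auto
  let ?ev = "\<lambda>f. \<lambda>s\<in>G. f s"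
  have ev: "module_map K (rs ?D) ?F ?ev"
  proof (rule KF.mm_dtuple)
    fix s assume s: "s \<in> G"
    show "module_map K (rs ?D) (reg_module K) (\<lambda>f. f s)"
    proof (rule KF.mmI)
      fix c f assume c: "c \<in> carrier K" and f: "f \<in> carrier (rs ?D)"
      have fm: "module_map K (O.rs Q) (reg_module K) f" using f by (simp add: dual_simps)
      show "(c \<odot>\<^bsub>rs ?D\<^esub> f) s = c \<odot>\<^bsub>reg_module K\<^esub> f s"
        using KF.mm_smult[OF fm c, of s] GQ[OF s] by (simp add: dual_simps(4))
    qed (use GQ[OF s] dual_val in \<open>auto simp: dual_simps(3) reg_op_simps\<close>)
  qed
  have inj: "inj_on ?ev (carrier (rs ?D))"
  proof (rule inj_onI)
    fix f g assume f: "f \<in> carrier (rs ?D)" and g: "g \<in> carrier (rs ?D)" and eq: "?ev f = ?ev g"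
    have fg: "module_map K (O.rs Q) (reg_module K) f" "module_map K (O.rs Q) (reg_module K) g"
      "f \<in> extensional (carrier Q)" "g \<in> extensional (carrier Q)" using f g by (simp_all add: dual_simps)
    have "f s = g s" if "s \<in> G" for s using fun_cong[OF eq, of s] that by simp
    then have "f x = g x" if "x \<in> carrier (O.rs Q)" for x
      using KF.mm_eq_on_gens[OF rQ KF.lmod_reg fg(1,2) G _ that] by blast
    then show "f = g" using fg(3,4) by (auto intro: extensionalityI)
  qed
  have "KF.finlen (rs ?D)" by (rule KF.finlen_inj[OF lmod_rs[OF lD] F(1) ev inj F(2)])
  then show ?thesis using finlen_rs[OF lD] lD by simp
qed

end

text \<open>Summation over J is a homomorphism from the power M^J to M and therefore commutes with
  the sum over I, which is formed componentwise.\<close>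

lemma (in ring) finsum_swap:
  assumes M: "lmod M" and I: "finite I" and J: "finite J"
    and f: "\<And>i j. i \<in> I \<Longrightarrow> j \<in> J \<Longrightarrow> f i j \<in> carrier M"
  shows "finsum M (\<lambda>i. finsum M (f i) J) I = finsum M (\<lambda>j. finsum M (\<lambda>i. f i j) I) J"
proof -
  let ?D = "dsum J (\<lambda>_. M)"
  have D: "lmod ?D" using M by (rule lmod_dsum)
  let ?s = "\<lambda>x. finsum M x J"
  have s: "mm ?D M ?s" using mm_dcopair[OF J M, of "\<lambda>_. M" "\<lambda>_ x. x"] M mm_id by auto
  let ?w = "\<lambda>i. restrict (f i) J"
  have w: "?w \<in> I \<rightarrow> carrier ?D" using f by (auto simp: dsum_def)
  note fc = abelian_monoid.finsum_cong'[OF lm_abm[OF M] refl]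
  have "finsum M (\<lambda>i. finsum M (f i) J) I = finsum M (\<lambda>i. ?s (?w i)) I"
    using f by (intro fc) (auto intro!: fc abelian_monoid.finsum_closed[OF lm_abm[OF M]])
  also have "\<dots> = ?s (finsum ?D ?w I)" by (rule module_map_finsum[OF D M s I w, symmetric])
  also have "\<dots> = finsum M (\<lambda>j. finsum M (\<lambda>i. f i j) I) J"
  proof (rule fc)
    fix j assume j: "j \<in> J"
    have "finsum ?D ?w I j = finsum M (\<lambda>i. ?w i j) I" using dsum_finsum[OF J _ I w j] M by simp
    also have "\<dots> = finsum M (\<lambda>i. f i j) I" using f j by (intro fc) auto
    finally show "finsum ?D ?w I j = finsum M (\<lambda>i. f i j) I" .
  next
    show "(\<lambda>j. finsum M (\<lambda>i. f i j) I) \<in> J \<rightarrow> carrier M"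
      using f by (auto intro!: abelian_monoid.finsum_closed[OF lm_abm[OF M]])
  qed
  finally show ?thesis .
qed

section \<open>Vanishing of Hom into the dual of a transpose\<close>

lemma hom_vanishesD:
  "hom_vanishes R M N \<Longrightarrow> module_map R M N f \<Longrightarrow> x \<in> carrier M \<Longrightarrow> f x = \<zero>\<^bsub>N\<^esub>"
  by (auto simp: hom_vanishes_def)

context fd_algebra
begin

interpretation O: fd_algebra K "op_ring \<Lambda>" by (rule fd_algebra_op)

text \<open>If \<open>Q\<close> is the cokernel of \<open>d\<^sup>*\<close>, then \<open>Hom(N, Q\<^sup>\<or>)\<close> is dual to \<open>Q \<otimes> N\<close>, which is the cokernel of
  \<open>Hom(P0, N) \<rightarrow> Hom(P1, N)\<close>. Both directions are proved with dual bases, which avoids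
  tensor products.\<close>

lemma extend_imp_vanish:
  fixes N :: "('a, 'x) module"
  assumes P1: "projective \<Lambda> P1" and P0: "projective \<Lambda> P0" and d: "module_map \<Lambda> P1 P0 d"
    and Q: "left_module (op_ring \<Lambda>) Q"
    and \<pi>: "module_map (op_ring \<Lambda>) (star \<Lambda> P1) Q \<pi>" "\<pi> ` carrier (star \<Lambda> P1) = carrier Q"
    and \<pi>d: "\<And>z. z \<in> carrier (star \<Lambda> P0) \<Longrightarrow> \<pi> (\<lambda>x\<in>carrier P1. z (d x)) = \<zero>\<^bsub>Q\<^esub>"
    and N: "left_module \<Lambda> N"
    and ext: "\<And>k. module_map \<Lambda> P1 N k \<Longrightarrow>
      \<exists>k'. module_map \<Lambda> P0 N k' \<and> (\<forall>x\<in>carrier P1. k' (d x) = k x)"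
  shows "hom_vanishes \<Lambda> N (dual_module K \<Lambda> Q)"
  unfolding hom_vanishes_def
proof (intro allI impI ballI)
  fix \<phi> n assume \<phi>: "module_map \<Lambda> N (dual_module K \<Lambda> Q) \<phi>" and n: "n \<in> carrier N"
  let ?D = "dual_module K \<Lambda> Q"
  have l: "left_module \<Lambda> P1" "left_module \<Lambda> P0" "left_module \<Lambda> ?D"
    using L.projective_fg[OF P1] L.projective_fg[OF P0] lmod_dual[OF Q] by auto
  note lS1 = lmod_star[OF l(1)]
  note rQ = O.lmod_rs[OF Q]
  have \<phi>c: "\<phi> m \<in> carrier ?D" if "m \<in> carrier N" for m by (rule LR.mm_closed[OF \<phi> that])
  have \<phi>m: "module_map K (O.rs Q) (reg_module K) (\<phi> m)" if "m \<in> carrier N" for m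
    using \<phi>c[OF that] unfolding dual_simps by (rule conjunct2)
  have \<phi>v: "\<phi> m q \<in> carrier K" if "m \<in> carrier N" "q \<in> carrier Q" for m q
    using dual_val[OF \<phi>c] that by blast
  \<comment> \<open>The balancing relation: (m, q) \<mapsto> \<phi> m q is a pairing of N with the
    right module Q along which \<Lambda> can be moved from one side to the other.\<close>
  have \<phi>s: "\<phi> m (a \<odot>\<^bsub>Q\<^esub> q) = \<phi> (a \<odot>\<^bsub>N\<^esub> m) q" if "m \<in> carrier N" "a \<in> carrier \<Lambda>" "q \<in> carrier Q" for m a q
    using LR.mm_smult[OF \<phi> that(2,1)] that(3) by (simp add: dual_simps(4))
  obtain S y where S: "finite S" "S \<subseteq> carrier P1"
    "\<And>s. s \<in> S \<Longrightarrow> module_map \<Lambda> P1 (reg_module \<Lambda>) (y s)"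
    "\<And>x. x \<in> carrier P1 \<Longrightarrow> finsum P1 (\<lambda>s. y s x \<odot>\<^bsub>P1\<^esub> s) S = x"
    using L.projective_basis[OF P1] by blast
  obtain S0 z where S0: "finite S0" "S0 \<subseteq> carrier P0"
    "\<And>s. s \<in> S0 \<Longrightarrow> module_map \<Lambda> P0 (reg_module \<Lambda>) (z s)"
    "\<And>x. x \<in> carrier P0 \<Longrightarrow> finsum P0 (\<lambda>s. z s x \<odot>\<^bsub>P0\<^esub> s) S0 = x"
    using L.projective_basis[OF P0] by blast
  define Y where "Y s = restrict (y s) (carrier P1)" for s
  have Y: "Y s \<in> carrier (star \<Lambda> P1)" if "s \<in> S" for s
    using S(3)[OF that] by (simp add: star_simps mm_restrict[OF l(1)] Y_def)
  have \<pi>Y: "\<pi> (Y s) \<in> carrier Q" if "s \<in> S" for s by (rule O.LR.mm_closed[OF \<pi>(1) Y[OF that]])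
  have \<pi>h: "\<pi> h = finsum Q (\<lambda>s. h s \<odot>\<^bsub>Q\<^esub> \<pi> (Y s)) S" if h: "h \<in> carrier (star \<Lambda> P1)" for h
  proof -
    have hs: "h s \<in> carrier (op_ring \<Lambda>)" if "s \<in> S" for s using star_val[OF h] S(2) that by auto
    have "\<pi> h = \<pi> (finsum (star \<Lambda> P1) (\<lambda>s. h s \<odot>\<^bsub>star \<Lambda> P1\<^esub> Y s) S)"
      using star_basis[OF P1 S h] by (simp add: Y_def)
    also have "\<dots> = finsum Q (\<lambda>s. \<pi> (h s \<odot>\<^bsub>star \<Lambda> P1\<^esub> Y s)) S"
      by (rule module_map_finsum[OF lS1 Q \<pi>(1) S(1)]) (use O.LR.lm_smult_closed[OF lS1 hs Y] in auto)
    also have "\<dots> = finsum Q (\<lambda>s. h s \<odot>\<^bsub>Q\<^esub> \<pi> (Y s)) S"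
      using O.LR.mm_smult[OF \<pi>(1) hs Y] O.LR.lm_smult_closed[OF Q hs \<pi>Y]
      by (intro abelian_monoid.finsum_cong'[OF O.LR.lm_abm[OF Q]]) auto
    finally show ?thesis .
  qed
  have \<phi>sum: "\<phi> m (finsum Q q S) = finsum (reg_module K) (\<lambda>s. \<phi> m (q s)) S"
    if "m \<in> carrier N" "\<And>s. s \<in> S \<Longrightarrow> q s \<in> carrier Q" for m q
  proof -
    have "finsum Q q S = finsum (O.rs Q) q S" by (rule finsum_same) simp_all
    then show ?thesis using module_map_finsum[OF rQ KF.lmod_reg \<phi>m[OF that(1)] S(1), of q] that(2) by auto
  qed
  note fcK = abelian_monoid.finsum_cong'[OF KF.lm_abm[OF KF.lmod_reg] refl]
  note Kc = reg_op_simps(1)[of K]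
  have fcl: "finsum (reg_module K) f S0 \<in> carrier K" if "\<And>t. t \<in> S0 \<Longrightarrow> f t \<in> carrier K" for f
    using abelian_monoid.finsum_closed[OF KF.lm_abm[OF KF.lmod_reg], of f S0] that by (auto simp: Kc)
  have main: "\<phi> n (\<pi> h) = \<zero>\<^bsub>K\<^esub>" if h: "h \<in> carrier (star \<Lambda> P1)" for h
  proof -
    have hs: "h s \<in> carrier \<Lambda>" if "s \<in> S" for s using star_val[OF h] S(2) that by auto
    have hm: "module_map \<Lambda> P1 (reg_module \<Lambda>) h" using h unfolding star_simps by (rule conjunct2)
    \<comment> \<open>The hypothesis is applied to the map x \<mapsto> h(x) n, the one that
      corresponds to the tensor of h and n.\<close>
    obtain \<psi> where \<psi>: "module_map \<Lambda> P0 N \<psi>" "\<And>x. x \<in> carrier P1 \<Longrightarrow> \<psi> (d x) = h x \<odot>\<^bsub>N\<^esub> n"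
      using ext[OF LR.mm_comp[OF hm LR.mm_reg[OF N n]]] by blast
    have ds: "d s \<in> carrier P0" if "s \<in> S" for s using LR.mm_closed[OF d] S(2) that by auto
    have \<psi>t: "\<psi> t \<in> carrier N" if "t \<in> S0" for t using LR.mm_closed[OF \<psi>(1)] S0(2) that by auto
    have zc: "z t (d s) \<in> carrier \<Lambda>" if "t \<in> S0" "s \<in> S" for s t
      by (rule L.reg_in[OF S0(3)[OF that(1)] ds[OF that(2)]])
    define Z where "Z t = restrict (z t) (carrier P0)" for t
    have Z: "Z t \<in> carrier (star \<Lambda> P0)" if "t \<in> S0" for t
      using S0(3)[OF that] by (simp add: star_simps mm_restrict[OF l(2)] Z_def)
    have hn: "\<phi> (h s \<odot>\<^bsub>N\<^esub> n) q = finsum (reg_module K) (\<lambda>t. \<phi> (\<psi> t) (z t (d s) \<odot>\<^bsub>Q\<^esub> q)) S0"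
      if s: "s \<in> S" and q: "q \<in> carrier Q" for s q
    proof -
      have tc: "z t (d s) \<odot>\<^bsub>N\<^esub> \<psi> t \<in> carrier N" if "t \<in> S0" for t
        by (rule LR.lm_smult_closed[OF N zc[OF that s] \<psi>t[OF that]])
      have ev: "module_map K (rs ?D) (reg_module K) (\<lambda>f. f q)"
      proof (rule KF.mmI)
        fix c f assume c: "c \<in> carrier K" and f: "f \<in> carrier (rs ?D)"
        have "module_map K (O.rs Q) (reg_module K) f" using f by (simp add: dual_simps)
        from KF.mm_smult[OF this c, of q] show "(c \<odot>\<^bsub>rs ?D\<^esub> f) q = c \<odot>\<^bsub>reg_module K\<^esub> f q"
          using q by (simp add: dual_simps(4))
      qed (use q dual_val in \<open>auto simp: dual_simps(3) reg_op_simps\<close>)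
      have sin: "s \<in> carrier P1" using S(2) s by auto
      have "h s \<odot>\<^bsub>N\<^esub> n = \<psi> (d s)" using \<psi>(2)[OF sin] by simp
      also have "\<dots> = finsum N (\<lambda>t. z t (d s) \<odot>\<^bsub>N\<^esub> \<psi> t) S0"
        by (rule L.basis_expand[OF l(2) N S0 \<psi>(1) ds[OF s]])
      finally have "\<phi> (h s \<odot>\<^bsub>N\<^esub> n) = finsum ?D (\<lambda>t. \<phi> (z t (d s) \<odot>\<^bsub>N\<^esub> \<psi> t)) S0"
        using module_map_finsum[OF N l(3) \<phi> S0(1), of "\<lambda>t. z t (d s) \<odot>\<^bsub>N\<^esub> \<psi> t"] tc by auto
      also have "\<dots> = finsum (rs ?D) (\<lambda>t. \<phi> (z t (d s) \<odot>\<^bsub>N\<^esub> \<psi> t)) S0"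
        by (rule finsum_same) simp_all
      finally have "\<phi> (h s \<odot>\<^bsub>N\<^esub> n) q = finsum (rs ?D) (\<lambda>t. \<phi> (z t (d s) \<odot>\<^bsub>N\<^esub> \<psi> t)) S0 q" by simp
      also have "\<dots> = finsum (reg_module K) (\<lambda>t. \<phi> (z t (d s) \<odot>\<^bsub>N\<^esub> \<psi> t) q) S0"
        by (rule module_map_finsum[OF lmod_rs[OF l(3)] KF.lmod_reg ev S0(1)]) (use \<phi>c[OF tc] in auto)
      also have "\<dots> = finsum (reg_module K) (\<lambda>t. \<phi> (\<psi> t) (z t (d s) \<odot>\<^bsub>Q\<^esub> q)) S0"
        using \<phi>s[OF \<psi>t zc[OF _ s] q] \<phi>v[OF tc q] by (intro fcK) (auto simp: Kc)
      finally show ?thesis .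
    qed
    have Qc: "z t (d s) \<odot>\<^bsub>Q\<^esub> \<pi> (Y s) \<in> carrier Q" if "t \<in> S0" "s \<in> S" for s t
      using O.LR.lm_smult_closed[OF Q _ \<pi>Y[OF that(2)], of "z t (d s)"] zc[OF that] by simp
    have "\<phi> n (\<pi> h) = finsum (reg_module K) (\<lambda>s. \<phi> n (h s \<odot>\<^bsub>Q\<^esub> \<pi> (Y s))) S"
      unfolding \<pi>h[OF h] by (rule \<phi>sum[OF n]) (use O.LR.lm_smult_closed[OF Q _ \<pi>Y] hs in auto)
    also have "\<dots> = finsum (reg_module K) (\<lambda>s. \<phi> (h s \<odot>\<^bsub>N\<^esub> n) (\<pi> (Y s))) S"
      using \<phi>s[OF n hs \<pi>Y] \<phi>v[OF LR.lm_smult_closed[OF N hs n] \<pi>Y] by (intro fcK) (auto simp: Kc)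
    also have "\<dots> = finsum (reg_module K)
        (\<lambda>s. finsum (reg_module K) (\<lambda>t. \<phi> (\<psi> t) (z t (d s) \<odot>\<^bsub>Q\<^esub> \<pi> (Y s))) S0) S"
      using hn[OF _ \<pi>Y] \<phi>v[OF \<psi>t Qc]
      by (intro fcK) (auto simp: Kc intro!: fcl)
    \<comment> \<open>After the interchange, the inner sum for fixed t is the pairing of \<psi> t
      with the image under \<pi> of z t composed with d. That image is zero by exactness.\<close>
    also have "\<dots> = finsum (reg_module K)
        (\<lambda>t. finsum (reg_module K) (\<lambda>s. \<phi> (\<psi> t) (z t (d s) \<odot>\<^bsub>Q\<^esub> \<pi> (Y s))) S) S0"
      by (rule KF.finsum_swap[OF KF.lmod_reg S(1) S0(1)]) (use \<phi>v[OF \<psi>t Qc] in \<open>simp add: Kc\<close>)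
    also have "\<dots> = finsum (reg_module K) (\<lambda>t. \<zero>\<^bsub>reg_module K\<^esub>) S0"
    proof (rule fcK)
      fix t assume t: "t \<in> S0"
      let ?g = "\<lambda>x\<in>carrier P1. Z t (d x)"
      have g: "?g \<in> carrier (star \<Lambda> P1)"
        by (rule O.LR.mm_closed[OF mm_star_comp[OF l(1,2) d] Z[OF t]])
      have gs: "?g s = z t (d s)" if "s \<in> S" for s using S(2) that ds[OF that] by (auto simp: Z_def)
      have "finsum (reg_module K) (\<lambda>s. \<phi> (\<psi> t) (z t (d s) \<odot>\<^bsub>Q\<^esub> \<pi> (Y s))) S =
          finsum (reg_module K) (\<lambda>s. \<phi> (\<psi> t) (?g s \<odot>\<^bsub>Q\<^esub> \<pi> (Y s))) S"
        using gs \<phi>v[OF \<psi>t Qc] t by (intro fcK) (auto simp: Kc)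
      also have "\<dots> = \<phi> (\<psi> t) (finsum Q (\<lambda>s. ?g s \<odot>\<^bsub>Q\<^esub> \<pi> (Y s)) S)"
        by (rule \<phi>sum[OF \<psi>t[OF t], symmetric]) (use gs Qc t in simp)
      also have "finsum Q (\<lambda>s. ?g s \<odot>\<^bsub>Q\<^esub> \<pi> (Y s)) S = \<pi> ?g" by (rule \<pi>h[OF g, symmetric])
      also have "\<pi> ?g = \<zero>\<^bsub>Q\<^esub>" by (rule \<pi>d[OF Z[OF t]])
      also have "\<phi> (\<psi> t) \<zero>\<^bsub>Q\<^esub> = \<zero>\<^bsub>reg_module K\<^esub>"
        using KF.mm_zero[OF \<phi>m[OF \<psi>t[OF t]] rQ KF.lmod_reg] by simp
      finally show "finsum (reg_module K) (\<lambda>s. \<phi> (\<psi> t) (z t (d s) \<odot>\<^bsub>Q\<^esub> \<pi> (Y s))) S = \<zero>\<^bsub>reg_module K\<^esub>" .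
    qed (use KF.lm_zero_closed[OF KF.lmod_reg] in auto)
    also have "\<dots> = \<zero>\<^bsub>K\<^esub>"
      using abelian_monoid.finsum_zero[OF KF.lm_abm[OF KF.lmod_reg]] by (simp add: reg_op_simps)
    finally show ?thesis .
  qed
  have "\<phi> n q = (\<lambda>x\<in>carrier Q. \<zero>\<^bsub>K\<^esub>) q" if q: "q \<in> carrier Q" for q
  proof -
    have "q \<in> \<pi> ` carrier (star \<Lambda> P1)" using \<pi>(2) q by simp
    then obtain h where "h \<in> carrier (star \<Lambda> P1)" "q = \<pi> h" by auto
    then show ?thesis using main q by simp
  qed
  moreover have "\<phi> n \<in> extensional (carrier Q)" using \<phi>c[OF n] unfolding dual_simps by (rule conjunct1)
  ultimately have "\<phi> n = (\<lambda>x\<in>carrier Q. \<zero>\<^bsub>K\<^esub>)" by (intro extensionalityI) auto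
  then show "\<phi> n = \<zero>\<^bsub>?D\<^esub>" by (simp add: dual_simps(2))
qed

text \<open>If k did not extend, a functional F on N^S would separate it from the maps that do. The
  rule sending n to the form \<pi> h \<mapsto> F(h n) is then a \<Lambda>-map from N to the dual of
  Q, which must be zero. But k is a sum of maps of the form h n by the dual basis, so F kills it, a
  contradiction.\<close>

lemma vanish_imp_extend:
  fixes N :: "('a, 'x) module"
  assumes P1: "projective \<Lambda> P1" and P0: "projective \<Lambda> P0" and d: "module_map \<Lambda> P1 P0 d"
    and Q: "left_module (op_ring \<Lambda>) Q"
    and \<pi>: "module_map (op_ring \<Lambda>) (star \<Lambda> P1) Q \<pi>" "\<pi> ` carrier (star \<Lambda> P1) = carrier Q"
    and \<pi>k: "{h \<in> carrier (star \<Lambda> P1). \<pi> h = \<zero>\<^bsub>Q\<^esub>} = (\<lambda>h. \<lambda>x\<in>carrier P1. h (d x)) ` carrier (star \<Lambda> P0)"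
    and N: "L.fg N" and van: "hom_vanishes \<Lambda> N (dual_module K \<Lambda> Q)"
    and k: "module_map \<Lambda> P1 N k"
  shows "\<exists>k'. module_map \<Lambda> P0 N k' \<and> (\<forall>x\<in>carrier P1. k' (d x) = k x)"
proof -
  let ?D = "dual_module K \<Lambda> Q"
  have l: "left_module \<Lambda> P1" "left_module \<Lambda> P0" "left_module \<Lambda> ?D" "left_module \<Lambda> N" "left_module K (rs N)"
    using L.projective_fg[OF P1] L.projective_fg[OF P0] lmod_dual[OF Q] N lmod_rs by auto
  note lS1 = lmod_star[OF l(1)]
  note rQ = O.lmod_rs[OF Q]
  note rS1 = O.lmod_rs[OF lS1]
  obtain S y where S: "finite S" "S \<subseteq> carrier P1"
    "\<And>s. s \<in> S \<Longrightarrow> module_map \<Lambda> P1 (reg_module \<Lambda>) (y s)"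
    "\<And>x. x \<in> carrier P1 \<Longrightarrow> finsum P1 (\<lambda>s. y s x \<odot>\<^bsub>P1\<^esub> s) S = x"
    using L.projective_basis[OF P1] by blast
  have SP: "s \<in> carrier P1" if "s \<in> S" for s using S(2) that by auto
  let ?V = "KF.dsum S (\<lambda>_. rs N)"
  have V: "left_module K ?V" "KF.finlen ?V"
    using KF.lmod_dsum[of S "\<lambda>_. rs N"] KF.finlen_dsum[OF S(1), of "\<lambda>_. rs N"] l finlen_K[OF N] by auto
  define ev where "ev f = (\<lambda>s\<in>S. f s)" for f :: "(nat \<Rightarrow> 'a) \<Rightarrow> 'x"
  have evV: "ev f \<in> carrier ?V" if "module_map \<Lambda> P1 N f" for f
    using LR.mm_closed[OF that SP] by (auto simp: ev_def KF.dsum_def)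
  define B where "B = (\<lambda>f. ev (\<lambda>x. f (d x))) ` {f. module_map \<Lambda> P0 N f}"
  have B: "submodule B K ?V"
  proof (rule KF.submI[OF V(1)])
    show "B \<subseteq> carrier ?V" using evV[OF LR.mm_comp[OF d]] by (auto simp: B_def)
    have "\<zero>\<^bsub>?V\<^esub> = ev (\<lambda>x. \<zero>\<^bsub>N\<^esub>)" by (simp add: ev_def KF.dsum_def)
    then show "\<zero>\<^bsub>?V\<^esub> \<in> B" using LR.mm_0[OF l(4), of P0] by (auto simp: B_def)
  next
    fix u v assume "u \<in> B" "v \<in> B"
    then obtain f g where f: "module_map \<Lambda> P0 N f" "module_map \<Lambda> P0 N g"
      "u = ev (\<lambda>x. f (d x))" "v = ev (\<lambda>x. g (d x))" by (auto simp: B_def)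
    have "u \<oplus>\<^bsub>?V\<^esub> v = ev (\<lambda>x. f (d x) \<oplus>\<^bsub>N\<^esub> g (d x))" using f by (auto simp: ev_def KF.dsum_def)
    then show "u \<oplus>\<^bsub>?V\<^esub> v \<in> B" using LR.mm_plus[OF l(4) f(1,2)]
      by (auto simp: B_def intro!: image_eqI[of _ _ "\<lambda>x. f x \<oplus>\<^bsub>N\<^esub> g x"])
  next
    fix c u assume c: "c \<in> carrier K" "u \<in> B"
    then obtain f where f: "module_map \<Lambda> P0 N f" "u = ev (\<lambda>x. f (d x))" by (auto simp: B_def)
    have "c \<odot>\<^bsub>?V\<^esub> u = ev (\<lambda>x. sc c \<odot>\<^bsub>N\<^esub> f (d x))" using f by (auto simp: ev_def KF.dsum_def)
    then show "c \<odot>\<^bsub>?V\<^esub> u \<in> B"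
      using LR.mm_comp[OF f(1) LR.mm_central[OF l(4) central_sc[OF c(1)]]]
      by (auto simp: B_def intro!: image_eqI[of _ _ "\<lambda>x. sc c \<odot>\<^bsub>N\<^esub> f x"])
  qed
  have "ev k \<in> B"
  proof (rule ccontr)
    assume nB: "ev k \<notin> B"
    obtain F where F: "module_map K ?V (reg_module K) F" "\<And>u. u \<in> B \<Longrightarrow> F u = \<zero>\<^bsub>K\<^esub>"
      "F (ev k) \<noteq> \<zero>\<^bsub>K\<^esub>" using KF.ex_functional[OF V B evV[OF k] nB] by blast
    \<comment> \<open>The values of the map x \<mapsto> h(x) n on the generators S, in the
      coordinates of N^S.\<close>
    define hn where "hn n h = (\<lambda>s\<in>S. h s \<odot>\<^bsub>N\<^esub> n)" for n :: 'x and h :: "(nat \<Rightarrow> 'a) \<Rightarrow> 'a"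
    have hm: "module_map \<Lambda> P1 (reg_module \<Lambda>) h" if "h \<in> carrier (star \<Lambda> P1)" for h
      using that unfolding star_simps by (rule conjunct2)
    have hs: "h s \<in> carrier \<Lambda>" if "h \<in> carrier (star \<Lambda> P1)" "s \<in> S" for h s
      using star_val[OF that(1)] SP[OF that(2)] by blast
    have hnV: "hn n h \<in> carrier ?V" if "n \<in> carrier N" "h \<in> carrier (star \<Lambda> P1)" for n h
      using hs[OF that(2)] that(1) l(4) by (auto simp: hn_def KF.dsum_def)
    have hnm: "module_map K (O.rs (star \<Lambda> P1)) ?V (hn n)" if n: "n \<in> carrier N" for n
      unfolding hn_def
    proof (rule KF.mm_dtuple)
      fix s assume s: "s \<in> S"
      show "module_map K (O.rs (star \<Lambda> P1)) (rs N) (\<lambda>h. h s \<odot>\<^bsub>N\<^esub> n)"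
      proof (rule KF.mmI)
        fix c h assume c: "c \<in> carrier K" and h: "h \<in> carrier (O.rs (star \<Lambda> P1))"
        have h': "h s \<in> carrier \<Lambda>" using hs[of h s] h s by simp
        have "(c \<odot>\<^bsub>O.rs (star \<Lambda> P1)\<^esub> h) s = h s \<otimes>\<^bsub>\<Lambda>\<^esub> sc c" using SP[OF s] by (simp add: star_simps(4))
        also have "\<dots> = sc c \<otimes>\<^bsub>\<Lambda>\<^esub> h s" using c h' by (simp add: sc)
        finally show "(c \<odot>\<^bsub>O.rs (star \<Lambda> P1)\<^esub> h) s \<odot>\<^bsub>N\<^esub> n = c \<odot>\<^bsub>rs N\<^esub> (h s \<odot>\<^bsub>N\<^esub> n)"
          using LR.lm_smult_assoc[OF l(4) sc(1)[OF c] h' n] by simp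
      next
        fix h g assume "h \<in> carrier (O.rs (star \<Lambda> P1))" "g \<in> carrier (O.rs (star \<Lambda> P1))"
        then show "(h \<oplus>\<^bsub>O.rs (star \<Lambda> P1)\<^esub> g) s \<odot>\<^bsub>N\<^esub> n = h s \<odot>\<^bsub>N\<^esub> n \<oplus>\<^bsub>rs N\<^esub> g s \<odot>\<^bsub>N\<^esub> n"
          using hs[OF _ s] SP[OF s] LR.lm_add_smult[OF l(4) _ _ n] by (simp add: star_simps(3))
      next
        fix h assume "h \<in> carrier (O.rs (star \<Lambda> P1))"
        then show "h s \<odot>\<^bsub>N\<^esub> n \<in> carrier (rs N)" using hs[OF _ s] n l(4) by simp
      qed
    qed
    \<comment> \<open>If \<pi> h = 0, then h is a functional on P0 composed with d, so x \<mapsto>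
      h(x) n extends to P0 and F kills it. Hence F (hn n h) depends only on \<pi> h.\<close>
    have van0: "F (hn n h) = \<zero>\<^bsub>reg_module K\<^esub>"
      if n: "n \<in> carrier N" and h: "h \<in> carrier (star \<Lambda> P1)" "\<pi> h = \<zero>\<^bsub>Q\<^esub>" for n h
    proof -
      have "h \<in> (\<lambda>h. \<lambda>x\<in>carrier P1. h (d x)) ` carrier (star \<Lambda> P0)" using h \<pi>k by blast
      then obtain g where g: "g \<in> carrier (star \<Lambda> P0)" "h = (\<lambda>x\<in>carrier P1. g (d x))" by blast
      have gm: "module_map \<Lambda> P0 (reg_module \<Lambda>) g" using g(1) unfolding star_simps by (rule conjunct2)
      have "hn n h = ev (\<lambda>x. g (d x) \<odot>\<^bsub>N\<^esub> n)" using g(2) SP by (auto simp: hn_def ev_def intro!: restrict_ext)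
      then have "hn n h \<in> B" using LR.mm_comp[OF gm LR.mm_reg[OF l(4) n]]
        by (auto simp: B_def intro!: image_eqI[of _ _ "\<lambda>x. g x \<odot>\<^bsub>N\<^esub> n"])
      then show ?thesis using F(2) by (simp add: reg_op_simps)
    qed
    have "\<exists>t. module_map K (O.rs Q) (reg_module K) t \<and> (\<forall>h\<in>carrier (O.rs (star \<Lambda> P1)). t (\<pi> h) = F (hn n h))"
      if n: "n \<in> carrier N" for n
      by (rule KF.mm_factor_surj[OF rS1 KF.lmod_reg O.mm_rs[OF \<pi>(1)] _ KF.mm_comp[OF hnm[OF n] F(1)] rQ])
        (use \<pi>(2) van0[OF n] in auto)
    then obtain t where t: "\<And>n. n \<in> carrier N \<Longrightarrow> module_map K (O.rs Q) (reg_module K) (t n)"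
      "\<And>n h. n \<in> carrier N \<Longrightarrow> h \<in> carrier (star \<Lambda> P1) \<Longrightarrow> t n (\<pi> h) = F (hn n h)"
      by (metis rs_simps(1) rs_op)
    define \<phi> where "\<phi> n = restrict (t n) (carrier Q)" for n
    have \<phi>c: "\<phi> n \<in> carrier ?D" if "n \<in> carrier N" for n
      using t(1)[OF that] by (simp add: \<phi>_def dual_simps mm_restrict_K[OF Q])
    have \<pi>c: "\<pi> h \<in> carrier Q" if "h \<in> carrier (star \<Lambda> P1)" for h by (rule O.LR.mm_closed[OF \<pi>(1) that])
    have \<phi>\<pi>: "\<phi> n (\<pi> h) = F (hn n h)" if "n \<in> carrier N" "h \<in> carrier (star \<Lambda> P1)" for n h
      using t(2)[OF that] \<pi>c[OF that(2)] by (simp add: \<phi>_def)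
    have D_eqI: "f = g" if f: "f \<in> carrier ?D" and g: "g \<in> carrier ?D"
      and e: "\<And>h. h \<in> carrier (star \<Lambda> P1) \<Longrightarrow> f (\<pi> h) = g (\<pi> h)" for f g
    proof (rule extensionalityI)
      show "f \<in> extensional (carrier Q)" "g \<in> extensional (carrier Q)" using f g by (simp_all add: dual_simps)
      fix q assume "q \<in> carrier Q"
      then have "q \<in> \<pi> ` carrier (star \<Lambda> P1)" using \<pi>(2) by simp
      then show "f q = g q" using e by auto
    qed
    have "module_map \<Lambda> N ?D \<phi>"
    proof (rule LR.mmI)
      fix n m assume nm: "n \<in> carrier N" "m \<in> carrier N"
      show "\<phi> (n \<oplus>\<^bsub>N\<^esub> m) = \<phi> n \<oplus>\<^bsub>?D\<^esub> \<phi> m"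
      proof (rule D_eqI)
        show "\<phi> (n \<oplus>\<^bsub>N\<^esub> m) \<in> carrier ?D" using \<phi>c nm l(4) by simp
        show "\<phi> n \<oplus>\<^bsub>?D\<^esub> \<phi> m \<in> carrier ?D" using \<phi>c nm l(3) by simp
        fix h assume h: "h \<in> carrier (star \<Lambda> P1)"
        have "hn (n \<oplus>\<^bsub>N\<^esub> m) h = hn n h \<oplus>\<^bsub>?V\<^esub> hn m h"
          using hs[OF h] nm LR.lm_smult_add[OF l(4)] by (auto simp: hn_def KF.dsum_def intro!: restrict_ext)
        then have "F (hn (n \<oplus>\<^bsub>N\<^esub> m) h) = F (hn n h) \<oplus>\<^bsub>K\<^esub> F (hn m h)"
          using KF.mm_add[OF F(1) hnV[OF nm(1) h] hnV[OF nm(2) h]] by (simp add: reg_op_simps)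
        then show "\<phi> (n \<oplus>\<^bsub>N\<^esub> m) (\<pi> h) = (\<phi> n \<oplus>\<^bsub>?D\<^esub> \<phi> m) (\<pi> h)"
          using \<phi>\<pi> nm h \<pi>c[OF h] l(4) by (simp add: dual_simps(3))
      qed
    next
      fix a n assume an: "a \<in> carrier \<Lambda>" "n \<in> carrier N"
      show "\<phi> (a \<odot>\<^bsub>N\<^esub> n) = a \<odot>\<^bsub>?D\<^esub> \<phi> n"
      proof (rule D_eqI)
        show "\<phi> (a \<odot>\<^bsub>N\<^esub> n) \<in> carrier ?D" using \<phi>c an l(4) by simp
        show "a \<odot>\<^bsub>?D\<^esub> \<phi> n \<in> carrier ?D" using \<phi>c an l(3) by simp
        fix h assume h: "h \<in> carrier (star \<Lambda> P1)"
        have ah: "a \<odot>\<^bsub>star \<Lambda> P1\<^esub> h \<in> carrier (star \<Lambda> P1)"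
          using O.LR.lm_smult_closed[OF lS1 _ h, of a] an by simp
        have "hn (a \<odot>\<^bsub>N\<^esub> n) h = hn n (a \<odot>\<^bsub>star \<Lambda> P1\<^esub> h)"
          using hs[OF h] an SP LR.lm_smult_assoc[OF l(4)]
          by (auto simp: hn_def star_simps(4) intro!: restrict_ext)
        moreover have "\<pi> (a \<odot>\<^bsub>star \<Lambda> P1\<^esub> h) = a \<odot>\<^bsub>Q\<^esub> \<pi> h"
          using O.LR.mm_smult[OF \<pi>(1) _ h, of a] an by simp
        ultimately show "\<phi> (a \<odot>\<^bsub>N\<^esub> n) (\<pi> h) = (a \<odot>\<^bsub>?D\<^esub> \<phi> n) (\<pi> h)"
          using \<phi>\<pi>[OF _ h, of "a \<odot>\<^bsub>N\<^esub> n"] \<phi>\<pi>[OF an(2) ah] an l(4) \<pi>c[OF h] by (simp add: dual_simps(4))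
      qed
    qed (rule \<phi>c)
    then have \<phi>0: "\<phi> n = \<zero>\<^bsub>?D\<^esub>" if "n \<in> carrier N" for n using van that by (simp add: hom_vanishes_def)
    have F0: "F (hn n h) = \<zero>\<^bsub>K\<^esub>" if "n \<in> carrier N" "h \<in> carrier (star \<Lambda> P1)" for n h
      using \<phi>\<pi>[OF that] \<phi>0[OF that(1)] \<pi>c[OF that(2)] by (simp add: dual_simps(2))
    define Y where "Y s = restrict (y s) (carrier P1)" for s
    have Y: "Y s \<in> carrier (star \<Lambda> P1)" if "s \<in> S" for s
      using S(3)[OF that] by (simp add: star_simps mm_restrict[OF l(1)] Y_def)
    have kN: "k s \<in> carrier N" if "s \<in> S" for s using LR.mm_closed[OF k SP[OF that]] .
    have c: "(\<lambda>i. hn (k i) (Y i)) \<in> S \<rightarrow> carrier ?V" using hnV[OF kN Y] by auto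
    \<comment> \<open>The dual basis expansion: k is the sum of the maps x \<mapsto> y i (x) k i,
      each of which has the form recorded by \<open>hn\<close>.\<close>
    have "ev k = finsum ?V (\<lambda>i. hn (k i) (Y i)) S"
    proof (rule KF.dsum_eqI[OF evV[OF k]])
      show "finsum ?V (\<lambda>i. hn (k i) (Y i)) S \<in> carrier ?V"
        by (rule abelian_monoid.finsum_closed[OF KF.lm_abm[OF V(1)] c])
      fix s assume s: "s \<in> S"
      have "finsum ?V (\<lambda>i. hn (k i) (Y i)) S s = finsum (rs N) (\<lambda>i. hn (k i) (Y i) s) S"
        using KF.dsum_finsum[OF S(1) _ S(1) c s] l(5) by simp
      also have "\<dots> = finsum N (\<lambda>i. hn (k i) (Y i) s) S" by (rule finsum_same) simp_all
      also have "\<dots> = finsum N (\<lambda>i. y i s \<odot>\<^bsub>N\<^esub> k i) S"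
        using s SP[OF s] L.reg_in[OF S(3) SP[OF s]] kN l(4)
        by (intro abelian_monoid.finsum_cong'[OF LR.lm_abm[OF l(4)]]) (auto simp: hn_def Y_def)
      also have "\<dots> = k s" by (rule L.basis_expand[OF l(1,4) S k SP[OF s], symmetric])
      finally show "ev k s = finsum ?V (\<lambda>i. hn (k i) (Y i)) S s" using s by (simp add: ev_def)
    qed
    then have "F (ev k) = finsum (reg_module K) (\<lambda>i. F (hn (k i) (Y i))) S"
      using module_map_finsum[OF V(1) KF.lmod_reg F(1) S(1) c] by simp
    also have "\<dots> = finsum (reg_module K) (\<lambda>i. \<zero>\<^bsub>reg_module K\<^esub>) S"
      using F0[OF kN Y] by (intro abelian_monoid.finsum_cong'[OF KF.lm_abm[OF KF.lmod_reg]])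
        (auto simp: reg_op_simps)
    also have "\<dots> = \<zero>\<^bsub>K\<^esub>"
      using abelian_monoid.finsum_zero[OF KF.lm_abm[OF KF.lmod_reg]] by (simp add: reg_op_simps)
    finally show False using F(3) by simp
  qed
  then obtain f where f: "module_map \<Lambda> P0 N f" "ev k = ev (\<lambda>x. f (d x))" by (auto simp: B_def)
  have fd: "module_map \<Lambda> P1 N (\<lambda>x. f (d x))" by (rule LR.mm_comp[OF d f(1)])
  have e: "f (d s) = k s" if "s \<in> S" for s using fun_cong[OF f(2), of s] that by (simp add: ev_def)
  have "f (d x) = k x" if x: "x \<in> carrier P1" for x
  proof -
    have "f (d x) = finsum N (\<lambda>s. y s x \<odot>\<^bsub>N\<^esub> f (d s)) S" by (rule L.basis_expand[OF l(1,4) S fd x])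
    also have "\<dots> = finsum N (\<lambda>s. y s x \<odot>\<^bsub>N\<^esub> k s) S"
      using e L.reg_in[OF S(3) x] LR.mm_closed[OF k SP] l(4)
      by (intro abelian_monoid.finsum_cong'[OF LR.lm_abm[OF l(4)]]) auto
    also have "\<dots> = k x" by (rule L.basis_expand[OF l(1,4) S k x, symmetric])
    finally show ?thesis .
  qed
  then show ?thesis using f(1) by blast
qed

text \<open>This gives the choice operator in \<open>tau\<close> something to choose: projective
  covers supply a minimal presentation, the cokernel of the dual map is moved to a standard module
  Q, and so is the dual of Q.\<close>

lemma ex_transpose_dual:
  fixes X :: "'a std_module"
  assumes X: "L.fg X"
  shows "\<exists>Q. is_transpose \<Lambda> X Q \<and> (\<exists>N\<in>fgmod \<Lambda>. module_iso \<Lambda> N (dual_module K \<Lambda> Q))"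
proof -
  have lX: "left_module \<Lambda> X" using X by simp
  obtain P0 e where P0: "projective_cover_onto \<Lambda> P0 e X (carrier X)"
    using L.ex_projective_cover[OF X LR.subm_carrier[OF lX]] by blast
  then have p0: "projective \<Lambda> P0" "module_map \<Lambda> P0 X e" by (auto simp: projective_cover_onto_def)
  have l0: "L.fg P0" "left_module \<Lambda> P0" using L.projective_fg[OF p0(1)] by auto
  obtain P1 d where P1: "projective_cover_onto \<Lambda> P1 d P0 {x \<in> carrier P0. e x = \<zero>\<^bsub>X\<^esub>}"
    using L.ex_projective_cover[OF l0(1) LR.subm_kernel[OF l0(2) lX p0(2)]] by blast
  then have p1: "projective \<Lambda> P1" "module_map \<Lambda> P1 P0 d" by (auto simp: projective_cover_onto_def)
  have l1: "left_module \<Lambda> P1" using L.projective_fg[OF p1(1)] by simp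
  have pres: "min_proj_presentation \<Lambda> P1 d P0 e X" using P0 P1 by (simp add: min_proj_presentation_def)
  note S1 = fg_star[OF p1(1)]
  have lS: "left_module (op_ring \<Lambda>) (star \<Lambda> P1)" "left_module (op_ring \<Lambda>) (star \<Lambda> P0)"
    using lmod_star l1 l0 by auto
  define B where "B = (\<lambda>h. \<lambda>x\<in>carrier P1. h (d x)) ` carrier (star \<Lambda> P0)"
  have B: "submodule B (op_ring \<Lambda>) (star \<Lambda> P1)"
    unfolding B_def by (rule O.LR.subm_image[OF lS(2,1) mm_star_comp[OF l1 l0(2) p1(2)] O.LR.subm_carrier[OF lS(2)]])
  note q = O.LR.quot[OF lS(1) B]
  define C where "C = O.LR.quot (star \<Lambda> P1) B"
  define p where "p = O.LR.qrep (star \<Lambda> P1) B"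
  have C: "O.L.fg C" "left_module (op_ring \<Lambda>) C" unfolding C_def using O.L.fg_quot[OF S1 B] by auto
  have p: "module_map (op_ring \<Lambda>) (star \<Lambda> P1) C p" "p ` carrier (star \<Lambda> P1) = carrier C"
    "\<And>h. h \<in> carrier (star \<Lambda> P1) \<Longrightarrow> p h = \<zero>\<^bsub>C\<^esub> \<longleftrightarrow> h \<in> B"
    using q by (auto simp: C_def p_def)
  obtain Q f where Q: "Q \<in> fgmod (op_ring \<Lambda>)" "module_map (op_ring \<Lambda>) C Q f" "bij_betw f (carrier C) (carrier Q)"
    using ex_iso_fgmod[OF C(2)] O.L.fin_gen_iff[OF C(2)] C(1) by (auto simp: module_iso_def)
  have lQ: "O.L.fg Q" "left_module (op_ring \<Lambda>) Q" using Q(1) by (auto simp: O.L.fgmod_iff)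
  have f0: "f \<zero>\<^bsub>C\<^esub> = \<zero>\<^bsub>Q\<^esub>" by (rule O.LR.mm_zero[OF Q(2) C(2) lQ(2)])
  have "is_transpose \<Lambda> X Q"
    unfolding is_transpose_def
  proof (intro conjI exI)
    show "module_map (op_ring \<Lambda>) (star \<Lambda> P1) Q (\<lambda>h. f (p h))" by (rule O.LR.mm_comp[OF p(1) Q(2)])
    have "(\<lambda>h. f (p h)) ` carrier (star \<Lambda> P1) = f ` (p ` carrier (star \<Lambda> P1))" by (simp add: image_image)
    then show "(\<lambda>h. f (p h)) ` carrier (star \<Lambda> P1) = carrier Q" using p(2) Q(3) by (simp add: bij_betw_def)
    have "f (p h) = \<zero>\<^bsub>Q\<^esub> \<longleftrightarrow> h \<in> B" if h: "h \<in> carrier (star \<Lambda> P1)" for h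
    proof -
      have "p h \<in> carrier C" by (rule O.LR.mm_closed[OF p(1) h])
      then have "f (p h) = \<zero>\<^bsub>Q\<^esub> \<longleftrightarrow> p h = \<zero>\<^bsub>C\<^esub>"
        using f0 bij_betw_imp_inj_on[OF Q(3)] C(2) by (metis O.LR.lm_zero_closed inj_onD)
      then show ?thesis using p(3)[OF h] by simp
    qed
    then show "{h \<in> carrier (star \<Lambda> P1). f (p h) = \<zero>\<^bsub>Q\<^esub>} =
        (\<lambda>h. \<lambda>x\<in>carrier P1. h (d x)) ` carrier (star \<Lambda> P0)"
      using O.LR.subm_in[OF B] by (auto simp: B_def[symmetric])
  qed (rule Q(1) pres)+
  moreover have "\<exists>N\<in>fgmod \<Lambda>. module_iso \<Lambda> N (dual_module K \<Lambda> Q)"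
  proof -
    obtain N :: "'a std_module" and f g where N: "L.fg N" "module_map \<Lambda> (dual_module K \<Lambda> Q) N f"
      "module_map \<Lambda> N (dual_module K \<Lambda> Q) g"
      "\<And>x. x \<in> carrier (dual_module K \<Lambda> Q) \<Longrightarrow> g (f x) = x" "\<And>y. y \<in> carrier N \<Longrightarrow> f (g y) = y"
    proof (rule L.std_copy[OF fg_dual[OF lQ(1)]])
      fix N :: "'a std_module" and f g
      assume "L.fg N" "module_map \<Lambda> (dual_module K \<Lambda> Q) N f" "module_map \<Lambda> N (dual_module K \<Lambda> Q) g"
        "\<And>x. x \<in> carrier (dual_module K \<Lambda> Q) \<Longrightarrow> g (f x) = x" "\<And>y. y \<in> carrier N \<Longrightarrow> f (g y) = y"
      then show thesis by (rule that[of N f g])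
    qed
    have "bij_betw g (carrier N) (carrier (dual_module K \<Lambda> Q))"
      by (rule bij_betw_byWitness[where f' = f])
        (use N(4,5) LR.mm_closed[OF N(2)] LR.mm_closed[OF N(3)] in auto)
    then show ?thesis using N(1,3) by (intro bexI[of _ N]) (auto simp: module_iso_def L.fgmod_iff)
  qed
  ultimately show ?thesis by blast
qed

text \<open>Whatever module is chosen as \<tau>X, it is isomorphic to the dual of some transpose Q.
  The presentation is the one that comes with this Q, and the isomorphism carries the vanishing of
  Hom over from the dual.\<close>

lemma tau_presentation:
  fixes X :: "'a std_module"
  assumes X: "L.fg X"
  shows "\<exists>P1 P0 d e. projective \<Lambda> P1 \<and> projective \<Lambda> P0 \<and> module_map \<Lambda> P1 P0 d \<and> module_map \<Lambda> P0 X e \<and>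
    e ` carrier P0 = carrier X \<and> d ` carrier P1 = {x \<in> carrier P0. e x = \<zero>\<^bsub>X\<^esub>} \<and>
    (\<forall>N :: 'a std_module. L.fg N \<longrightarrow> (hom_vanishes \<Lambda> N (tau K \<Lambda> X) \<longleftrightarrow>
      (\<forall>k. module_map \<Lambda> P1 N k \<longrightarrow> (\<exists>k'. module_map \<Lambda> P0 N k' \<and> (\<forall>x\<in>carrier P1. k' (d x) = k x)))))"
proof -
  have "\<exists>N. N \<in> fgmod \<Lambda> \<and> (\<exists>Q. is_transpose \<Lambda> X Q \<and> module_iso \<Lambda> N (dual_module K \<Lambda> Q))"
    using ex_transpose_dual[OF X] by blast
  from someI_ex[OF this] have "tau K \<Lambda> X \<in> fgmod \<Lambda>"
    "\<exists>Q. is_transpose \<Lambda> X Q \<and> module_iso \<Lambda> (tau K \<Lambda> X) (dual_module K \<Lambda> Q)"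
    by (simp_all add: tau_def)
  then obtain Q i where Q: "is_transpose \<Lambda> X Q" and i: "module_map \<Lambda> (tau K \<Lambda> X) (dual_module K \<Lambda> Q) i"
    "bij_betw i (carrier (tau K \<Lambda> X)) (carrier (dual_module K \<Lambda> Q))"
    and lt: "left_module \<Lambda> (tau K \<Lambda> X)" by (auto simp: module_iso_def L.fgmod_iff)
  obtain P1 d P0 e \<pi> where Qf: "Q \<in> fgmod (op_ring \<Lambda>)" and pres: "min_proj_presentation \<Lambda> P1 d P0 e X"
    and \<pi>: "module_map (op_ring \<Lambda>) (star \<Lambda> P1) Q \<pi>" "\<pi> ` carrier (star \<Lambda> P1) = carrier Q"
      "{h \<in> carrier (star \<Lambda> P1). \<pi> h = \<zero>\<^bsub>Q\<^esub>} = (\<lambda>h. \<lambda>x\<in>carrier P1. h (d x)) ` carrier (star \<Lambda> P0)"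
    using Q unfolding is_transpose_def by (elim exE conjE) (rule that, assumption+)
  have lQ: "left_module (op_ring \<Lambda>) Q" using Qf by (simp add: O.L.fgmod_iff)
  have P: "projective \<Lambda> P1" "projective \<Lambda> P0" "module_map \<Lambda> P1 P0 d" "module_map \<Lambda> P0 X e"
    "e ` carrier P0 = carrier X" "d ` carrier P1 = {x \<in> carrier P0. e x = \<zero>\<^bsub>X\<^esub>}"
    using pres by (auto simp: min_proj_presentation_def projective_cover_onto_def)
  note lD = lmod_dual[OF lQ]
  let ?D = "dual_module K \<Lambda> Q" and ?t = "tau K \<Lambda> X"
  define j where "j = inv_into (carrier ?t) i"
  have j: "module_map \<Lambda> ?D ?t j" unfolding j_def by (rule LR.mm_inv[OF lt i])
  have ij: "i (j x) = x" if "x \<in> carrier ?D" for x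
    using bij_betw_inv_into_right[OF i(2) that] by (simp add: j_def)
  have ji: "j (i x) = x" if "x \<in> carrier ?t" for x
    using bij_betw_inv_into_left[OF i(2) that] by (simp add: j_def)
  have iff: "hom_vanishes \<Lambda> N ?t \<longleftrightarrow> hom_vanishes \<Lambda> N ?D" for N :: "'a std_module"
  proof
    assume v: "hom_vanishes \<Lambda> N ?t"
    show "hom_vanishes \<Lambda> N ?D"
      unfolding hom_vanishes_def
    proof (intro allI impI ballI)
      fix f x assume f: "module_map \<Lambda> N ?D f" and x: "x \<in> carrier N"
      have "j (f x) = \<zero>\<^bsub>?t\<^esub>" by (rule hom_vanishesD[OF v LR.mm_comp[OF f j] x])
      then show "f x = \<zero>\<^bsub>?D\<^esub>" using ij[OF LR.mm_closed[OF f x]] LR.mm_zero[OF i(1) lt lD] by simp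
    qed
  next
    assume v: "hom_vanishes \<Lambda> N ?D"
    show "hom_vanishes \<Lambda> N ?t"
      unfolding hom_vanishes_def
    proof (intro allI impI ballI)
      fix f x assume f: "module_map \<Lambda> N ?t f" and x: "x \<in> carrier N"
      have "i (f x) = \<zero>\<^bsub>?D\<^esub>" by (rule hom_vanishesD[OF v LR.mm_comp[OF f i(1)] x])
      then show "f x = \<zero>\<^bsub>?t\<^esub>" using ji[OF LR.mm_closed[OF f x]] LR.mm_zero[OF j lD lt] by simp
    qed
  qed
  have "hom_vanishes \<Lambda> N ?t \<longleftrightarrow>
      (\<forall>k. module_map \<Lambda> P1 N k \<longrightarrow> (\<exists>k'. module_map \<Lambda> P0 N k' \<and> (\<forall>x\<in>carrier P1. k' (d x) = k x)))"
    if N: "L.fg N" for N :: "'a std_module"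
  proof
    assume "hom_vanishes \<Lambda> N ?t"
    then have v: "hom_vanishes \<Lambda> N ?D" using iff by simp
    show "\<forall>k. module_map \<Lambda> P1 N k \<longrightarrow> (\<exists>k'. module_map \<Lambda> P0 N k' \<and> (\<forall>x\<in>carrier P1. k' (d x) = k x))"
      using vanish_imp_extend[OF P(1-3) lQ \<pi> N v] by blast
  next
    assume x: "\<forall>k. module_map \<Lambda> P1 N k \<longrightarrow> (\<exists>k'. module_map \<Lambda> P0 N k' \<and> (\<forall>x\<in>carrier P1. k' (d x) = k x))"
    have z: "\<pi> (\<lambda>x\<in>carrier P1. z (d x)) = \<zero>\<^bsub>Q\<^esub>" if "z \<in> carrier (star \<Lambda> P0)" for z
      using that \<pi>(3) by blast
    have lN: "left_module \<Lambda> N" using N by simp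
    have "hom_vanishes \<Lambda> N ?D"
      by (rule extend_imp_vanish[OF P(1-3) lQ \<pi>(1,2) z lN]) (use x in auto)
    then show "hom_vanishes \<Lambda> N ?t" using iff by simp
  qed
  note main = this
  show ?thesis
    by (rule exI[of _ P1], rule exI[of _ P0], rule exI[of _ d], rule exI[of _ e])
      (intro conjI allI impI P, rule main)
qed

end

section \<open>The corollary\<close>

context artin_ring
begin

section \<open>Krull-Schmidt arguments for direct summands\<close>

lemma direct_sum_maps:
  fixes M :: "('a, 'y) module"
  assumes "module_direct_sum R Xs M" "\<And>i. i < length Xs \<Longrightarrow> lmod (Xs ! i)" "lmod M"
  shows "\<exists>\<iota> \<pi>. (\<forall>i<length Xs. mm (Xs ! i) M (\<iota> i) \<and> mm M (Xs ! i) (\<pi> i)) \<and>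
    (\<forall>m\<in>carrier M. finsum M (\<lambda>i. \<iota> i (\<pi> i m)) {..<length Xs} = m)"
  by (rule direct_sumD[OF assms]) blast+

text \<open>The automorphism p i of X is the sum of the composites through the components
  \<open>Zs ! k\<close>. As the endomorphism ring of X is local, one of them is already
  bijective.\<close>

lemma retract_component:
  fixes X W :: "'a std_module"
  assumes X: "indecomposable R X" and W: "lmod W"
    and ds: "module_direct_sum R Zs W" and Z: "\<And>k. k < length Zs \<Longrightarrow> lmod (Zs ! k)"
    and i: "mm X W i" and p: "mm W X p" and pi: "bij_betw (\<lambda>x. p (i x)) (carrier X) (carrier X)"
  shows "\<exists>k<length Zs. \<exists>a b. mm X (Zs ! k) a \<and> mm (Zs ! k) X b \<and>
    bij_betw (\<lambda>x. b (a x)) (carrier X) (carrier X)"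
proof -
  have lX: "lmod X" using indecomposable_fg[OF X] by simp
  obtain \<iota> \<pi> where \<iota>: "\<forall>k<length Zs. mm (Zs ! k) W (\<iota> k) \<and> mm W (Zs ! k) (\<pi> k)"
    "\<forall>m\<in>carrier W. finsum W (\<lambda>k. \<iota> k (\<pi> k m)) {..<length Zs} = m"
    using direct_sum_maps[OF ds Z W] by blast
  have m: "mm X (Zs ! k) (\<lambda>x. \<pi> k (i x))" "mm (Zs ! k) X (\<lambda>z. p (\<iota> k z))" if "k < length Zs" for k
    using mm_comp[OF i, of "Zs ! k" "\<pi> k"] mm_comp[of "Zs ! k" W "\<iota> k" X p] p \<iota>(1) that by auto
  have c: "\<iota> k (\<pi> k (i x)) \<in> carrier W" if "k < length Zs" "x \<in> carrier X" for k x
  proof -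
    have "mm (Zs ! k) W (\<iota> k)" using \<iota>(1) that(1) by simp
    from mm_closed[OF this mm_closed[OF m(1)[OF that(1)] that(2)]] show ?thesis .
  qed
  have eq: "p (i x) = finsum X (\<lambda>k. p (\<iota> k (\<pi> k (i x)))) {..<length Zs}" if x: "x \<in> carrier X" for x
  proof -
    have "p (i x) = p (finsum W (\<lambda>k. \<iota> k (\<pi> k (i x))) {..<length Zs})"
      using \<iota>(2) mm_closed[OF i x] by simp
    also have "\<dots> = finsum X (\<lambda>k. p (\<iota> k (\<pi> k (i x)))) {..<length Zs}"
      by (rule module_map_finsum[OF W lX p]) (use c x in auto)
    finally show ?thesis .
  qed
  have "bij_betw (\<lambda>x. finsum X (\<lambda>k. p (\<iota> k (\<pi> k (i x)))) {..<length Zs}) (carrier X) (carrier X)"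
    by (rule bij_betw_cong[THEN iffD1, OF eq pi])
  then obtain k where k: "k < length Zs" "bij_betw (\<lambda>x. p (\<iota> k (\<pi> k (i x)))) (carrier X) (carrier X)"
    using local_finsum[OF X finite_lessThan, of "length Zs" "\<lambda>k x. p (\<iota> k (\<pi> k (i x)))"]
      mm_comp[OF m] by auto
  show ?thesis
    by (intro exI[of _ k] conjI k exI[of _ "\<lambda>x. \<pi> k (i x)"] exI[of _ "\<lambda>z. p (\<iota> k z)"] m)
qed

text \<open>If X were also a summand of U, it would occur twice in M. Each occurrence selects a
  component of the given decomposition into pairwise non-isomorphic modules, and both must select
  the same one. The two occurrences are independent, and comparing them forces yet another component
  isomorphic to X.\<close>

lemma basic_not_retract:
  fixes M X U :: "'a std_module"
  assumes basic: "basic_module R M" and ds: "module_direct_sum R [X, U] M"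
    and X: "indecomposable R X" and U: "lmod U"
    and a: "mm X U a" and b: "mm U X b" and ba: "bij_betw (\<lambda>x. b (a x)) (carrier X) (carrier X)"
  shows False
proof -
  have lX: "lmod X" using indecomposable_fg[OF X] by simp
  obtain Zs where Zs: "\<And>Z. Z \<in> set Zs \<Longrightarrow> indecomposable R Z" "pairwise_non_iso R Zs"
    "module_direct_sum R Zs M" and M: "fg M"
    using basic by (auto simp: basic_module_def fgmod_iff)
  have lM: "lmod M" using M by simp
  have Zi: "indecomposable R (Zs ! k)" if "k < length Zs" for k using Zs(1) that by simp
  have lZ: "lmod (Zs ! k)" if "k < length Zs" for k using indecomposable_fg[OF Zi[OF that]] by simp
  obtain i j p q where D: "mm X M i" "mm U M j" "mm M X p" "mm M U q"
    "\<And>x. x \<in> carrier X \<Longrightarrow> p (i x) = x" "\<And>x. x \<in> carrier X \<Longrightarrow> q (i x) = \<zero>\<^bsub>U\<^esub>"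
    "\<And>y. y \<in> carrier U \<Longrightarrow> q (j y) = y" "\<And>y. y \<in> carrier U \<Longrightarrow> p (j y) = \<zero>\<^bsub>X\<^esub>"
    by (rule direct_sum2D[OF ds lX U lM]) blast
  obtain \<iota> \<pi> where \<iota>: "\<And>k. k < length Zs \<Longrightarrow> mm (Zs ! k) M (\<iota> k)"
    "\<And>k. k < length Zs \<Longrightarrow> mm M (Zs ! k) (\<pi> k)"
    "\<And>m. m \<in> carrier M \<Longrightarrow> finsum M (\<lambda>k. \<iota> k (\<pi> k m)) {..<length Zs} = m"
    using direct_sum_maps[OF Zs(3) lZ lM] by blast
  \<comment> \<open>The part of the endomorphism s t of X that passes through the component
    \<open>Zs ! k\<close>.\<close>
  define c where "c s t k = (\<lambda>x. s (\<iota> k (\<pi> k (t x))))" for s :: "(nat \<Rightarrow> 'a) \<Rightarrow> nat \<Rightarrow> 'a" and t :: "(nat \<Rightarrow> 'a) \<Rightarrow> nat \<Rightarrow> 'a" and k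
  have cm: "mm X X (c s t k)" if "mm M X s" "mm X M t" "k < length Zs" for s t k
    unfolding c_def by (rule mm_comp[OF mm_comp[OF mm_comp[OF that(2) \<iota>(2)[OF that(3)]] \<iota>(1)[OF that(3)]] that(1)])
  have csum: "s (t x) = finsum X (\<lambda>k. c s t k x) {..<length Zs}"
    if "mm M X s" "mm X M t" "x \<in> carrier X" for s t x
  proof -
    have tx: "t x \<in> carrier M" by (rule mm_closed[OF that(2,3)])
    have e: "\<iota> k (\<pi> k (t x)) \<in> carrier M" if "k < length Zs" for k
      by (rule mm_closed[OF \<iota>(1)[OF that] mm_closed[OF \<iota>(2)[OF that] tx]])
    have "s (t x) = s (finsum M (\<lambda>k. \<iota> k (\<pi> k (t x))) {..<length Zs})" using \<iota>(3)[OF tx] by simp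
    also have "\<dots> = finsum X (\<lambda>k. c s t k x) {..<length Zs}"
      unfolding c_def by (rule module_map_finsum[OF lM lX that(1)]) (use e in auto)
    finally show ?thesis .
  qed
  have iso: "bij_betw (\<lambda>x. \<pi> k (t x)) (carrier X) (carrier (Zs ! k))"
    "bij_betw (\<lambda>z. s (\<iota> k z)) (carrier (Zs ! k)) (carrier X)"
    if "mm M X s" "mm X M t" "k < length Zs" "bij_betw (c s t k) (carrier X) (carrier X)" for s t k
    using retract_indecomposable[OF X Zi[OF that(3)] mm_comp[OF that(2) \<iota>(2)[OF that(3)]]
      mm_comp[OF \<iota>(1)[OF that(3)] that(1)]] that(4) by (auto simp: c_def)
  have ex: "\<exists>k<length Zs. bij_betw (c s t k) (carrier X) (carrier X)"
    if st: "mm M X s" "mm X M t" "bij_betw (\<lambda>x. s (t x)) (carrier X) (carrier X)" for s t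
  proof -
    have "bij_betw (\<lambda>x. finsum X (\<lambda>k. c s t k x) {..<length Zs}) (carrier X) (carrier X)"
      by (rule bij_betw_cong[THEN iffD1, OF csum[OF st(1,2)] st(3)])
    then show ?thesis
      using local_finsum[OF X finite_lessThan, of "length Zs" "c s t"] cm[OF st(1,2)] by auto
  qed
  have uniq: "k = l" if kl: "k < length Zs" "l < length Zs"
    and t: "mm X M t" "mm X M t'" "bij_betw (\<lambda>x. \<pi> k (t x)) (carrier X) (carrier (Zs ! k))"
      "bij_betw (\<lambda>x. \<pi> l (t' x)) (carrier X) (carrier (Zs ! l))" for k l t t'
  proof (rule ccontr)
    assume ne: "k \<noteq> l"
    let ?f = "\<lambda>x. \<pi> k (t x)" and ?g = "\<lambda>x. \<pi> l (t' x)"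
    have "mm (Zs ! k) (Zs ! l) (\<lambda>z. ?g (inv_into (carrier X) ?f z))"
      by (rule mm_comp[OF mm_inv[OF lX mm_comp[OF t(1) \<iota>(2)[OF kl(1)]] t(3)] mm_comp[OF t(2) \<iota>(2)[OF kl(2)]]])
    moreover have "bij_betw (\<lambda>z. ?g (inv_into (carrier X) ?f z)) (carrier (Zs ! k)) (carrier (Zs ! l))"
      using bij_betw_trans[OF bij_betw_inv_into[OF t(3)] t(4)] by (simp add: o_def)
    ultimately have "module_iso R (Zs ! k) (Zs ! l)" by (auto simp: module_iso_def)
    then show False using Zs(2) kl ne by (auto simp: pairwise_non_iso_def)
  qed
  define i2 where "i2 = (\<lambda>x. j (a x))"
  define p2 where "p2 = (\<lambda>m. b (q m))"
  have i2: "mm X M i2" unfolding i2_def by (rule mm_comp[OF a D(2)])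
  have p2: "mm M X p2" unfolding p2_def by (rule mm_comp[OF D(4) b])
  have "bij_betw (\<lambda>x. p (i x)) (carrier X) (carrier X)"
    by (rule bij_betw_cong[THEN iffD1, OF D(5)[symmetric] bij_betw_id[unfolded id_def]])
  then obtain k where k: "k < length Zs" "bij_betw (c p i k) (carrier X) (carrier X)"
    using ex[OF D(3,1)] by blast
  have p2i2: "p2 (i2 x) = b (a x)" if "x \<in> carrier X" for x
    using D(7)[OF mm_closed[OF a that]] by (simp add: p2_def i2_def)
  have "bij_betw (\<lambda>x. p2 (i2 x)) (carrier X) (carrier X)"
    by (rule bij_betw_cong[THEN iffD1, OF p2i2[symmetric] ba])
  then obtain l where l: "l < length Zs" "bij_betw (c p2 i2 l) (carrier X) (carrier X)"
    using ex[OF p2 i2] by blast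
  note k_iso = iso[OF D(3,1) k] and l_iso = iso[OF p2 i2 l]
  \<comment> \<open>Both selected components are isomorphic to X, and distinct components are not
    isomorphic.\<close>
  have kl: "k = l" by (rule uniq[OF k(1) l(1) D(1) i2 k_iso(1) l_iso(1)])
  have ck: "bij_betw (c p i2 k) (carrier X) (carrier X)"
    using bij_betw_trans[OF l_iso(1)[folded kl] k_iso(2)] by (simp add: c_def o_def)
  \<comment> \<open>Since p vanishes on the copy of X inside U, the composites of \<open>i2\<close>
    and p through all components add up to zero. The one through component k is bijective, so the
    sum \<open>?r\<close> of the others, its negative, is bijective as well, and one of them must
    be.\<close>
  let ?r = "\<lambda>x. finsum X (\<lambda>m. c p i2 m x) ({..<length Zs} - {k})"
  have cc: "c p i2 m x \<in> carrier X" if "m < length Zs" "x \<in> carrier X" for m x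
    by (rule mm_closed[OF cm[OF D(3) i2 that(1)] that(2)])
  have rest: "?r x = sb X \<zero>\<^bsub>X\<^esub> (c p i2 k x)" if x: "x \<in> carrier X" for x
  proof -
    have I: "{..<length Zs} = insert k ({..<length Zs} - {k})" using k(1) by auto
    have "\<zero>\<^bsub>X\<^esub> = p (i2 x)" using D(8)[OF mm_closed[OF a x]] by (simp add: i2_def)
    also have "\<dots> = finsum X (\<lambda>m. c p i2 m x) (insert k ({..<length Zs} - {k}))"
      using csum[OF D(3) i2 x] I by simp
    also have "\<dots> = c p i2 k x \<oplus>\<^bsub>X\<^esub> ?r x"
      by (rule abelian_monoid.finsum_insert[OF lm_abm[OF lX]]) (use cc x k(1) in auto)
    finally have z: "\<zero>\<^bsub>X\<^esub> = c p i2 k x \<oplus>\<^bsub>X\<^esub> ?r x" .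
    have "?r x \<in> carrier X"
      by (rule abelian_monoid.finsum_closed[OF lm_abm[OF lX]]) (use cc x in auto)
    then show ?thesis using z lX cc[OF k(1) x] sb_eq_iff[OF lX lm_zero_closed[OF lX] cc[OF k(1) x], of "?r x"]
        lm_comm[OF lX cc[OF k(1) x]] by simp
  qed
  have neg: "bij_betw (\<lambda>y. sb X \<zero>\<^bsub>X\<^esub> y) (carrier X) (carrier X)"
    by (rule bij_betw_byWitness[where f' = "\<lambda>y. sb X \<zero>\<^bsub>X\<^esub> y"]) (use lX in \<open>auto simp: sb_eq_iff\<close>)
  have "bij_betw (\<lambda>x. sb X \<zero>\<^bsub>X\<^esub> (c p i2 k x)) (carrier X) (carrier X)"
    using bij_betw_trans[OF ck neg] by (simp add: o_def)
  moreover have "bij_betw ?r (carrier X) (carrier X) \<longleftrightarrow>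
      bij_betw (\<lambda>x. sb X \<zero>\<^bsub>X\<^esub> (c p i2 k x)) (carrier X) (carrier X)"
    by (rule bij_betw_cong) (rule rest)
  ultimately have "bij_betw ?r (carrier X) (carrier X)" by simp
  then obtain m where m: "m < length Zs" "m \<noteq> k" "bij_betw (c p i2 m) (carrier X) (carrier X)"
    using local_finsum[OF X, of "{..<length Zs} - {k}" "c p i2"] cm[OF D(3) i2] by auto
  have "m = k" by (rule uniq[OF m(1) k(1) i2 i2 iso(1)[OF D(3) i2 m(1,3)] l_iso(1)[folded kl]])
  then show False using m(2) by simp
qed

lemma module_add_maps:
  fixes U V :: "'a std_module"
  assumes "V \<in> module_add R U"
  shows "\<exists>n W i p. W \<in> fgmod R \<and> module_direct_sum R (replicate n U) W \<and> mm V W i \<and> mm W V p \<and>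
    (\<forall>v\<in>carrier V. p (i v) = v) \<and> fg V"
proof -
  obtain n W where W: "W \<in> fgmod R" "module_direct_sum R (replicate n U) W" "module_summand R V W"
    using assms by (auto simp: module_add_def)
  then obtain V' where V: "V \<in> fgmod R" "V' \<in> fgmod R" "module_direct_sum R [V, V'] W"
    by (auto simp: module_summand_def)
  have l: "lmod V" "lmod V'" "lmod W" "fg V" using V W by (auto simp: fgmod_iff)
  have "\<exists>i p. mm V W i \<and> mm W V p \<and> (\<forall>v\<in>carrier V. p (i v) = v)"
    by (rule direct_sum2D[OF V(3) l(1-3)]) blast
  then show ?thesis using W l(4) by blast
qed

text \<open>The complement of U in its first power is the zero submodule, which has the right
  element type.\<close>

lemma self_in_module_add:
  fixes U :: "'a std_module"
  assumes U: "fg U" shows "U \<in> module_add R U"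
proof -
  have l: "lmod U" using U by simp
  let ?Z = "U\<lparr>carrier := {\<zero>\<^bsub>U\<^esub>}\<rparr>"
  have Z: "?Z \<in> fgmod R" using fg_sub[OF U subm_0[OF l]] by (simp add: fgmod_iff)
  then have lZ: "lmod ?Z" by (simp add: fgmod_iff)
  have "module_direct_sum R [U, ?Z] U"
  proof (rule direct_sum2I[where i = "\<lambda>x. x" and j = "\<lambda>x. x" and p = "\<lambda>x. x" and q = "\<lambda>_. \<zero>\<^bsub>U\<^esub>"])
    show "mm ?Z U (\<lambda>x. x)" by (rule mm_sub_dom[OF mm_id]) (use l in auto)
    show "mm U ?Z (\<lambda>_. \<zero>\<^bsub>U\<^esub>)" using mm_0[OF lZ, of U] by simp
  qed (use l lZ mm_id in auto)
  then have s: "module_summand R U U" using U Z by (auto simp: module_summand_def fgmod_iff)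
  have "module_direct_sum R [U] U"
  proof (rule direct_sumI[where \<iota> = "\<lambda>_ x. x" and \<pi> = "\<lambda>_ x. x"])
    fix m assume "m \<in> carrier U"
    then have "finsum U (\<lambda>i. m) {0} = m"
      using l by (simp add: abelian_monoid.finsum_insert[OF lm_abm[OF l]] abelian_monoid.finsum_empty[OF lm_abm[OF l]])
    then show "finsum U (\<lambda>i. m) {..<length [U]} = m" by (simp add: lessThan_Suc)
  qed (use l mm_id in auto)
  then have "module_direct_sum R (replicate 1 U) U" by simp
  then show ?thesis unfolding module_add_def using s U fgmod_iff by blast
qed

end

text \<open>Bilinearity of composition gives the algebra axioms, and Hom-finiteness the finite
  dimension. Multiplication is composition in the order of functions, so left modules over the
  \<Lambda> of the theorem are right modules over this algebra.\<close>

lemma fd_algebra_End: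
  assumes "linear_category K C" "hom_finite K C" "T \<in> obj C"
  shows "fd_algebra K (End_alg C T)"
proof -
  interpret linear_category K C by fact
  note T = assms(3)
  interpret H: module K "homs C T T" by (rule homs_module[OF T T])
  note cl = comp_closed[OF T T T]
  have simps [simp]: "carrier (End_alg C T) = Homs C T T" "one (End_alg C T) = idm C T"
    "monoid.mult (End_alg C T) = cmp C" "zero (End_alg C T) = zero (homs C T T)"
    "add (End_alg C T) = add (homs C T T)" "smult (End_alg C T) = smult (homs C T T)"
    by (simp_all add: End_alg_def)
  have lin: "g \<bullet>\<^bsub>C\<^esub> (f \<oplus>\<^bsub>homs C T T\<^esub> f') = g \<bullet>\<^bsub>C\<^esub> f \<oplus>\<^bsub>homs C T T\<^esub> g \<bullet>\<^bsub>C\<^esub> f'"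
    "(f \<oplus>\<^bsub>homs C T T\<^esub> f') \<bullet>\<^bsub>C\<^esub> g = f \<bullet>\<^bsub>C\<^esub> g \<oplus>\<^bsub>homs C T T\<^esub> f' \<bullet>\<^bsub>C\<^esub> g"
    if "f \<in> Homs C T T" "f' \<in> Homs C T T" "g \<in> Homs C T T" for f f' g
    using linear_left[OF T T T that(3)] linear_right[OF T T T that(3)] that by (auto simp: module_map_def)
  have lins: "g \<bullet>\<^bsub>C\<^esub> (c \<odot>\<^bsub>homs C T T\<^esub> f) = c \<odot>\<^bsub>homs C T T\<^esub> (g \<bullet>\<^bsub>C\<^esub> f)"
    "(c \<odot>\<^bsub>homs C T T\<^esub> f) \<bullet>\<^bsub>C\<^esub> g = c \<odot>\<^bsub>homs C T T\<^esub> (f \<bullet>\<^bsub>C\<^esub> g)"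
    if "f \<in> Homs C T T" "g \<in> Homs C T T" "c \<in> carrier K" for f g c
    using linear_left[OF T T T that(2)] linear_right[OF T T T that(2)] that by (auto simp: module_map_def)
  have ab: "abelian_group (End_alg C T)"
  proof (rule abelian_groupI)
    fix x assume "x \<in> carrier (End_alg C T)"
    then show "\<exists>y\<in>carrier (End_alg C T). y \<oplus>\<^bsub>End_alg C T\<^esub> x = \<zero>\<^bsub>End_alg C T\<^esub>"
      by (intro bexI[of _ "\<ominus>\<^bsub>homs C T T\<^esub> x"]) (auto simp: H.M.l_neg)
  qed (auto simp: H.M.a_ac)
  have R: "ring (End_alg C T)"
  proof (rule ringI[OF ab])
    show "monoid (End_alg C T)"
      by (rule monoidI) (auto simp: cl idm_closed[OF T] comp_assoc[OF T T T T] comp_idm[OF T T] idm_comp[OF T T])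
  qed (auto simp: lin)
  have rK: "ring K" by (rule H.R.ring_axioms)
  have M: "left_module K (End_alg C T)"
    by (intro left_module.intro left_module_axioms.intro rK ab)
      (auto simp: H.smult_l_distr H.smult_r_distr H.smult_assoc1)
  have M': "left_module K (homs C T T)"
    by (intro left_module.intro left_module_axioms.intro rK H.M.abelian_group_axioms)
      (auto simp: H.smult_l_distr H.smult_r_distr H.smult_assoc1)
  have fin: "fin_gen K (homs C T T)" using assms(2) T by (simp add: hom_finite_def)
  have "module_map K (homs C T T) (End_alg C T) (\<lambda>x. x)" by (auto simp: module_map_def)
  then have "fin_gen K (End_alg C T)" using ring.fin_gen_surj[OF rK M' M fin] by simp
  then show ?thesis
    using field R M by (intro fd_algebra.intro) (auto simp: lins)
qed

theorem corollary4p20: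
  fixes K :: "('k, 'z) ring_scheme"
    and D :: "('k, 'o, 'm, 'q) tricat_scheme"
    and T :: 'o
    and \<Lambda> :: "('k, 'm) module"
    and M\<^sub>\<Lambda> X\<^sub>\<Lambda> U\<^sub>\<Lambda> U'\<^sub>\<Lambda> Y\<^sub>\<Lambda> :: "'m std_module"
    and g\<^sub>\<Lambda> f\<^sub>\<Lambda> :: "(nat \<Rightarrow> 'm) \<Rightarrow> (nat \<Rightarrow> 'm)"
  assumes "algebraically_closed K"
    and "triangulated_category K D"
    and "krull_schmidt D"
    and "hom_finite K D"
    and "cluster_tilting D T"
    and "\<exists>SO SM. is_Serre_functor K D SO SM"
    and "\<Lambda> = op_ring (End_alg D T)"
    and "M\<^sub>\<Lambda> \<in> fgmod \<Lambda>" and "X\<^sub>\<Lambda> \<in> fgmod \<Lambda>" and "U\<^sub>\<Lambda> \<in> fgmod \<Lambda>" and "U'\<^sub>\<Lambda> \<in> fgmod \<Lambda>" and "Y\<^sub>\<Lambda> \<in> fgmod \<Lambda>"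
    and "module_direct_sum \<Lambda> [X\<^sub>\<Lambda>, U\<^sub>\<Lambda>] M\<^sub>\<Lambda>"
    and "basic_module \<Lambda> M\<^sub>\<Lambda>"
    and "tau_tilting K \<Lambda> M\<^sub>\<Lambda>"
    and "is_Bongartz_completion K \<Lambda> U\<^sub>\<Lambda> M\<^sub>\<Lambda>"
    and "indecomposable \<Lambda> X\<^sub>\<Lambda>"
    and "right_exact_seq \<Lambda> X\<^sub>\<Lambda> g\<^sub>\<Lambda> U'\<^sub>\<Lambda> f\<^sub>\<Lambda> Y\<^sub>\<Lambda>"
    and "left_approximation \<Lambda> (module_add \<Lambda> U\<^sub>\<Lambda>) X\<^sub>\<Lambda> g\<^sub>\<Lambda> U'\<^sub>\<Lambda>"
    and "left_minimal \<Lambda> X\<^sub>\<Lambda> g\<^sub>\<Lambda> U'\<^sub>\<Lambda>"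
    and "sincere \<Lambda> U\<^sub>\<Lambda>"
  shows "indecomposable \<Lambda> Y\<^sub>\<Lambda>"
proof -
  have T: "T \<in> obj D" and lc: "linear_category K D"
    using assms(2,5) by (simp_all add: cluster_tilting_def triangulated_category_def)
  have "fd_algebra K \<Lambda>"
    unfolding assms(7) by (rule fd_algebra.fd_algebra_op[OF fd_algebra_End[OF lc assms(4) T]])
  then interpret A: fd_algebra K \<Lambda> .
  note mm_comp = A.LR.mm_comp
  have fgs: "A.L.fg M\<^sub>\<Lambda>" "A.L.fg X\<^sub>\<Lambda>" "A.L.fg U\<^sub>\<Lambda>" "A.L.fg U'\<^sub>\<Lambda>" "A.L.fg Y\<^sub>\<Lambda>"
    using assms(8-12) by (simp_all add: A.L.fgmod_iff)
  then have l: "left_module \<Lambda> M\<^sub>\<Lambda>" "left_module \<Lambda> X\<^sub>\<Lambda>" "left_module \<Lambda> U\<^sub>\<Lambda>" "left_module \<Lambda> U'\<^sub>\<Lambda>" "left_module \<Lambda> Y\<^sub>\<Lambda>"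
    by auto
  obtain P1 P0 d e where P: "projective \<Lambda> P1" "projective \<Lambda> P0" "module_map \<Lambda> P1 P0 d"
    "module_map \<Lambda> P0 U\<^sub>\<Lambda> e" "e ` carrier P0 = carrier U\<^sub>\<Lambda>" "d ` carrier P1 = {x \<in> carrier P0. e x = \<zero>\<^bsub>U\<^sub>\<Lambda>\<^esub>}"
    and perp: "\<forall>N :: 'm std_module. A.L.fg N \<longrightarrow> (hom_vanishes \<Lambda> N (tau K \<Lambda> U\<^sub>\<Lambda>) \<longleftrightarrow>
      (\<forall>k. module_map \<Lambda> P1 N k \<longrightarrow> (\<exists>k'. module_map \<Lambda> P0 N k' \<and> (\<forall>x\<in>carrier P1. k' (d x) = k x))))"
    using A.tau_presentation[OF fgs(3)] by (elim exE conjE) (rule that, assumption+)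
  interpret presentation \<Lambda> P1 P0 "U\<^sub>\<Lambda>" d e
    by (intro presentation.intro presentation_axioms.intro A.L.artin_ring_axioms P fgs(3)) (rule A.Hom_span)
  \<comment> \<open>From here on the torsion class is handled through the presentation, and \<tau>
    does not appear in the arguments about X and U.\<close>
  have T_iff: "inT N \<longleftrightarrow> N \<in> left_perp \<Lambda> (tau K \<Lambda> U\<^sub>\<Lambda>)" for N :: "'m std_module"
    using perp[rule_format, of N] by (auto simp: inT_def left_perp_def A.L.fgmod_iff)
  obtain Xs where Xs: "set Xs \<subseteq> indec_ext_projectives \<Lambda> (left_perp \<Lambda> (tau K \<Lambda> U\<^sub>\<Lambda>))"
    "module_direct_sum \<Lambda> Xs M\<^sub>\<Lambda>"
    using assms(16) by (auto simp: is_Bongartz_completion_def is_P_def)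
  have XT: "inT Z" "Tproj Z" if "Z \<in> set Xs" for Z
  proof -
    have Z: "Z \<in> indec_ext_projectives \<Lambda> (left_perp \<Lambda> (tau K \<Lambda> U\<^sub>\<Lambda>))" using Xs(1) that by blast
    then show "inT Z" by (simp add: indec_ext_projectives_def T_iff)
    show "Tproj Z"
      by (rule Tproj_Ext1) (use Z T_iff inT_fg[OF \<open>inT Z\<close>] in \<open>auto simp: indec_ext_projectives_def\<close>)
  qed
  have MP: "Tproj M\<^sub>\<Lambda>" by (rule Tproj_direct_sum[OF fgs(1) XT(2) Xs(2)])
  have Xk: "inT (Xs ! k)" if "k < length Xs" for k using XT that by simp
  \<comment> \<open>M is an image of the product of its summands, and the torsion class is closed
    under finite sums and images.\<close>
  have MT: "inT M\<^sub>\<Lambda>"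
  proof -
    have lk: "left_module \<Lambda> (Xs ! k)" if "k < length Xs" for k using inT_fg[OF Xk[OF that]] by simp
    obtain \<iota> where \<iota>: "\<forall>i<length Xs. module_map \<Lambda> (Xs ! i) M\<^sub>\<Lambda> (\<iota> i)"
      "bij_betw (\<lambda>x. finsum M\<^sub>\<Lambda> (\<lambda>i. \<iota> i (x i)) {..<length Xs})
        (carrier (A.LR.dsum {..<length Xs} ((!) Xs))) (carrier M\<^sub>\<Lambda>)"
      using Xs(2) unfolding module_direct_sum_def A.LR.dsum_def by auto
    have "inT (A.LR.dsum {..<length Xs} ((!) Xs))" by (rule inT_dsum) (use Xk in auto)
    then show ?thesis
      by (rule inT_image[OF _ l(1) A.LR.mm_dcopair[OF finite_lessThan l(1)]])
        (use lk \<iota> in \<open>auto simp: bij_betw_def\<close>)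
  qed
  obtain i j p q where S: "module_map \<Lambda> X\<^sub>\<Lambda> M\<^sub>\<Lambda> i" "module_map \<Lambda> U\<^sub>\<Lambda> M\<^sub>\<Lambda> j" "module_map \<Lambda> M\<^sub>\<Lambda> X\<^sub>\<Lambda> p"
    "module_map \<Lambda> M\<^sub>\<Lambda> U\<^sub>\<Lambda> q" "\<And>x. x \<in> carrier X\<^sub>\<Lambda> \<Longrightarrow> p (i x) = x" "\<And>y. y \<in> carrier U\<^sub>\<Lambda> \<Longrightarrow> q (j y) = y"
    by (rule A.LR.direct_sum2D[OF assms(13) l(2,3,1)]) blast
  have ps: "p ` carrier M\<^sub>\<Lambda> = carrier X\<^sub>\<Lambda>" and qs: "q ` carrier M\<^sub>\<Lambda> = carrier U\<^sub>\<Lambda>"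
    using A.LR.mm_closed[OF S(1)] A.LR.mm_closed[OF S(2)] A.LR.mm_closed[OF S(3)] A.LR.mm_closed[OF S(4)] S(5,6)
    by (auto simp: image_iff) metis+
  have TX: "inT X\<^sub>\<Lambda>" by (rule inT_image[OF MT l(2) S(3) ps])
  have TU: "inT U\<^sub>\<Lambda>" by (rule inT_image[OF MT l(3) S(4) qs])
  have PX: "Tproj X\<^sub>\<Lambda>" by (rule Tproj_retract[OF MP fgs(2) S(1,3,5)])
  have PU: "Tproj U\<^sub>\<Lambda>" by (rule Tproj_retract[OF MP fgs(3) S(2,4,6)])
  have U': "U'\<^sub>\<Lambda> \<in> module_add \<Lambda> U\<^sub>\<Lambda>" and g: "module_map \<Lambda> X\<^sub>\<Lambda> U'\<^sub>\<Lambda> g\<^sub>\<Lambda>"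
    and apx: "\<And>W h. W \<in> module_add \<Lambda> U\<^sub>\<Lambda> \<Longrightarrow> module_map \<Lambda> X\<^sub>\<Lambda> W h \<Longrightarrow>
      \<exists>t. module_map \<Lambda> U'\<^sub>\<Lambda> W t \<and> (\<forall>x\<in>carrier X\<^sub>\<Lambda>. h x = t (g\<^sub>\<Lambda> x))"
    using assms(19) by (auto simp: left_approximation_def)
  obtain n W a b where W: "W \<in> fgmod \<Lambda>" "module_direct_sum \<Lambda> (replicate n U\<^sub>\<Lambda>) W"
    "module_map \<Lambda> U'\<^sub>\<Lambda> W a" "module_map \<Lambda> W U'\<^sub>\<Lambda> b" "\<And>v. v \<in> carrier U'\<^sub>\<Lambda> \<Longrightarrow> b (a v) = v"
    using A.L.module_add_maps[OF U'] by blast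
  have fW: "A.L.fg W" "left_module \<Lambda> W" using W(1) by (auto simp: A.L.fgmod_iff)
  \<comment> \<open>U' is a summand of a power of U, so it inherits relative projectivity from U by
    way of that power.\<close>
  have "Tproj W" by (rule Tproj_direct_sum[OF fW(1) _ W(2)]) (use PU in auto)
  then have PU': "Tproj U'\<^sub>\<Lambda>" by (rule Tproj_retract[OF _ fgs(4) W(3,4,5)])
  \<comment> \<open>If g were bijective, X would be a direct summand of a power of U. Since X has a
    local endomorphism ring it would then be a direct summand of U itself, contradicting the
    basicness of M.\<close>
  have niso: "\<not> bij_betw g\<^sub>\<Lambda> (carrier X\<^sub>\<Lambda>) (carrier U'\<^sub>\<Lambda>)"
  proof
    assume bg: "bij_betw g\<^sub>\<Lambda> (carrier X\<^sub>\<Lambda>) (carrier U'\<^sub>\<Lambda>)"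
    let ?g' = "inv_into (carrier X\<^sub>\<Lambda>) g\<^sub>\<Lambda>"
    have g': "module_map \<Lambda> U'\<^sub>\<Lambda> X\<^sub>\<Lambda> ?g'" by (rule A.LR.mm_inv[OF l(2) g bg])
    have e: "x = ?g' (b (a (g\<^sub>\<Lambda> x)))" if "x \<in> carrier X\<^sub>\<Lambda>" for x
      using W(5)[OF A.LR.mm_closed[OF g that]] bij_betw_inv_into_left[OF bg that] by simp
    have bij: "bij_betw (\<lambda>x. ?g' (b (a (g\<^sub>\<Lambda> x)))) (carrier X\<^sub>\<Lambda>) (carrier X\<^sub>\<Lambda>)"
      by (rule bij_betw_cong[THEN iffD1, OF e bij_betw_id[unfolded id_def]])
    have lk: "left_module \<Lambda> (replicate n U\<^sub>\<Lambda> ! k)" if "k < length (replicate n U\<^sub>\<Lambda>)" for k using l(3) that by simp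
    obtain k a' b' where "k < length (replicate n U\<^sub>\<Lambda>)" "module_map \<Lambda> X\<^sub>\<Lambda> (replicate n U\<^sub>\<Lambda> ! k) a'"
      "module_map \<Lambda> (replicate n U\<^sub>\<Lambda> ! k) X\<^sub>\<Lambda> b'" "bij_betw (\<lambda>x. b' (a' x)) (carrier X\<^sub>\<Lambda>) (carrier X\<^sub>\<Lambda>)"
      using A.L.retract_component[OF assms(17) fW(2) W(2) lk mm_comp[OF g W(3)] mm_comp[OF W(4) g'] bij] by blast
    then show False using A.L.basic_not_retract[OF assms(14,13,17) l(3), of a' b'] by simp
  qed
  have f: "module_map \<Lambda> U'\<^sub>\<Lambda> Y\<^sub>\<Lambda> f\<^sub>\<Lambda>" "f\<^sub>\<Lambda> ` carrier U'\<^sub>\<Lambda> = carrier Y\<^sub>\<Lambda>"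
    "g\<^sub>\<Lambda> ` carrier X\<^sub>\<Lambda> = {u \<in> carrier U'\<^sub>\<Lambda>. f\<^sub>\<Lambda> u = \<zero>\<^bsub>Y\<^sub>\<Lambda>\<^esub>}"
    using assms(18) by (simp_all add: right_exact_seq_def)
  show ?thesis
  proof (rule cokernel_indecomposable[OF TU TX PX assms(17) PU' g _ _ fgs(5) f _ assms(21) niso])
    show "\<exists>t. module_map \<Lambda> U'\<^sub>\<Lambda> U\<^sub>\<Lambda> t \<and> (\<forall>x\<in>carrier X\<^sub>\<Lambda>. h x = t (g\<^sub>\<Lambda> x))"
      if "module_map \<Lambda> X\<^sub>\<Lambda> U\<^sub>\<Lambda> h" for h
      by (rule apx[OF A.L.self_in_module_add[OF fgs(3)] that])
    show "\<exists>t. module_map \<Lambda> U'\<^sub>\<Lambda> U'\<^sub>\<Lambda> t \<and> (\<forall>x\<in>carrier X\<^sub>\<Lambda>. h x = t (g\<^sub>\<Lambda> x))"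
      if "module_map \<Lambda> X\<^sub>\<Lambda> U'\<^sub>\<Lambda> h" for h
      by (rule apx[OF U' that])
    show "bij_betw k (carrier U'\<^sub>\<Lambda>) (carrier U'\<^sub>\<Lambda>)"
      if "module_map \<Lambda> U'\<^sub>\<Lambda> U'\<^sub>\<Lambda> k" "\<And>x. x \<in> carrier X\<^sub>\<Lambda> \<Longrightarrow> k (g\<^sub>\<Lambda> x) = g\<^sub>\<Lambda> x" for k
      using assms(20) that by (simp add: left_minimal_def)
  qed
qed

end
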